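(* Let $d,n\ge 1$. For $i=1,\dots,d$ let $D_i$ be a complete discrete valuation ring (possibly noncommutative; see context) with division ring of quotients $F_i$ and $J(D_i)$-adic filtration $v_{F_i}$ on $F_i$. Put $D=D_1\times\cdots\times D_d$ and $F=F_1\times\cdots\times F_d$, let $v_F$ be the product filtration on $F$, and identify $M_n(F)=M_n(F_1)\times\cdots\times M_n(F_d)$. Let $Q=A_1\times\cdots\times A_d$ be a semisimple artinian ring whose minimal nonzero ideals are $A_1,\dots,A_d$, let $\iota_i:A_i\to M_n(F_i)$ be ring isomorphisms, let $\iota=\prod_i\iota_i:Q\to M_n(F)$, and let $Q$ carry the filtration $v_Q=M_n(v_F)\circ\iota$ (so that the $\iota_i$ and $\iota$ are filtered isomorphisms). Put $\mathcal{O}_i=\iota_i^{-1}(M_n(D_i))$ and $\mathcal{O}=\mathcal{O}_1\times\cdots\times\mathcal{O}_d=\iota^{-1}(M_n(D))$. Let $(\sigma,\delta)$ be a skew derivation on $Q$ compatible with $v_Q$, and suppose that $\sigma$ permutes the minimal nonzero ideals $A_1,\dots,A_d$ transitively. Then there exist a skew derivation $(\tau,\theta)$ on $F$, compatible with $v_F$, and an isomorphism of filtered rings $$\varphi:\mathcal{O}[[x;\sigma,\delta]]\to M_n(D[[y;\tau,\theta]])$$ extending $\iota|_{\mathcal{O}}$, such that $y$ (i.e. the scalar matrix $yI$) is the image under $\varphi$ of $ax-t$ for some $a\in\mathcal{O}^\times$ and $t\in J(\mathcal{O})$.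
   Context: A filtration on a ring $R$ is a function $f:R\to\mathbb{Z}\cup\{\infty\}$ with $f(1)=0$, $f(r+s)\ge\min\{f(r),f(s)\}$, $f(rs)\ge f(r)+f(s)$, and $f(r)=\infty$ iff $r=0$; it is positive if its values lie in $\mathbb{N}\cup\{\infty\}$. The product filtration on $A\times B$ is $(a,b)\mapsto\min\{f_A(a),f_B(b)\}$; the matrix filtration $M_n(f)$ on $M_n(A)$ sends a matrix to the minimum of the $f$-values of its entries. An isomorphism of filtered rings is a ring isomorphism preserving the values of the filtrations. A discrete valuation ring is a (two-sided) noetherian domain $D$, not necessarily commutative, such that for every nonzero $z$ in its division ring of quotients $Q(D)$, either $z\in D$ or $z^{-1}\in D$. Then $J(D)=\pi D=D\pi$ for some normal element $\pi$ (a uniformiser), and the $J(D)$-adic filtration on $F=Q(D)$ is $v_F(z)=\sup\{k: z\in\pi^kD\}$ (so $v_F(z)=0$ for all $z\neq 0$ if $J(D)=0$). $D$ is complete if it is complete for this filtration. $J(\cdot)$ denotes the Jacobson radical. A skew derivation $(\sigma,\delta)$ on a ring $R$ consists of an automorphism $\sigma$ and an additive map $\delta:R\to R$ with $\delta(rs)=\delta(r)s+\sigma(r)\delta(s)$. It is compatible with a filtration $v$ if $v(\sigma(r))=v(r)$ and $v(\delta(r))>v(r)$ for all $0\ne r\in R$. In the setting of the claim, compatible skew derivations on $Q$ and $F$ restrict to compatible skew derivations on $\mathcal{O}$ and $D$. If $(R,v)$ is a complete positively filtered ring with compatible skew derivation $(\sigma,\delta)$, the skew power series ring $R[[x;\sigma,\delta]]$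 is the set of formal series $\sum_{i\ge0}r_ix^i$ ($r_i\in R$) with its left $R$-module structure and the (well-defined, continuous, associative) multiplication determined by $xr=\sigma(r)x+\delta(r)$; it carries the complete positive filtration $f_{v,x}(\sum r_ix^i)=\inf_i\{v(r_i)+i\}$. Here $\mathcal{O}$ and $D$ carry the restrictions of $v_Q$ and $v_F$, and $M_n(D[[y;\tau,\theta]])$ carries the matrix filtration of the standard filtration on $D[[y;\tau,\theta]]$. *)

theory Defs
  imports "HOL-Algebra.Algebra" "HOL-Library.Extended_Real"
begin

section \<open>Filtered rings\<close>

text \<open>Filtrations take values in \<open>\<int> \<union> {\<infinity>}\<close>, regarded as a subset of \<^typ>\<open>ereal\<close>. Only the values
  on the carrier matter, so the restriction of a filtration \<open>v\<close> to a subring is again written \<open>v\<close>.\<close>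

definition filtration :: "('a, 'm) ring_scheme \<Rightarrow> ('a \<Rightarrow> ereal) \<Rightarrow> bool" where
  "filtration R f \<longleftrightarrow>
     (\<forall>r\<in>carrier R. f r = \<infinity> \<or> (\<exists>k::int. f r = ereal (real_of_int k))) \<and>
     f \<one>\<^bsub>R\<^esub> = 0 \<and>
     (\<forall>r\<in>carrier R. \<forall>s\<in>carrier R. f (r \<oplus>\<^bsub>R\<^esub> s) \<ge> min (f r) (f s)) \<and>
     (\<forall>r\<in>carrier R. \<forall>s\<in>carrier R. f (r \<otimes>\<^bsub>R\<^esub> s) \<ge> f r + f s) \<and>
     (\<forall>r\<in>carrier R. f r = \<infinity> \<longleftrightarrow> r = \<zero>\<^bsub>R\<^esub>)"

definition filtered_ring :: "('a, 'm) ring_scheme \<Rightarrow> ('a \<Rightarrow> ereal) \<Rightarrow> bool" where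
  "filtered_ring R f \<longleftrightarrow> ring R \<and> filtration R f"

definition filtered_ring_iso ::
  "('a, 'm) ring_scheme \<Rightarrow> ('a \<Rightarrow> ereal) \<Rightarrow> ('b, 'k) ring_scheme \<Rightarrow> ('b \<Rightarrow> ereal) \<Rightarrow> ('a \<Rightarrow> 'b) \<Rightarrow> bool" where
  "filtered_ring_iso R f S g \<phi> \<longleftrightarrow>
     filtered_ring R f \<and> filtered_ring S g \<and> \<phi> \<in> ring_iso R S \<and> (\<forall>r\<in>carrier R. g (\<phi> r) = f r)"

definition filt_tendsto :: "('a, 'm) ring_scheme \<Rightarrow> ('a \<Rightarrow> ereal) \<Rightarrow> (nat \<Rightarrow> 'a) \<Rightarrow> 'a \<Rightarrow> bool" where
  "filt_tendsto R f s l \<longleftrightarrow> l \<in> carrier R \<and> (\<lambda>n. f (s n \<ominus>\<^bsub>R\<^esub> l)) \<longlonglongrightarrow> \<infinity>"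

definition filt_lim :: "('a, 'm) ring_scheme \<Rightarrow> ('a \<Rightarrow> ereal) \<Rightarrow> (nat \<Rightarrow> 'a) \<Rightarrow> 'a" where
  "filt_lim R f s = (THE l. filt_tendsto R f s l)"

definition filt_complete :: "('a, 'm) ring_scheme \<Rightarrow> ('a \<Rightarrow> ereal) \<Rightarrow> bool" where
  "filt_complete R f \<longleftrightarrow>
     (\<forall>s. range s \<subseteq> carrier R \<and>
          ((\<lambda>(m, n). f (s m \<ominus>\<^bsub>R\<^esub> s n)) \<longlongrightarrow> \<infinity>) (sequentially \<times>\<^sub>F sequentially)
        \<longrightarrow> (\<exists>l. filt_tendsto R f s l))"

section \<open>One-sided ideals and chain conditions\<close>

definition left_ideal :: "'a set \<Rightarrow> ('a, 'm) ring_scheme \<Rightarrow> bool" where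
  "left_ideal I R \<longleftrightarrow> additive_subgroup I R \<and> (\<forall>r\<in>carrier R. \<forall>x\<in>I. r \<otimes>\<^bsub>R\<^esub> x \<in> I)"

definition right_ideal :: "'a set \<Rightarrow> ('a, 'm) ring_scheme \<Rightarrow> bool" where
  "right_ideal I R \<longleftrightarrow> additive_subgroup I R \<and> (\<forall>r\<in>carrier R. \<forall>x\<in>I. x \<otimes>\<^bsub>R\<^esub> r \<in> I)"

definition maximal_left_ideal :: "'a set \<Rightarrow> ('a, 'm) ring_scheme \<Rightarrow> bool" where
  "maximal_left_ideal I R \<longleftrightarrow> left_ideal I R \<and> I \<noteq> carrier R \<and>
     (\<forall>K. left_ideal K R \<and> I \<subseteq> K \<longrightarrow> K = I \<or> K = carrier R)"

definition jacobson_radical :: "('a, 'm) ring_scheme \<Rightarrow> 'a set" where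
  "jacobson_radical R = carrier R \<inter> \<Inter>{I. maximal_left_ideal I R}"

definition acc :: "('a set \<Rightarrow> bool) \<Rightarrow> bool" where
  "acc P \<longleftrightarrow> (\<forall>I::nat \<Rightarrow> 'a set. (\<forall>k. P (I k) \<and> I k \<subseteq> I (Suc k)) \<longrightarrow> (\<exists>N. \<forall>k\<ge>N. I k = I N))"

definition dcc :: "('a set \<Rightarrow> bool) \<Rightarrow> bool" where
  "dcc P \<longleftrightarrow> (\<forall>I::nat \<Rightarrow> 'a set. (\<forall>k. P (I k) \<and> I (Suc k) \<subseteq> I k) \<longrightarrow> (\<exists>N. \<forall>k\<ge>N. I k = I N))"

definition two_sided_noetherian :: "('a, 'm) ring_scheme \<Rightarrow> bool" where
  "two_sided_noetherian R \<longleftrightarrow> acc (\<lambda>I. left_ideal I R) \<and> acc (\<lambda>I. right_ideal I R)"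

definition semisimple_artinian :: "('a, 'm) ring_scheme \<Rightarrow> bool" where
  "semisimple_artinian R \<longleftrightarrow> ring R \<and> dcc (\<lambda>I. left_ideal I R) \<and> dcc (\<lambda>I. right_ideal I R) \<and>
     jacobson_radical R = {\<zero>\<^bsub>R\<^esub>}"

definition minimal_nonzero_ideals :: "('a, 'm) ring_scheme \<Rightarrow> 'a set set" where
  "minimal_nonzero_ideals R =
     {I. ideal I R \<and> I \<noteq> {\<zero>\<^bsub>R\<^esub>} \<and> (\<forall>K. ideal K R \<and> K \<subseteq> I \<longrightarrow> K = {\<zero>\<^bsub>R\<^esub>} \<or> K = I)}"

section \<open>Noncommutative discrete valuation rings\<close>

text \<open>The locales \<^locale>\<open>field\<close>, \<^locale>\<open>domain\<close> and \<^locale>\<open>noetherian_ring\<close> of the library do not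
  apply here: the first two include commutativity, the last concerns two-sided ideals only.\<close>

definition division_ring :: "('a, 'm) ring_scheme \<Rightarrow> bool" where
  "division_ring R \<longleftrightarrow> ring R \<and> Units R = carrier R - {\<zero>\<^bsub>R\<^esub>}"

definition noncomm_domain :: "('a, 'm) ring_scheme \<Rightarrow> bool" where
  "noncomm_domain R \<longleftrightarrow> ring R \<and> \<one>\<^bsub>R\<^esub> \<noteq> \<zero>\<^bsub>R\<^esub> \<and>
     (\<forall>a\<in>carrier R. \<forall>b\<in>carrier R. a \<otimes>\<^bsub>R\<^esub> b = \<zero>\<^bsub>R\<^esub> \<longrightarrow> a = \<zero>\<^bsub>R\<^esub> \<or> b = \<zero>\<^bsub>R\<^esub>)"

definition division_ring_of_quotients :: "('a, 'm) ring_scheme \<Rightarrow> 'a set \<Rightarrow> bool" where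
  "division_ring_of_quotients F D \<longleftrightarrow> division_ring F \<and> subring D F \<and>
     (\<forall>z\<in>carrier F. \<exists>a\<in>D. \<exists>b\<in>D - {\<zero>\<^bsub>F\<^esub>}. z = a \<otimes>\<^bsub>F\<^esub> inv\<^bsub>F\<^esub> b) \<and>
     (\<forall>z\<in>carrier F. \<exists>a\<in>D. \<exists>b\<in>D - {\<zero>\<^bsub>F\<^esub>}. z = inv\<^bsub>F\<^esub> b \<otimes>\<^bsub>F\<^esub> a)"

definition discrete_valuation_ring :: "('a, 'm) ring_scheme \<Rightarrow> 'a set \<Rightarrow> bool" where
  "discrete_valuation_ring F D \<longleftrightarrow>
     division_ring_of_quotients F D \<and>
     noncomm_domain (F\<lparr>carrier := D\<rparr>) \<and> two_sided_noetherian (F\<lparr>carrier := D\<rparr>) \<and>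
     (\<forall>z\<in>carrier F - {\<zero>\<^bsub>F\<^esub>}. z \<in> D \<or> inv\<^bsub>F\<^esub> z \<in> D)"

definition uniformiser :: "('a, 'm) ring_scheme \<Rightarrow> 'a set \<Rightarrow> 'a \<Rightarrow> bool" where
  "uniformiser F D p \<longleftrightarrow> p \<in> D \<and>
     jacobson_radical (F\<lparr>carrier := D\<rparr>) = p <#\<^bsub>F\<^esub> D \<and>
     jacobson_radical (F\<lparr>carrier := D\<rparr>) = D #>\<^bsub>F\<^esub> p"

text \<open>The choice of uniformiser is immaterial. If \<open>J(D) = 0\<close> the only uniformiser is \<open>0\<close>, whose negative
  powers make no sense; hence the separate case.\<close>

definition adic_filtration :: "('a, 'm) ring_scheme \<Rightarrow> 'a set \<Rightarrow> 'a \<Rightarrow> ereal" where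
  "adic_filtration F D z =
     (if z = \<zero>\<^bsub>F\<^esub> then \<infinity>
      else if jacobson_radical (F\<lparr>carrier := D\<rparr>) = {\<zero>\<^bsub>F\<^esub>} then 0
      else let p = (SOME p. uniformiser F D p) in
        SUP k\<in>{k::int. z \<in> (p [^]\<^bsub>F\<^esub> k) <#\<^bsub>F\<^esub> D}. ereal (real_of_int k))"

definition complete_dvr :: "('a, 'm) ring_scheme \<Rightarrow> 'a set \<Rightarrow> bool" where
  "complete_dvr F D \<longleftrightarrow>
     discrete_valuation_ring F D \<and> filt_complete (F\<lparr>carrier := D\<rparr>) (adic_filtration F D)"

section \<open>Products and matrix rings\<close>

definition prod_ring :: "'i set \<Rightarrow> ('i \<Rightarrow> ('a, 'm) ring_scheme) \<Rightarrow> ('i \<Rightarrow> 'a) ring" where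
  "prod_ring I R =
     \<lparr>carrier = (\<Pi>\<^sub>E i\<in>I. carrier (R i)),
      monoid.mult = (\<lambda>x y. \<lambda>i\<in>I. x i \<otimes>\<^bsub>R i\<^esub> y i),
      one = (\<lambda>i\<in>I. \<one>\<^bsub>R i\<^esub>),
      ring.zero = (\<lambda>i\<in>I. \<zero>\<^bsub>R i\<^esub>),
      add = (\<lambda>x y. \<lambda>i\<in>I. x i \<oplus>\<^bsub>R i\<^esub> y i)\<rparr>"

definition prod_factor :: "'i set \<Rightarrow> ('i \<Rightarrow> ('a, 'm) ring_scheme) \<Rightarrow> 'i \<Rightarrow> ('i \<Rightarrow> 'a) set" where
  "prod_factor I R i = {x \<in> carrier (prod_ring I R). \<forall>j\<in>I - {i}. x j = \<zero>\<^bsub>R j\<^esub>}"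

definition prod_filtration :: "'i set \<Rightarrow> ('i \<Rightarrow> 'a \<Rightarrow> ereal) \<Rightarrow> ('i \<Rightarrow> 'a) \<Rightarrow> ereal" where
  "prod_filtration I f x = Min ((\<lambda>i. f i (x i)) ` I)"

definition mat_ring :: "nat \<Rightarrow> ('a, 'm) ring_scheme \<Rightarrow> (nat \<times> nat \<Rightarrow> 'a) ring" where
  "mat_ring n R =
     \<lparr>carrier = (({..<n} \<times> {..<n}) \<rightarrow>\<^sub>E carrier R),
      monoid.mult = (\<lambda>A B. \<lambda>(i, j)\<in>{..<n} \<times> {..<n}. \<Oplus>\<^bsub>R\<^esub>k\<in>{..<n}. A (i, k) \<otimes>\<^bsub>R\<^esub> B (k, j)),
      one = (\<lambda>(i, j)\<in>{..<n} \<times> {..<n}. if i = j then \<one>\<^bsub>R\<^esub> else \<zero>\<^bsub>R\<^esub>),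
      ring.zero = (\<lambda>p\<in>{..<n} \<times> {..<n}. \<zero>\<^bsub>R\<^esub>),
      add = (\<lambda>A B. \<lambda>p\<in>{..<n} \<times> {..<n}. A p \<oplus>\<^bsub>R\<^esub> B p)\<rparr>"

definition scalar_mat :: "nat \<Rightarrow> ('a, 'm) ring_scheme \<Rightarrow> 'a \<Rightarrow> nat \<times> nat \<Rightarrow> 'a" where
  "scalar_mat n R c = (\<lambda>(i, j)\<in>{..<n} \<times> {..<n}. if i = j then c else \<zero>\<^bsub>R\<^esub>)"

definition mat_map :: "nat \<Rightarrow> ('a \<Rightarrow> 'b) \<Rightarrow> (nat \<times> nat \<Rightarrow> 'a) \<Rightarrow> nat \<times> nat \<Rightarrow> 'b" where
  "mat_map n h A = (\<lambda>p\<in>{..<n} \<times> {..<n}. h (A p))"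

definition mat_filtration :: "nat \<Rightarrow> ('a \<Rightarrow> ereal) \<Rightarrow> (nat \<times> nat \<Rightarrow> 'a) \<Rightarrow> ereal" where
  "mat_filtration n f A = Min ((\<lambda>p. f (A p)) ` ({..<n} \<times> {..<n}))"

text \<open>The product of maps \<open>\<iota>\<^sub>i : A\<^sub>i \<rightarrow> M\<^sub>n(F\<^sub>i)\<close>, as a map into \<open>M\<^sub>n(\<Prod>\<^sub>i F\<^sub>i) = \<Prod>\<^sub>i M\<^sub>n(F\<^sub>i)\<close>.\<close>

definition prod_mat_map ::
  "'i set \<Rightarrow> nat \<Rightarrow> ('i \<Rightarrow> 'b \<Rightarrow> nat \<times> nat \<Rightarrow> 'a) \<Rightarrow> ('i \<Rightarrow> 'b) \<Rightarrow> nat \<times> nat \<Rightarrow> 'i \<Rightarrow> 'a" where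
  "prod_mat_map I n \<iota> q = (\<lambda>p\<in>{..<n} \<times> {..<n}. \<lambda>i\<in>I. \<iota> i (q i) p)"

section \<open>Skew derivations and skew power series\<close>

definition skew_derivation :: "('a, 'm) ring_scheme \<Rightarrow> ('a \<Rightarrow> 'a) \<Rightarrow> ('a \<Rightarrow> 'a) \<Rightarrow> bool" where
  "skew_derivation R \<sigma> \<delta> \<longleftrightarrow>
     \<sigma> \<in> ring_iso R R \<and> \<delta> \<in> carrier R \<rightarrow> carrier R \<and>
     (\<forall>r\<in>carrier R. \<forall>s\<in>carrier R. \<delta> (r \<oplus>\<^bsub>R\<^esub> s) = \<delta> r \<oplus>\<^bsub>R\<^esub> \<delta> s) \<and>
     (\<forall>r\<in>carrier R. \<forall>s\<in>carrier R. \<delta> (r \<otimes>\<^bsub>R\<^esub> s) = \<delta> r \<otimes>\<^bsub>R\<^esub> s \<oplus>\<^bsub>R\<^esub> \<sigma> r \<otimes>\<^bsub>R\<^esub> \<delta> s)"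

definition skew_compatible ::
  "('a, 'm) ring_scheme \<Rightarrow> ('a \<Rightarrow> ereal) \<Rightarrow> ('a \<Rightarrow> 'a) \<Rightarrow> ('a \<Rightarrow> 'a) \<Rightarrow> bool" where
  "skew_compatible R v \<sigma> \<delta> \<longleftrightarrow>
     (\<forall>r\<in>carrier R - {\<zero>\<^bsub>R\<^esub>}. v (\<sigma> r) = v r \<and> v (\<delta> r) > v r)"

text \<open>\<open>skew_coeff R \<sigma> \<delta> i k s\<close> is the coefficient of \<open>x\<^sup>k\<close> in \<open>x\<^sup>i s\<close>, obtained by iterating
  \<open>x r = \<sigma>(r) x + \<delta>(r)\<close>.\<close>

fun skew_coeff ::
  "('a, 'm) ring_scheme \<Rightarrow> ('a \<Rightarrow> 'a) \<Rightarrow> ('a \<Rightarrow> 'a) \<Rightarrow> nat \<Rightarrow> nat \<Rightarrow> 'a \<Rightarrow> 'a" where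
  "skew_coeff R \<sigma> \<delta> 0 k s = (if k = 0 then s else \<zero>\<^bsub>R\<^esub>)"
| "skew_coeff R \<sigma> \<delta> (Suc i) 0 s = \<delta> (skew_coeff R \<sigma> \<delta> i 0 s)"
| "skew_coeff R \<sigma> \<delta> (Suc i) (Suc k) s =
     \<sigma> (skew_coeff R \<sigma> \<delta> i k s) \<oplus>\<^bsub>R\<^esub> \<delta> (skew_coeff R \<sigma> \<delta> i (Suc k) s)"

text \<open>The series \<open>\<Sum>\<^sub>i r\<^sub>i x\<^sup>i\<close> is the sequence \<open>r\<close>. In the product
  \<open>(\<Sum>\<^sub>i r\<^sub>i x\<^sup>i) (\<Sum>\<^sub>j s\<^sub>j x\<^sup>j)\<close> the coefficient of \<open>x\<^sup>m\<close> is the infinite sum over \<open>i\<close> of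
  \<open>\<Sum>\<^sub>j\<^sub>\<le>\<^sub>m r\<^sub>i (coefficient of x\<^sup>m\<^sup>-\<^sup>j in x\<^sup>i s\<^sub>j)\<close>, which converges by completeness and compatibility.\<close>

definition skew_ps_ring ::
  "('a, 'm) ring_scheme \<Rightarrow> ('a \<Rightarrow> ereal) \<Rightarrow> ('a \<Rightarrow> 'a) \<Rightarrow> ('a \<Rightarrow> 'a) \<Rightarrow> (nat \<Rightarrow> 'a) ring" where
  "skew_ps_ring R v \<sigma> \<delta> =
     \<lparr>carrier = {r. \<forall>i. r i \<in> carrier R},
      monoid.mult = (\<lambda>r s m. filt_lim R v
                (\<lambda>N. \<Oplus>\<^bsub>R\<^esub>i\<in>{..N}. \<Oplus>\<^bsub>R\<^esub>j\<in>{..m}. r i \<otimes>\<^bsub>R\<^esub> skew_coeff R \<sigma> \<delta> i (m - j) (s j))),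
      one = (\<lambda>i. if i = 0 then \<one>\<^bsub>R\<^esub> else \<zero>\<^bsub>R\<^esub>),
      ring.zero = (\<lambda>i. \<zero>\<^bsub>R\<^esub>),
      add = (\<lambda>r s i. r i \<oplus>\<^bsub>R\<^esub> s i)\<rparr>"

definition ps_const :: "('a, 'm) ring_scheme \<Rightarrow> 'a \<Rightarrow> nat \<Rightarrow> 'a" where
  "ps_const R r = (\<lambda>i. if i = 0 then r else \<zero>\<^bsub>R\<^esub>)"

definition ps_var :: "('a, 'm) ring_scheme \<Rightarrow> nat \<Rightarrow> 'a" where
  "ps_var R = (\<lambda>i. if i = 1 then \<one>\<^bsub>R\<^esub> else \<zero>\<^bsub>R\<^esub>)"

definition ps_filtration :: "('a \<Rightarrow> ereal) \<Rightarrow> (nat \<Rightarrow> 'a) \<Rightarrow> ereal" where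
  "ps_filtration v r = (INF i. v (r i) + ereal (real i))"

end

theory Submission
  imports Defs
begin

text \<open>Transport \<open>(\<sigma>,\<delta>)\<close> to \<open>M\<^sub>n(F)\<close>. Then \<open>\<sigma>\<close> maps the matrix units \<open>E\<^sub>i\<^sub>j\<close> to another system of matrix units
  of \<open>M\<^sub>n(D)\<close>, and since \<open>D\<close> is a product of local domains, the two systems are conjugate by a unit \<open>a\<close> of
  \<open>M\<^sub>n(D)\<close>. Replacing \<open>x\<close> by \<open>a x\<close> turns \<open>(\<sigma>,\<delta>)\<close> into \<open>(a \<sigma> a\<^sup>-\<^sup>1, a \<delta>)\<close>, whose automorphism fixes every
  \<open>E\<^sub>i\<^sub>j\<close>. Subtracting \<open>t = \<Sum>\<^sub>k a \<delta>(E\<^sub>k\<^sub>0) E\<^sub>0\<^sub>k\<close> changes the derivation by an inner one, so that it kills every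
  \<open>E\<^sub>i\<^sub>j\<close>. A skew derivation that respects the matrix units in this way acts entrywise, which defines
  \<open>(\<tau>,\<theta>)\<close> on \<open>F\<close>. By the universal property of skew power series rings, the substitution \<open>y = a x - t\<close> is
  an isomorphism, and so is the map that reads a series of matrices as a matrix of series.

  Convergence is expressed by congruences modulo the subgroups of elements of value at least \<open>k\<close>:
  a term of the \<open>i\<close>-th place of a series always has value at least \<open>i\<close>, so that the partial sums of length \<open>k\<close>
  determine the sum modulo the \<open>k\<close>-th subgroup.\<close>

section \<open>Finite sums and chains of subgroups\<close>

text \<open>The product in \<open>skew_ps_ring\<close> is an infinite sum of
  \<open>skew_coeff\<close> terms; convergence, associativity and the universal property all have to
  be proved. They have one source: a series acts on every complete module that has an operator
  \<open>Y\<close> in the place of \<open>x\<close> (\<open>skew_module\<close>), and this action is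
  multiplicative. The series as a module over themselves give associativity; a ring with a suitable
  image of \<open>x\<close> gives the universal property. Conjugating the matrix units meets two
  obstacles. The diagonal unit whose corner entry is invertible depends on the component of
  \<open>D\<close>, so the choice is made componentwise by central idempotents. And the construction
  yields only \<open>u w = E_00\<close>; the reverse product is recovered because idempotents of
  \<open>D\<close> are central. The formula for \<open>t\<close> comes from solving
  \<open>a \<delta>(E_ij) = t E_ij - E_ij t\<close> on the elements \<open>E_k0\<close>. Since
  \<open>\<delta>\<close> raises values, \<open>t\<close> has value at least \<open>1\<close>, hence
  lies in the radical, and passing to \<open>a x - t\<close> preserves the filtration.\<close>

fun psum :: "('m, 'x) ring_scheme \<Rightarrow> (nat \<Rightarrow> 'm) \<Rightarrow> nat \<Rightarrow> 'm" where
  "psum M t 0 = \<zero>\<^bsub>M\<^esub>"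
| "psum M t (Suc n) = psum M t n \<oplus>\<^bsub>M\<^esub> t n"

lemma psum_cong: "(\<And>i. i < n \<Longrightarrow> t i = u i) \<Longrightarrow> psum M t n = psum M u n"
  by (induction n) auto

context abelian_group
begin

lemma psum_closed [intro, simp]: "(\<And>i. i < n \<Longrightarrow> t i \<in> carrier G) \<Longrightarrow> psum G t n \<in> carrier G"
  by (induction n) auto

lemma psum_add:
  assumes "\<And>i. i < n \<Longrightarrow> t i \<in> carrier G" "\<And>i. i < n \<Longrightarrow> u i \<in> carrier G"
  shows "psum G (\<lambda>i. t i \<oplus> u i) n = psum G t n \<oplus> psum G u n"
  using assms
proof (induction n)
  case (Suc n)
  then have "psum G t n \<in> carrier G" "psum G u n \<in> carrier G" "t n \<in> carrier G" "u n \<in> carrier G"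
    by auto
  then show ?case using Suc by (simp add: a_ac)
qed simp

lemma psum_zero: "(\<And>i. i < n \<Longrightarrow> t i = \<zero>) \<Longrightarrow> psum G t n = \<zero>"
  by (induction n) auto

lemma psum_single:
  assumes "k < n" "c \<in> carrier G" "t k = c" "\<And>i. i < n \<Longrightarrow> i \<noteq> k \<Longrightarrow> t i = \<zero>"
  shows "psum G t n = c"
  using assms
proof (induction n)
  case (Suc n)
  show ?case
  proof (cases "k = n")
    case True
    then have "psum G t n = \<zero>" using Suc.prems by (intro psum_zero) auto
    then show ?thesis using Suc.prems True by simp
  next
    case False
    then have "psum G t n = c" using Suc by auto
    then show ?thesis using Suc.prems False by simp
  qed
qed simp

lemma psum_swap:
  assumes "\<And>i j. i < n \<Longrightarrow> j < m \<Longrightarrow> f i j \<in> carrier G"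
  shows "psum G (\<lambda>i. psum G (\<lambda>j. f i j) m) n = psum G (\<lambda>j. psum G (\<lambda>i. f i j) n) m"
  using assms
proof (induction n)
  case 0
  have "psum G (\<lambda>j. psum G (\<lambda>i. f i j) 0) m = \<zero>" by (intro psum_zero) simp
  then show ?case by simp
next
  case (Suc n)
  have "psum G (\<lambda>j. psum G (\<lambda>i. f i j) n \<oplus> f n j) m
      = psum G (\<lambda>j. psum G (\<lambda>i. f i j) n) m \<oplus> psum G (f n) m"
    using Suc.prems by (intro psum_add) auto
  then show ?case using Suc by simp
qed

text \<open>\<open>mat_ring\<close> and \<open>skew_ps_ring\<close> are defined with
  \<open>finsum\<close>, whose recursion needs every term in the carrier. Calculations go through
  \<open>psum\<close> instead, which unfolds unconditionally and gives the same result when the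
  carrier is restricted to a subring.\<close>

lemma finsum_lessThan_eq_psum:
  assumes "\<And>i. i < n \<Longrightarrow> t i \<in> carrier G"
  shows "finsum G t {..<n} = psum G t n"
  using assms
proof (induction n)
  case (Suc n)
  have "finsum G t (insert n {..<n}) = t n \<oplus> finsum G t {..<n}"
    using Suc.prems by (intro finsum_insert) auto
  then show ?case using Suc by (simp add: lessThan_Suc a_comm)
qed simp

lemma finsum_atMost_eq_psum:
  assumes "\<And>i. i \<le> n \<Longrightarrow> t i \<in> carrier G"
  shows "finsum G t {..n} = psum G t (Suc n)"
  using finsum_lessThan_eq_psum[of "Suc n" t] assms by (simp add: lessThan_Suc_atMost)

lemma minus_add_distrib:
  assumes "a \<in> carrier G" "b \<in> carrier G" "c \<in> carrier G" "d \<in> carrier G"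
  shows "(a \<oplus> b) \<ominus> (c \<oplus> d) = (a \<ominus> c) \<oplus> (b \<ominus> d)"
  using assms by (simp add: a_minus_def minus_add a_ac)

lemma minus_trans:
  assumes "a \<in> carrier G" "b \<in> carrier G" "c \<in> carrier G"
  shows "a \<ominus> c = (a \<ominus> b) \<oplus> (b \<ominus> c)"
proof -
  have "(a \<oplus> \<ominus> b) \<oplus> (b \<oplus> \<ominus> c) = a \<oplus> (\<ominus> b \<oplus> (b \<oplus> \<ominus> c))"
    using assms by (simp add: a_assoc)
  also have "\<ominus> b \<oplus> (b \<oplus> \<ominus> c) = \<ominus> c" using assms by (simp add: r_neg1)
  finally show ?thesis by (simp add: a_minus_def)
qed

lemma minus_swap:
  assumes "a \<in> carrier G" "b \<in> carrier G"
  shows "b \<ominus> a = \<ominus> (a \<ominus> b)"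
  using assms by (simp add: a_minus_def minus_add a_comm)

lemma minus_eq_zeroD:
  assumes "a \<in> carrier G" "b \<in> carrier G" "a \<ominus> b = \<zero>"
  shows "a = b"
proof -
  have "a = (a \<ominus> b) \<oplus> b" using assms(1,2) by (simp add: a_minus_def a_assoc l_neg)
  then show ?thesis using assms by simp
qed

lemma minus_self [simp]: "a \<in> carrier G \<Longrightarrow> a \<ominus> a = \<zero>"
  by (simp add: a_minus_def r_neg)

lemma minus_zero_right [simp]: "a \<in> carrier G \<Longrightarrow> a \<ominus> \<zero> = a"
  using r_neg[of \<zero>] by (simp add: a_minus_def)

end

lemma additive_psum:
  assumes "abelian_group M" "h \<zero>\<^bsub>M\<^esub> = \<zero>\<^bsub>M'\<^esub>"
    and "\<And>x y. x \<in> carrier M \<Longrightarrow> y \<in> carrier M \<Longrightarrow> h (x \<oplus>\<^bsub>M\<^esub> y) = h x \<oplus>\<^bsub>M'\<^esub> h y"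
    and "\<And>i. i < n \<Longrightarrow> t i \<in> carrier M"
  shows "h (psum M t n) = psum M' (\<lambda>i. h (t i)) n"
proof -
  interpret abelian_group M by fact
  show ?thesis using assms(2-) by (induction n) auto
qed

lemma additive_zero:
  assumes "abelian_group M" "abelian_group N"
    and "\<And>x. x \<in> carrier M \<Longrightarrow> h x \<in> carrier N"
    and "\<And>x y. x \<in> carrier M \<Longrightarrow> y \<in> carrier M \<Longrightarrow> h (x \<oplus>\<^bsub>M\<^esub> y) = h x \<oplus>\<^bsub>N\<^esub> h y"
  shows "h \<zero>\<^bsub>M\<^esub> = \<zero>\<^bsub>N\<^esub>"
proof -
  interpret M: abelian_group M by fact
  interpret N: abelian_group N by fact
  have "h \<zero>\<^bsub>M\<^esub> \<oplus>\<^bsub>N\<^esub> h \<zero>\<^bsub>M\<^esub> = h \<zero>\<^bsub>M\<^esub> \<oplus>\<^bsub>N\<^esub> \<zero>\<^bsub>N\<^esub>"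
    using assms(3,4) by (metis M.l_zero M.zero_closed N.r_zero)
  then show ?thesis using assms(3) N.add.l_cancel by (metis M.zero_closed N.zero_closed)
qed

lemma additive_minus:
  assumes "abelian_group M" "abelian_group N"
    and "\<And>x. x \<in> carrier M \<Longrightarrow> h x \<in> carrier N"
    and "\<And>x y. x \<in> carrier M \<Longrightarrow> y \<in> carrier M \<Longrightarrow> h (x \<oplus>\<^bsub>M\<^esub> y) = h x \<oplus>\<^bsub>N\<^esub> h y"
    and "x \<in> carrier M" "y \<in> carrier M"
  shows "h (x \<ominus>\<^bsub>M\<^esub> y) = h x \<ominus>\<^bsub>N\<^esub> h y"
proof -
  interpret M: abelian_group M by fact
  interpret N: abelian_group N by fact
  have "h (\<ominus>\<^bsub>M\<^esub> y) \<oplus>\<^bsub>N\<^esub> h y = \<zero>\<^bsub>N\<^esub>"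
    using assms(3-) additive_zero[OF assms(1-4)] by (metis M.a_inv_closed M.l_neg)
  then have "h (\<ominus>\<^bsub>M\<^esub> y) = \<ominus>\<^bsub>N\<^esub> h y"
    using assms(3,6) by (metis M.a_inv_closed N.minus_equality)
  then show ?thesis using assms by (simp add: a_minus_def)
qed

text \<open>Models the subgroups of elements of value at least \<open>k\<close> without mentioning
  values. Only sequences that move by an element of \<open>L n\<close> at step \<open>n\<close> are
  required to converge, with an explicit rate; series with \<open>i\<close>-th term in
  \<open>L i\<close> ask for no more. Coefficients, power series and matrices of power series are
  all instances.\<close>

locale chain_group = abelian_group M for M (structure) +
  fixes L :: "nat \<Rightarrow> 'a set"
  assumes L_0: "L 0 = carrier M"
    and L_Suc: "L (Suc k) \<subseteq> L k"
    and zero_L [simp]: "\<zero> \<in> L k"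
    and add_L: "x \<in> L k \<Longrightarrow> y \<in> L k \<Longrightarrow> x \<oplus> y \<in> L k"
    and neg_L: "x \<in> L k \<Longrightarrow> \<ominus> x \<in> L k"
    and L_separated: "(\<And>k. x \<in> L k) \<Longrightarrow> x = \<zero>"
    and L_complete: "(\<And>n. s n \<in> carrier M) \<Longrightarrow> (\<And>n. s (Suc n) \<ominus> s n \<in> L n)
        \<Longrightarrow> \<exists>l\<in>carrier M. \<forall>n. s n \<ominus> l \<in> L n"
begin

lemma L_mono: "i \<le> j \<Longrightarrow> L j \<subseteq> L i"
  by (rule lift_Suc_antimono_le[of L]) (use L_Suc in auto)

lemma L_le: "x \<in> L j \<Longrightarrow> i \<le> j \<Longrightarrow> x \<in> L i"
  using L_mono by blast

lemma L_carrier: "x \<in> L k \<Longrightarrow> x \<in> carrier M"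
  using L_mono[of 0 k] L_0 by auto

lemma psum_L: "(\<And>i. i < n \<Longrightarrow> t i \<in> L k) \<Longrightarrow> psum M t n \<in> L k"
  by (induction n) (auto intro: add_L)

text \<open>Membership of both sides in the carrier is part of the relation, so that symmetry,
  transitivity and addition need no side conditions.\<close>

definition cg :: "nat \<Rightarrow> 'a \<Rightarrow> 'a \<Rightarrow> bool" where
  "cg k x y \<longleftrightarrow> x \<in> carrier M \<and> y \<in> carrier M \<and> x \<ominus> y \<in> L k"

lemma cg_refl: "x \<in> carrier M \<Longrightarrow> cg k x x"
  by (simp add: cg_def)

lemma cg_sym: "cg k x y \<Longrightarrow> cg k y x"
  unfolding cg_def using minus_swap[of x y] neg_L by auto

lemma cg_trans: "cg k x y \<Longrightarrow> cg k y z \<Longrightarrow> cg k x z"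
  unfolding cg_def using minus_trans[of x y z] add_L by auto

lemma cg_add: "cg k x y \<Longrightarrow> cg k u v \<Longrightarrow> cg k (x \<oplus> u) (y \<oplus> v)"
  unfolding cg_def using minus_add_distrib[of x u y v] add_L by auto

lemma cg_le: "cg j x y \<Longrightarrow> i \<le> j \<Longrightarrow> cg i x y"
  unfolding cg_def using L_le by blast

lemma cg_zero: "x \<in> carrier M \<Longrightarrow> cg k x \<zero> \<longleftrightarrow> x \<in> L k"
  by (simp add: cg_def)

lemma cg_eqI:
  assumes "\<And>k. cg k x y"
  shows "x = y"
  using assms L_separated[of "x \<ominus> y"] minus_eq_zeroD unfolding cg_def by blast

lemma cg_L: "cg k x y \<Longrightarrow> x \<in> L k \<Longrightarrow> y \<in> L k"
  using cg_trans[OF cg_sym, of k x y \<zero>] cg_zero[of x k] cg_zero[of y k] unfolding cg_def by auto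

text \<open>Meaningful when \<open>t i\<close> lies in \<open>L i\<close>: completeness then
  provides the sum, its first \<open>n\<close> terms fix it modulo \<open>L n\<close>, and
  separatedness makes it unique.\<close>

definition tsum :: "(nat \<Rightarrow> 'a) \<Rightarrow> 'a" where
  "tsum t = (THE l. \<forall>n. cg n (psum M t n) l)"

lemma tsum_eqI:
  assumes "\<And>n. cg n (psum M t n) l"
  shows "tsum t = l"
  unfolding tsum_def
proof (rule the_equality)
  fix l' assume "\<forall>n. cg n (psum M t n) l'"
  then show "l' = l" using assms by (intro cg_eqI) (metis cg_trans cg_sym)
qed (use assms in auto)

lemma cg_tsum:
  assumes "\<And>i. t i \<in> L i"
  shows "cg n (psum M t n) (tsum t)"
proof -
  have c: "psum M t n \<in> carrier M" for n using assms L_carrier by auto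
  have "\<exists>l\<in>carrier M. \<forall>n. psum M t n \<ominus> l \<in> L n"
  proof (rule L_complete[OF c])
    fix n
    have "psum M t (Suc n) \<ominus> psum M t n = t n"
      using c[of n] L_carrier[OF assms[of n]]
      by (simp add: a_minus_def a_comm[of "psum M t n"] a_assoc r_neg)
    then show "psum M t (Suc n) \<ominus> psum M t n \<in> L n" using assms by simp
  qed
  then obtain l where "\<And>n. cg n (psum M t n) l" unfolding cg_def using c by auto
  then show ?thesis using tsum_eqI by metis
qed

lemma tsum_closed: "(\<And>i. t i \<in> L i) \<Longrightarrow> tsum t \<in> carrier M"
  using cg_tsum unfolding cg_def by blast

lemma tsum_add:
  assumes "\<And>i. t i \<in> L i" "\<And>i. u i \<in> L i"
  shows "tsum (\<lambda>i. t i \<oplus> u i) = tsum t \<oplus> tsum u"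
proof (rule tsum_eqI)
  fix n
  show "cg n (psum M (\<lambda>i. t i \<oplus> u i) n) (tsum t \<oplus> tsum u)"
    using cg_add[OF cg_tsum[of t n, OF assms(1)] cg_tsum[of u n, OF assms(2)]] assms L_carrier
    by (subst psum_add) auto
qed

lemma tsum_L:
  assumes "\<And>i. t i \<in> L i" "\<And>i. t i \<in> L k"
  shows "tsum t \<in> L k"
  using cg_L[OF cg_tsum[OF assms(1)] psum_L, of k] assms(2) by blast

text \<open>Additive maps that respect the chains are continuous. This is applied to multiplication
  by a fixed element, to matrix entries, to the action of a series on a fixed element of a module,
  and to ring homomorphisms.\<close>

lemma additive_tsum:
  assumes N: "chain_group N K"
    and h: "\<And>x. x \<in> carrier M \<Longrightarrow> h x \<in> carrier N"
      "\<And>x y. x \<in> carrier M \<Longrightarrow> y \<in> carrier M \<Longrightarrow> h (x \<oplus> y) = h x \<oplus>\<^bsub>N\<^esub> h y"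
      "\<And>x k. x \<in> L k \<Longrightarrow> h x \<in> K k"
    and t: "\<And>i. t i \<in> L i"
  shows "h (tsum t) = chain_group.tsum N K (\<lambda>i. h (t i))"
proof -
  interpret N: chain_group N K by fact
  have ag: "abelian_group M" "abelian_group N"
    using abelian_group_axioms N.abelian_group_axioms by auto
  show ?thesis
  proof (rule sym, rule N.tsum_eqI)
    fix n
    have "psum N (\<lambda>i. h (t i)) n = h (psum M t n)"
      by (rule additive_psum[where h = h, symmetric, OF ag(1) additive_zero[where h = h, OF ag h(1,2)] h(2)])
        (use t L_carrier in auto)
    then show "N.cg n (psum N (\<lambda>i. h (t i)) n) (h (tsum t))"
      unfolding N.cg_def using cg_tsum[of t n, OF t] h additive_minus[where h = h, OF ag h(1,2)]
      unfolding cg_def by metis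
  qed
qed

end

section \<open>Skew power series rings\<close>

locale chain_ring = ring R + chain_group R L for R (structure) and L +
  assumes mult_L: "x \<in> L i \<Longrightarrow> y \<in> L j \<Longrightarrow> x \<otimes> y \<in> L (i + j)"

text \<open>\<open>L_iff\<close> ties the chain to the \<open>ereal\<close> values, which enter the
  product of series through \<open>filt_lim\<close>. As values are integers,
  \<open>v (\<delta> r) > v r\<close> becomes the step by one in \<open>del_L\<close>; it lets left
  multiplication by \<open>x\<close> raise the filtration of a series by one.\<close>

locale skew_chain_ring = chain_ring R L for R (structure) and L +
  fixes v :: "'a \<Rightarrow> ereal" and \<sigma> \<delta>
  assumes L_iff: "x \<in> L k \<longleftrightarrow> x \<in> carrier R \<and> ereal (real k) \<le> v x"
    and sig_add: "x \<in> carrier R \<Longrightarrow> y \<in> carrier R \<Longrightarrow> \<sigma> (x \<oplus> y) = \<sigma> x \<oplus> \<sigma> y"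
    and sig_mult: "x \<in> carrier R \<Longrightarrow> y \<in> carrier R \<Longrightarrow> \<sigma> (x \<otimes> y) = \<sigma> x \<otimes> \<sigma> y"
    and sig_one [simp]: "\<sigma> \<one> = \<one>"
    and sig_L: "x \<in> L k \<Longrightarrow> \<sigma> x \<in> L k"
    and del_add: "x \<in> carrier R \<Longrightarrow> y \<in> carrier R \<Longrightarrow> \<delta> (x \<oplus> y) = \<delta> x \<oplus> \<delta> y"
    and del_mult: "x \<in> carrier R \<Longrightarrow> y \<in> carrier R \<Longrightarrow> \<delta> (x \<otimes> y) = \<delta> x \<otimes> y \<oplus> \<sigma> x \<otimes> \<delta> y"
    and del_L: "x \<in> L k \<Longrightarrow> \<delta> x \<in> L (Suc k)"
begin

lemma sig_closed [simp]: "x \<in> carrier R \<Longrightarrow> \<sigma> x \<in> carrier R"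
  using sig_L[of x 0] L_0 by simp

lemma del_closed [simp]: "x \<in> carrier R \<Longrightarrow> \<delta> x \<in> carrier R"
  using del_L[of x 0] L_0 L_carrier by simp

lemma sig_zero [simp]: "\<sigma> \<zero> = \<zero>"
  by (rule additive_zero[where h = \<sigma>, OF abelian_group_axioms abelian_group_axioms]) (auto simp: sig_add)

lemma del_zero [simp]: "\<delta> \<zero> = \<zero>"
  by (rule additive_zero[where h = \<delta>, OF abelian_group_axioms abelian_group_axioms]) (auto simp: del_add)

lemma del_one [simp]: "\<delta> \<one> = \<zero>"
  using del_mult[of \<one> \<one>] by (simp add: add.l_cancel_one)

text \<open>Left multiplication by \<open>x\<close> on coefficient sequences: the term
  \<open>s_i x^i\<close> contributes \<open>\<sigma>(s_i)\<close> in degree \<open>i + 1\<close> and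
  \<open>\<delta>(s_i)\<close> in degree \<open>i\<close>.\<close>

definition shift :: "(nat \<Rightarrow> 'a) \<Rightarrow> nat \<Rightarrow> 'a" where
  "shift s i = (case i of 0 \<Rightarrow> \<delta> (s 0) | Suc j \<Rightarrow> \<sigma> (s j) \<oplus> \<delta> (s (Suc j)))"

lemma shift_Suc: "shift s (Suc i) = \<sigma> (s i) \<oplus> \<delta> (s (Suc i))"
  by (simp add: shift_def)

end

text \<open>A complete module over the future ring of series, given by the action of the
  coefficients and an operator \<open>Y\<close> standing for \<open>x\<close>; \<open>Y_act\<close>
  is the relation \<open>x r = \<sigma>(r) x + \<delta>(r)\<close>. The series themselves, with
  \<open>Y = shift\<close>, will give associativity of their product; a ring, with \<open>Y\<close>
  the left multiplication by the image of \<open>x\<close>, will give the universal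
  property.\<close>

locale skew_module = skew_chain_ring R L v \<sigma> \<delta> + M: chain_group M K
  for R (structure) and L v \<sigma> \<delta> and M (structure) and K +
  fixes act :: "'a \<Rightarrow> 'c \<Rightarrow> 'c" and Y :: "'c \<Rightarrow> 'c"
  assumes act_L: "r \<in> L i \<Longrightarrow> m \<in> K j \<Longrightarrow> act r m \<in> K (i + j)"
    and act_add_left: "r \<in> carrier R \<Longrightarrow> s \<in> carrier R \<Longrightarrow> m \<in> carrier M \<Longrightarrow>
           act (r \<oplus> s) m = act r m \<oplus>\<^bsub>M\<^esub> act s m"
    and act_add_right: "r \<in> carrier R \<Longrightarrow> m \<in> carrier M \<Longrightarrow> m' \<in> carrier M \<Longrightarrow>
           act r (m \<oplus>\<^bsub>M\<^esub> m') = act r m \<oplus>\<^bsub>M\<^esub> act r m'"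
    and act_mult: "r \<in> carrier R \<Longrightarrow> s \<in> carrier R \<Longrightarrow> m \<in> carrier M \<Longrightarrow>
           act (r \<otimes> s) m = act r (act s m)"
    and Y_L: "m \<in> K j \<Longrightarrow> Y m \<in> K (Suc j)"
    and Y_add: "m \<in> carrier M \<Longrightarrow> m' \<in> carrier M \<Longrightarrow> Y (m \<oplus>\<^bsub>M\<^esub> m') = Y m \<oplus>\<^bsub>M\<^esub> Y m'"
    and Y_act: "r \<in> carrier R \<Longrightarrow> m \<in> carrier M \<Longrightarrow>
           Y (act r m) = act (\<sigma> r) (Y m) \<oplus>\<^bsub>M\<^esub> act (\<delta> r) m"
begin

lemma act_closed [simp]: "r \<in> carrier R \<Longrightarrow> m \<in> carrier M \<Longrightarrow> act r m \<in> carrier M"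
  using act_L[of r 0 m 0] L_0 M.L_0 by simp

lemma Y_closed [simp]: "m \<in> carrier M \<Longrightarrow> Y m \<in> carrier M"
  using Y_L[of m 0] M.L_0 M.L_carrier by simp

lemma Ypow_L: "m \<in> K j \<Longrightarrow> (Y ^^ i) m \<in> K (i + j)"
  by (induction i) (auto intro: Y_L)

lemma Ypow_closed [simp]: "m \<in> carrier M \<Longrightarrow> (Y ^^ i) m \<in> carrier M"
  by (induction i) auto

lemma act_zero_left [simp]: "m \<in> carrier M \<Longrightarrow> act \<zero> m = \<zero>\<^bsub>M\<^esub>"
  by (rule additive_zero[where h = "\<lambda>r. act r m", OF abelian_group_axioms M.abelian_group_axioms])
    (auto simp: act_add_left)

text \<open>The action of the series \<open>r\<close> on \<open>m\<close>. The sum converges because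
  \<open>Y\<close> raises the index of the chain by one.\<close>

definition star :: "(nat \<Rightarrow> 'a) \<Rightarrow> 'c \<Rightarrow> 'c" where
  "star r m = M.tsum (\<lambda>i. act (r i) ((Y ^^ i) m))"

lemma term_L:
  assumes "\<And>i. r i \<in> L (k - i)" "m \<in> K j"
  shows "act (r i) ((Y ^^ i) m) \<in> K (k + j)" "act (r i) ((Y ^^ i) m) \<in> K (i + j)"
proof -
  \<comment> \<open>With truncated subtraction, \<open>(k - i) + (i + j)\<close> is
    \<open>max k i + j\<close>, so one membership yields both bounds.\<close>
  have *: "act (r i) ((Y ^^ i) m) \<in> K ((k - i) + (i + j))"
    using assms by (intro act_L Ypow_L) auto
  show "act (r i) ((Y ^^ i) m) \<in> K (k + j)" by (rule M.L_le[OF *]) simp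
  show "act (r i) ((Y ^^ i) m) \<in> K (i + j)" by (rule M.L_le[OF *]) simp
qed

lemma term_L':
  assumes "\<And>i. r i \<in> carrier R" "m \<in> carrier M"
  shows "act (r i) ((Y ^^ i) m) \<in> K i"
  using term_L(2)[of r 0 m 0 i] assms L_0 M.L_0 by simp

lemma cg_star:
  assumes "\<And>i. r i \<in> carrier R" "m \<in> carrier M"
  shows "M.cg n (psum M (\<lambda>i. act (r i) ((Y ^^ i) m)) n) (star r m)"
  unfolding star_def using term_L'[OF assms] by (rule M.cg_tsum)

lemma star_closed:
  assumes "\<And>i. r i \<in> carrier R" "m \<in> carrier M"
  shows "star r m \<in> carrier M"
  using cg_star[of r, OF assms] unfolding M.cg_def by blast

lemma star_L:
  assumes "\<And>i. r i \<in> L (k - i)" "m \<in> K j"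
  shows "star r m \<in> K (k + j)"
  unfolding star_def
proof (rule M.tsum_L)
  show "act (r i) ((Y ^^ i) m) \<in> K i" for i
    using M.L_le[OF term_L(2)[OF assms]] by simp
qed (rule term_L(1)[OF assms])

lemma Ypow_add: "m \<in> carrier M \<Longrightarrow> m' \<in> carrier M \<Longrightarrow>
    (Y ^^ i) (m \<oplus>\<^bsub>M\<^esub> m') = (Y ^^ i) m \<oplus>\<^bsub>M\<^esub> (Y ^^ i) m'"
  by (induction i) (auto simp: Y_add)

lemma star_add_left:
  assumes "\<And>i. r i \<in> carrier R" "\<And>i. s i \<in> carrier R" "m \<in> carrier M"
  shows "star (\<lambda>i. r i \<oplus> s i) m = star r m \<oplus>\<^bsub>M\<^esub> star s m"
  unfolding star_def using assms
  by (subst M.tsum_add[symmetric]) (auto simp: term_L' act_add_left)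

lemma star_add_right:
  assumes "\<And>i. r i \<in> carrier R" "m \<in> carrier M" "m' \<in> carrier M"
  shows "star r (m \<oplus>\<^bsub>M\<^esub> m') = star r m \<oplus>\<^bsub>M\<^esub> star r m'"
  unfolding star_def using assms
  by (subst M.tsum_add[symmetric]) (auto simp: term_L' act_add_right Ypow_add)

lemma star_scale:
  assumes "\<And>i. r i \<in> carrier R" "c \<in> carrier R" "m \<in> carrier M"
  shows "star (\<lambda>i. c \<otimes> r i) m = act c (star r m)"
proof -
  have "act c (star r m) = M.tsum (\<lambda>i. act c (act (r i) ((Y ^^ i) m)))"
    unfolding star_def
  proof (rule M.additive_tsum[OF M.chain_group_axioms])
    show "x \<in> K k \<Longrightarrow> act c x \<in> K k" for x k
      using act_L[of c 0 x k] assms(2) L_0 by simp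
  qed (use assms in \<open>auto simp: act_add_right term_L'\<close>)
  then show ?thesis using assms unfolding star_def by (simp add: act_mult)
qed

text \<open>Collecting the terms of the shifted series by the coefficient \<open>s i\<close> gives
  \<open>\<sigma>(s i) Y^(i+1) m + \<delta>(s i) Y^i m\<close>, which \<open>Y_act\<close>
  recognises as \<open>Y\<close> applied to the \<open>i\<close>-th term of the original
  sum.\<close>

lemma star_shift:
  assumes s: "\<And>i. s i \<in> carrier R" and m: "m \<in> carrier M"
  shows "star (shift s) m = Y (star s m)"
proof -
  let ?t = "\<lambda>i. act (s i) ((Y ^^ i) m)"
  have tc: "?t i \<in> carrier M" for i using s m by simp
  have pc: "psum M ?t n \<in> carrier M" for n using tc by (intro M.psum_closed)
  \<comment> \<open>The shifted sum has one term more: it contains \<open>\<sigma> (s i)\<close> for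
    \<open>i < n\<close> but \<open>\<delta> (s i)\<close> up to \<open>i = n\<close>. The excess
    term lies in \<open>K n\<close> and disappears in the limit.\<close>
  have eq: "psum M (\<lambda>i. act (shift s i) ((Y ^^ i) m)) (Suc n)
      = Y (psum M ?t n) \<oplus>\<^bsub>M\<^esub> act (\<delta> (s n)) ((Y ^^ n) m)" for n
  proof (induction n)
    case 0
    have "Y \<zero>\<^bsub>M\<^esub> = \<zero>\<^bsub>M\<^esub>"
      by (rule additive_zero[where h = Y, OF M.abelian_group_axioms M.abelian_group_axioms])
        (auto simp: Y_add)
    then show ?case using s m by (simp add: shift_def)
  next
    case (Suc n)
    have "act (shift s (Suc n)) ((Y ^^ Suc n) m)
        = act (\<sigma> (s n)) ((Y ^^ Suc n) m) \<oplus>\<^bsub>M\<^esub> act (\<delta> (s (Suc n))) ((Y ^^ Suc n) m)"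
      using s m by (simp add: shift_def act_add_left)
    moreover have "Y (psum M ?t (Suc n)) = Y (psum M ?t n) \<oplus>\<^bsub>M\<^esub>
        (act (\<sigma> (s n)) ((Y ^^ Suc n) m) \<oplus>\<^bsub>M\<^esub> act (\<delta> (s n)) ((Y ^^ n) m))"
      using s m tc pc by (simp add: Y_add Y_act)
    ultimately show ?case
      unfolding psum.simps(2)[of _ _ "Suc n"] Suc.IH using s m pc by (simp add: M.a_ac)
  qed
  show ?thesis
  proof (rule M.cg_eqI)
    fix n
    have sh: "shift s i \<in> carrier R" for i unfolding shift_def using s by (auto split: nat.split)
    have 1: "M.cg n (star (shift s) m) (psum M (\<lambda>i. act (shift s i) ((Y ^^ i) m)) (Suc n))"
      by (rule M.cg_sym[OF M.cg_le[OF cg_star[of "shift s", OF sh m]]]) simp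
    have 2: "M.cg n (Y (psum M ?t n)) (Y (star s m))"
      unfolding M.cg_def
      using cg_star[of s, OF s m, of n] Y_L[THEN M.L_le, of _ n n]
        additive_minus[where h = Y, OF M.abelian_group_axioms M.abelian_group_axioms Y_closed Y_add, symmetric]
      unfolding M.cg_def by auto
    have "act (\<delta> (s n)) ((Y ^^ n) m) \<in> K n"
      using term_L'[of "\<lambda>i. \<delta> (s i)" m n] s m by simp
    then have 3: "M.cg n (act (\<delta> (s n)) ((Y ^^ n) m)) \<zero>\<^bsub>M\<^esub>"
      using M.cg_zero s m by simp
    have "M.cg n (Y (psum M ?t n) \<oplus>\<^bsub>M\<^esub> act (\<delta> (s n)) ((Y ^^ n) m)) (Y (star s m) \<oplus>\<^bsub>M\<^esub> \<zero>\<^bsub>M\<^esub>)"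
      by (rule M.cg_add[OF 2 3])
    then show "M.cg n (star (shift s) m) (Y (star s m))"
      using M.cg_trans[OF 1] unfolding eq using star_closed[of s, OF s m] by simp
  qed
qed

lemma star_shift_pow:
  assumes s: "\<And>i. s i \<in> carrier R" and m: "m \<in> carrier M"
  shows "star ((shift ^^ i) s) m = (Y ^^ i) (star s m)"
proof -
  have c: "(shift ^^ i) s j \<in> carrier R" for i j
    by (induction i arbitrary: j) (auto simp: s shift_def split: nat.split)
  show ?thesis by (induction i) (auto simp: star_shift[of _ m, OF c m])
qed

end

text \<open>Turns the topological limit in the definition of the product into congruences: every
  real is below some natural number, so tending to infinity means eventually lying in each
  \<open>L k\<close>, and separatedness makes the limit unique.\<close>

lemma filt_lim_eqI:
  assumes R: "chain_group R L" and L: "\<And>x k. x \<in> L k \<longleftrightarrow> x \<in> carrier R \<and> ereal (real k) \<le> v x"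
    and s: "\<And>n. s n \<in> carrier R" and l: "l \<in> carrier R"
    and lim: "\<And>k. \<exists>n0. \<forall>n\<ge>n0. s n \<ominus>\<^bsub>R\<^esub> l \<in> L k"
  shows "filt_lim R v s = l"
proof -
  interpret chain_group R L by fact
  have iff: "filt_tendsto R v s m \<longleftrightarrow> m \<in> carrier R \<and> (\<forall>k. \<exists>n0. \<forall>n\<ge>n0. s n \<ominus>\<^bsub>R\<^esub> m \<in> L k)" for m
  proof (cases "m \<in> carrier R")
    case True
    have "(\<lambda>n. v (s n \<ominus>\<^bsub>R\<^esub> m)) \<longlonglongrightarrow> \<infinity> \<longleftrightarrow> (\<forall>k::nat. \<exists>n0. \<forall>n\<ge>n0. ereal (real k) \<le> v (s n \<ominus>\<^bsub>R\<^esub> m))"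
      unfolding tendsto_PInfty eventually_sequentially
      by (meson ereal_less_eq(3) le_less less_le_trans less_ereal.simps(1) order.strict_implies_order reals_Archimedean2)
    then show ?thesis using True s by (simp add: filt_tendsto_def L)
  qed (auto simp: filt_tendsto_def)
  show ?thesis
    unfolding filt_lim_def
  proof (rule the_equality)
    show "filt_tendsto R v s l" using iff lim l by blast
    fix m assume m: "filt_tendsto R v s m"
    then have mc: "m \<in> carrier R" using iff by blast
    show "m = l"
    proof (rule cg_eqI)
      fix k
      obtain n1 n2 where "\<forall>n\<ge>n1. s n \<ominus>\<^bsub>R\<^esub> m \<in> L k" "\<forall>n\<ge>n2. s n \<ominus>\<^bsub>R\<^esub> l \<in> L k"
        using m iff lim by meson
      then have "cg k (s (max n1 n2)) m" "cg k (s (max n1 n2)) l"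
        unfolding cg_def using s l mc by auto
      then show "cg k m l" using cg_sym cg_trans by blast
    qed
  qed
qed

section \<open>The complete group of series and the product as an action\<close>

context skew_chain_ring
begin

abbreviation S :: "(nat \<Rightarrow> 'a) ring" where
  "S \<equiv> skew_ps_ring R v \<sigma> \<delta>"

text \<open>The condition \<open>v (r i) + i \<ge> k\<close> for all \<open>i\<close>. For
  \<open>i \<ge> k\<close> the truncated difference is \<open>0\<close> and \<open>L 0\<close> is
  the whole carrier, so no condition remains.\<close>

definition SL :: "nat \<Rightarrow> (nat \<Rightarrow> 'a) set" where
  "SL k = {r. \<forall>i. r i \<in> L (k - i)}"

lemma S_carrier: "r \<in> carrier S \<longleftrightarrow> (\<forall>i. r i \<in> carrier R)"
  by (simp add: skew_ps_ring_def)

lemma S_add: "r \<oplus>\<^bsub>S\<^esub> s = (\<lambda>i. r i \<oplus> s i)"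
  and S_zero: "\<zero>\<^bsub>S\<^esub> = (\<lambda>i. \<zero>)"
  and S_one: "\<one>\<^bsub>S\<^esub> = (\<lambda>i. if i = 0 then \<one> else \<zero>)"
  by (simp_all add: skew_ps_ring_def)

lemma abelian_group_S: "abelian_group S"
proof (rule abelian_groupI)
  fix x assume "x \<in> carrier S"
  then show "\<exists>y\<in>carrier S. y \<oplus>\<^bsub>S\<^esub> x = \<zero>\<^bsub>S\<^esub>"
    by (intro bexI[of _ "\<lambda>i. \<ominus> x i"]) (auto simp: S_carrier S_add S_zero l_neg)
qed (auto simp: S_carrier S_add S_zero a_ac)

lemma S_minus:
  assumes "r \<in> carrier S" "s \<in> carrier S"
  shows "r \<ominus>\<^bsub>S\<^esub> s = (\<lambda>i. r i \<ominus> s i)"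
proof -
  interpret S: abelian_group S by (rule abelian_group_S)
  have "\<ominus>\<^bsub>S\<^esub> s = (\<lambda>i. \<ominus> s i)"
    by (rule S.minus_equality) (use assms in \<open>auto simp: S_carrier S_add S_zero l_neg\<close>)
  then show ?thesis by (simp add: a_minus_def S_add)
qed

lemma S_uminus: "s \<in> carrier S \<Longrightarrow> \<ominus>\<^bsub>S\<^esub> s = (\<lambda>i. \<ominus> s i)"
proof -
  interpret S: abelian_group S by (rule abelian_group_S)
  show "s \<in> carrier S \<Longrightarrow> \<ominus>\<^bsub>S\<^esub> s = (\<lambda>i. \<ominus> s i)"
    by (rule S.minus_equality) (auto simp: S_carrier S_add S_zero l_neg)
qed

lemma S_psum: "psum S t n i = psum R (\<lambda>k. t k i) n"
  by (induction n) (auto simp: S_zero S_add)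

text \<open>Concerns the additive structure of \<open>S\<close> only, so it is available before
  anything is known about the product. Completeness holds coefficient by coefficient.\<close>

lemma chain_group_S: "chain_group S SL"
proof -
  interpret S: abelian_group S by (rule abelian_group_S)
  show ?thesis
  proof
    show "SL 0 = carrier S" unfolding SL_def using S_carrier L_0 by auto
    show "SL (Suc k) \<subseteq> SL k" for k
      unfolding SL_def using L_le[of _ "Suc k - i" "k - i" for i] by (auto simp: le_diff_conv)
    show "\<zero>\<^bsub>S\<^esub> \<in> SL k" for k by (simp add: SL_def S_zero)
    show "x \<oplus>\<^bsub>S\<^esub> y \<in> SL k" if "x \<in> SL k" "y \<in> SL k" for x y k
      using that by (simp add: SL_def S_add add_L)
    show "\<ominus>\<^bsub>S\<^esub> x \<in> SL k" if "x \<in> SL k" for x k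
    proof -
      have "x \<in> carrier S" using that L_carrier by (auto simp: SL_def S_carrier)
      then show ?thesis using that by (simp add: S_uminus SL_def neg_L)
    qed
    show "x = \<zero>\<^bsub>S\<^esub>" if "\<And>k. x \<in> SL k" for x
    proof
      fix i
      have "x i \<in> L k" for k using that[of "k + i"] by (auto simp: SL_def dest: spec[of _ i])
      then show "x i = \<zero>\<^bsub>S\<^esub> i" by (simp add: L_separated S_zero)
    qed
    fix s assume s: "\<And>n. s n \<in> carrier S" and d: "\<And>n. s (Suc n) \<ominus>\<^bsub>S\<^esub> s n \<in> SL n"
    have sc: "s n i \<in> carrier R" for n i using s by (simp add: S_carrier)
    \<comment> \<open>A difference in \<open>SL m\<close> controls the coefficient at
      \<open>i\<close> only modulo \<open>L (m - i)\<close>. Starting the sequence at index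
      \<open>i\<close> restores the rate that \<open>L_complete\<close> asks for.\<close>
    have "\<exists>l\<in>carrier R. \<forall>n. s (n + i) i \<ominus> l \<in> L n" for i
    proof (rule L_complete)
      fix n
      show "s (Suc n + i) i \<ominus> s (n + i) i \<in> L n"
        using d[of "n + i"] by (auto simp: S_minus s SL_def dest: spec[of _ i])
    qed (rule sc)
    then obtain l where l: "\<And>i. l i \<in> carrier R" "\<And>i n. s (n + i) i \<ominus> l i \<in> L n"
      by metis
    have "s n \<ominus>\<^bsub>S\<^esub> l \<in> SL n" for n
    proof -
      have "s n i \<ominus> l i \<in> L (n - i)" for i
      proof (cases "i \<le> n")
        case True
        then show ?thesis using l(2)[of "n - i" i] by simp
      next
        case False
        then show ?thesis using l(1) sc L_0 by simp
      qed
      then show ?thesis using s l by (simp add: S_carrier S_minus SL_def)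
    qed
    then show "\<exists>l\<in>carrier S. \<forall>n. s n \<ominus>\<^bsub>S\<^esub> l \<in> SL n"
      using l(1) by (intro bexI[of _ l]) (auto simp: S_carrier)
  qed
qed

lemma shift_SL: "s \<in> SL k \<Longrightarrow> shift s \<in> SL (Suc k)"
  unfolding SL_def
proof safe
  fix i assume s: "\<forall>i. s i \<in> L (k - i)"
  have *: "\<delta> (s i) \<in> L (Suc k - i)" for i
    by (rule L_le[OF del_L[OF s[rule_format, of i]]]) simp
  show "shift s i \<in> L (Suc k - i)"
  proof (cases i)
    case (Suc j)
    have "\<sigma> (s j) \<in> L (Suc k - i)" unfolding Suc using sig_L s by simp
    then show ?thesis using *[of i] by (simp add: shift_def Suc add_L)
  qed (use *[of 0] in \<open>simp add: shift_def\<close>)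
qed

text \<open>The series as a left module over themselves, set up before \<open>S\<close> is known to
  be a ring: only addition, scaling of coefficients and \<open>shift\<close> enter.\<close>

lemma ps_module: "skew_module R L v \<sigma> \<delta> S SL (\<lambda>c s i. c \<otimes> s i) shift"
proof -
  interpret S: chain_group S SL by (rule chain_group_S)
  show ?thesis
  proof
    fix r i m j assume "r \<in> L i" "m \<in> SL j"
    moreover have "r \<otimes> m l \<in> L (i + j - l)" if "r \<in> L i" "m l \<in> L (j - l)" for l
      by (rule L_le[OF mult_L[OF that]]) simp
    ultimately show "(\<lambda>l. r \<otimes> m l) \<in> SL (i + j)" unfolding SL_def by auto
  next
    fix m m' assume "m \<in> carrier S" "m' \<in> carrier S"
    then show "shift (m \<oplus>\<^bsub>S\<^esub> m') = shift m \<oplus>\<^bsub>S\<^esub> shift m'"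
      by (auto simp: fun_eq_iff shift_def S_add S_carrier sig_add del_add a_ac split: nat.split)
  next
    fix r m assume "r \<in> carrier R" "m \<in> carrier S"
    then show "shift (\<lambda>i. r \<otimes> m i) = (\<lambda>i. \<sigma> r \<otimes> shift m i) \<oplus>\<^bsub>S\<^esub> (\<lambda>i. \<delta> r \<otimes> m i)"
      by (auto simp: fun_eq_iff shift_def S_add S_carrier sig_mult del_mult r_distr a_ac split: nat.split)
  qed (auto simp: S_carrier S_add l_distr r_distr m_assoc shift_SL)
qed

lemma skew_coeff_closed: "s \<in> carrier R \<Longrightarrow> skew_coeff R \<sigma> \<delta> i k s \<in> carrier R"
proof (induction i arbitrary: k)
  case (Suc i)
  then show ?case by (cases k) auto
qed simp

text \<open>Links the recursion \<open>skew_coeff\<close>, which treats one coefficient at a time,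
  with the iterated operator: in \<open>x^i s\<close>, the coefficient of \<open>x^m\<close>
  collects from each \<open>s_j x^j\<close> with \<open>j \<le> m\<close> the coefficient of
  \<open>x^(m-j)\<close> in \<open>x^i s_j\<close>.\<close>

lemma shift_pow_eq:
  assumes s: "\<And>j. s j \<in> carrier R"
  shows "(shift ^^ i) s m = psum R (\<lambda>j. skew_coeff R \<sigma> \<delta> i (m - j) (s j)) (Suc m)"
proof (induction i arbitrary: m)
  case 0
  show ?case unfolding funpow_0 by (rule psum_single[of m, symmetric]) (use s in auto)
next
  case (Suc i)
  let ?c = "\<lambda>i m j. skew_coeff R \<sigma> \<delta> i (m - j) (s j)"
  have c: "?c i m j \<in> carrier R" for i m j using s by (rule skew_coeff_closed)
  note ag = abelian_group_axioms
  have sg: "\<sigma> (psum R (?c i m) k) = psum R (\<lambda>j. \<sigma> (?c i m j)) k" for m k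
    by (rule additive_psum[where h = \<sigma>, OF ag sig_zero sig_add]) (use c in auto)
  have dl: "\<delta> (psum R (?c i m) k) = psum R (\<lambda>j. \<delta> (?c i m j)) k" for m k
    by (rule additive_psum[where h = \<delta>, OF ag del_zero del_add]) (use c in auto)
  show ?case
  proof (cases m)
    case 0
    then show ?thesis using Suc c[of i 0 0] by (simp add: shift_def)
  next
    case (Suc m')
    \<comment> \<open>The sum with \<open>\<sigma>\<close> comes from coefficient
      \<open>m' = m - 1\<close> and has one term fewer than the sum with \<open>\<delta>\<close>.
      The term \<open>j = m\<close> of the latter is split off; it is the case of
      \<open>skew_coeff\<close> at \<open>k = 0\<close>, where only \<open>\<delta>\<close>
      occurs.\<close>
    have "(shift ^^ Suc i) s m = psum R (\<lambda>j. \<sigma> (?c i m' j)) (Suc m') \<oplus> psum R (\<lambda>j. \<delta> (?c i m j)) (Suc m)"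
      unfolding Suc funpow.simps comp_apply shift_Suc Suc.IH sg dl ..
    also have "\<dots> = (psum R (\<lambda>j. \<sigma> (?c i m' j)) (Suc m') \<oplus> psum R (\<lambda>j. \<delta> (?c i m j)) m) \<oplus> \<delta> (?c i m m)"
      unfolding psum.simps(2)[of R "\<lambda>j. \<delta> (?c i m j)"]
      by (rule a_assoc[symmetric]; (intro psum_closed)?) (simp_all add: skew_coeff_closed[OF s])
    also have "psum R (\<lambda>j. \<sigma> (?c i m' j)) (Suc m') \<oplus> psum R (\<lambda>j. \<delta> (?c i m j)) m
        = psum R (?c (Suc i) m) m"
    proof -
      have "psum R (\<lambda>j. \<sigma> (?c i m' j)) (Suc m') \<oplus> psum R (\<lambda>j. \<delta> (?c i m j)) (Suc m')
          = psum R (\<lambda>j. \<sigma> (?c i m' j) \<oplus> \<delta> (?c i m j)) (Suc m')"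
        by (rule psum_add[symmetric]) (simp_all add: skew_coeff_closed[OF s])
      also have "\<dots> = psum R (?c (Suc i) m) (Suc m')"
        by (rule psum_cong) (simp add: Suc Suc_diff_le)
      finally show ?thesis unfolding Suc .
    qed
    also have "\<delta> (?c i m m) = ?c (Suc i) m m" by simp
    finally show ?thesis by simp
  qed
qed

text \<open>The defining formula is the action of \<open>r\<close> on \<open>s\<close> in the module
  of series. From here on products are computed through \<open>star\<close>.\<close>

lemma S_mult:
  assumes "r \<in> carrier S" "s \<in> carrier S"
  shows "r \<otimes>\<^bsub>S\<^esub> s = skew_module.star S SL (\<lambda>c s i. c \<otimes> s i) shift r s"
proof
  fix m
  interpret ps: skew_module R L v \<sigma> \<delta> S SL "\<lambda>c s i. c \<otimes> s i" shift by (rule ps_module)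
  have rc: "r i \<in> carrier R" and sc: "s i \<in> carrier R" for i using assms by (auto simp: S_carrier)
  have spc: "(shift ^^ i) s \<in> carrier S" for i using assms(2) by simp
  have spc': "(shift ^^ i) s j \<in> carrier R" for i j using spc[of i] by (simp add: S_carrier)
  let ?P = "\<lambda>N. psum S (\<lambda>i k. r i \<otimes> (shift ^^ i) s k) N"
  have Pc: "?P N \<in> carrier S" for N by (simp add: S_carrier S_psum rc spc')
  have st: "ps.star r s \<in> carrier S" using ps.star_closed rc assms(2) by blast
  have cc: "skew_coeff R \<sigma> \<delta> i (m - j) (s j) \<in> carrier R" for i j
    using sc by (rule skew_coeff_closed)
  \<comment> \<open>The index set \<open>{..N}\<close> has \<open>N + 1\<close> elements, hence
    \<open>Suc N\<close> on the right.\<close>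
  have eq: "(\<Oplus>i\<in>{..N}. \<Oplus>j\<in>{..m}. r i \<otimes> skew_coeff R \<sigma> \<delta> i (m - j) (s j)) = ?P (Suc N) m" for N
  proof -
    have "(\<Oplus>j\<in>{..m}. r i \<otimes> skew_coeff R \<sigma> \<delta> i (m - j) (s j)) = r i \<otimes> (shift ^^ i) s m" for i
    proof -
      have "(\<Oplus>j\<in>{..m}. r i \<otimes> skew_coeff R \<sigma> \<delta> i (m - j) (s j))
          = psum R (\<lambda>j. r i \<otimes> skew_coeff R \<sigma> \<delta> i (m - j) (s j)) (Suc m)"
        by (rule finsum_atMost_eq_psum) (simp add: rc cc)
      also have "\<dots> = r i \<otimes> psum R (\<lambda>j. skew_coeff R \<sigma> \<delta> i (m - j) (s j)) (Suc m)"
        by (rule additive_psum[where h = "\<lambda>x. r i \<otimes> x", OF abelian_group_axioms, symmetric])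
          (auto simp: rc cc r_distr)
      finally show ?thesis by (simp only: shift_pow_eq[OF sc])
    qed
    then show ?thesis
      unfolding S_psum
      by (subst finsum_atMost_eq_psum) (auto simp: rc spc' simp del: psum.simps)
  qed
  have "(r \<otimes>\<^bsub>S\<^esub> s) m = filt_lim R v
      (\<lambda>N. \<Oplus>i\<in>{..N}. \<Oplus>j\<in>{..m}. r i \<otimes> skew_coeff R \<sigma> \<delta> i (m - j) (s j))"
    by (simp add: skew_ps_ring_def)
  also have "\<dots> = ps.star r s m"
    unfolding eq
  proof (rule filt_lim_eqI[OF chain_group_axioms L_iff])
    show "?P (Suc n) m \<in> carrier R" for n using Pc by (simp only: S_carrier)
    show "ps.star r s m \<in> carrier R" using st by (simp add: S_carrier)
    fix k
    \<comment> \<open>Congruence modulo \<open>SL (Suc n)\<close> is congruence modulo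
      \<open>L (Suc n - m)\<close> in coefficient \<open>m\<close>, so \<open>n \<ge> k + m\<close>
      is enough.\<close>
    have "?P (Suc n) m \<ominus> ps.star r s m \<in> L k" if "n \<ge> k + m" for n
    proof -
      have "ps.M.cg (Suc n) (?P (Suc n)) (ps.star r s)" by (rule ps.cg_star) (use rc assms in auto)
      then have "?P (Suc n) m \<ominus> ps.star r s m \<in> L (Suc n - m)"
        unfolding ps.M.cg_def using st Pc by (simp add: S_minus SL_def del: psum.simps)
      then show ?thesis by (rule L_le) (use that in simp)
    qed
    then show "\<exists>n0. \<forall>n\<ge>n0. ?P (Suc n) m \<ominus> ps.star r s m \<in> L k" by blast
  qed
  finally show "(r \<otimes>\<^bsub>S\<^esub> s) m = ps.star r s m" .
qed

end

definition ps_monom :: "('a, 'm) ring_scheme \<Rightarrow> 'a \<Rightarrow> nat \<Rightarrow> nat \<Rightarrow> 'a" where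
  "ps_monom R c i = (\<lambda>j. if j = i then c else \<zero>\<^bsub>R\<^esub>)"

lemma ps_const_eq_monom: "ps_const R c = ps_monom R c 0"
  and ps_var_eq_monom: "ps_var R = ps_monom R \<one>\<^bsub>R\<^esub> (Suc 0)"
  by (auto simp: fun_eq_iff ps_const_def ps_var_def ps_monom_def)

lemma (in skew_module) star_monom:
  assumes "c \<in> carrier R" "m \<in> carrier M"
  shows "star (ps_monom R c i) m = act c ((Y ^^ i) m)"
  unfolding star_def
proof (rule M.tsum_eqI)
  fix n
  let ?a = "act c ((Y ^^ i) m)"
  have a: "?a \<in> carrier M" using assms by simp
  show "M.cg n (psum M (\<lambda>j. act (ps_monom R c i j) ((Y ^^ j) m)) n) ?a"
  proof (cases "i < n")
    case True
    have "psum M (\<lambda>j. act (ps_monom R c i j) ((Y ^^ j) m)) n = ?a"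
      by (rule M.psum_single[OF True]) (use assms in \<open>auto simp: ps_monom_def\<close>)
    then show ?thesis using M.cg_refl a by simp
  next
    \<comment> \<open>Before the only nonzero term is reached the partial sums vanish, while that
      term lies in \<open>K i\<close> and so in \<open>K n\<close>.\<close>
    case False
    have "psum M (\<lambda>j. act (ps_monom R c i j) ((Y ^^ j) m)) n = \<zero>\<^bsub>M\<^esub>"
      by (rule M.psum_zero) (use False assms in \<open>auto simp: ps_monom_def\<close>)
    moreover have "?a \<in> K n"
      using M.L_le[OF term_L'[of "\<lambda>_. c" m i]] assms False by simp
    ultimately show ?thesis using M.cg_sym[of n ?a "\<zero>\<^bsub>M\<^esub>"] M.cg_zero a by simp
  qed
qed

context skew_chain_ring
begin

lemma monom_closed: "c \<in> carrier R \<Longrightarrow> ps_monom R c i \<in> carrier S"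
  by (simp add: ps_monom_def S_carrier)

lemma const_closed: "c \<in> carrier R \<Longrightarrow> ps_const R c \<in> carrier S"
  and var_closed: "ps_var R \<in> carrier S"
  by (simp_all add: ps_const_eq_monom ps_var_eq_monom monom_closed)

lemma const_SL: "c \<in> L k \<Longrightarrow> ps_const R c \<in> SL k"
  by (simp add: SL_def ps_const_def)

lemma var_SL: "ps_var R \<in> SL 1"
  using L_0 by (auto simp: SL_def ps_var_def)

lemma const_mult:
  assumes "c \<in> carrier R" "s \<in> carrier S"
  shows "ps_const R c \<otimes>\<^bsub>S\<^esub> s = (\<lambda>i. c \<otimes> s i)"
proof -
  interpret ps: skew_module R L v \<sigma> \<delta> S SL "\<lambda>c s i. c \<otimes> s i" shift by (rule ps_module)
  show ?thesis using assms by (simp add: ps_const_eq_monom S_mult monom_closed ps.star_monom)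
qed

lemma var_mult:
  assumes "s \<in> carrier S"
  shows "ps_var R \<otimes>\<^bsub>S\<^esub> s = shift s"
proof -
  interpret ps: skew_module R L v \<sigma> \<delta> S SL "\<lambda>c s i. c \<otimes> s i" shift by (rule ps_module)
  have "shift s \<in> carrier S" using ps.Y_closed assms .
  then have "shift s i \<in> carrier R" for i by (simp add: S_carrier)
  then show ?thesis using assms
    by (simp add: ps_var_eq_monom S_mult monom_closed ps.star_monom)
qed

text \<open>Monomials span topologically. This gives the right unit law and reduces continuous
  homomorphisms to their values on monomials.\<close>

lemma tsum_monom:
  assumes "s \<in> carrier S"
  shows "chain_group.tsum S SL (\<lambda>i. ps_monom R (s i) i) = s"
proof -
  interpret S: chain_group S SL by (rule chain_group_S)
  show ?thesis
  proof (rule S.tsum_eqI)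
    fix n
    have s: "s i \<in> carrier R" for i using assms by (simp add: S_carrier)
    have c: "psum S (\<lambda>i. ps_monom R (s i) i) n \<in> carrier S" using s by (auto intro: monom_closed)
    have "psum S (\<lambda>i. ps_monom R (s i) i) n j \<ominus> s j \<in> L (n - j)" for j
    proof (cases "j < n")
      case True
      have "psum S (\<lambda>i. ps_monom R (s i) i) n j = s j"
        unfolding S_psum by (rule psum_single[OF True]) (use s in \<open>auto simp: ps_monom_def\<close>)
      then show ?thesis using s by simp
    next
      case False
      then show ?thesis using s c L_0 by (auto simp: S_carrier)
    qed
    then show "S.cg n (psum S (\<lambda>i. ps_monom R (s i) i) n) s"
      unfolding S.cg_def using c assms by (simp add: S_minus SL_def)
  qed
qed

end

text \<open>The product \<open>r s\<close> is the convergent sum of the \<open>r_i x^i s\<close>.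
  The action is continuous in the series and can be taken term by term, and \<open>x^i s\<close>
  acts as \<open>s\<close> followed by \<open>Y^i\<close>. For the module of series this is
  associativity; for a ring it is multiplicativity of the induced map.\<close>

lemma (in skew_module) star_mult:
  assumes r: "r \<in> carrier S" and s: "s \<in> carrier S" and m: "m \<in> carrier M"
  shows "star (r \<otimes>\<^bsub>S\<^esub> s) m = star r (star s m)"
proof -
  interpret ps: skew_module R L v \<sigma> \<delta> S SL "\<lambda>c s i. c \<otimes> s i" shift by (rule ps_module)
  have rc: "r i \<in> carrier R" and sc: "s i \<in> carrier R" for i using r s by (auto simp: S_carrier)
  have spc: "(shift ^^ i) s \<in> carrier S" for i using s by simp
  have "star (ps.M.tsum (\<lambda>i j. r i \<otimes> (shift ^^ i) s j)) m
      = M.tsum (\<lambda>i. star (\<lambda>j. r i \<otimes> (shift ^^ i) s j) m)"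
  proof (rule ps.M.additive_tsum[OF M.chain_group_axioms])
    show "x \<in> carrier S \<Longrightarrow> star x m \<in> carrier M" for x
      using star_closed m by (simp add: S_carrier)
    show "x \<in> carrier S \<Longrightarrow> y \<in> carrier S \<Longrightarrow> star (x \<oplus>\<^bsub>S\<^esub> y) m = star x m \<oplus>\<^bsub>M\<^esub> star y m" for x y
      using star_add_left m by (simp add: S_carrier S_add)
    show "x \<in> SL k \<Longrightarrow> star x m \<in> K k" for x k
      using star_L[of x k m 0] m M.L_0 by (simp add: SL_def)
    show "(\<lambda>j. r i \<otimes> (shift ^^ i) s j) \<in> SL i" for i
      by (rule ps.term_L') (use rc s in auto)
  qed
  also have "(\<lambda>i. star (\<lambda>j. r i \<otimes> (shift ^^ i) s j) m) = (\<lambda>i. act (r i) ((Y ^^ i) (star s m)))"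
    using spc rc m by (simp add: star_scale star_shift_pow[of s, OF sc] S_carrier)
  finally show ?thesis unfolding S_mult[OF r s] ps.star_def star_def[of r] .
qed

lemma (in skew_chain_ring) ring_S: "ring S"
proof -
  interpret ps: skew_module R L v \<sigma> \<delta> S SL "\<lambda>c s i. c \<otimes> s i" shift by (rule ps_module)
  have clos: "r \<otimes>\<^bsub>S\<^esub> s \<in> carrier S" if "r \<in> carrier S" "s \<in> carrier S" for r s
    unfolding S_mult[OF that] by (rule ps.star_closed) (use that in \<open>auto simp: S_carrier\<close>)
  have one: "\<one>\<^bsub>S\<^esub> = ps_const R \<one>" by (simp add: S_one ps_const_def)
  have onec: "\<one>\<^bsub>S\<^esub> \<in> carrier S" unfolding one by (intro const_closed) simp
  \<comment> \<open>Applied to \<open>1\<close>, the powers of \<open>shift\<close> produce the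
    monomials, so the right unit law becomes the expansion \<open>tsum_monom\<close>.\<close>
  have pow: "(shift ^^ i) \<one>\<^bsub>S\<^esub> = ps_monom R \<one> i" for i
    by (induction i) (auto simp: one ps_const_eq_monom fun_eq_iff ps_monom_def shift_def split: nat.split)
  show ?thesis
  proof (rule ringI[OF abelian_group_S monoidI])
    fix x y z assume x: "x \<in> carrier S" and y: "y \<in> carrier S" and z: "z \<in> carrier S"
    show "x \<otimes>\<^bsub>S\<^esub> y \<otimes>\<^bsub>S\<^esub> z = x \<otimes>\<^bsub>S\<^esub> (y \<otimes>\<^bsub>S\<^esub> z)"
      using ps.star_mult[OF x y z] x y z clos by (simp add: S_mult)
    have xyc: "\<And>i. x i \<in> carrier R" "\<And>i. y i \<in> carrier R" using x y by (auto simp: S_carrier)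
    show "(x \<oplus>\<^bsub>S\<^esub> y) \<otimes>\<^bsub>S\<^esub> z = x \<otimes>\<^bsub>S\<^esub> z \<oplus>\<^bsub>S\<^esub> y \<otimes>\<^bsub>S\<^esub> z"
      using ps.star_add_left[of x y z] x y z xyc by (simp add: S_mult) (simp add: S_add)
    show "z \<otimes>\<^bsub>S\<^esub> (x \<oplus>\<^bsub>S\<^esub> y) = z \<otimes>\<^bsub>S\<^esub> x \<oplus>\<^bsub>S\<^esub> z \<otimes>\<^bsub>S\<^esub> y"
      unfolding S_mult[OF z x] S_mult[OF z y] S_mult[OF z ps.M.a_closed[OF x y]]
      by (rule ps.star_add_right) (use x y z in \<open>auto simp: S_carrier\<close>)
  next
    fix x assume x: "x \<in> carrier S"
    then have xc: "x i \<in> carrier R" for i by (simp add: S_carrier)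
    show "\<one>\<^bsub>S\<^esub> \<otimes>\<^bsub>S\<^esub> x = x" unfolding one using x xc by (simp add: const_mult)
    have "x \<otimes>\<^bsub>S\<^esub> \<one>\<^bsub>S\<^esub> = ps.M.tsum (\<lambda>i. ps_monom R (x i) i)"
      unfolding S_mult[OF x onec] ps.star_def pow
      by (rule arg_cong[where f = ps.M.tsum]) (auto simp: fun_eq_iff ps_monom_def xc)
    then show "x \<otimes>\<^bsub>S\<^esub> \<one>\<^bsub>S\<^esub> = x" using tsum_monom x by simp
  qed (use clos onec in auto)
qed

lemma (in skew_chain_ring) chain_ring_S: "chain_ring S SL"
proof -
  interpret S: chain_group S SL by (rule chain_group_S)
  interpret ps: skew_module R L v \<sigma> \<delta> S SL "\<lambda>c s i. c \<otimes> s i" shift by (rule ps_module)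
  show ?thesis
  proof (intro chain_ring.intro chain_ring_axioms.intro ring_S chain_group_S)
    fix x i y j assume xy: "x \<in> SL i" "y \<in> SL j"
    then have "\<And>l. x l \<in> L (i - l)" by (simp add: SL_def)
    from ps.star_L[OF this xy(2)] show "x \<otimes>\<^bsub>S\<^esub> y \<in> SL (i + j)"
      using xy[THEN S.L_carrier] by (simp add: S_mult)
  qed
qed

text \<open>\<open>T\<close> becomes a \<open>skew_module\<close> on which \<open>r\<close> acts by
  left multiplication with \<open>g r\<close> and \<open>x\<close> by left multiplication with
  \<open>y\<close>; \<open>yg\<close> supplies \<open>Y_act\<close>. The homomorphism sends a series
  to its action on \<open>\<one>\<close>.\<close>

lemma (in skew_chain_ring) ps_hom_exists:
  fixes T (structure)
  assumes T: "chain_ring T TL" and g: "g \<in> ring_hom R T" and gL: "\<And>r k. r \<in> L k \<Longrightarrow> g r \<in> TL k"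
    and y: "y \<in> TL 1"
    and yg: "\<And>r. r \<in> carrier R \<Longrightarrow> y \<otimes>\<^bsub>T\<^esub> g r = g (\<sigma> r) \<otimes>\<^bsub>T\<^esub> y \<oplus>\<^bsub>T\<^esub> g (\<delta> r)"
  obtains \<Phi> where "\<Phi> \<in> ring_hom S T" "\<And>s k. s \<in> SL k \<Longrightarrow> \<Phi> s \<in> TL k"
    "\<And>r. r \<in> carrier R \<Longrightarrow> \<Phi> (ps_const R r) = g r" "\<Phi> (ps_var R) = y"
    "\<And>s. s \<in> carrier S \<Longrightarrow> \<Phi> s = chain_group.tsum T TL (\<lambda>i. g (s i) \<otimes>\<^bsub>T\<^esub> y [^]\<^bsub>T\<^esub> i)"
proof -
  interpret T: chain_ring T TL by fact
  note gm = ring_hom_memE[OF g]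
  have yc: "y \<in> carrier T" using T.L_carrier y .
  interpret M: skew_module R L v \<sigma> \<delta> T TL "\<lambda>r m. g r \<otimes>\<^bsub>T\<^esub> m" "\<lambda>m. y \<otimes>\<^bsub>T\<^esub> m"
  proof
    fix r m assume "r \<in> carrier R" "m \<in> carrier T"
    then show "y \<otimes>\<^bsub>T\<^esub> (g r \<otimes>\<^bsub>T\<^esub> m) = g (\<sigma> r) \<otimes>\<^bsub>T\<^esub> (y \<otimes>\<^bsub>T\<^esub> m) \<oplus>\<^bsub>T\<^esub> g (\<delta> r) \<otimes>\<^bsub>T\<^esub> m"
      using yg[of r] yc gm by (simp add: T.m_assoc[symmetric] T.l_distr)
  next
    fix m j assume "m \<in> TL j"
    then show "y \<otimes>\<^bsub>T\<^esub> m \<in> TL (Suc j)" using T.mult_L[OF y, of m j] by simp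
  qed (use gm yc gL in \<open>auto simp: T.l_distr T.r_distr T.m_assoc intro: T.mult_L\<close>)
  have ypow: "y \<otimes>\<^bsub>T\<^esub> y [^]\<^bsub>T\<^esub> i = y [^]\<^bsub>T\<^esub> Suc i" for i :: nat
    using T.nat_pow_Suc2[OF yc] by simp
  have pow: "((\<lambda>m. y \<otimes>\<^bsub>T\<^esub> m) ^^ i) m = y [^]\<^bsub>T\<^esub> i \<otimes>\<^bsub>T\<^esub> m" if "m \<in> carrier T" for i m
    using that yc by (induction i) (auto simp: T.m_assoc[symmetric] ypow simp del: T.nat_pow_Suc)
  \<comment> \<open>The action consists of left multiplications and so commutes with right
    multiplications. It is therefore determined by its value at \<open>\<one>\<close>, which turns
    composition of actions into a product in \<open>T\<close>.\<close>
  have star_mult: "M.star r m = M.star r \<one>\<^bsub>T\<^esub> \<otimes>\<^bsub>T\<^esub> m" if r: "r \<in> carrier S" and m: "m \<in> carrier T" for r m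
  proof -
    have rc: "r i \<in> carrier R" for i using r by (simp add: S_carrier)
    have "M.star r \<one>\<^bsub>T\<^esub> \<otimes>\<^bsub>T\<^esub> m = T.tsum (\<lambda>i. (g (r i) \<otimes>\<^bsub>T\<^esub> ((\<lambda>m. y \<otimes>\<^bsub>T\<^esub> m) ^^ i) \<one>\<^bsub>T\<^esub>) \<otimes>\<^bsub>T\<^esub> m)"
      unfolding M.star_def
    proof (rule T.additive_tsum[where h = "\<lambda>x. x \<otimes>\<^bsub>T\<^esub> m", OF T.chain_group_axioms])
      show "g (r i) \<otimes>\<^bsub>T\<^esub> ((\<lambda>m. y \<otimes>\<^bsub>T\<^esub> m) ^^ i) \<one>\<^bsub>T\<^esub> \<in> TL i" for i
        by (rule M.term_L') (use rc in auto)
      show "x \<in> TL k \<Longrightarrow> x \<otimes>\<^bsub>T\<^esub> m \<in> TL k" for x k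
        using T.mult_L[of x k m 0] m T.L_0 by simp
    qed (use m in \<open>auto simp: T.l_distr\<close>)
    then show ?thesis unfolding M.star_def using rc m gm yc by (simp add: pow T.m_assoc)
  qed
  let ?F = "\<lambda>s. M.star s \<one>\<^bsub>T\<^esub>"
  have Fc: "?F s \<in> carrier T" if "s \<in> carrier S" for s
    using that by (intro M.star_closed) (auto simp: S_carrier)
  have const: "?F (ps_const R r) = g r" if "r \<in> carrier R" for r
    using that gm by (simp add: ps_const_eq_monom M.star_monom)
  show thesis
  proof
    show "?F \<in> ring_hom S T"
    proof (rule ring_hom_memI)
      fix r s assume rs: "r \<in> carrier S" "s \<in> carrier S"
      show "?F (r \<otimes>\<^bsub>S\<^esub> s) = ?F r \<otimes>\<^bsub>T\<^esub> ?F s"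
        using M.star_mult[OF rs T.one_closed] star_mult[OF rs(1) Fc[OF rs(2)]] by simp
      show "?F (r \<oplus>\<^bsub>S\<^esub> s) = ?F r \<oplus>\<^bsub>T\<^esub> ?F s"
        using M.star_add_left rs by (simp add: S_carrier S_add)
    next
      have "\<one>\<^bsub>S\<^esub> = ps_const R \<one>" by (simp add: S_one ps_const_def)
      then show "?F \<one>\<^bsub>S\<^esub> = \<one>\<^bsub>T\<^esub>" using const[of \<one>] gm by simp
    qed (rule Fc)
    show "?F s \<in> TL k" if "s \<in> SL k" for s k
      using M.star_L[of s k "\<one>\<^bsub>T\<^esub>" 0] that T.L_0 by (simp add: SL_def)
    show "?F (ps_var R) = y" using yc gm by (simp add: ps_var_eq_monom M.star_monom)
    show "?F s = T.tsum (\<lambda>i. g (s i) \<otimes>\<^bsub>T\<^esub> y [^]\<^bsub>T\<^esub> i)" if "s \<in> carrier S" for s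
      unfolding M.star_def using yc by (simp add: pow)
  qed (rule const)
qed

text \<open>Both maps are continuous, so it suffices that they agree on monomials, and these are
  products of a constant and copies of the variable.\<close>

lemma (in skew_chain_ring) ps_hom_unique:
  assumes T: "chain_ring T TL" and h: "h \<in> ring_hom S T" "h' \<in> ring_hom S T"
    and L: "\<And>s k. s \<in> SL k \<Longrightarrow> h s \<in> TL k" "\<And>s k. s \<in> SL k \<Longrightarrow> h' s \<in> TL k"
    and const: "\<And>r. r \<in> carrier R \<Longrightarrow> h (ps_const R r) = h' (ps_const R r)"
    and var: "h (ps_var R) = h' (ps_var R)" and s: "s \<in> carrier S"
  shows "h s = h' s"
proof -
  interpret T: chain_ring T TL by fact
  interpret S: chain_ring S SL by (rule chain_ring_S)
  note hm = ring_hom_memE[OF h(1)] ring_hom_memE[OF h(2)]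
  have sc: "s i \<in> carrier R" for i using s by (simp add: S_carrier)
  have m1: "ps_monom R \<one> (Suc i) = ps_var R \<otimes>\<^bsub>S\<^esub> ps_monom R \<one> i" for i
    unfolding var_mult[OF monom_closed[OF one_closed]]
    by (auto simp: fun_eq_iff ps_monom_def shift_def split: nat.split)
  have p: "h (ps_monom R \<one> i) = h' (ps_monom R \<one> i)" for i
  proof (induction i)
    case 0
    then show ?case using const[of \<one>] by (simp add: ps_const_eq_monom)
  next
    case (Suc i)
    then show ?case unfolding m1 using hm var by (simp add: monom_closed var_closed)
  qed
  have mc: "ps_monom R c i = ps_const R c \<otimes>\<^bsub>S\<^esub> ps_monom R \<one> i" if "c \<in> carrier R" for c i
  proof -
    have "ps_const R c \<otimes>\<^bsub>S\<^esub> ps_monom R \<one> i = (\<lambda>j. c \<otimes> ps_monom R \<one> i j)"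
      by (rule const_mult[OF that monom_closed]) simp
    also have "\<dots> = ps_monom R c i" using that by (simp add: ps_monom_def fun_eq_iff)
    finally show ?thesis by simp
  qed
  have "h (ps_monom R (s i) i) = h' (ps_monom R (s i) i)" for i
    unfolding mc[OF sc[of i]] using sc[of i] hm p const by (simp add: monom_closed const_closed)
  moreover have "ps_monom R (s i) i \<in> SL i" for i
    using sc L_0 by (simp add: ps_monom_def SL_def)
  then have "h (S.tsum (\<lambda>i. ps_monom R (s i) i)) = T.tsum (\<lambda>i. h (ps_monom R (s i) i))"
    "h' (S.tsum (\<lambda>i. ps_monom R (s i) i)) = T.tsum (\<lambda>i. h' (ps_monom R (s i) i))"
    by (auto intro!: S.additive_tsum[OF T.chain_group_axioms] simp: hm L)
  ultimately show ?thesis using tsum_monom[OF s] by simp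
qed

section \<open>Change of variable\<close>

lemma (in skew_chain_ring) ps_const_ring_hom: "ps_const R \<in> ring_hom R S"
proof (rule ring_hom_memI)
  fix x y assume xy: "x \<in> carrier R" "y \<in> carrier R"
  then show "ps_const R (x \<otimes> y) = ps_const R x \<otimes>\<^bsub>S\<^esub> ps_const R y"
    by (simp add: const_mult const_closed) (auto simp: ps_const_def fun_eq_iff)
  show "ps_const R (x \<oplus> y) = ps_const R x \<oplus>\<^bsub>S\<^esub> ps_const R y"
    using xy by (auto simp: S_add ps_const_def fun_eq_iff)
qed (simp_all add: const_closed, simp add: S_one ps_const_def)

lemma (in skew_chain_ring) var_const:
  assumes "r \<in> carrier R"
  shows "ps_var R \<otimes>\<^bsub>S\<^esub> ps_const R r
    = ps_const R (\<sigma> r) \<otimes>\<^bsub>S\<^esub> ps_var R \<oplus>\<^bsub>S\<^esub> ps_const R (\<delta> r)"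
  using assms
  by (simp add: var_mult const_mult const_closed var_closed)
    (auto simp: S_add ps_const_def ps_var_def shift_def fun_eq_iff split: nat.split)

text \<open>The rule that \<open>b (x + t)\<close> inherits from \<open>x r = s' x + e'\<close>: the
  assumption \<open>s\<close> compares the coefficients of \<open>x\<close>, the assumption
  \<open>e\<close> the remaining terms.\<close>

lemma (in ring) commutation_after_substitution:
  assumes "b \<in> carrier R" "x \<in> carrier R" "t \<in> carrier R" "r \<in> carrier R"
    and "s \<in> carrier R" "s' \<in> carrier R" "e \<in> carrier R" "e' \<in> carrier R"
    and x: "x \<otimes> r = s' \<otimes> x \<oplus> e'" and s: "b \<otimes> s' = s \<otimes> b"
    and e: "b \<otimes> (e' \<oplus> t \<otimes> r) = e \<oplus> s \<otimes> (b \<otimes> t)"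
  shows "(b \<otimes> (x \<oplus> t)) \<otimes> r = s \<otimes> (b \<otimes> (x \<oplus> t)) \<oplus> e"
proof -
  have "(b \<otimes> (x \<oplus> t)) \<otimes> r = b \<otimes> (x \<otimes> r \<oplus> t \<otimes> r)"
    using assms by (simp add: m_assoc l_distr)
  also have "\<dots> = (b \<otimes> s') \<otimes> x \<oplus> b \<otimes> (e' \<oplus> t \<otimes> r)"
    unfolding x using assms(1-8) by (simp add: m_assoc r_distr a_assoc)
  also have "\<dots> = s \<otimes> (b \<otimes> (x \<oplus> t)) \<oplus> e"
    unfolding s e using assms(1-8) by (simp add: m_assoc r_distr a_ac)
  finally show ?thesis .
qed

text \<open>The universal property of \<open>S\<close>, applied to the element
  \<open>b (x + t)\<close> of \<open>S'\<close>. The assumptions \<open>sig\<close> and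
  \<open>del\<close> are what makes this element satisfy the commutation rule of
  \<open>(\<sigma>, \<delta>)\<close>.\<close>

lemma change_of_variable_hom:
  fixes R (structure)
  assumes 1: "skew_chain_ring R L v \<sigma> \<delta>" and 2: "skew_chain_ring R L v \<sigma>' \<delta>'"
    and b: "b \<in> carrier R" and t: "t \<in> L 1"
    and sig: "\<And>r. r \<in> carrier R \<Longrightarrow> b \<otimes> \<sigma>' r = \<sigma> r \<otimes> b"
    and del: "\<And>r. r \<in> carrier R \<Longrightarrow> b \<otimes> (\<delta>' r \<oplus> t \<otimes> r) = \<delta> r \<oplus> \<sigma> r \<otimes> (b \<otimes> t)"
  defines "S \<equiv> skew_ps_ring R v \<sigma> \<delta>" and "S' \<equiv> skew_ps_ring R v \<sigma>' \<delta>'"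
  obtains \<Phi> where "\<Phi> \<in> ring_hom S S'"
    "\<And>s k. s \<in> skew_chain_ring.SL L k \<Longrightarrow> \<Phi> s \<in> skew_chain_ring.SL L k"
    "\<And>r. r \<in> carrier R \<Longrightarrow> \<Phi> (ps_const R r) = ps_const R r"
    "\<Phi> (ps_var R) = ps_const R b \<otimes>\<^bsub>S'\<^esub> (ps_var R \<oplus>\<^bsub>S'\<^esub> ps_const R t)"
proof -
  interpret A: skew_chain_ring R L v \<sigma> \<delta> by fact
  interpret B: skew_chain_ring R L v \<sigma>' \<delta>' by fact
  interpret T: chain_ring S' B.SL unfolding S'_def by (rule B.chain_ring_S)
  note ch = ring_hom_memE[OF B.ps_const_ring_hom, folded S'_def]
  have tc: "t \<in> carrier R" using A.L_carrier t .
  note cl = B.var_closed[folded S'_def] ch(1)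
  show thesis
  proof (rule A.ps_hom_exists[of S' B.SL "ps_const R" "ps_const R b \<otimes>\<^bsub>S'\<^esub> (ps_var R \<oplus>\<^bsub>S'\<^esub> ps_const R t)",
        folded S_def])
    show "chain_ring S' B.SL" by (rule T.chain_ring_axioms)
    show "ps_const R \<in> ring_hom R S'" unfolding S'_def by (rule B.ps_const_ring_hom)
    have "ps_const R b \<in> B.SL 0" using cl(2)[OF b] T.L_0 by simp
    then show "ps_const R b \<otimes>\<^bsub>S'\<^esub> (ps_var R \<oplus>\<^bsub>S'\<^esub> ps_const R t) \<in> B.SL 1"
      using T.mult_L[of "ps_const R b" 0 _ 1] T.add_L[OF B.var_SL B.const_SL[OF t]] by simp
    fix r assume r: "r \<in> carrier R"
    have 1: "\<sigma> r \<in> carrier R" "\<delta> r \<in> carrier R" "\<sigma>' r \<in> carrier R" "\<delta>' r \<in> carrier R"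
      using r A.sig_closed A.del_closed B.sig_closed B.del_closed by auto
    show "(ps_const R b \<otimes>\<^bsub>S'\<^esub> (ps_var R \<oplus>\<^bsub>S'\<^esub> ps_const R t)) \<otimes>\<^bsub>S'\<^esub> ps_const R r =
        ps_const R (\<sigma> r) \<otimes>\<^bsub>S'\<^esub> (ps_const R b \<otimes>\<^bsub>S'\<^esub> (ps_var R \<oplus>\<^bsub>S'\<^esub> ps_const R t))
        \<oplus>\<^bsub>S'\<^esub> ps_const R (\<delta> r)"
      by (rule T.commutation_after_substitution[where s' = "ps_const R (\<sigma>' r)" and e' = "ps_const R (\<delta>' r)"])
        (use r 1 b tc sig del in \<open>simp_all add: cl ch(2,3)[symmetric] B.var_const[folded S'_def]\<close>)
  qed (use that B.const_SL in auto)
qed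

text \<open>The relation \<open>y = a x - t\<close> is solved by \<open>x = b (y + t)\<close>. Both
  substitutions have the form treated in \<open>change_of_variable_hom\<close>, and both composites
  fix the constants and the variable, so they are identities. Since both maps respect the chain,
  each \<open>SL k\<close> is preserved in both directions; this later yields equality of
  filtrations.\<close>

lemma change_of_variable:
  fixes R (structure)
  assumes 1: "skew_chain_ring R L v \<sigma> \<delta>" and 2: "skew_chain_ring R L v \<sigma>' \<delta>'"
    and ab: "a \<in> carrier R" "b \<in> carrier R" "a \<otimes> b = \<one>" "b \<otimes> a = \<one>" and t: "t \<in> L 1"
    and sig: "\<And>r. r \<in> carrier R \<Longrightarrow> \<sigma>' r \<otimes> a = a \<otimes> \<sigma> r"
    and del: "\<And>r. r \<in> carrier R \<Longrightarrow> a \<otimes> \<delta> r \<oplus> \<sigma>' r \<otimes> t = \<delta>' r \<oplus> t \<otimes> r"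
  defines "S \<equiv> skew_ps_ring R v \<sigma> \<delta>" and "S' \<equiv> skew_ps_ring R v \<sigma>' \<delta>'"
  obtains \<Phi> where "\<Phi> \<in> ring_iso S S'"
    "\<And>s k. s \<in> carrier S \<Longrightarrow> \<Phi> s \<in> skew_chain_ring.SL L k \<longleftrightarrow> s \<in> skew_chain_ring.SL L k"
    "\<And>r. r \<in> carrier R \<Longrightarrow> \<Phi> (ps_const R r) = ps_const R r"
    "\<Phi> (ps_const R a \<otimes>\<^bsub>S\<^esub> ps_var R \<ominus>\<^bsub>S\<^esub> ps_const R t) = ps_var R"
proof -
  interpret A: skew_chain_ring R L v \<sigma> \<delta> by fact
  interpret B: skew_chain_ring R L v \<sigma>' \<delta>' by fact
  interpret S: chain_ring S A.SL unfolding S_def by (rule A.chain_ring_S)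
  interpret T: chain_ring S' A.SL unfolding S'_def by (rule B.chain_ring_S)
  note ca = ring_hom_memE[OF A.ps_const_ring_hom, folded S_def]
  note cb = ring_hom_memE[OF B.ps_const_ring_hom, folded S'_def]
  note va = A.var_closed[folded S_def] and vb = B.var_closed[folded S'_def]
  have tc: "t \<in> carrier R" using A.L_carrier t .
  \<comment> \<open>Chosen so that \<open>a (x + u) = a x - t\<close>, which gives the inverse
    substitution the same shape as \<open>b (y + t)\<close>.\<close>
  define u where "u = \<ominus> (b \<otimes> t)"
  have bt: "b \<otimes> t \<in> L 1" using A.mult_L[of b 0 t 1] ab t A.L_0 by simp
  have u: "u \<in> L 1" "u \<in> carrier R" unfolding u_def using bt A.neg_L A.L_carrier by auto
  have bsig: "b \<otimes> \<sigma>' r = \<sigma> r \<otimes> b" if r: "r \<in> carrier R" for r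
  proof -
    have c: "\<sigma>' r \<in> carrier R" "\<sigma> r \<in> carrier R" using r A.sig_closed B.sig_closed by auto
    have "b \<otimes> \<sigma>' r = b \<otimes> (\<sigma>' r \<otimes> a) \<otimes> b" using ab c by (simp add: A.m_assoc)
    also have "\<dots> = (b \<otimes> a) \<otimes> \<sigma> r \<otimes> b" unfolding sig[OF r] using ab(1,2) c by (simp add: A.m_assoc)
    finally show ?thesis using ab c by simp
  qed
  have bdel: "b \<otimes> (\<delta>' r \<oplus> t \<otimes> r) = \<delta> r \<oplus> \<sigma> r \<otimes> (b \<otimes> t)" if r: "r \<in> carrier R" for r
  proof -
    have c: "\<sigma>' r \<in> carrier R" "\<sigma> r \<in> carrier R" "\<delta> r \<in> carrier R"
      using r A.sig_closed B.sig_closed A.del_closed by auto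
    have "b \<otimes> (\<delta>' r \<oplus> t \<otimes> r) = (b \<otimes> a) \<otimes> \<delta> r \<oplus> (b \<otimes> \<sigma>' r) \<otimes> t"
      unfolding del[OF r, symmetric] using ab(1,2) c tc by (simp add: A.m_assoc A.r_distr)
    also have "\<dots> = \<delta> r \<oplus> \<sigma> r \<otimes> (b \<otimes> t)"
      unfolding bsig[OF r] ab(4) using ab(1,2) c tc by (simp add: A.m_assoc)
    finally show ?thesis .
  qed
  have adel: "a \<otimes> (\<delta> r \<oplus> u \<otimes> r) = \<delta>' r \<oplus> \<sigma>' r \<otimes> (a \<otimes> u)" if r: "r \<in> carrier R" for r
  proof -
    have c: "\<sigma>' r \<in> carrier R" "\<sigma> r \<in> carrier R" "\<delta> r \<in> carrier R" "\<delta>' r \<in> carrier R"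
      using r A.sig_closed B.sig_closed A.del_closed B.del_closed by auto
    have au: "a \<otimes> u = \<ominus> t"
      unfolding u_def using ab tc by (simp add: A.r_minus A.m_assoc[symmetric])
    have "a \<otimes> (\<delta> r \<oplus> u \<otimes> r) = a \<otimes> \<delta> r \<oplus> (a \<otimes> u) \<otimes> r"
      using ab c u r by (simp add: A.m_assoc A.r_distr)
    also have "\<dots> = (a \<otimes> \<delta> r \<oplus> \<sigma>' r \<otimes> t) \<oplus> (\<ominus> (\<sigma>' r \<otimes> t) \<oplus> \<ominus> (t \<otimes> r))"
      unfolding au using ab c tc r by (simp add: A.l_minus A.a_assoc A.r_neg2)
    also have "\<dots> = \<delta>' r \<oplus> (t \<otimes> r \<oplus> (\<ominus> (t \<otimes> r) \<oplus> \<ominus> (\<sigma>' r \<otimes> t)))"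
      unfolding del[OF r] using c tc r by (simp add: A.a_ac)
    also have "\<dots> = \<delta>' r \<oplus> \<sigma>' r \<otimes> (a \<otimes> u)"
      unfolding au using c tc r by (simp add: A.r_neg2 A.r_minus)
    finally show ?thesis .
  qed
  obtain \<Phi> where \<Phi>: "\<Phi> \<in> ring_hom S S'" "\<And>s k. s \<in> A.SL k \<Longrightarrow> \<Phi> s \<in> A.SL k"
    "\<And>r. r \<in> carrier R \<Longrightarrow> \<Phi> (ps_const R r) = ps_const R r"
    "\<Phi> (ps_var R) = ps_const R b \<otimes>\<^bsub>S'\<^esub> (ps_var R \<oplus>\<^bsub>S'\<^esub> ps_const R t)"
    using change_of_variable_hom[OF 1 2 ab(2) t bsig bdel, folded S_def S'_def] by metis
  obtain \<Psi> where \<Psi>: "\<Psi> \<in> ring_hom S' S" "\<And>s k. s \<in> A.SL k \<Longrightarrow> \<Psi> s \<in> A.SL k"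
    "\<And>r. r \<in> carrier R \<Longrightarrow> \<Psi> (ps_const R r) = ps_const R r"
    "\<Psi> (ps_var R) = ps_const R a \<otimes>\<^bsub>S\<^esub> (ps_var R \<oplus>\<^bsub>S\<^esub> ps_const R u)"
    using change_of_variable_hom[OF 2 1 ab(1) u(1) sig[symmetric] adel, folded S_def S'_def] by metis
  note hm = ring_hom_memE[OF \<Phi>(1)] ring_hom_memE[OF \<Psi>(1)]
  note clA = ca(1) va and clB = cb(1) vb
  have btc: "b \<otimes> t \<in> carrier R" using ab tc by simp
  have cneg: "ps_const R (b \<otimes> t) \<oplus>\<^bsub>S\<^esub> ps_const R u = \<zero>\<^bsub>S\<^esub>"
    "ps_const R u \<oplus>\<^bsub>S'\<^esub> ps_const R (b \<otimes> t) = \<zero>\<^bsub>S'\<^esub>"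
    unfolding S_def S'_def A.S_zero B.S_zero A.S_add B.S_add
    using btc by (auto simp: u_def ps_const_def A.r_neg A.l_neg)
  have cab: "ps_const R a \<otimes>\<^bsub>S\<^esub> ps_const R b = \<one>\<^bsub>S\<^esub>" "ps_const R b \<otimes>\<^bsub>S\<^esub> ps_const R a = \<one>\<^bsub>S\<^esub>"
    "ps_const R a \<otimes>\<^bsub>S'\<^esub> ps_const R b = \<one>\<^bsub>S'\<^esub>" "ps_const R b \<otimes>\<^bsub>S'\<^esub> ps_const R a = \<one>\<^bsub>S'\<^esub>"
    using ab ca(4) cb(4) by (simp_all add: ca(2)[symmetric] cb(2)[symmetric])
  have \<Psi>\<Phi>x: "\<Psi> (\<Phi> (ps_var R)) = ps_var R"
  proof -
    have "\<Psi> (\<Phi> (ps_var R)) = ps_const R b \<otimes>\<^bsub>S\<^esub>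
        (ps_const R a \<otimes>\<^bsub>S\<^esub> (ps_var R \<oplus>\<^bsub>S\<^esub> ps_const R u) \<oplus>\<^bsub>S\<^esub> ps_const R t)"
      unfolding \<Phi>(4) using ab tc u clA clB by (simp add: hm \<Psi>)
    also have "\<dots> = (ps_const R b \<otimes>\<^bsub>S\<^esub> ps_const R a) \<otimes>\<^bsub>S\<^esub> (ps_var R \<oplus>\<^bsub>S\<^esub> ps_const R u)
        \<oplus>\<^bsub>S\<^esub> ps_const R (b \<otimes> t)"
      using ab tc u clA by (simp add: S.m_assoc S.r_distr ca)
    also have "\<dots> = ps_var R"
      unfolding cab using ab tc u clA cneg btc by (simp add: S.a_ac)
    finally show ?thesis .
  qed
  have \<Phi>\<Psi>x: "\<Phi> (\<Psi> (ps_var R)) = ps_var R"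
  proof -
    have "\<Phi> (\<Psi> (ps_var R)) = ps_const R a \<otimes>\<^bsub>S'\<^esub>
        (ps_const R b \<otimes>\<^bsub>S'\<^esub> (ps_var R \<oplus>\<^bsub>S'\<^esub> ps_const R t) \<oplus>\<^bsub>S'\<^esub> ps_const R u)"
      unfolding \<Psi>(4) using ab tc u clA clB by (simp add: hm \<Phi>)
    also have "\<dots> = ps_const R a \<otimes>\<^bsub>S'\<^esub> ((ps_const R b \<otimes>\<^bsub>S'\<^esub> ps_var R \<oplus>\<^bsub>S'\<^esub>
        (ps_const R u \<oplus>\<^bsub>S'\<^esub> ps_const R (b \<otimes> t))))"
      using ab tc u clB by (simp add: T.r_distr cb T.a_ac)
    also have "\<dots> = (ps_const R a \<otimes>\<^bsub>S'\<^esub> ps_const R b) \<otimes>\<^bsub>S'\<^esub> ps_var R"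
      unfolding cneg using ab clB by (simp add: T.m_assoc)
    also have "\<dots> = ps_var R" unfolding cab using clB by simp
    finally show ?thesis .
  qed
  have \<Psi>\<Phi>: "\<Psi> (\<Phi> s) = s" if "s \<in> carrier S" for s
  proof -
    have "(\<Psi> \<circ> \<Phi>) s = id s"
      by (rule A.ps_hom_unique[of S A.SL, folded S_def])
        (use that \<Phi> \<Psi> \<Psi>\<Phi>x S.chain_ring_axioms ring_hom_trans[OF \<Phi>(1) \<Psi>(1)] in
          \<open>auto simp: comp_def id_def intro!: ring_hom_memI\<close>)
    then show ?thesis by simp
  qed
  have \<Phi>\<Psi>: "\<Phi> (\<Psi> s) = s" if "s \<in> carrier S'" for s
  proof -
    have "(\<Phi> \<circ> \<Psi>) s = id s"
      by (rule B.ps_hom_unique[of S' A.SL, folded S'_def])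
        (use that \<Phi> \<Psi> \<Phi>\<Psi>x T.chain_ring_axioms ring_hom_trans[OF \<Psi>(1) \<Phi>(1)] in
          \<open>auto simp: comp_def id_def intro!: ring_hom_memI\<close>)
    then show ?thesis by simp
  qed
  show thesis
  proof
    show "\<Phi> \<in> ring_iso S S'"
      unfolding ring_iso_def
      using \<Phi>(1) by (auto intro!: bij_betw_byWitness[where f' = \<Psi>] simp: \<Psi>\<Phi> \<Phi>\<Psi> hm)
    show "\<Phi> s \<in> A.SL k \<longleftrightarrow> s \<in> A.SL k" if "s \<in> carrier S" for s k
      using \<Phi>(2) \<Psi>(2)[of "\<Phi> s" k] \<Psi>\<Phi>[OF that] by auto
    have "ps_const R a \<otimes>\<^bsub>S\<^esub> ps_var R \<ominus>\<^bsub>S\<^esub> ps_const R t = \<Psi> (ps_var R)"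
    proof -
      have "\<ominus>\<^bsub>S\<^esub> ps_const R t = ps_const R (a \<otimes> u)"
      proof (rule S.minus_equality)
        have au: "a \<otimes> u = \<ominus> t"
          unfolding u_def using ab tc by (simp add: A.r_minus A.m_assoc[symmetric])
        show "ps_const R (a \<otimes> u) \<oplus>\<^bsub>S\<^esub> ps_const R t = \<zero>\<^bsub>S\<^esub>"
          unfolding au S_def A.S_add A.S_zero using tc by (auto simp: ps_const_def A.l_neg)
      qed (use ab u tc clA in auto)
      then show ?thesis unfolding \<Psi>(4) using ab u tc clA by (simp add: a_minus_def S.r_distr ca)
    qed
    then show "\<Phi> (ps_const R a \<otimes>\<^bsub>S\<^esub> ps_var R \<ominus>\<^bsub>S\<^esub> ps_const R t) = ps_var R"
      using \<Phi>\<Psi>x by simp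
  qed (rule \<Phi>(3))
qed

section \<open>The valuation of a noncommutative discrete valuation ring\<close>

text \<open>Negation is defined by a description over the carrier, so its agreement on a subring is
  something to prove.\<close>

lemma (in ring) a_inv_subring:
  assumes "subring H R" "x \<in> H"
  shows "\<ominus>\<^bsub>R\<lparr>carrier := H\<rparr>\<^esub> x = \<ominus> x"
proof -
  interpret H: ring "R\<lparr>carrier := H\<rparr>" using subring_is_ring[OF assms(1)] .
  have "x \<in> carrier R" using subringE(1)[OF assms(1)] assms(2) by auto
  then show ?thesis
    using H.minus_equality[of "\<ominus> x" x] subringE(5)[OF assms] assms(2) by (simp add: l_neg)
qed

lemma (in ring) a_minus_subring:
  "subring H R \<Longrightarrow> y \<in> H \<Longrightarrow> x \<ominus>\<^bsub>R\<lparr>carrier := H\<rparr>\<^esub> y = x \<ominus> y"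
  using a_inv_subring by (simp add: a_minus_def)

locale nc_dvr =
  fixes F (structure) and D
  assumes dvr: "discrete_valuation_ring F D"
begin

abbreviation DR where "DR \<equiv> F\<lparr>carrier := D\<rparr>"

lemma div: "division_ring F" and sub: "subring D F" and noeth: "two_sided_noetherian DR"
  and total: "z \<in> carrier F \<Longrightarrow> z \<noteq> \<zero> \<Longrightarrow> z \<in> D \<or> inv z \<in> D" and one_neq_zero: "\<one> \<noteq> \<zero>"
  using dvr unfolding discrete_valuation_ring_def division_ring_of_quotients_def noncomm_domain_def
  by auto

sublocale ring F using div by (simp add: division_ring_def)

lemma units: "x \<in> Units F \<longleftrightarrow> x \<in> carrier F \<and> x \<noteq> \<zero>"
  using div by (auto simp: division_ring_def)

sublocale DR: ring DR using subring_is_ring[OF sub] .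

lemma D_closed: "D \<subseteq> carrier F" "\<zero> \<in> D" "\<one> \<in> D" "x \<in> D \<Longrightarrow> \<ominus> x \<in> D"
  "x \<in> D \<Longrightarrow> y \<in> D \<Longrightarrow> x \<otimes> y \<in> D" "x \<in> D \<Longrightarrow> y \<in> D \<Longrightarrow> x \<oplus> y \<in> D"
  using subringE[OF sub] by auto

lemma D_carrier [simp]: "x \<in> D \<Longrightarrow> x \<in> carrier F"
  using D_closed by auto

lemma inv_nz [simp]:
  assumes "x \<in> carrier F" "x \<noteq> \<zero>"
  shows "inv x \<in> carrier F" "inv x \<noteq> \<zero>" "x \<otimes> inv x = \<one>" "inv x \<otimes> x = \<one>" "inv (inv x) = x"
proof -
  have u: "x \<in> Units F" using assms units by simp
  then show "inv x \<in> carrier F" "inv x \<noteq> \<zero>" using units Units_inv_Units by blast+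
  show "x \<otimes> inv x = \<one>" "inv x \<otimes> x = \<one>" "inv (inv x) = x" using u by auto
qed

lemma mult_nz: "x \<in> carrier F \<Longrightarrow> x \<noteq> \<zero> \<Longrightarrow> y \<in> carrier F \<Longrightarrow> y \<noteq> \<zero> \<Longrightarrow> x \<otimes> y \<noteq> \<zero>"
  using units Units_m_closed[of x y] by auto

lemma inv_eqI:
  assumes "x \<in> carrier F" "x \<noteq> \<zero>" "y \<in> carrier F" "x \<otimes> y = \<one> \<or> y \<otimes> x = \<one>"
  shows "inv x = y"
proof -
  have "inv x \<otimes> (x \<otimes> y) = y" "(y \<otimes> x) \<otimes> inv x = y"
    using assms(1-3) m_assoc[of "inv x" x y] m_assoc[of y x "inv x"] by simp_all
  then show ?thesis using assms by (metis inv_nz(1) l_one r_one)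
qed

lemma left_cancel:
  assumes "x \<in> carrier F" "x \<noteq> \<zero>" "y \<in> carrier F" "z \<in> carrier F" "x \<otimes> y = x \<otimes> z"
  shows "y = z"
proof -
  have "inv x \<otimes> (x \<otimes> w) = w" if "w \<in> carrier F" for w
    using assms(1,2) that by (simp add: m_assoc[symmetric])
  then show ?thesis using assms(3-5) by metis
qed

text \<open>The nonunits of \<open>D\<close>, later identified with the Jacobson radical. Zero is
  listed separately because \<open>inv\<close> is unspecified there.\<close>

definition N where "N = {x \<in> D. x = \<zero> \<or> inv x \<notin> D}"

lemma N_D: "x \<in> N \<Longrightarrow> x \<in> D" and zero_N: "\<zero> \<in> N" and one_N: "\<one> \<notin> N"
  using D_closed one_neq_zero by (auto simp: N_def)

text \<open>In a division ring a one-sided inverse is two-sided, so elements of \<open>N\<close> are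
  not invertible from either side.\<close>

lemma mult_N_eq_one:
  assumes "x \<in> N" "y \<in> D"
  shows "x \<otimes> y \<noteq> \<one>" "y \<otimes> x \<noteq> \<one>"
  using assms inv_eqI[of x y] one_neq_zero by (cases "x = \<zero>"; auto simp: N_def)+

lemma N_I: "x \<in> D \<Longrightarrow> (\<And>y. y \<in> D \<Longrightarrow> x \<otimes> y \<noteq> \<one>) \<Longrightarrow> x \<in> N"
  using inv_nz(3)[of x] D_carrier[of x] unfolding N_def by blast

lemma N_I': "x \<in> D \<Longrightarrow> (\<And>y. y \<in> D \<Longrightarrow> y \<otimes> x \<noteq> \<one>) \<Longrightarrow> x \<in> N"
  using inv_nz(4)[of x] D_carrier[of x] unfolding N_def by blast

lemma N_mult:
  assumes "x \<in> N" "d \<in> D"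
  shows "x \<otimes> d \<in> N" "d \<otimes> x \<in> N"
proof -
  have x: "x \<in> D" using N_D assms by simp
  show "x \<otimes> d \<in> N"
  proof (rule N_I)
    fix y assume "y \<in> D"
    then show "x \<otimes> d \<otimes> y \<noteq> \<one>" using mult_N_eq_one(1)[OF assms(1), of "d \<otimes> y"] x assms(2)
      by (simp add: m_assoc D_closed)
  qed (use x assms D_closed in auto)
  show "d \<otimes> x \<in> N"
  proof (rule N_I')
    fix y assume "y \<in> D"
    then show "y \<otimes> (d \<otimes> x) \<noteq> \<one>" using mult_N_eq_one(2)[OF assms(1), of "y \<otimes> d"] x assms(2)
      by (simp add: m_assoc D_closed)
  qed (use x assms D_closed in auto)
qed

lemma N_neg: "x \<in> N \<Longrightarrow> \<ominus> x \<in> N"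
  using N_mult(2)[of x "\<ominus> \<one>"] N_D D_closed by (simp add: l_minus)

text \<open>The dichotomy \<open>total\<close>, applied to \<open>inv x \<otimes> y\<close> and to
  \<open>y \<otimes> inv x\<close>. Principal right ideals thus form a chain, and so do principal
  left ideals.\<close>

lemma comparable:
  assumes "x \<in> carrier F" "y \<in> carrier F" "x \<noteq> \<zero>"
  shows "(\<exists>d\<in>D. y = x \<otimes> d) \<or> (\<exists>d\<in>D. x = y \<otimes> d)" "(\<exists>d\<in>D. y = d \<otimes> x) \<or> (\<exists>d\<in>D. x = d \<otimes> y)"
proof -
  consider "y = \<zero>" | "y \<noteq> \<zero>" by auto
  then have "((\<exists>d\<in>D. y = x \<otimes> d) \<or> (\<exists>d\<in>D. x = y \<otimes> d)) \<and> ((\<exists>d\<in>D. y = d \<otimes> x) \<or> (\<exists>d\<in>D. x = d \<otimes> y))"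
  proof cases
    case 1
    then show ?thesis using assms D_closed(2) by (intro conjI disjI1 bexI[of _ \<zero>]) auto
  next
    case 2
    have z: "inv x \<otimes> y \<in> carrier F" "inv x \<otimes> y \<noteq> \<zero>" "y \<otimes> inv x \<in> carrier F" "y \<otimes> inv x \<noteq> \<zero>"
      using assms 2 mult_nz by auto
    have c: "x \<otimes> (inv x \<otimes> w) = w" "y \<otimes> (inv y \<otimes> w) = w" "inv x \<otimes> (x \<otimes> w) = w" "inv y \<otimes> (y \<otimes> w) = w"
      if "w \<in> carrier F" for w
      using that assms 2 by (simp_all add: m_assoc[symmetric])
    have i: "inv (inv x \<otimes> y) = inv y \<otimes> x" "inv (y \<otimes> inv x) = x \<otimes> inv y"
      by (rule inv_eqI; use assms 2 z c in \<open>simp add: m_assoc\<close>)+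
    have "(\<exists>d\<in>D. y = x \<otimes> d) \<or> (\<exists>d\<in>D. x = y \<otimes> d)"
    proof -
      have "y = x \<otimes> (inv x \<otimes> y)" "x = y \<otimes> (inv y \<otimes> x)" using assms c by simp_all
      then show ?thesis using total[OF z(1,2)] unfolding i by blast
    qed
    moreover have "(\<exists>d\<in>D. y = d \<otimes> x) \<or> (\<exists>d\<in>D. x = d \<otimes> y)"
    proof -
      have "y = (y \<otimes> inv x) \<otimes> x" "x = (x \<otimes> inv y) \<otimes> y" using assms 2 by (simp_all add: m_assoc)
      then show ?thesis using total[OF z(3,4)] unfolding i by blast
    qed
    ultimately show ?thesis by blast
  qed
  then show "(\<exists>d\<in>D. y = x \<otimes> d) \<or> (\<exists>d\<in>D. x = y \<otimes> d)" "(\<exists>d\<in>D. y = d \<otimes> x) \<or> (\<exists>d\<in>D. x = d \<otimes> y)"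
    by blast+
qed

text \<open>One summand is a right multiple of the other, so the sum is a right multiple of a
  nonunit. This makes \<open>D\<close> local.\<close>

lemma N_add:
  assumes "x \<in> N" "y \<in> N"
  shows "x \<oplus> y \<in> N"
proof (cases "x = \<zero>")
  case False
  have xy: "x \<in> D" "y \<in> D" using assms N_D by auto
  from comparable(1)[of x y] False xy
  consider d where "d \<in> D" "y = x \<otimes> d" | d where "d \<in> D" "x = y \<otimes> d" by auto
  then show ?thesis
  proof cases
    case 1
    then have "x \<oplus> y = x \<otimes> (\<one> \<oplus> d)" using xy by (simp add: r_distr)
    then show ?thesis using N_mult(1)[OF assms(1)] D_closed 1 by simp
  next
    case 2
    then have "x \<oplus> y = y \<otimes> (d \<oplus> \<one>)" using xy by (simp add: r_distr)
    then show ?thesis using N_mult(1)[OF assms(2)] D_closed 2 by simp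
  qed
qed (use assms N_D in auto)

lemma additive_subgroup_DR:
  assumes "I \<subseteq> D" "\<zero> \<in> I" "\<And>x y. x \<in> I \<Longrightarrow> y \<in> I \<Longrightarrow> x \<oplus> y \<in> I" "\<And>x. x \<in> I \<Longrightarrow> \<ominus> x \<in> I"
  shows "additive_subgroup I DR"
proof (rule additive_subgroupI, unfold_locales)
  fix x assume x: "x \<in> I"
  have "inv\<^bsub>add_monoid DR\<^esub> x = \<ominus>\<^bsub>DR\<^esub> x" by (simp add: a_inv_def)
  also have "\<dots> = \<ominus> x" using a_inv_subring[OF sub] x assms(1) by auto
  finally show "inv\<^bsub>add_monoid DR\<^esub> x \<in> I" using assms(4) x by simp
qed (use assms in auto)

lemma left_ideal_N: "left_ideal N DR"
  unfolding left_ideal_def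
  using additive_subgroup_DR[of N] N_D zero_N N_add N_neg N_mult by auto

lemma left_ideal_cases:
  assumes "left_ideal I DR"
  shows "I \<subseteq> N \<or> I = D"
proof (rule disjCI)
  interpret additive_subgroup I DR using assms by (simp add: left_ideal_def)
  have ID: "I \<subseteq> D" using a_subset by simp
  assume "I \<noteq> D"
  show "I \<subseteq> N"
  proof
    fix x assume x: "x \<in> I"
    show "x \<in> N"
    proof (rule N_I')
      fix y assume y: "y \<in> D"
      show "y \<otimes> x \<noteq> \<one>"
      proof
        assume "y \<otimes> x = \<one>"
        then have 1: "\<one> \<in> I" using assms x y unfolding left_ideal_def by force
        have "z \<in> I" if "z \<in> D" for z
        proof -
          have "\<forall>r\<in>D. \<forall>x\<in>I. r \<otimes> x \<in> I" using assms by (simp add: left_ideal_def)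
          then have "z \<otimes> \<one> \<in> I" using 1 that by blast
          then show ?thesis using that by simp
        qed
        then show False using ID \<open>I \<noteq> D\<close> by auto
      qed
    qed (use x ID in auto)
  qed
qed

text \<open>A proper left ideal consists of nonunits, and the nonunits form a proper left ideal, so
  there is only one maximal left ideal.\<close>

lemma jacobson_DR: "jacobson_radical DR = N"
proof -
  have ND: "N \<noteq> D" using one_N D_closed by auto
  have "maximal_left_ideal I DR \<longleftrightarrow> I = N" for I
  proof
    assume "maximal_left_ideal I DR"
    then show "I = N"
      unfolding maximal_left_ideal_def using left_ideal_cases[of I] left_ideal_N ND by auto
  next
    assume "I = N"
    then show "maximal_left_ideal I DR"
      unfolding maximal_left_ideal_def using left_ideal_cases left_ideal_N ND by auto
  qed
  then have "{I. maximal_left_ideal I DR} = {N}" by auto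
  then show ?thesis unfolding jacobson_radical_def using N_D by auto
qed

lemma coset_mem: "z \<in> p <# D \<longleftrightarrow> (\<exists>d\<in>D. z = p \<otimes> d)" "z \<in> D #> p \<longleftrightarrow> (\<exists>d\<in>D. z = d \<otimes> p)"
  by (auto simp: l_coset_def r_coset_def)

lemma right_ideal_coset: "p \<in> D \<Longrightarrow> right_ideal (p <# D) DR"
  unfolding right_ideal_def
proof (intro conjI ballI additive_subgroup_DR subsetI)
  assume p: "p \<in> D"
  show "x \<in> p <# D \<Longrightarrow> x \<in> D" for x using p D_closed by (auto simp: coset_mem)
  show "\<zero> \<in> p <# D" unfolding coset_mem using p by (intro bexI[of _ \<zero>]) (auto simp: D_closed)
  show "x \<oplus> y \<in> p <# D" if xy: "x \<in> p <# D" "y \<in> p <# D" for x y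
  proof -
    obtain d e where "d \<in> D" "e \<in> D" "x = p \<otimes> d" "y = p \<otimes> e" using xy unfolding coset_mem by blast
    then show ?thesis unfolding coset_mem using p by (intro bexI[of _ "d \<oplus> e"]) (auto simp: D_closed r_distr)
  qed
  show "\<ominus> x \<in> p <# D" if xm: "x \<in> p <# D" for x
  proof -
    obtain d where "d \<in> D" "x = p \<otimes> d" using xm unfolding coset_mem by blast
    then show ?thesis unfolding coset_mem using p by (intro bexI[of _ "\<ominus> d"]) (auto simp: D_closed r_minus)
  qed
  show "x \<otimes>\<^bsub>DR\<^esub> r \<in> p <# D" if r: "r \<in> carrier DR" and xm: "x \<in> p <# D" for x r
  proof -
    obtain d where "d \<in> D" "x = p \<otimes> d" using xm unfolding coset_mem by blast
    then show ?thesis unfolding coset_mem using p r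
      by (intro bexI[of _ "d \<otimes> r"]) (auto simp: D_closed m_assoc)
  qed
qed

lemma left_ideal_coset: "p \<in> D \<Longrightarrow> left_ideal (D #> p) DR"
  unfolding left_ideal_def
proof (intro conjI ballI additive_subgroup_DR subsetI)
  assume p: "p \<in> D"
  show "x \<in> D #> p \<Longrightarrow> x \<in> D" for x using p D_closed by (auto simp: coset_mem)
  show "\<zero> \<in> D #> p" unfolding coset_mem using p by (intro bexI[of _ \<zero>]) (auto simp: D_closed)
  show "x \<oplus> y \<in> D #> p" if xy: "x \<in> D #> p" "y \<in> D #> p" for x y
  proof -
    obtain d e where "d \<in> D" "e \<in> D" "x = d \<otimes> p" "y = e \<otimes> p" using xy unfolding coset_mem by blast
    then show ?thesis unfolding coset_mem using p by (intro bexI[of _ "d \<oplus> e"]) (auto simp: D_closed l_distr)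
  qed
  show "\<ominus> x \<in> D #> p" if xm: "x \<in> D #> p" for x
  proof -
    obtain d where "d \<in> D" "x = d \<otimes> p" using xm unfolding coset_mem by blast
    then show ?thesis unfolding coset_mem using p by (intro bexI[of _ "\<ominus> d"]) (auto simp: D_closed l_minus)
  qed
  show "r \<otimes>\<^bsub>DR\<^esub> x \<in> D #> p" if r: "r \<in> carrier DR" and xm: "x \<in> D #> p" for x r
  proof -
    obtain d where "d \<in> D" "x = d \<otimes> p" using xm unfolding coset_mem by blast
    then show ?thesis unfolding coset_mem using p r
      by (intro bexI[of _ "r \<otimes> d"]) (auto simp: D_closed m_assoc)
  qed
qed

text \<open>Otherwise one could go on choosing elements of \<open>N\<close>, each outside the right
  ideal of its predecessor. By comparability these principal right ideals would ascend strictly,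
  against the chain condition.\<close>

lemma N_right_principal: "\<exists>p\<in>N. N = p <# D"
proof (rule ccontr)
  assume no: "\<not> ?thesis"
  have ex: "\<exists>q\<in>N. q \<notin> p <# D" if "p \<in> N" for p
  proof -
    have "p <# D \<subseteq> N" using that N_mult by (auto simp: coset_mem)
    then show ?thesis using no that by blast
  qed
  define s where "s = rec_nat \<zero> (\<lambda>_ p. SOME q. q \<in> N \<and> q \<notin> p <# D)"
  have s: "s n \<in> N" for n
    by (induction n) (auto simp: s_def zero_N intro: someI2_ex[OF ex[unfolded Bex_def]])
  have s': "s (Suc n) \<in> N \<and> s (Suc n) \<notin> s n <# D" for n
    using someI_ex[OF ex[OF s[of n], unfolded Bex_def]] by (simp add: s_def)
  have sub: "s n <# D \<subseteq> s (Suc n) <# D" for n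
  proof -
    have c: "s n \<in> carrier F" "s (Suc n) \<in> carrier F" using s N_D by auto
    have "s (Suc n) \<noteq> \<zero>" using s'[of n] c D_closed(2) by (auto simp: coset_mem)
    then obtain d where "d \<in> D" "s n = s (Suc n) \<otimes> d"
      using comparable(1)[of "s (Suc n)" "s n"] c s'[of n] by (auto simp: coset_mem)
    note d = this
    show ?thesis
    proof
      fix z assume "z \<in> s n <# D"
      then obtain x where x: "x \<in> D" "z = s n \<otimes> x" unfolding coset_mem by blast
      then have "z = s (Suc n) \<otimes> (d \<otimes> x)" using d c by (simp add: m_assoc)
      moreover have "d \<otimes> x \<in> D" using d x D_closed(5) by simp
      ultimately show "z \<in> s (Suc n) <# D" unfolding coset_mem by blast
    qed
  qed
  have "acc (\<lambda>I. right_ideal I DR)" using noeth by (simp add: two_sided_noetherian_def)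
  from this[unfolded acc_def, rule_format, of "\<lambda>k. s k <# D"]
  obtain M where M: "\<forall>k\<ge>M. s k <# D = s M <# D"
    using right_ideal_coset[OF N_D[OF s]] sub by blast
  have "s (Suc M) <# D = s M <# D" by (rule M[rule_format]) simp
  moreover have "s (Suc M) \<in> s (Suc M) <# D"
    unfolding coset_mem using N_D[OF s] D_closed by (intro bexI[of _ \<one>]) auto
  ultimately show False using s'[of M] by simp
qed

lemma N_left_principal: "\<exists>p\<in>N. N = D #> p"
proof (rule ccontr)
  assume no: "\<not> ?thesis"
  have ex: "\<exists>q\<in>N. q \<notin> D #> p" if "p \<in> N" for p
  proof -
    have "D #> p \<subseteq> N" using that N_mult by (auto simp: coset_mem)
    then show ?thesis using no that by blast
  qed
  define s where "s = rec_nat \<zero> (\<lambda>_ p. SOME q. q \<in> N \<and> q \<notin> D #> p)"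
  have s: "s n \<in> N" for n
    by (induction n) (auto simp: s_def zero_N intro: someI2_ex[OF ex[unfolded Bex_def]])
  have s': "s (Suc n) \<in> N \<and> s (Suc n) \<notin> D #> s n" for n
    using someI_ex[OF ex[OF s[of n], unfolded Bex_def]] by (simp add: s_def)
  have sub: "D #> s n \<subseteq> D #> s (Suc n)" for n
  proof -
    have c: "s n \<in> carrier F" "s (Suc n) \<in> carrier F" using s N_D by auto
    have "s (Suc n) \<noteq> \<zero>" using s'[of n] c D_closed(2) by (auto simp: coset_mem)
    then obtain d where "d \<in> D" "s n = d \<otimes> s (Suc n)"
      using comparable(2)[of "s (Suc n)" "s n"] c s'[of n] by (auto simp: coset_mem)
    note d = this
    show ?thesis
    proof
      fix z assume "z \<in> D #> s n"
      then obtain x where x: "x \<in> D" "z = x \<otimes> s n" unfolding coset_mem by blast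
      then have "z = (x \<otimes> d) \<otimes> s (Suc n)" using d c by (simp add: m_assoc)
      moreover have "x \<otimes> d \<in> D" using d x D_closed(5) by simp
      ultimately show "z \<in> D #> s (Suc n)" unfolding coset_mem by blast
    qed
  qed
  have "acc (\<lambda>I. left_ideal I DR)" using noeth by (simp add: two_sided_noetherian_def)
  from this[unfolded acc_def, rule_format, of "\<lambda>k. D #> s k"]
  obtain M where M: "\<forall>k\<ge>M. D #> s k = D #> s M"
    using left_ideal_coset[OF N_D[OF s]] sub by blast
  have "D #> s (Suc M) = D #> s M" by (rule M[rule_format]) simp
  moreover have "s (Suc M) \<in> D #> s (Suc M)"
    unfolding coset_mem using N_D[OF s] D_closed by (intro bexI[of _ \<one>]) auto
  ultimately show False using s'[of M] by simp
qed

text \<open>The chain conditions give \<open>N = pD = Dq\<close> with unrelated generators; the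
  point is that \<open>p\<close> also generates on the left. The case \<open>p = \<zero>\<close> is
  that of a division ring \<open>D\<close>.\<close>

lemma uniformiser_exists: "\<exists>p. uniformiser F D p"
proof -
  obtain p q where p: "p \<in> N" "N = p <# D" and q: "q \<in> N" "N = D #> q"
    using N_right_principal N_left_principal by blast
  have NR: "z \<in> N \<longleftrightarrow> (\<exists>d\<in>D. z = p \<otimes> d)" and NL: "z \<in> N \<longleftrightarrow> (\<exists>d\<in>D. z = d \<otimes> q)" for z
    by (subst p(2), rule coset_mem(1)) (subst q(2), rule coset_mem(2))
  have pq: "p \<in> carrier F" "q \<in> carrier F" using p(1) q(1) N_D by auto
  have "D #> p = N"
  proof (cases "p = \<zero>")
    case True
    have "z \<in> N \<longleftrightarrow> z = \<zero>" for z
      unfolding NR True using D_closed(2) by (metis D_carrier l_null)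
    moreover have "z \<in> D #> p \<longleftrightarrow> z = \<zero>" for z
      unfolding coset_mem True using D_closed(2) by (metis D_carrier r_null)
    ultimately show ?thesis by blast
  next
    case False
    obtain u where u: "u \<in> D" "q = p \<otimes> u" using q(1) NR by blast
    obtain s where s: "s \<in> D" "p = s \<otimes> q" using p(1) NL by blast
    \<comment> \<open>If \<open>s\<close> were in \<open>N = pD\<close>, then \<open>p = s q\<close>
      would read \<open>p = p s' p u\<close>, and cancelling \<open>p\<close> would give the element
      \<open>s' p\<close> of \<open>N\<close> a right inverse. Hence \<open>s\<close> is a unit and
      \<open>q\<close> is a left multiple of \<open>p\<close>.\<close>
    have "s \<notin> N"
    proof
      assume "s \<in> N"
      then obtain s' where s': "s' \<in> D" "s = p \<otimes> s'" using NR by blast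
      have "p \<otimes> \<one> = s \<otimes> q" using s pq by simp
      also have "\<dots> = (p \<otimes> s') \<otimes> (p \<otimes> u)" by (simp only: s'(2)[symmetric] u(2)[symmetric])
      also have "\<dots> = p \<otimes> (s' \<otimes> p \<otimes> u)" using s'(1) u(1) pq by (simp add: m_assoc)
      finally have e: "p \<otimes> \<one> = p \<otimes> (s' \<otimes> p \<otimes> u)" .
      have "\<one> = s' \<otimes> p \<otimes> u"
        by (rule left_cancel[OF pq(1) False _ _ e]) (use s'(1) u(1) pq in auto)
      then show False using mult_N_eq_one(1)[OF N_mult(2)[OF p(1) s'(1)] u(1)] by simp
    qed
    then have si: "inv s \<in> D" "s \<noteq> \<zero>" using s(1) by (auto simp: N_def)
    have "x \<in> D #> p" if "x \<in> N" for x
    proof -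
      obtain d where d: "d \<in> D" "x = d \<otimes> q" using \<open>x \<in> N\<close> NL by blast
      have "inv s \<otimes> (s \<otimes> q) = q" using s(1) si pq by (simp add: m_assoc[symmetric])
      then have "inv s \<otimes> p = q" using s(2) by simp
      then have "x = (d \<otimes> inv s) \<otimes> p" using d si(1) pq by (simp add: m_assoc)
      then show ?thesis unfolding coset_mem using d(1) si(1) D_closed(5) by blast
    qed
    moreover have "D #> p \<subseteq> N" using N_mult(2)[OF p(1)] by (auto simp: coset_mem)
    ultimately show ?thesis by blast
  qed
  then show ?thesis using p(2) N_D[OF p(1)] unfolding uniformiser_def jacobson_DR by blast
qed

end

section \<open>Factorisation into a power of the uniformiser and a unit\<close>

context nc_dvr
begin

text \<open>Integer powers are computed in the group \<open>units_of F\<close>, where the laws of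
  exponents hold.\<close>

lemma int_pow_facts:
  assumes p: "p \<in> carrier F" "p \<noteq> \<zero>"
  shows "p [^] (k::int) \<in> carrier F" "p [^] (k::int) \<noteq> \<zero>"
    "p [^] (i + j :: int) = p [^] i \<otimes> p [^] j" "p [^] (0::int) = \<one>" "p [^] (1::int) = p"
    "p [^] (int n) = p [^] n"
proof -
  interpret G: group "units_of F" by (rule units_group)
  have pu: "p \<in> Units F" using p units by simp
  then have pG: "p \<in> carrier (units_of F)" by (simp add: units_of_carrier)
  have nat: "p [^]\<^bsub>units_of F\<^esub> (n::nat) = p [^] n" for n
    by (induction n) (simp_all add: units_of_mult units_of_one)
  have eq: "p [^] (k::int) = p [^]\<^bsub>units_of F\<^esub> k" for k
    unfolding int_pow_def2 nat units_of_inv[OF Units_pow_closed[OF pu]] ..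
  have "p [^] (k::int) \<in> Units F"
    unfolding eq using G.int_pow_closed[OF pG] by (simp add: units_of_carrier)
  then show "p [^] (k::int) \<in> carrier F" "p [^] (k::int) \<noteq> \<zero>" using units by auto
  show "p [^] (i + j :: int) = p [^] i \<otimes> p [^] j"
    unfolding eq G.int_pow_mult[OF pG] by (simp add: units_of_mult)
  show "p [^] (0::int) = \<one>" "p [^] (1::int) = p" "p [^] (int n) = p [^] n"
    using p by (simp_all add: int_pow_def2)
qed

definition U where "U = {u \<in> D. u \<noteq> \<zero> \<and> inv u \<in> D}"

lemma U_carrier: "u \<in> U \<Longrightarrow> u \<in> carrier F" "u \<in> U \<Longrightarrow> u \<noteq> \<zero>" "u \<in> U \<Longrightarrow> u \<in> D"
  by (auto simp: U_def)

lemma U_iff: "u \<in> U \<longleftrightarrow> u \<in> D \<and> u \<notin> N"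
  by (auto simp: U_def N_def)

lemma U_inv: "u \<in> U \<Longrightarrow> inv u \<in> U"
  by (auto simp: U_def)

lemma U_I: "u \<in> D \<Longrightarrow> w \<in> D \<Longrightarrow> u \<otimes> w = \<one> \<Longrightarrow> u \<in> U"
  using mult_N_eq_one(1) by (auto simp: U_iff)

lemma U_mult:
  assumes "u \<in> U" "w \<in> U"
  shows "u \<otimes> w \<in> U"
proof (rule U_I[of _ "inv w \<otimes> inv u"])
  have c: "u \<in> carrier F" "w \<in> carrier F" "inv u \<in> carrier F" "inv w \<in> carrier F"
    using assms U_carrier U_inv by blast+
  have "u \<otimes> w \<otimes> (inv w \<otimes> inv u) = u \<otimes> (w \<otimes> inv w) \<otimes> inv u"
    using c by (simp add: m_assoc)
  then show "u \<otimes> w \<otimes> (inv w \<otimes> inv u) = \<one>" using assms[THEN U_carrier(2)] c by simp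
qed (use assms in \<open>auto simp: U_def D_closed\<close>)

end

locale nc_dvr_uniformiser = nc_dvr +
  fixes p
  assumes p: "p \<in> N" "p \<noteq> \<zero>" "N = p <# D" "N = D #> p"
begin

lemma pc: "p \<in> carrier F" using p(1) N_D by auto

lemma N_iff_right: "z \<in> N \<longleftrightarrow> (\<exists>d\<in>D. z = p \<otimes> d)" and N_iff_left: "z \<in> N \<longleftrightarrow> (\<exists>d\<in>D. z = d \<otimes> p)"
  by (subst p(3), rule coset_mem(1)) (subst p(4), rule coset_mem(2))

abbreviation P :: "int \<Rightarrow> 'a" where "P k \<equiv> p [^] k"

lemmas P = int_pow_facts[OF pc p(2)]

lemma P_neg: "P k \<otimes> P (- k) = \<one>" "P (- k) \<otimes> P k = \<one>"
  using P(3)[of k "- k"] P(3)[of "- k" k] P(4) by simp_all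

lemma P_cancel [simp]:
  "z \<in> carrier F \<Longrightarrow> P k \<otimes> (P (- k) \<otimes> z) = z" "z \<in> carrier F \<Longrightarrow> P (- k) \<otimes> (P k \<otimes> z) = z"
  by (simp_all add: m_assoc[symmetric] P_neg P)

text \<open>Elements that can be moved past units at the price of changing the unit: the substitute
  for commutativity. All powers of \<open>p\<close>, negative ones included, will turn out to belong
  here.\<close>

definition C where "C = {g \<in> carrier F. \<forall>u\<in>U. \<exists>w\<in>U. g \<otimes> u = w \<otimes> g}"

text \<open>\<open>p u\<close> lies in \<open>N = Dp\<close>, so \<open>p u = d p\<close> for some
  \<open>d\<close>. The same for \<open>inv u\<close> yields \<open>d'\<close> with
  \<open>d' d = \<one>\<close>, and therefore \<open>d\<close> is a unit.\<close>

lemma p_C: "p \<in> C"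
  unfolding C_def
proof (intro CollectI conjI ballI pc)
  fix u assume u: "u \<in> U"
  note uc = U_carrier[OF u] and iu = U_inv[OF u]
  have "p \<otimes> u \<in> N" "p \<otimes> inv u \<in> N" using N_mult(1)[OF p(1)] u by (auto simp: U_def)
  then obtain d d' where d: "d \<in> D" "p \<otimes> u = d \<otimes> p" "d' \<in> D" "p \<otimes> inv u = d' \<otimes> p"
    using N_iff_left by metis
  have "p = (p \<otimes> inv u) \<otimes> u" using uc pc by (simp add: m_assoc)
  also have "\<dots> = d' \<otimes> (p \<otimes> u)" unfolding d(4) using d(3) uc pc by (simp add: m_assoc)
  also have "\<dots> = (d' \<otimes> d) \<otimes> p" unfolding d(2) using d(1,3) pc by (simp add: m_assoc)
  finally have e: "(d' \<otimes> d) \<otimes> p = p" by simp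
  have "d' \<otimes> d = ((d' \<otimes> d) \<otimes> p) \<otimes> inv p" using d(1,3) pc p(2) by (simp add: m_assoc)
  then have e: "d' \<otimes> d = \<one>" unfolding e using pc p(2) by simp
  then have "d \<notin> N" using mult_N_eq_one(2)[of d d'] d by auto
  then show "\<exists>w\<in>U. p \<otimes> u = w \<otimes> p" using d by (auto simp: U_iff)
qed

text \<open>The argument of \<open>p_C\<close> with \<open>N = pD\<close> in place of
  \<open>N = Dp\<close>, giving \<open>u p = p d\<close>, followed by multiplication with the
  inverse of \<open>p\<close> on both sides.\<close>

lemma inv_p_C: "P (-1) \<in> C"
  unfolding C_def
proof (intro CollectI conjI ballI P)
  fix u assume u: "u \<in> U"
  note uc = U_carrier[OF u] and iu = U_inv[OF u]
  have P1: "P (-1) \<otimes> p = \<one>" "p \<otimes> P (-1) = \<one>" using P_neg[of 1] P(5) by simp_all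
  have "u \<otimes> p \<in> N" "inv u \<otimes> p \<in> N" using N_mult(2)[OF p(1)] u by (auto simp: U_def)
  then obtain d d' where d: "d \<in> D" "u \<otimes> p = p \<otimes> d" "d' \<in> D" "inv u \<otimes> p = p \<otimes> d'"
    using N_iff_right by metis
  have "p = u \<otimes> (inv u \<otimes> p)" using uc pc by (simp add: m_assoc[symmetric])
  also have "\<dots> = (u \<otimes> p) \<otimes> d'" unfolding d(4) using d(3) uc pc by (simp add: m_assoc)
  also have "\<dots> = p \<otimes> (d \<otimes> d')" unfolding d(2) using d(1,3) pc by (simp add: m_assoc)
  finally have e: "p \<otimes> \<one> = p \<otimes> (d \<otimes> d')" using pc by simp
  have "\<one> = d \<otimes> d'" by (rule left_cancel[OF pc p(2) _ _ e]) (use d in auto)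
  then have dU: "d \<in> U" using U_I[of d d'] d by simp
  have "P (-1) \<otimes> u = P (-1) \<otimes> (u \<otimes> p) \<otimes> P (-1)" using uc pc P1 P(1) by (simp add: m_assoc)
  also have "\<dots> = (P (-1) \<otimes> p) \<otimes> d \<otimes> P (-1)" unfolding d(2) using d(1) pc P(1) by (simp add: m_assoc)
  finally have "P (-1) \<otimes> u = d \<otimes> P (-1)" unfolding P1 using d(1) by simp
  then show "\<exists>w\<in>U. P (-1) \<otimes> u = w \<otimes> P (-1)" using dU by blast
qed

lemma C_mult:
  assumes "g \<in> C" "h \<in> C"
  shows "g \<otimes> h \<in> C"
  unfolding C_def
proof (intro CollectI conjI ballI)
  have c: "g \<in> carrier F" "h \<in> carrier F" using assms by (auto simp: C_def)
  then show "g \<otimes> h \<in> carrier F" by simp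
  fix u assume u: "u \<in> U"
  then obtain w where w: "w \<in> U" "h \<otimes> u = w \<otimes> h" using assms(2) unfolding C_def by blast
  then obtain x where x: "x \<in> U" "g \<otimes> w = x \<otimes> g" using assms(1) unfolding C_def by blast
  note cc = c U_carrier(1)[OF u] U_carrier(1)[OF w(1)] U_carrier(1)[OF x(1)]
  have "g \<otimes> h \<otimes> u = g \<otimes> (h \<otimes> u)" using cc by (simp add: m_assoc)
  also have "\<dots> = (g \<otimes> w) \<otimes> h" unfolding w(2) using cc by (simp add: m_assoc)
  also have "\<dots> = x \<otimes> (g \<otimes> h)" unfolding x(2) using cc by (simp add: m_assoc)
  finally show "\<exists>w\<in>U. g \<otimes> h \<otimes> u = w \<otimes> (g \<otimes> h)" using x(1) by blast
qed

lemma P_C: "P k \<in> C"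
proof (induction k rule: int_induct[of _ 0])
  case base
  then show ?case unfolding P(4) C_def using U_carrier by auto
next
  case (step1 i)
  then show ?case unfolding P(3) P(5) using C_mult p_C by blast
next
  case (step2 i)
  have "P (i - 1) = P i \<otimes> P (-1)" using P(3)[of i "-1"] by simp
  then show ?case using C_mult inv_p_C step2 by simp
qed

lemma P_D: "P k \<in> D \<longleftrightarrow> 0 \<le> k"
proof
  have pow: "p [^] (n::nat) \<in> D" for n
    by (induction n) (use D_closed N_D[OF p(1)] in auto)
  then show "0 \<le> k \<Longrightarrow> P k \<in> D" using P(6)[of "nat k"] by (metis int_nat_eq)
  assume k: "P k \<in> D"
  show "0 \<le> k"
  proof (rule ccontr)
    assume "\<not> 0 \<le> k"
    then have "p [^] nat (- k - 1) \<otimes> P k = P (- 1)"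
      using P(3)[of "- k - 1" k] P(6)[of "nat (- k - 1)"] by simp
    then have "P (-1) \<in> D" using pow k D_closed(5) by metis
    moreover have "p \<otimes> P (-1) = \<one>" using P_neg[of 1] P(5) by simp
    ultimately show False using mult_N_eq_one(1)[OF p(1)] by blast
  qed
qed

text \<open>Otherwise \<open>p\<close> could be divided off indefinitely, with quotients
  \<open>s n\<close> in \<open>N\<close>. The left ideals \<open>D s n\<close> ascend, so
  \<open>s (M+1) = e s M = e p s (M+1)\<close> for some \<open>M\<close> and \<open>e\<close>, and
  \<open>e p = \<one>\<close> contradicts \<open>p \<in> N\<close>.\<close>

lemma decomposition_D:
  assumes "z \<in> D" "z \<noteq> \<zero>"
  shows "\<exists>k u. u \<in> U \<and> z = P k \<otimes> u"
proof (rule ccontr)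
  assume no: "\<not> ?thesis"
  have zc: "z \<in> carrier F" using assms by simp
  define s where "s n = P (- int n) \<otimes> z" for n
  have sD: "s n \<in> D" for n
  proof (induction n)
    case 0
    then show ?case unfolding s_def using assms P(4) zc by simp
  next
    case (Suc n)
    have "z = P (int n) \<otimes> s n" unfolding s_def using zc by simp
    then have "s n \<in> N" using no Suc by (auto simp: U_iff)
    then obtain d where d: "d \<in> D" "s n = p \<otimes> d" using N_iff_right by blast
    have "s (Suc n) = (P (- 1) \<otimes> P (- int n)) \<otimes> z"
      unfolding s_def P(3)[symmetric] by (simp add: add.commute)
    also have "\<dots> = P (-1) \<otimes> s n" unfolding s_def using P(1) zc by (simp add: m_assoc)
    also have "\<dots> = d" unfolding d(2) using P_cancel(2)[of d 1] P(5) d(1) by simp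
    finally show ?case using d by simp
  qed
  have step: "s n = p \<otimes> s (Suc n)" for n
  proof -
    have "p \<otimes> s (Suc n) = (P 1 \<otimes> P (- int (Suc n))) \<otimes> z"
      unfolding s_def P(5) using zc pc P(1) by (simp add: m_assoc)
    then show ?thesis unfolding s_def P(3)[symmetric] by simp
  qed
  have sub: "D #> s n \<subseteq> D #> s (Suc n)" for n
  proof
    fix x assume "x \<in> D #> s n"
    then obtain d where d: "d \<in> D" "x = d \<otimes> s n" unfolding coset_mem by blast
    then have "x = (d \<otimes> p) \<otimes> s (Suc n)" using step[of n] sD pc by (simp add: m_assoc)
    then show "x \<in> D #> s (Suc n)" unfolding coset_mem using d(1) N_D[OF p(1)] D_closed(5) by blast
  qed
  have "acc (\<lambda>I. left_ideal I DR)" using noeth by (simp add: two_sided_noetherian_def)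
  from this[unfolded acc_def, rule_format, of "\<lambda>k. D #> s k"]
  obtain M where M: "\<forall>k\<ge>M. D #> s k = D #> s M"
    using left_ideal_coset[OF sD] sub by blast
  have eq: "D #> s (Suc M) = D #> s M" by (rule M[rule_format]) simp
  have "s (Suc M) \<in> D #> s (Suc M)"
    unfolding coset_mem using sD D_closed by (intro bexI[of _ \<one>]) auto
  then obtain e where e: "e \<in> D" "s (Suc M) = e \<otimes> s M" unfolding eq coset_mem by blast
  have snz: "s n \<noteq> \<zero>" for n
    unfolding s_def using mult_nz P zc assms(2) by blast
  have c: "s (Suc M) \<in> carrier F" using sD by simp
  have "s (Suc M) = (e \<otimes> p) \<otimes> s (Suc M)"
    using e step[of M] pc c by (metis D_carrier m_assoc)
  then have "s (Suc M) \<otimes> inv s (Suc M) = (e \<otimes> p) \<otimes> s (Suc M) \<otimes> inv s (Suc M)" by simp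
  also have "\<dots> = e \<otimes> p" using e(1) pc c snz by (simp add: m_assoc)
  finally have "e \<otimes> p = \<one>" using c snz by simp
  then show False using mult_N_eq_one(2)[OF p(1) e(1)] by simp
qed

lemma decomposition:
  assumes "z \<in> carrier F" "z \<noteq> \<zero>"
  obtains k u where "u \<in> U" "z = P k \<otimes> u"
proof (cases "z \<in> D")
  case True
  then show thesis using decomposition_D assms that by blast
next
  \<comment> \<open>Outside \<open>D\<close> the inverse of \<open>z\<close> is factored. Inverting
    leaves the unit on the wrong side of the power, and \<open>P_C\<close> moves it across.\<close>
  case False
  then have "inv z \<in> D" using total assms by blast
  then obtain k u where u: "u \<in> U" "inv z = P k \<otimes> u" using decomposition_D assms by (metis inv_nz(2))
  note uc = U_carrier(1)[OF u(1)] U_carrier(1)[OF U_inv[OF u(1)]]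
  obtain w where w: "w \<in> U" "P k \<otimes> inv u = w \<otimes> P k"
    using P_C[of k] U_inv[OF u(1)] unfolding C_def by blast
  note wc = U_carrier(1)[OF w(1)]
  have "z = inv u \<otimes> P (- k)"
  proof -
    have "(P k \<otimes> u) \<otimes> (inv u \<otimes> P (- k)) = P k \<otimes> ((u \<otimes> inv u) \<otimes> P (- k))"
      using uc P(1) by (simp add: m_assoc)
    also have "\<dots> = \<one>" using uc U_carrier(2)[OF u(1)] P(1) P_neg by simp
    finally have "inv (inv z) = inv u \<otimes> P (- k)"
      unfolding u(2) using uc P(1) mult_nz[OF P(1,2) uc(1) U_carrier(2)[OF u(1)]] by (intro inv_eqI) auto
    then show ?thesis using assms by simp
  qed
  also have "\<dots> = P (- k) \<otimes> ((P k \<otimes> inv u) \<otimes> P (- k))"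
    using uc P(1) by (simp add: m_assoc)
  also have "\<dots> = P (- k) \<otimes> w" unfolding w(2) using wc P(1) P_neg by (simp add: m_assoc)
  finally show thesis using that w(1) by blast
qed

lemma P_mult_U_mem:
  assumes u: "u \<in> U"
  shows "P k \<otimes> u \<in> D \<longleftrightarrow> 0 \<le> k"
proof -
  have c: "u \<in> carrier F" "inv u \<in> D" "u \<in> D" "u \<noteq> \<zero>" using u by (auto simp: U_def)
  have "P k = (P k \<otimes> u) \<otimes> inv u" using c P(1) by (simp add: m_assoc)
  then show ?thesis using c D_closed(5) P_D by metis
qed

text \<open>Shows that the supremum in \<open>adic_filtration\<close> is attained, at the exponent
  of the factorisation.\<close>

lemma coset_P:
  assumes u: "u \<in> U" and z: "z = P k \<otimes> u"
  shows "{j. z \<in> P j <# D} = {..k}"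
proof -
  have c: "u \<in> carrier F" using U_carrier u by blast
  have zj: "P j \<otimes> (P (k - j) \<otimes> u) = z" for j
    unfolding z using P(3)[of j "k - j"] P(1) c by (simp add: m_assoc[symmetric])
  have "z \<in> P j <# D \<longleftrightarrow> P (k - j) \<otimes> u \<in> D" for j
  proof
    assume "z \<in> P j <# D"
    then obtain d where d: "d \<in> D" "P j \<otimes> (P (k - j) \<otimes> u) = P j \<otimes> d" unfolding coset_mem zj by blast
    have "P (k - j) \<otimes> u = d" by (rule left_cancel[OF P(1,2) _ _ d(2)]) (use c d P in auto)
    then show "P (k - j) \<otimes> u \<in> D" using d by simp
  next
    assume "P (k - j) \<otimes> u \<in> D"
    then show "z \<in> P j <# D" unfolding coset_mem using zj by metis
  qed
  then show ?thesis using P_mult_U_mem[OF u] by auto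
qed

lemma SUP_coset:
  assumes "u \<in> U" "z = P k \<otimes> u"
  shows "(SUP j\<in>{j. z \<in> P j <# D}. ereal (real_of_int j)) = ereal (real_of_int k)"
  unfolding coset_P[OF assms] by (rule SUP_eqI) auto

end

section \<open>The adic filtration is a valuation\<close>

context nc_dvr
begin

abbreviation v where "v \<equiv> adic_filtration F D"

lemma v_zero: "v \<zero> = \<infinity>"
  by (simp add: adic_filtration_def)

text \<open>Proved together because the definition of \<open>v\<close> has two branches: a zero
  radical, where \<open>v\<close> is trivial, and a nonzero uniformiser, where everything follows
  from the factorisation. Exact additivity on products is what later turns value \<open>0\<close>
  into invertibility.\<close>

lemma v_facts:
  shows "x \<in> carrier F \<Longrightarrow> x \<noteq> \<zero> \<Longrightarrow> \<exists>k::int. v x = ereal (real_of_int k)"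
    and "x \<in> carrier F \<Longrightarrow> 0 \<le> v x \<longleftrightarrow> x \<in> D"
    and "x \<in> carrier F \<Longrightarrow> y \<in> carrier F \<Longrightarrow> x \<noteq> \<zero> \<Longrightarrow> y \<noteq> \<zero> \<Longrightarrow> v (x \<otimes> y) = v x + v y"
proof -
  have "(x \<in> carrier F \<longrightarrow> x \<noteq> \<zero> \<longrightarrow> (\<exists>k::int. v x = ereal (real_of_int k))) \<and>
      (x \<in> carrier F \<longrightarrow> (0 \<le> v x \<longleftrightarrow> x \<in> D)) \<and>
      (x \<in> carrier F \<longrightarrow> y \<in> carrier F \<longrightarrow> x \<noteq> \<zero> \<longrightarrow> y \<noteq> \<zero> \<longrightarrow> v (x \<otimes> y) = v x + v y)" for x y
  proof (cases "N = {\<zero>}")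
    \<comment> \<open>A zero radical means that every nonzero element of \<open>D\<close> is a unit;
      by \<open>total\<close>, then, \<open>D\<close> is all of \<open>F\<close>.\<close>
    case True
    have nz: "v z = 0" if "z \<noteq> \<zero>" for z
      using that True by (simp add: adic_filtration_def jacobson_DR)
    have "z \<in> D" if "z \<in> carrier F" for z
    proof (cases "z = \<zero>")
      case False
      then have "z \<in> D \<or> inv z \<in> D \<and> inv z \<notin> N" using total that True by auto
      then show ?thesis using that False by (auto simp: N_def)
    qed (simp add: D_closed)
    moreover have "\<exists>k::int. (0::ereal) = ereal (real_of_int k)" by (rule exI[of _ 0]) simp
    ultimately show ?thesis using nz mult_nz[of x y] by (cases "x = \<zero>") (auto simp: v_zero D_closed)
  next
    case False
    \<comment> \<open>The very uniformiser chosen in the definition of the filtration, so that the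
      factorisation applies to it directly.\<close>
    define p where "p = (SOME p. uniformiser F D p)"
    have "uniformiser F D p" unfolding p_def using uniformiser_exists by (rule someI_ex)
    then have p: "p \<in> D" "N = p <# D" "N = D #> p" by (auto simp: uniformiser_def jacobson_DR)
    have pN: "p \<in> N" unfolding p(2) coset_mem using p(1) D_closed(3) by (intro bexI[of _ \<one>]) auto
    have "p \<noteq> \<zero>"
    proof
      assume 0: "p = \<zero>"
      have "z \<in> N \<longleftrightarrow> z = \<zero>" for z
        unfolding p(2) coset_mem 0 using D_closed(2) by (metis D_carrier l_null)
      then show False using False by blast
    qed
    then interpret nc_dvr_uniformiser F D p by unfold_locales (use p pN in auto)
    have v_eq: "v (P k \<otimes> u) = ereal (real_of_int k)" if u: "u \<in> U" for k u
    proof -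
      have "P k \<otimes> u \<noteq> \<zero>" using mult_nz P U_carrier[OF u] by blast
      then show ?thesis
        using SUP_coset[OF u refl, of k] False
        by (simp add: adic_filtration_def jacobson_DR p_def[symmetric])
    qed
    have "v (x \<otimes> y) = v x + v y"
      if xy: "x \<in> carrier F" "y \<in> carrier F" "x \<noteq> \<zero>" "y \<noteq> \<zero>" for x y
    proof -
      obtain k u where u: "u \<in> U" "x = P k \<otimes> u" using decomposition xy by metis
      obtain l w where w: "w \<in> U" "y = P l \<otimes> w" using decomposition xy by metis
      \<comment> \<open>\<open>t\<close> is the unit with \<open>u p^l = p^l t\<close>, which brings
        the two powers of \<open>p\<close> together.\<close>
      obtain t where t: "t \<in> U" "P (- l) \<otimes> u = t \<otimes> P (- l)" using P_C[of "- l"] u(1) unfolding C_def by blast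
      note c = U_carrier(1)[OF u(1)] U_carrier(1)[OF w(1)] U_carrier(1)[OF t(1)]
      have "u \<otimes> P l = P l \<otimes> ((P (- l) \<otimes> u) \<otimes> P l)" using c P(1) by (simp add: m_assoc)
      also have "\<dots> = P l \<otimes> t" unfolding t(2) using c P(1) P_neg by (simp add: m_assoc)
      finally have ut: "u \<otimes> P l = P l \<otimes> t" .
      have "x \<otimes> y = P k \<otimes> (u \<otimes> P l) \<otimes> w" unfolding u(2) w(2) using c P(1) by (simp add: m_assoc)
      also have "\<dots> = P (k + l) \<otimes> (t \<otimes> w)" unfolding ut P(3) using c P(1) by (simp add: m_assoc)
      finally show ?thesis using v_eq[OF U_mult[OF t(1) w(1)]] v_eq[OF u(1)] v_eq[OF w(1)] u w by simp
    qed
    moreover have "(\<exists>k::int. v x = ereal (real_of_int k)) \<and> (0 \<le> v x \<longleftrightarrow> x \<in> D)"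
      if x: "x \<in> carrier F" "x \<noteq> \<zero>" for x
    proof -
      obtain k u where u: "u \<in> U" "x = P k \<otimes> u" using decomposition x by metis
      show ?thesis unfolding u(2) v_eq[OF u(1)] P_mult_U_mem[OF u(1)] by auto
    qed
    ultimately show ?thesis using v_zero D_closed(2) by (cases "x = \<zero>") auto
  qed
  then show "x \<in> carrier F \<Longrightarrow> x \<noteq> \<zero> \<Longrightarrow> \<exists>k::int. v x = ereal (real_of_int k)"
    and "x \<in> carrier F \<Longrightarrow> 0 \<le> v x \<longleftrightarrow> x \<in> D"
    and "x \<in> carrier F \<Longrightarrow> y \<in> carrier F \<Longrightarrow> x \<noteq> \<zero> \<Longrightarrow> y \<noteq> \<zero> \<Longrightarrow> v (x \<otimes> y) = v x + v y"
    by blast+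
qed

lemma v_one: "v \<one> = 0"
proof -
  obtain k :: int where k: "v \<one> = ereal (real_of_int k)" using v_facts(1)[of \<one>] one_neq_zero by auto
  have "v \<one> = v \<one> + v \<one>" using v_facts(3)[of \<one> \<one>] one_neq_zero by simp
  then show ?thesis unfolding k by simp
qed

text \<open>If \<open>v x \<le> v y\<close>, then \<open>d = inv x \<otimes> y\<close> has value at
  least \<open>0\<close> and lies in \<open>D\<close>; so does \<open>1 + d\<close>, and
  \<open>x + y = x (1 + d)\<close>.\<close>

lemma v_add:
  assumes x: "x \<in> carrier F" and y: "y \<in> carrier F"
  shows "min (v x) (v y) \<le> v (x \<oplus> y)"
proof -
  have *: "v x \<le> v (x \<oplus> y)"
    if x: "x \<in> carrier F" and y: "y \<in> carrier F" and le: "v x \<le> v y" for x y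
  proof (cases "x = \<zero> \<or> y = \<zero> \<or> x \<oplus> y = \<zero>")
    case True
    then show ?thesis using x y le by (auto simp: v_zero)
  next
    case False
    obtain k l :: int where k: "v x = ereal (real_of_int k)" "v y = ereal (real_of_int l)"
      using v_facts(1) x y False by meson
    define d where "d = inv x \<otimes> y"
    have d: "d \<in> carrier F" "d \<noteq> \<zero>" "y = x \<otimes> d"
      unfolding d_def using x y False mult_nz by (simp_all add: m_assoc[symmetric])
    have "v y = v x + v d" unfolding d(3) using v_facts(3) x d False by simp
    then have "0 \<le> v d" using le k by (cases "v d") auto
    then have "d \<in> D" using v_facts(2) d by simp
    then have "\<one> \<oplus> d \<in> D" using D_closed by simp
    then have v1: "0 \<le> v (\<one> \<oplus> d)" using v_facts(2)[of "\<one> \<oplus> d"] d by simp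
    have e: "x \<oplus> y = x \<otimes> (\<one> \<oplus> d)" unfolding d(3) using x d(1) by (simp add: r_distr)
    then have "\<one> \<oplus> d \<noteq> \<zero>" using False x by auto
    then have "v (x \<oplus> y) = v x + v (\<one> \<oplus> d)" unfolding e using v_facts(3) x d False by simp
    then show ?thesis using v1 k by (cases "v (\<one> \<oplus> d)") auto
  qed
  show ?thesis
  proof (cases "v x \<le> v y")
    case True
    then show ?thesis using *[OF x y True] by (simp add: min_def)
  next
    case False
    then show ?thesis using *[OF y x] a_comm[OF x y] by (simp add: min_def)
  qed
qed

lemma filtration_v: "filtration F v"
  unfolding filtration_def
proof (intro conjI ballI)
  fix r assume r: "r \<in> carrier F"
  show "v r = \<infinity> \<or> (\<exists>k::int. v r = ereal (real_of_int k))" using v_facts(1)[OF r] v_zero by auto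
  show "(v r = \<infinity>) = (r = \<zero>)" using v_facts(1)[OF r] v_zero by (cases "r = \<zero>") auto
  fix s assume s: "s \<in> carrier F"
  show "min (v r) (v s) \<le> v (r \<oplus> s)" using v_add r s .
  show "v r + v s \<le> v (r \<otimes> s)"
    using v_facts(3)[OF r s] r s by (cases "r = \<zero> \<or> s = \<zero>") (auto simp: v_zero)
qed (rule v_one)

lemma v_unit:
  assumes "x \<in> carrier F" "v x = 0"
  shows "x \<noteq> \<zero>" "inv x \<in> D"
proof -
  show x: "x \<noteq> \<zero>" using assms v_zero by auto
  have "v x + v (inv x) = 0" using v_facts(3)[of x "inv x"] assms(1) x v_one by simp
  then show "inv x \<in> D" using v_facts(2)[of "inv x"] assms x by simp
qed

end

section \<open>Complete filtered rings\<close>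

text \<open>Invariance under negation does not follow from \<open>filtration\<close>: on the integers, the value
  \<open>0\<close> on positive and \<open>-1\<close> on negative numbers is a filtration.\<close>

locale complete_filtered_ring = ring R for R (structure) +
  fixes v :: "'a \<Rightarrow> ereal"
  assumes filt: "filtration R v"
    and v_neg: "x \<in> carrier R \<Longrightarrow> v (\<ominus> x) = v x"
    and v_complete: "(\<And>n. s n \<in> carrier R) \<Longrightarrow> (\<And>n. ereal (real n) \<le> v (s (Suc n) \<ominus> s n))
        \<Longrightarrow> \<exists>l\<in>carrier R. \<forall>n. ereal (real n) \<le> v (s n \<ominus> l)"
begin

lemma v_int: "x \<in> carrier R \<Longrightarrow> v x = \<infinity> \<or> (\<exists>k::int. v x = ereal (real_of_int k))"
  and v_one [simp]: "v \<one> = 0"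
  and v_inf: "x \<in> carrier R \<Longrightarrow> v x = \<infinity> \<longleftrightarrow> x = \<zero>"
  and v_add: "x \<in> carrier R \<Longrightarrow> y \<in> carrier R \<Longrightarrow> min (v x) (v y) \<le> v (x \<oplus> y)"
  and v_mult: "x \<in> carrier R \<Longrightarrow> y \<in> carrier R \<Longrightarrow> v x + v y \<le> v (x \<otimes> y)"
  using filt unfolding filtration_def by auto

lemma v_zero [simp]: "v \<zero> = \<infinity>"
  using v_inf by simp

lemma v_add_le: "x \<in> carrier R \<Longrightarrow> y \<in> carrier R \<Longrightarrow> c \<le> v x \<Longrightarrow> c \<le> v y \<Longrightarrow> c \<le> v (x \<oplus> y)"
  using v_add[of x y] by (meson min.boundedI order_trans)

lemma v_mult_le:
  "x \<in> carrier R \<Longrightarrow> y \<in> carrier R \<Longrightarrow> c \<le> v x \<Longrightarrow> d \<le> v y \<Longrightarrow> c + d \<le> v (x \<otimes> y)"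
  using v_mult[of x y] by (meson add_mono order_trans)

lemma v_minus_le: "x \<in> carrier R \<Longrightarrow> y \<in> carrier R \<Longrightarrow> c \<le> v x \<Longrightarrow> c \<le> v y \<Longrightarrow> c \<le> v (x \<ominus> y)"
  using v_add_le[of x "\<ominus> y"] v_neg by (simp add: a_minus_def)

lemma v_psum_le:
  "(\<And>i. i < n \<Longrightarrow> t i \<in> carrier R) \<Longrightarrow> (\<And>i. i < n \<Longrightarrow> c \<le> v (t i)) \<Longrightarrow> c \<le> v (psum R t n)"
  by (induction n) (auto intro!: v_add_le)

text \<open>For the product of the \<open>F_i\<close> this will be the product of the
  \<open>D_i\<close>, and for \<open>Q\<close> the ring called \<open>Op\<close> in the
  theorem.\<close>

definition nonneg where "nonneg = {x \<in> carrier R. 0 \<le> v x}"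

definition vL :: "nat \<Rightarrow> 'a set" where "vL k = {x \<in> carrier R. ereal (real k) \<le> v x}"

lemma subring_nonneg: "subring nonneg R"
proof (rule subringI)
  show "h1 \<otimes> h2 \<in> nonneg" if "h1 \<in> nonneg" "h2 \<in> nonneg" for h1 h2
    using that v_mult_le[of h1 h2 0 0] by (simp add: nonneg_def)
qed (auto simp: nonneg_def v_neg intro: v_add_le)

lemma chain_ring_nonneg: "chain_ring (R\<lparr>carrier := nonneg\<rparr>) vL"
proof -
  let ?O = "R\<lparr>carrier := nonneg\<rparr>"
  interpret O: ring ?O using subring_is_ring[OF subring_nonneg] .
  have min: "x \<ominus>\<^bsub>?O\<^esub> y = x \<ominus> y" if "y \<in> nonneg" for x y
    using a_minus_subring[OF subring_nonneg that] .
  show ?thesis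
  proof (intro chain_ring.intro chain_ring_axioms.intro chain_group.intro chain_group_axioms.intro
      O.ring_axioms O.abelian_group_axioms)
    show "vL 0 = carrier ?O" unfolding vL_def nonneg_def by (simp only: of_nat_0 partial_object.simps flip: zero_ereal_def) simp
    show "vL (Suc k) \<subseteq> vL k" for k
    proof -
      have "ereal (real k) \<le> v x" if "ereal (real (Suc k)) \<le> v x" for x
        by (rule order_trans[OF _ that]) simp
      then show ?thesis unfolding vL_def by blast
    qed
    show "\<zero>\<^bsub>?O\<^esub> \<in> vL k" for k by (simp add: vL_def)
    show "x \<oplus>\<^bsub>?O\<^esub> y \<in> vL k" if "x \<in> vL k" "y \<in> vL k" for x y k
      using that by (simp add: vL_def v_add_le)
    show "\<ominus>\<^bsub>?O\<^esub> x \<in> vL k" if "x \<in> vL k" for x k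
    proof -
      have "0 \<le> v x" by (rule order_trans[of _ "ereal (real k)"]) (use that in \<open>auto simp: vL_def\<close>)
      then have "x \<in> nonneg" using that by (simp add: vL_def nonneg_def)
      then show ?thesis using that a_inv_subring[OF subring_nonneg] by (simp add: vL_def v_neg)
    qed
    show "x = \<zero>\<^bsub>?O\<^esub>" if x: "\<And>k. x \<in> vL k" for x
    proof -
      have xc: "x \<in> carrier R" using x[of 0] by (simp add: vL_def)
      have "v x = \<infinity>"
        using x by (intro ereal_top) (metis (mono_tags, lifting) ereal_less_eq(3) mem_Collect_eq order_trans real_arch_simple vL_def)
      then show ?thesis using v_inf xc by simp
    qed
    show "x \<otimes>\<^bsub>?O\<^esub> y \<in> vL (i + j)" if "x \<in> vL i" "y \<in> vL j" for x i y j
      using that v_mult_le[of x y "ereal (real i)" "ereal (real j)"] by (simp add: vL_def)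
    fix s assume s: "\<And>n. s n \<in> carrier ?O" and d: "\<And>n. s (Suc n) \<ominus>\<^bsub>?O\<^esub> s n \<in> vL n"
    have sn: "s n \<in> nonneg" for n using s by simp
    then have sc: "s n \<in> carrier R" for n by (simp add: nonneg_def)
    have "\<exists>l\<in>carrier R. \<forall>n. ereal (real n) \<le> v (s n \<ominus> l)"
      by (rule v_complete) (use d sc in \<open>auto simp: min[OF sn] vL_def\<close>)
    then obtain l where l: "l \<in> carrier R" "\<And>n. ereal (real n) \<le> v (s n \<ominus> l)" by blast
    \<comment> \<open>Completeness is assumed for all of \<open>R\<close>. The limit lands in
      \<open>nonneg\<close> because it is the difference of \<open>s 0\<close> and an element of
      value at least \<open>0\<close>.\<close>
    have "s 0 \<ominus> (s 0 \<ominus> l) = l" using l(1) sc[of 0]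
      by (simp add: a_minus_def minus_add a_assoc[symmetric] r_neg)
    moreover have "ereal (real 0) \<le> v (s 0 \<ominus> (s 0 \<ominus> l))"
      by (rule v_minus_le[OF _ _ _ l(2)]) (use l(1) sc sn[of 0] in \<open>auto simp: nonneg_def zero_ereal_def\<close>)
    ultimately have "0 \<le> v l" by (simp add: zero_ereal_def)
    then have "l \<in> nonneg" using l(1) by (simp add: nonneg_def)
    then show "\<exists>l\<in>carrier ?O. \<forall>n. s n \<ominus>\<^bsub>?O\<^esub> l \<in> vL n"
      using l sc by (intro bexI[of _ l]) (auto simp: min vL_def)
  qed
qed

end

lemma ereal_le_MinI:
  "finite J \<Longrightarrow> J \<noteq> {} \<Longrightarrow> (c::ereal) \<le> Min (f ` J) \<longleftrightarrow> (\<forall>p\<in>J. c \<le> f p)"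
  by simp

text \<open>Products and matrix rings are treated alike: both are function spaces with componentwise
  addition and the minimum of the values. Their multiplications differ, whence the separate
  assumptions \<open>one\<close> and \<open>mult\<close>.\<close>

lemma complete_filtered_ring_componentwise:
  assumes T: "ring T" and J: "finite J" "J \<noteq> {}" and R: "\<And>p. p \<in> J \<Longrightarrow> complete_filtered_ring (R p) (f p)"
    and car: "carrier T = (\<Pi>\<^sub>E p\<in>J. carrier (R p))"
    and add: "\<And>x y p. x \<in> carrier T \<Longrightarrow> y \<in> carrier T \<Longrightarrow> p \<in> J \<Longrightarrow> (x \<oplus>\<^bsub>T\<^esub> y) p = x p \<oplus>\<^bsub>R p\<^esub> y p"
    and zero: "\<And>p. p \<in> J \<Longrightarrow> \<zero>\<^bsub>T\<^esub> p = \<zero>\<^bsub>R p\<^esub>"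
    and w: "w = (\<lambda>x. Min ((\<lambda>p. f p (x p)) ` J))"
    and one: "w \<one>\<^bsub>T\<^esub> = 0"
    and mult: "\<And>x y. x \<in> carrier T \<Longrightarrow> y \<in> carrier T \<Longrightarrow> w x + w y \<le> w (x \<otimes>\<^bsub>T\<^esub> y)"
  shows "complete_filtered_ring T w"
proof -
  interpret T: ring T by fact
  have c: "x p \<in> carrier (R p)" if "x \<in> carrier T" "p \<in> J" for x p
    using that car by auto
  have eqI: "x = y" if "x \<in> carrier T" "y \<in> carrier T" "\<And>p. p \<in> J \<Longrightarrow> x p = y p" for x y
    using that unfolding car by (meson PiE_ext)
  have neg: "(\<ominus>\<^bsub>T\<^esub> x) p = \<ominus>\<^bsub>R p\<^esub> x p" if x: "x \<in> carrier T" and p: "p \<in> J" for x p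
  proof -
    interpret R: complete_filtered_ring "R p" "f p" using R p .
    have "(\<ominus>\<^bsub>T\<^esub> x) p \<oplus>\<^bsub>R p\<^esub> x p = \<zero>\<^bsub>R p\<^esub>"
      using add[of "\<ominus>\<^bsub>T\<^esub> x" x p] x p zero T.l_neg[OF x] by simp
    then show ?thesis using R.minus_equality[of "(\<ominus>\<^bsub>T\<^esub> x) p" "x p"] c x p by simp
  qed
  have minus: "(x \<ominus>\<^bsub>T\<^esub> y) p = x p \<ominus>\<^bsub>R p\<^esub> y p"
    if "x \<in> carrier T" "y \<in> carrier T" "p \<in> J" for x y p
    using that by (simp add: a_minus_def add neg)
  note le = ereal_le_MinI[OF J]
  show ?thesis
  proof
    show "filtration T w"
      unfolding filtration_def
    proof (intro conjI ballI)
      fix x assume x: "x \<in> carrier T"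
      have "w x \<in> (\<lambda>p. f p (x p)) ` J" unfolding w using J by (intro Min_in) auto
      then obtain p where p: "p \<in> J" "w x = f p (x p)" by auto
      interpret R: complete_filtered_ring "R p" "f p" using R[OF p(1)] .
      show "w x = \<infinity> \<or> (\<exists>k::int. w x = ereal (real_of_int k))"
        unfolding p(2) by (rule R.v_int[OF c[OF x p(1)]])
      show "(w x = \<infinity>) = (x = \<zero>\<^bsub>T\<^esub>)"
      proof -
        have "w x = \<infinity> \<longleftrightarrow> (\<forall>p\<in>J. f p (x p) = \<infinity>)"
          using le[of \<infinity> "\<lambda>p. f p (x p)"] unfolding w by simp
        also have "\<dots> \<longleftrightarrow> (\<forall>p\<in>J. x p = \<zero>\<^bsub>R p\<^esub>)"
          using complete_filtered_ring.v_inf[OF R] c[OF x] by blast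
        also have "\<dots> \<longleftrightarrow> x = \<zero>\<^bsub>T\<^esub>" using eqI[OF x T.zero_closed] zero by auto
        finally show ?thesis .
      qed
      fix y assume y: "y \<in> carrier T"
      show "w x + w y \<le> w (x \<otimes>\<^bsub>T\<^esub> y)" using mult x y .
      have "min (w x) (w y) \<le> f p ((x \<oplus>\<^bsub>T\<^esub> y) p)" if p: "p \<in> J" for p
      proof -
        have "w x \<le> f p (x p)" "w y \<le> f p (y p)" unfolding w using J p by auto
        then show ?thesis
          using complete_filtered_ring.v_add[OF R[OF p] c[OF x p] c[OF y p]] add[OF x y p]
          by (simp add: min_le_iff_disj) (meson order_trans)
      qed
      then show "min (w x) (w y) \<le> w (x \<oplus>\<^bsub>T\<^esub> y)"
        using le[of _ "\<lambda>p. f p ((x \<oplus>\<^bsub>T\<^esub> y) p)"] unfolding w by blast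
    qed (rule one)
    show "w (\<ominus>\<^bsub>T\<^esub> x) = w x" if x: "x \<in> carrier T" for x
    proof -
      have "(\<lambda>p. f p ((\<ominus>\<^bsub>T\<^esub> x) p)) ` J = (\<lambda>p. f p (x p)) ` J"
        using neg[OF x] complete_filtered_ring.v_neg[OF R c[OF x]] by (intro image_cong) auto
      then show ?thesis unfolding w by simp
    qed
    fix s assume s: "\<And>n. s n \<in> carrier T" and d: "\<And>n. ereal (real n) \<le> w (s (Suc n) \<ominus>\<^bsub>T\<^esub> s n)"
    have "\<exists>l\<in>carrier (R p). \<forall>n. ereal (real n) \<le> f p (s n p \<ominus>\<^bsub>R p\<^esub> l)" if p: "p \<in> J" for p
    proof -
      interpret R: complete_filtered_ring "R p" "f p" using R p .
      show ?thesis
      proof (rule R.v_complete)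
        fix n
        show "ereal (real n) \<le> f p (s (Suc n) p \<ominus>\<^bsub>R p\<^esub> s n p)"
          using d[of n] le p unfolding w by (simp add: minus s)
      qed (use s c p in auto)
    qed
    then obtain l where l: "\<And>p. p \<in> J \<Longrightarrow> l p \<in> carrier (R p)"
      "\<And>p n. p \<in> J \<Longrightarrow> ereal (real n) \<le> f p (s n p \<ominus>\<^bsub>R p\<^esub> l p)" by metis
    have lc: "restrict l J \<in> carrier T" unfolding car using l(1) by auto
    have "ereal (real n) \<le> w (s n \<ominus>\<^bsub>T\<^esub> restrict l J)" for n
      unfolding w le using minus[OF s lc] l(2) by simp
    then show "\<exists>l\<in>carrier T. \<forall>n. ereal (real n) \<le> w (s n \<ominus>\<^bsub>T\<^esub> l)" using lc by blast
  qed
qed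

section \<open>Products of filtered rings\<close>

lemma ring_prod_ring:
  assumes "\<And>i. i \<in> I \<Longrightarrow> ring (R i)"
  shows "ring (prod_ring I R)"
proof -
  let ?P = "prod_ring I R"
  have mem: "x i \<in> carrier (R i)" if "x \<in> carrier ?P" "i \<in> I" for x i
    using that by (auto simp: prod_ring_def)
  have res: "restrict x I \<in> carrier ?P" if "\<And>i. i \<in> I \<Longrightarrow> x i \<in> carrier (R i)" for x
    using that by (auto simp: prod_ring_def)
  have ops: "x \<otimes>\<^bsub>?P\<^esub> y = (\<lambda>i\<in>I. x i \<otimes>\<^bsub>R i\<^esub> y i)" "x \<oplus>\<^bsub>?P\<^esub> y = (\<lambda>i\<in>I. x i \<oplus>\<^bsub>R i\<^esub> y i)"
    "\<one>\<^bsub>?P\<^esub> = (\<lambda>i\<in>I. \<one>\<^bsub>R i\<^esub>)" "\<zero>\<^bsub>?P\<^esub> = (\<lambda>i\<in>I. \<zero>\<^bsub>R i\<^esub>)" for x y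
    by (simp_all add: prod_ring_def)
  have self: "(\<lambda>i\<in>I. x i) = x" if "x \<in> carrier ?P" for x
    using that by (simp add: prod_ring_def)
  have ag: "abelian_group (R i)" and am: "abelian_monoid (R i)" and mo: "monoid (R i)" and sr: "semiring (R i)"
    if "i \<in> I" for i
  proof -
    interpret ring "R i" using assms that .
    show "abelian_group (R i)" "abelian_monoid (R i)" "monoid (R i)" "semiring (R i)" by unfold_locales
  qed
  note cl = monoid.m_closed[OF mo] abelian_monoid.a_closed[OF am] monoid.one_closed[OF mo] abelian_monoid.zero_closed[OF am]
  show ?thesis
  proof (rule ringI)
    show "abelian_group ?P"
    proof (rule abelian_groupI)
      fix x assume x: "x \<in> carrier ?P"
      show "\<exists>y\<in>carrier ?P. y \<oplus>\<^bsub>?P\<^esub> x = \<zero>\<^bsub>?P\<^esub>"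
      proof (intro bexI[of _ "\<lambda>i\<in>I. \<ominus>\<^bsub>R i\<^esub> x i"])
        show "(\<lambda>i\<in>I. \<ominus>\<^bsub>R i\<^esub> x i) \<oplus>\<^bsub>?P\<^esub> x = \<zero>\<^bsub>?P\<^esub>"
          unfolding ops by (rule restrict_ext) (simp add: abelian_group.l_neg[OF ag] mem[OF x])
        show "(\<lambda>i\<in>I. \<ominus>\<^bsub>R i\<^esub> x i) \<in> carrier ?P"
          by (rule res) (simp add: abelian_group.a_inv_closed[OF ag] mem[OF x])
      qed
      have "\<zero>\<^bsub>?P\<^esub> \<oplus>\<^bsub>?P\<^esub> x = (\<lambda>i\<in>I. x i)"
        unfolding ops by (rule restrict_ext) (simp add: abelian_monoid.l_zero[OF am] mem[OF x])
      then show "\<zero>\<^bsub>?P\<^esub> \<oplus>\<^bsub>?P\<^esub> x = x" using self[OF x] by simp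
      fix y assume y: "y \<in> carrier ?P"
      show "x \<oplus>\<^bsub>?P\<^esub> y \<in> carrier ?P" unfolding ops by (rule res) (simp add: cl mem[OF x] mem[OF y])
      show "x \<oplus>\<^bsub>?P\<^esub> y = y \<oplus>\<^bsub>?P\<^esub> x"
        unfolding ops by (rule restrict_ext) (rule abelian_monoid.a_comm[OF am]; simp add: mem[OF x] mem[OF y])
      fix z assume z: "z \<in> carrier ?P"
      show "x \<oplus>\<^bsub>?P\<^esub> y \<oplus>\<^bsub>?P\<^esub> z = x \<oplus>\<^bsub>?P\<^esub> (y \<oplus>\<^bsub>?P\<^esub> z)"
        unfolding ops by (rule restrict_ext) (simp add: abelian_monoid.a_assoc[OF am] mem[OF x] mem[OF y] mem[OF z])
    qed (unfold ops, rule res, simp add: cl)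
    show "monoid ?P"
    proof (rule monoidI)
      fix x assume x: "x \<in> carrier ?P"
      have "\<one>\<^bsub>?P\<^esub> \<otimes>\<^bsub>?P\<^esub> x = (\<lambda>i\<in>I. x i)" "x \<otimes>\<^bsub>?P\<^esub> \<one>\<^bsub>?P\<^esub> = (\<lambda>i\<in>I. x i)"
        unfolding ops by (rule restrict_ext; simp add: monoid.l_one[OF mo] monoid.r_one[OF mo] mem[OF x])+
      then show "\<one>\<^bsub>?P\<^esub> \<otimes>\<^bsub>?P\<^esub> x = x" "x \<otimes>\<^bsub>?P\<^esub> \<one>\<^bsub>?P\<^esub> = x" using self[OF x] by simp_all
      fix y assume y: "y \<in> carrier ?P"
      show "x \<otimes>\<^bsub>?P\<^esub> y \<in> carrier ?P" unfolding ops by (rule res) (simp add: cl mem[OF x] mem[OF y])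
      fix z assume z: "z \<in> carrier ?P"
      show "x \<otimes>\<^bsub>?P\<^esub> y \<otimes>\<^bsub>?P\<^esub> z = x \<otimes>\<^bsub>?P\<^esub> (y \<otimes>\<^bsub>?P\<^esub> z)"
        unfolding ops by (rule restrict_ext) (simp add: monoid.m_assoc[OF mo] mem[OF x] mem[OF y] mem[OF z])
    qed (unfold ops, rule res, simp add: cl)
    fix x y z assume x: "x \<in> carrier ?P" and y: "y \<in> carrier ?P" and z: "z \<in> carrier ?P"
    show "(x \<oplus>\<^bsub>?P\<^esub> y) \<otimes>\<^bsub>?P\<^esub> z = x \<otimes>\<^bsub>?P\<^esub> z \<oplus>\<^bsub>?P\<^esub> y \<otimes>\<^bsub>?P\<^esub> z"
      unfolding ops by (rule restrict_ext) (simp add: semiring.l_distr[OF sr] mem[OF x] mem[OF y] mem[OF z])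
    show "z \<otimes>\<^bsub>?P\<^esub> (x \<oplus>\<^bsub>?P\<^esub> y) = z \<otimes>\<^bsub>?P\<^esub> x \<oplus>\<^bsub>?P\<^esub> z \<otimes>\<^bsub>?P\<^esub> y"
      unfolding ops by (rule restrict_ext) (simp add: semiring.r_distr[OF sr] mem[OF x] mem[OF y] mem[OF z])
  qed
qed

lemma prod_ring_simps:
  "carrier (prod_ring I R) = (\<Pi>\<^sub>E i\<in>I. carrier (R i))"
  "i \<in> I \<Longrightarrow> (x \<otimes>\<^bsub>prod_ring I R\<^esub> y) i = x i \<otimes>\<^bsub>R i\<^esub> y i"
  "i \<in> I \<Longrightarrow> (x \<oplus>\<^bsub>prod_ring I R\<^esub> y) i = x i \<oplus>\<^bsub>R i\<^esub> y i"
  "i \<in> I \<Longrightarrow> \<one>\<^bsub>prod_ring I R\<^esub> i = \<one>\<^bsub>R i\<^esub>"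
  "i \<in> I \<Longrightarrow> \<zero>\<^bsub>prod_ring I R\<^esub> i = \<zero>\<^bsub>R i\<^esub>"
  by (simp_all add: prod_ring_def)

lemma prod_ring_eqI:
  "x \<in> carrier (prod_ring I R) \<Longrightarrow> y \<in> carrier (prod_ring I R) \<Longrightarrow> (\<And>i. i \<in> I \<Longrightarrow> x i = y i) \<Longrightarrow> x = y"
  unfolding prod_ring_def by (auto intro: PiE_ext)

lemma complete_filtered_ring_prod:
  assumes I: "finite I" "I \<noteq> {}" and R: "\<And>i. i \<in> I \<Longrightarrow> complete_filtered_ring (R i) (f i)"
  shows "complete_filtered_ring (prod_ring I R) (prod_filtration I f)"
proof (rule complete_filtered_ring_componentwise[OF _ I R])
  have rg: "ring (R i)" if "i \<in> I" for i
    using R[OF that] by (simp add: complete_filtered_ring_def)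
  then show "ring (prod_ring I R)" by (rule ring_prod_ring)
  show "prod_filtration I f = (\<lambda>x. Min ((\<lambda>p. f p (x p)) ` I))"
    by (simp add: prod_filtration_def fun_eq_iff)
  have "(\<lambda>i. f i (\<one>\<^bsub>prod_ring I R\<^esub> i)) ` I = {0}"
    using I complete_filtered_ring.v_one[OF R] by (auto simp: prod_ring_simps image_iff)
  then show "prod_filtration I f \<one>\<^bsub>prod_ring I R\<^esub> = 0" by (simp add: prod_filtration_def)
  fix x y assume xy: "x \<in> carrier (prod_ring I R)" "y \<in> carrier (prod_ring I R)"
  have "prod_filtration I f x + prod_filtration I f y \<le> f i ((x \<otimes>\<^bsub>prod_ring I R\<^esub> y) i)" if i: "i \<in> I" for i
  proof -
    have "prod_filtration I f x \<le> f i (x i)" "prod_filtration I f y \<le> f i (y i)"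
      unfolding prod_filtration_def using I i by auto
    then show ?thesis using complete_filtered_ring.v_mult_le[OF R[OF i], of "x i" "y i"] xy i
      by (auto simp: prod_ring_simps PiE_mem)
  qed
  then show "prod_filtration I f x + prod_filtration I f y \<le> prod_filtration I f (x \<otimes>\<^bsub>prod_ring I R\<^esub> y)"
    using ereal_le_MinI[OF I, of _ "\<lambda>i. f i ((x \<otimes>\<^bsub>prod_ring I R\<^esub> y) i)"]
    by (simp add: prod_filtration_def)
qed (simp_all add: prod_ring_simps)

section \<open>Matrix rings\<close>

context ring
begin

lemma psum_ldistr:
  "(\<And>i. i < n \<Longrightarrow> t i \<in> carrier R) \<Longrightarrow> c \<in> carrier R \<Longrightarrow> psum R t n \<otimes> c = psum R (\<lambda>i. t i \<otimes> c) n"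
  by (rule additive_psum[where h = "\<lambda>x. x \<otimes> c", OF abelian_group_axioms]) (auto simp: l_distr)

lemma psum_rdistr:
  "(\<And>i. i < n \<Longrightarrow> t i \<in> carrier R) \<Longrightarrow> c \<in> carrier R \<Longrightarrow> c \<otimes> psum R t n = psum R (\<lambda>i. c \<otimes> t i) n"
  by (rule additive_psum[where h = "\<lambda>x. c \<otimes> x", OF abelian_group_axioms]) (auto simp: r_distr)

abbreviation M where "M n \<equiv> mat_ring n R"

lemma mat_entry_closed: "A \<in> carrier (M n) \<Longrightarrow> i < n \<Longrightarrow> j < n \<Longrightarrow> A (i, j) \<in> carrier R"
  by (auto simp: mat_ring_def)

lemma mat_eqI:
  "A \<in> carrier (M n) \<Longrightarrow> B \<in> carrier (M n) \<Longrightarrow> (\<And>i j. i < n \<Longrightarrow> j < n \<Longrightarrow> A (i, j) = B (i, j)) \<Longrightarrow> A = B"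
  unfolding mat_ring_def by (rule PiE_ext) auto

lemma mat_closedI:
  "(\<And>i j. i < n \<Longrightarrow> j < n \<Longrightarrow> f (i, j) \<in> carrier R) \<Longrightarrow> (\<lambda>p\<in>{..<n} \<times> {..<n}. f p) \<in> carrier (M n)"
  by (auto simp: mat_ring_def)

lemma mat_mult:
  assumes "A \<in> carrier (M n)" "B \<in> carrier (M n)" "i < n" "j < n"
  shows "(A \<otimes>\<^bsub>M n\<^esub> B) (i, j) = psum R (\<lambda>k. A (i, k) \<otimes> B (k, j)) n"
proof -
  have "(A \<otimes>\<^bsub>M n\<^esub> B) (i, j) = (\<Oplus>k\<in>{..<n}. A (i, k) \<otimes> B (k, j))"
    using assms by (simp add: mat_ring_def)
  also have "\<dots> = psum R (\<lambda>k. A (i, k) \<otimes> B (k, j)) n"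
    by (rule finsum_lessThan_eq_psum) (use assms mat_entry_closed in auto)
  finally show ?thesis .
qed

lemma mat_mult_closed:
  assumes "A \<in> carrier (M n)" "B \<in> carrier (M n)"
  shows "A \<otimes>\<^bsub>M n\<^esub> B \<in> carrier (M n)"
proof -
  have "(A \<otimes>\<^bsub>M n\<^esub> B) (i, j) \<in> carrier R" if "i < n" "j < n" for i j
    unfolding mat_mult[OF assms that] by (rule psum_closed) (use assms that mat_entry_closed in auto)
  moreover have "A \<otimes>\<^bsub>M n\<^esub> B = (\<lambda>p\<in>{..<n} \<times> {..<n}. (A \<otimes>\<^bsub>M n\<^esub> B) p)"
    by (auto simp: mat_ring_def)
  ultimately show ?thesis using mat_closedI[of n "A \<otimes>\<^bsub>M n\<^esub> B"] by simp
qed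

lemma mat_add: "i < n \<Longrightarrow> j < n \<Longrightarrow> (A \<oplus>\<^bsub>M n\<^esub> B) (i, j) = A (i, j) \<oplus> B (i, j)"
  and mat_one: "i < n \<Longrightarrow> j < n \<Longrightarrow> \<one>\<^bsub>M n\<^esub> (i, j) = (if i = j then \<one> else \<zero>)"
  and mat_zero: "i < n \<Longrightarrow> j < n \<Longrightarrow> \<zero>\<^bsub>M n\<^esub> (i, j) = \<zero>"
  by (simp_all add: mat_ring_def)

lemma mat_add_closed:
  "A \<in> carrier (M n) \<Longrightarrow> B \<in> carrier (M n) \<Longrightarrow> A \<oplus>\<^bsub>M n\<^esub> B \<in> carrier (M n)"
  and mat_one_closed: "\<one>\<^bsub>M n\<^esub> \<in> carrier (M n)"
  and mat_zero_closed: "\<zero>\<^bsub>M n\<^esub> \<in> carrier (M n)"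
  by (auto simp: mat_ring_def PiE_mem)

lemma ring_mat_ring: "ring (M n)"
proof (rule ringI)
  note ec = mat_entry_closed
  note cl = mat_mult_closed mat_add_closed mat_one_closed mat_zero_closed
  show "abelian_group (M n)"
  proof (rule abelian_groupI)
    fix x assume x: "x \<in> carrier (M n)"
    let ?y = "\<lambda>p\<in>{..<n} \<times> {..<n}. \<ominus> x p"
    have y: "?y \<in> carrier (M n)" by (rule mat_closedI) (simp add: ec[OF x])
    show "\<exists>y\<in>carrier (M n). y \<oplus>\<^bsub>M n\<^esub> x = \<zero>\<^bsub>M n\<^esub>"
    proof (rule bexI[OF _ y], rule mat_eqI[where n = n])
      show "(?y \<oplus>\<^bsub>M n\<^esub> x) (i, j) = \<zero>\<^bsub>M n\<^esub> (i, j)" if "i < n" "j < n" for i j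
        using that by (simp add: mat_add mat_zero l_neg ec[OF x])
    qed (use cl x y in auto)
    show "\<zero>\<^bsub>M n\<^esub> \<oplus>\<^bsub>M n\<^esub> x = x"
      by (rule mat_eqI[where n = n]) (use cl x in \<open>auto simp: mat_add mat_zero ec[OF x]\<close>)
    fix y assume y: "y \<in> carrier (M n)"
    show "x \<oplus>\<^bsub>M n\<^esub> y = y \<oplus>\<^bsub>M n\<^esub> x"
      by (rule mat_eqI[where n = n]) (use cl x y in \<open>auto simp: mat_add ec[OF x] ec[OF y] a_comm\<close>)
    fix z assume z: "z \<in> carrier (M n)"
    show "x \<oplus>\<^bsub>M n\<^esub> y \<oplus>\<^bsub>M n\<^esub> z = x \<oplus>\<^bsub>M n\<^esub> (y \<oplus>\<^bsub>M n\<^esub> z)"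
      by (rule mat_eqI[where n = n]) (use cl x y z in \<open>auto simp: mat_add ec[OF x] ec[OF y] ec[OF z] a_assoc\<close>)
  qed (use cl in auto)
  show "monoid (M n)"
  proof (rule monoidI)
    fix x assume x: "x \<in> carrier (M n)"
    show "\<one>\<^bsub>M n\<^esub> \<otimes>\<^bsub>M n\<^esub> x = x"
    proof (rule mat_eqI[where n = n])
      fix i j assume ij: "i < n" "j < n"
      show "(\<one>\<^bsub>M n\<^esub> \<otimes>\<^bsub>M n\<^esub> x) (i, j) = x (i, j)"
        unfolding mat_mult[OF mat_one_closed x ij]
        by (rule psum_single[OF ij(1)]) (use ij x ec in \<open>auto simp: mat_one\<close>)
    qed (use cl x in auto)
    show "x \<otimes>\<^bsub>M n\<^esub> \<one>\<^bsub>M n\<^esub> = x"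
    proof (rule mat_eqI[where n = n])
      fix i j assume ij: "i < n" "j < n"
      show "(x \<otimes>\<^bsub>M n\<^esub> \<one>\<^bsub>M n\<^esub>) (i, j) = x (i, j)"
        unfolding mat_mult[OF x mat_one_closed ij]
        by (rule psum_single[OF ij(2)]) (use ij x ec in \<open>auto simp: mat_one\<close>)
    qed (use cl x in auto)
    fix y z assume y: "y \<in> carrier (M n)" and z: "z \<in> carrier (M n)"
    show "x \<otimes>\<^bsub>M n\<^esub> y \<otimes>\<^bsub>M n\<^esub> z = x \<otimes>\<^bsub>M n\<^esub> (y \<otimes>\<^bsub>M n\<^esub> z)"
    proof (rule mat_eqI[where n = n])
      fix i j assume ij: "i < n" "j < n"
      have "(x \<otimes>\<^bsub>M n\<^esub> y \<otimes>\<^bsub>M n\<^esub> z) (i, j)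
          = psum R (\<lambda>k. psum R (\<lambda>l. x (i, l) \<otimes> y (l, k)) n \<otimes> z (k, j)) n"
        unfolding mat_mult[OF mat_mult_closed[OF x y] z ij]
        by (rule psum_cong) (simp add: mat_mult[OF x y] ij)
      also have "\<dots> = psum R (\<lambda>k. psum R (\<lambda>l. x (i, l) \<otimes> y (l, k) \<otimes> z (k, j)) n) n"
        by (rule psum_cong, rule psum_ldistr) (use ij ec x y z in auto)
      also have "\<dots> = psum R (\<lambda>l. psum R (\<lambda>k. x (i, l) \<otimes> y (l, k) \<otimes> z (k, j)) n) n"
        by (rule psum_swap) (use ij ec x y z in auto)
      also have "\<dots> = psum R (\<lambda>l. psum R (\<lambda>k. x (i, l) \<otimes> (y (l, k) \<otimes> z (k, j))) n) n"
        by (rule psum_cong, rule psum_cong) (simp add: m_assoc ij ec[OF x] ec[OF y] ec[OF z])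
      also have "\<dots> = psum R (\<lambda>l. x (i, l) \<otimes> psum R (\<lambda>k. y (l, k) \<otimes> z (k, j)) n) n"
        by (rule psum_cong, rule psum_rdistr[symmetric]) (use ij ec x y z in auto)
      also have "\<dots> = (x \<otimes>\<^bsub>M n\<^esub> (y \<otimes>\<^bsub>M n\<^esub> z)) (i, j)"
        unfolding mat_mult[OF x mat_mult_closed[OF y z] ij]
        by (rule psum_cong) (simp add: mat_mult[OF y z] ij)
      finally show "(x \<otimes>\<^bsub>M n\<^esub> y \<otimes>\<^bsub>M n\<^esub> z) (i, j) = (x \<otimes>\<^bsub>M n\<^esub> (y \<otimes>\<^bsub>M n\<^esub> z)) (i, j)" .
    qed (use cl x y z in auto)
  qed (use cl in auto)
  fix x y z assume x: "x \<in> carrier (M n)" and y: "y \<in> carrier (M n)" and z: "z \<in> carrier (M n)"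
  show "(x \<oplus>\<^bsub>M n\<^esub> y) \<otimes>\<^bsub>M n\<^esub> z = x \<otimes>\<^bsub>M n\<^esub> z \<oplus>\<^bsub>M n\<^esub> y \<otimes>\<^bsub>M n\<^esub> z"
  proof (rule mat_eqI[where n = n])
    fix i j assume ij: "i < n" "j < n"
    have "((x \<oplus>\<^bsub>M n\<^esub> y) \<otimes>\<^bsub>M n\<^esub> z) (i, j) = psum R (\<lambda>k. x (i, k) \<otimes> z (k, j) \<oplus> y (i, k) \<otimes> z (k, j)) n"
      unfolding mat_mult[OF mat_add_closed[OF x y] z ij]
      by (rule psum_cong) (simp add: mat_add ij l_distr ec[OF x] ec[OF y] ec[OF z])
    also have "\<dots> = psum R (\<lambda>k. x (i, k) \<otimes> z (k, j)) n \<oplus> psum R (\<lambda>k. y (i, k) \<otimes> z (k, j)) n"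
      by (rule psum_add) (use ij ec x y z in auto)
    finally show "((x \<oplus>\<^bsub>M n\<^esub> y) \<otimes>\<^bsub>M n\<^esub> z) (i, j) = (x \<otimes>\<^bsub>M n\<^esub> z \<oplus>\<^bsub>M n\<^esub> y \<otimes>\<^bsub>M n\<^esub> z) (i, j)"
      by (simp add: mat_add ij mat_mult x y z)
  qed (use cl x y z in auto)
  show "z \<otimes>\<^bsub>M n\<^esub> (x \<oplus>\<^bsub>M n\<^esub> y) = z \<otimes>\<^bsub>M n\<^esub> x \<oplus>\<^bsub>M n\<^esub> z \<otimes>\<^bsub>M n\<^esub> y"
  proof (rule mat_eqI[where n = n])
    fix i j assume ij: "i < n" "j < n"
    have "(z \<otimes>\<^bsub>M n\<^esub> (x \<oplus>\<^bsub>M n\<^esub> y)) (i, j) = psum R (\<lambda>k. z (i, k) \<otimes> x (k, j) \<oplus> z (i, k) \<otimes> y (k, j)) n"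
      unfolding mat_mult[OF z mat_add_closed[OF x y] ij]
      by (rule psum_cong) (simp add: mat_add ij r_distr ec[OF x] ec[OF y] ec[OF z])
    also have "\<dots> = psum R (\<lambda>k. z (i, k) \<otimes> x (k, j)) n \<oplus> psum R (\<lambda>k. z (i, k) \<otimes> y (k, j)) n"
      by (rule psum_add) (use ij ec x y z in auto)
    finally show "(z \<otimes>\<^bsub>M n\<^esub> (x \<oplus>\<^bsub>M n\<^esub> y)) (i, j) = (z \<otimes>\<^bsub>M n\<^esub> x \<oplus>\<^bsub>M n\<^esub> z \<otimes>\<^bsub>M n\<^esub> y) (i, j)"
      by (simp add: mat_add ij mat_mult x y z)
  qed (use cl x y z in auto)
qed

end

lemma le_mat_filtration_iff:
  "n \<ge> 1 \<Longrightarrow> c \<le> mat_filtration n v A \<longleftrightarrow> (\<forall>i<n. \<forall>j<n. c \<le> v (A (i, j)))"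
  unfolding mat_filtration_def by (subst ereal_le_MinI) (auto simp: lessThan_empty_iff)

lemma complete_filtered_ring_mat:
  assumes "complete_filtered_ring R v" and n: "n \<ge> 1"
  shows "complete_filtered_ring (mat_ring n R) (mat_filtration n v)"
proof -
  interpret complete_filtered_ring R v by fact
  let ?J = "{..<n} \<times> {..<n}"
  show ?thesis
  proof (rule complete_filtered_ring_componentwise[where J = ?J and R = "\<lambda>_. R" and f = "\<lambda>_. v"])
    show "ring (mat_ring n R)" by (rule ring_mat_ring)
    show "?J \<noteq> {}" using n by (auto simp: lessThan_empty_iff)
    show "mat_filtration n v \<one>\<^bsub>mat_ring n R\<^esub> = 0"
    proof (rule antisym)
      have "mat_filtration n v \<one>\<^bsub>mat_ring n R\<^esub> \<le> v (\<one>\<^bsub>mat_ring n R\<^esub> (0, 0))"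
        using le_mat_filtration_iff[OF n, THEN iffD1, OF order_refl, rule_format, of 0 0] n by simp
      then show "mat_filtration n v \<one>\<^bsub>mat_ring n R\<^esub> \<le> 0" using n by (simp add: mat_one)
      show "0 \<le> mat_filtration n v \<one>\<^bsub>mat_ring n R\<^esub>"
        by (simp add: le_mat_filtration_iff[OF n] mat_one)
    qed
    fix x y assume xy: "x \<in> carrier (mat_ring n R)" "y \<in> carrier (mat_ring n R)"
    let ?c = "mat_filtration n v x + mat_filtration n v y"
    have "?c \<le> v ((x \<otimes>\<^bsub>mat_ring n R\<^esub> y) (i, j))" if ij: "i < n" "j < n" for i j
      unfolding mat_mult[OF xy ij]
    proof (rule v_psum_le)
      fix k assume k: "k < n"
      show "?c \<le> v (x (i, k) \<otimes>\<^bsub>R\<^esub> y (k, j))"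
        using le_mat_filtration_iff[OF n, THEN iffD1, OF order_refl, rule_format] xy mat_entry_closed ij k
        by (intro v_mult_le) auto
    qed (use xy mat_entry_closed ij in auto)
    then show "?c \<le> mat_filtration n v (x \<otimes>\<^bsub>mat_ring n R\<^esub> y)" by (simp add: le_mat_filtration_iff[OF n])
  qed (auto simp: mat_ring_def mat_filtration_def fun_eq_iff complete_filtered_ring_axioms)
qed

text \<open>This is how \<open>Q\<close> carries its filtration: values are read off after applying
  \<open>h\<close>, which is therefore filtered by construction.\<close>

lemma complete_filtered_ring_pullback:
  assumes "complete_filtered_ring M w" and Q: "ring Q" and h: "h \<in> ring_iso Q M"
  shows "complete_filtered_ring Q (\<lambda>q. w (h q))"
proof -
  interpret M: complete_filtered_ring M w by fact
  interpret Q: ring Q by fact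
  note hm = ring_iso_memE[OF h]
  note ag = Q.abelian_group_axioms M.abelian_group_axioms
  have h0: "h \<zero>\<^bsub>Q\<^esub> = \<zero>\<^bsub>M\<^esub>"
    by (rule additive_zero[where h = h, OF ag]) (use hm in auto)
  have hminus: "h (x \<ominus>\<^bsub>Q\<^esub> y) = h x \<ominus>\<^bsub>M\<^esub> h y" if "x \<in> carrier Q" "y \<in> carrier Q" for x y
    by (rule additive_minus[where h = h, OF ag]) (use hm that in auto)
  have inj: "h x = h y \<longleftrightarrow> x = y" if "x \<in> carrier Q" "y \<in> carrier Q" for x y
    using hm(5) that by (auto simp: bij_betw_def inj_on_def)
  show ?thesis
  proof
    show "filtration Q (\<lambda>q. w (h q))"
      unfolding filtration_def
    proof (intro conjI ballI)
      fix x assume x: "x \<in> carrier Q"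
      note hx = hm(1)[OF x]
      show "w (h x) = \<infinity> \<or> (\<exists>k::int. w (h x) = ereal (real_of_int k))" by (rule M.v_int[OF hx])
      show "w (h x) = \<infinity> \<longleftrightarrow> x = \<zero>\<^bsub>Q\<^esub>"
        using M.v_inf[OF hx] inj[OF x Q.zero_closed] h0 by simp
      fix y assume y: "y \<in> carrier Q"
      note hy = hm(1)[OF y]
      show "min (w (h x)) (w (h y)) \<le> w (h (x \<oplus>\<^bsub>Q\<^esub> y))"
        unfolding hm(3)[OF x y] by (rule M.v_add[OF hx hy])
      show "w (h x) + w (h y) \<le> w (h (x \<otimes>\<^bsub>Q\<^esub> y))"
        unfolding hm(2)[OF x y] by (rule M.v_mult[OF hx hy])
    qed (simp add: hm(4))
    fix x assume x: "x \<in> carrier Q"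
    have "h (\<zero>\<^bsub>Q\<^esub> \<ominus>\<^bsub>Q\<^esub> x) = h \<zero>\<^bsub>Q\<^esub> \<ominus>\<^bsub>M\<^esub> h x" by (rule hminus) (use x in auto)
    then have "h (\<ominus>\<^bsub>Q\<^esub> x) = \<ominus>\<^bsub>M\<^esub> h x" using x hm(1)[OF x] by (simp add: h0 a_minus_def)
    then show "w (h (\<ominus>\<^bsub>Q\<^esub> x)) = w (h x)" using M.v_neg[OF hm(1)[OF x]] by simp
  next
    fix s assume s: "\<And>n. s n \<in> carrier Q" and d: "\<And>n. ereal (real n) \<le> w (h (s (Suc n) \<ominus>\<^bsub>Q\<^esub> s n))"
    have "\<exists>l\<in>carrier M. \<forall>n. ereal (real n) \<le> w (h (s n) \<ominus>\<^bsub>M\<^esub> l)"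
      by (rule M.v_complete) (use hm(1) s d in \<open>auto simp: hminus[symmetric]\<close>)
    then obtain m where m: "m \<in> carrier M" "\<forall>n. ereal (real n) \<le> w (h (s n) \<ominus>\<^bsub>M\<^esub> m)" by blast
    have "m \<in> h ` carrier Q" using m(1) hm(5) by (simp add: bij_betw_def)
    then obtain l where "l \<in> carrier Q" "h l = m" by blast
    with m(2) show "\<exists>l\<in>carrier Q. \<forall>n. ereal (real n) \<le> w (h (s n \<ominus>\<^bsub>Q\<^esub> l))"
      using s by (intro bexI[of _ l]) (auto simp: hminus)
  qed
qed

text \<open>A value that is a natural number or infinite is determined by the natural thresholds
  below it. This recovers equality of filtrations from equality of chains.\<close>

lemma nat_valued_eqI:
  fixes a b :: ereal
  assumes "a = \<infinity> \<or> (\<exists>k::nat. a = ereal (real k))" "b = \<infinity> \<or> (\<exists>k::nat. b = ereal (real k))"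
    and le: "\<And>k::nat. ereal (real k) \<le> a \<longleftrightarrow> ereal (real k) \<le> b"
  shows "a = b"
proof -
  have *: "c \<le> d" if "c = \<infinity> \<or> (\<exists>k::nat. c = ereal (real k))" "\<And>k::nat. ereal (real k) \<le> c \<Longrightarrow> ereal (real k) \<le> d"
    for c d :: ereal
  proof (cases "c = \<infinity>")
    case True
    have "d = \<infinity>"
    proof (rule ereal_top)
      fix B :: real
      obtain k :: nat where "B \<le> real k" using real_arch_simple by blast
      then show "ereal B \<le> d" using that(2)[of k] True by (meson ereal_less_eq(1,3) order_trans)
    qed
    then show ?thesis by simp
  qed (use that in auto)
  show ?thesis using *[of a b] *[of b a] assms by (intro antisym) auto
qed

text \<open>Converse to \<open>chain_ring_nonneg\<close> for values in the natural numbers: the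
  filtration axioms are read off from the chain.\<close>

lemma complete_filtered_ring_of_chain:
  assumes "chain_ring T L" and one: "w \<one>\<^bsub>T\<^esub> = 0"
    and val: "\<And>x. x \<in> carrier T \<Longrightarrow> w x = \<infinity> \<or> (\<exists>k::nat. w x = ereal (real k))"
    and L: "\<And>x k. x \<in> L k \<longleftrightarrow> x \<in> carrier T \<and> ereal (real k) \<le> w x"
  shows "complete_filtered_ring T w"
proof -
  interpret chain_ring T L by fact
  have inf: "w x = \<infinity> \<longleftrightarrow> x = \<zero>\<^bsub>T\<^esub>" if "x \<in> carrier T" for x
  proof
    assume "w x = \<infinity>"
    then show "x = \<zero>\<^bsub>T\<^esub>" using that by (intro L_separated) (simp add: L)
  next
    assume "x = \<zero>\<^bsub>T\<^esub>"
    then have "ereal (real k) \<le> w x" for k using zero_L L by blast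
    then show "w x = \<infinity>" using nat_valued_eqI[OF val[OF that], of \<infinity>] by simp
  qed
  show ?thesis
  proof
    show "filtration T w"
      unfolding filtration_def
    proof (intro conjI ballI)
      fix x assume x: "x \<in> carrier T"
      show "w x = \<infinity> \<or> (\<exists>k::int. w x = ereal (real_of_int k))" using val[OF x] by (metis of_int_of_nat_eq)
      show "w x = \<infinity> \<longleftrightarrow> x = \<zero>\<^bsub>T\<^esub>" by (rule inf[OF x])
      fix y assume y: "y \<in> carrier T"
      show "min (w x) (w y) \<le> w (x \<oplus>\<^bsub>T\<^esub> y)"
      proof (cases "x = \<zero>\<^bsub>T\<^esub> \<or> y = \<zero>\<^bsub>T\<^esub>")
        case True
        then show ?thesis using x y by auto
      next
        case False
        then obtain i j :: nat where "w x = ereal (real i)" "w y = ereal (real j)"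
          using val inf x y by metis
        moreover have "x \<oplus>\<^bsub>T\<^esub> y \<in> L (min i j)"
          using x y calculation by (intro add_L) (auto simp: L)
        ultimately show ?thesis by (simp add: L min_def split: if_splits)
      qed
      show "w x + w y \<le> w (x \<otimes>\<^bsub>T\<^esub> y)"
      proof (cases "x = \<zero>\<^bsub>T\<^esub> \<or> y = \<zero>\<^bsub>T\<^esub>")
        case True
        then show ?thesis using x y inf[of "\<zero>\<^bsub>T\<^esub>"] by auto
      next
        case False
        then obtain i j :: nat where "w x = ereal (real i)" "w y = ereal (real j)"
          using val inf x y by metis
        moreover have "x \<otimes>\<^bsub>T\<^esub> y \<in> L (i + j)"
          using x y calculation by (intro mult_L) (auto simp: L)
        ultimately show ?thesis by (simp add: L)
      qed
    qed (rule one)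
    show "w (\<ominus>\<^bsub>T\<^esub> x) = w x" if "x \<in> carrier T" for x
    proof (rule nat_valued_eqI[OF val val])
      fix k
      show "ereal (real k) \<le> w (\<ominus>\<^bsub>T\<^esub> x) \<longleftrightarrow> ereal (real k) \<le> w x"
        using neg_L[of x k] neg_L[of "\<ominus>\<^bsub>T\<^esub> x" k] that by (auto simp: L)
    qed (use that in auto)
    fix s assume s: "\<And>n. s n \<in> carrier T" "\<And>n. ereal (real n) \<le> w (s (Suc n) \<ominus>\<^bsub>T\<^esub> s n)"
    have "\<exists>l\<in>carrier T. \<forall>n. s n \<ominus>\<^bsub>T\<^esub> l \<in> L n"
      by (rule L_complete) (use s in \<open>auto simp: L\<close>)
    then show "\<exists>l\<in>carrier T. \<forall>n. ereal (real n) \<le> w (s n \<ominus>\<^bsub>T\<^esub> l)" using L by blast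
  qed
qed

context skew_chain_ring
begin

text \<open>By well-ordering the infimum over infinitely many coefficients is attained or infinite,
  so it is a value that \<open>filtration\<close> admits.\<close>

lemma INF_nat_valued:
  fixes f :: "nat \<Rightarrow> ereal"
  assumes "\<And>i. f i = \<infinity> \<or> (\<exists>k::nat. f i = ereal (real k))"
  shows "(INF i. f i) = \<infinity> \<or> (\<exists>k::nat. (INF i. f i) = ereal (real k))"
proof (cases "\<exists>i. \<exists>k::nat. f i = ereal (real k)")
  case True
  define m where "m = (LEAST k::nat. \<exists>i. f i = ereal (real k))"
  have "\<exists>i. f i = ereal (real m)" unfolding m_def by (rule LeastI_ex) (use True in blast)
  then obtain i where i: "f i = ereal (real m)" by blast
  have "ereal (real m) \<le> f j" for j
  proof (cases "f j = \<infinity>")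
    case False
    then obtain k :: nat where k: "f j = ereal (real k)" using assms by blast
    then have "m \<le> k" unfolding m_def by (intro Least_le) blast
    then show ?thesis by (simp add: k)
  qed simp
  then have "(INF i. f i) = ereal (real m)"
    using i by (intro antisym INF_greatest) (metis INF_lower UNIV_I)
  then show ?thesis by blast
next
  case False
  then have "f i = \<infinity>" for i using assms by blast
  then show ?thesis by simp
qed

lemma complete_filtered_ring_S:
  assumes one: "v \<one> = 0"
    and val: "\<And>x. x \<in> carrier R \<Longrightarrow> v x = \<infinity> \<or> (\<exists>k::nat. v x = ereal (real k))"
  shows "complete_filtered_ring S (ps_filtration v)"
    and "s \<in> SL k \<longleftrightarrow> s \<in> carrier S \<and> ereal (real k) \<le> ps_filtration v s"
    and "s \<in> carrier S \<Longrightarrow> ps_filtration v s = \<infinity> \<or> (\<exists>k::nat. ps_filtration v s = ereal (real k))"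
proof -
  interpret S: chain_ring S SL by (rule chain_ring_S)
  have lev: "r \<in> SL k \<longleftrightarrow> r \<in> carrier S \<and> ereal (real k) \<le> ps_filtration v r" for r k
  proof (cases "r \<in> carrier S")
    case True
    then have rc: "r i \<in> carrier R" for i by (simp add: S_carrier)
    have "r i \<in> L (k - i) \<longleftrightarrow> ereal (real k) \<le> v (r i) + ereal (real i)" for i
      using val[OF rc[of i]] rc[of i] by (auto simp: L_iff)
    then show ?thesis using True by (simp add: SL_def ps_filtration_def le_INF_iff)
  qed (use S.L_carrier in blast)
  have vals: "ps_filtration v r = \<infinity> \<or> (\<exists>k::nat. ps_filtration v r = ereal (real k))" if "r \<in> carrier S" for r
    unfolding ps_filtration_def
  proof (rule INF_nat_valued)
    fix i
    have "r i \<in> carrier R" using that by (simp add: S_carrier)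
    from val[OF this] show "v (r i) + ereal (real i) = \<infinity> \<or> (\<exists>k::nat. v (r i) + ereal (real i) = ereal (real k))"
      by (metis of_nat_add plus_ereal.simps(1) plus_ereal.simps(2))
  qed
  have v0: "v \<zero> = \<infinity>"
    using nat_valued_eqI[OF val[OF zero_closed], of \<infinity>] zero_L L_iff by simp
  have "ps_filtration v \<one>\<^bsub>S\<^esub> = 0"
  proof (rule antisym)
    have "ps_filtration v \<one>\<^bsub>S\<^esub> \<le> v (\<one>\<^bsub>S\<^esub> 0) + ereal (real 0)"
      unfolding ps_filtration_def by (rule INF_lower) simp
    then show "ps_filtration v \<one>\<^bsub>S\<^esub> \<le> 0" using one by (simp add: S_one)
    show "0 \<le> ps_filtration v \<one>\<^bsub>S\<^esub>"
      unfolding ps_filtration_def by (rule INF_greatest) (simp add: S_one one v0)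
  qed
  then show "complete_filtered_ring S (ps_filtration v)"
    by (rule complete_filtered_ring_of_chain[OF chain_ring_S _ vals lev])
  show "s \<in> SL k \<longleftrightarrow> s \<in> carrier S \<and> ereal (real k) \<le> ps_filtration v s" by (rule lev)
  show "s \<in> carrier S \<Longrightarrow> ps_filtration v s = \<infinity> \<or> (\<exists>k::nat. ps_filtration v s = ereal (real k))"
    by (rule vals)
qed

end

section \<open>Systems of matrix units\<close>

context ring
begin

definition matrix_units :: "nat \<Rightarrow> (nat \<Rightarrow> nat \<Rightarrow> 'a) \<Rightarrow> bool" where
  "matrix_units n e \<longleftrightarrow> (\<forall>i<n. \<forall>j<n. e i j \<in> carrier R) \<and>
     (\<forall>i<n. \<forall>j<n. \<forall>k<n. \<forall>l<n. e i j \<otimes> e k l = (if j = k then e i l else \<zero>)) \<and>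
     psum R (\<lambda>i. e i i) n = \<one>"

lemma matrix_unitsD:
  assumes "matrix_units n e"
  shows "i < n \<Longrightarrow> j < n \<Longrightarrow> e i j \<in> carrier R"
    and "i < n \<Longrightarrow> j < n \<Longrightarrow> k < n \<Longrightarrow> l < n \<Longrightarrow> e i j \<otimes> e k l = (if j = k then e i l else \<zero>)"
    and "psum R (\<lambda>i. e i i) n = \<one>"
  using assms by (auto simp: matrix_units_def)

text \<open>Spreads an element \<open>u\<close> linking the corners \<open>e 0 0\<close> and
  \<open>f 0 0\<close> to one that links the whole systems; in the cases of interest it becomes a
  unit that conjugates \<open>f\<close> into \<open>e\<close>.\<close>

definition intertwiner :: "nat \<Rightarrow> (nat \<Rightarrow> nat \<Rightarrow> 'a) \<Rightarrow> 'a \<Rightarrow> (nat \<Rightarrow> nat \<Rightarrow> 'a) \<Rightarrow> 'a" where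
  "intertwiner n e u f = psum R (\<lambda>l. e l 0 \<otimes> u \<otimes> f 0 l) n"

lemma intertwiner_closed:
  assumes "matrix_units n e" "matrix_units n f" "u \<in> carrier R"
  shows "intertwiner n e u f \<in> carrier R"
  unfolding intertwiner_def using assms matrix_unitsD(1) by (intro psum_closed) auto

text \<open>In either product only the summand with the matching index survives, and both leave the
  same expression. Together they give \<open>e k l \<otimes> a = a \<otimes> f k l\<close> for the
  intertwiner \<open>a\<close>.\<close>

lemma intertwiner_mult:
  assumes e: "matrix_units n e" and f: "matrix_units n f" and u: "u \<in> carrier R"
    and kl: "k < n" "l < n"
  shows "intertwiner n e u f \<otimes> f k l = e k 0 \<otimes> u \<otimes> f 0 l"
    and "e k l \<otimes> intertwiner n e u f = e k 0 \<otimes> u \<otimes> f 0 l"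
proof -
  note E = matrix_unitsD[OF e] and F = matrix_unitsD[OF f]
  have n0: "0 < n" using kl by simp
  have c: "e m 0 \<otimes> u \<otimes> f 0 m \<in> carrier R" if "m < n" for m using that E F u n0 by simp
  have "intertwiner n e u f \<otimes> f k l = psum R (\<lambda>m. e m 0 \<otimes> u \<otimes> f 0 m \<otimes> f k l) n"
    unfolding intertwiner_def by (rule psum_ldistr) (use c F kl in auto)
  also have "\<dots> = e k 0 \<otimes> u \<otimes> f 0 l"
  proof (rule psum_single[OF kl(1)])
    have "e m 0 \<otimes> u \<otimes> f 0 m \<otimes> f k l = e m 0 \<otimes> u \<otimes> (f 0 m \<otimes> f k l)" if "m < n" for m
      using that E(1) F(1) u n0 kl by (simp add: m_assoc)
    then show "e k 0 \<otimes> u \<otimes> f 0 k \<otimes> f k l = e k 0 \<otimes> u \<otimes> f 0 l"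
      "\<And>m. m < n \<Longrightarrow> m \<noteq> k \<Longrightarrow> e m 0 \<otimes> u \<otimes> f 0 m \<otimes> f k l = \<zero>"
      using E(1) F(2) u n0 kl by auto
  qed (use E F u n0 kl in auto)
  finally show "intertwiner n e u f \<otimes> f k l = e k 0 \<otimes> u \<otimes> f 0 l" .
  have "e k l \<otimes> intertwiner n e u f = psum R (\<lambda>m. e k l \<otimes> (e m 0 \<otimes> u \<otimes> f 0 m)) n"
    unfolding intertwiner_def by (rule psum_rdistr) (use c E kl in auto)
  also have "\<dots> = e k 0 \<otimes> u \<otimes> f 0 l"
  proof (rule psum_single[OF kl(2)])
    have "e k l \<otimes> (e m 0 \<otimes> u \<otimes> f 0 m) = (e k l \<otimes> e m 0) \<otimes> u \<otimes> f 0 m" if "m < n" for m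
      using that E(1) F(1) u n0 kl by (simp add: m_assoc)
    then show "e k l \<otimes> (e l 0 \<otimes> u \<otimes> f 0 l) = e k 0 \<otimes> u \<otimes> f 0 l"
      "\<And>m. m < n \<Longrightarrow> m \<noteq> l \<Longrightarrow> e k l \<otimes> (e m 0 \<otimes> u \<otimes> f 0 m) = \<zero>"
      using E(2) F(1) u n0 kl by auto
  qed (use E F u n0 kl in auto)
  finally show "e k l \<otimes> intertwiner n e u f = e k 0 \<otimes> u \<otimes> f 0 l" .
qed

text \<open>The product reduces to the sum of the \<open>e_l0 u f_00 w e_0l = e_ll\<close>. Only one
  order of the factors is covered; the other order is the same lemma with the systems exchanged, and
  then requires \<open>w \<otimes> u = f 0 0\<close>.\<close>

lemma intertwiner_inverse:
  assumes e: "matrix_units n e" and f: "matrix_units n f" and n: "0 < n"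
    and u: "u \<in> carrier R" "u \<otimes> f 0 0 = u" and w: "w \<in> carrier R" and uw: "u \<otimes> w = e 0 0"
  shows "intertwiner n e u f \<otimes> intertwiner n f w e = \<one>"
proof -
  note E = matrix_unitsD[OF e] and F = matrix_unitsD[OF f]
  have b: "intertwiner n f w e \<in> carrier R" using intertwiner_closed[OF f e w] .
  have "intertwiner n e u f \<otimes> intertwiner n f w e
      = psum R (\<lambda>l. e l 0 \<otimes> u \<otimes> f 0 l \<otimes> intertwiner n f w e) n"
    unfolding intertwiner_def[of n e u f] by (rule psum_ldistr) (use E F u b n in auto)
  also have "\<dots> = psum R (\<lambda>l. e l l) n"
  proof (rule psum_cong)
    fix l assume l: "l < n"
    have "e l 0 \<otimes> u \<otimes> f 0 l \<otimes> intertwiner n f w e = e l 0 \<otimes> u \<otimes> (f 0 l \<otimes> intertwiner n f w e)"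
      using E(1) F(1) u(1) b n l by (simp add: m_assoc)
    also have "\<dots> = e l 0 \<otimes> u \<otimes> (f 0 0 \<otimes> w \<otimes> e 0 l)"
      using intertwiner_mult(2)[OF f e w n l] by simp
    also have "\<dots> = e l 0 \<otimes> ((u \<otimes> f 0 0) \<otimes> w) \<otimes> e 0 l"
      using E(1) F(1) u(1) w n l by (simp add: m_assoc)
    also have "\<dots> = e l l" unfolding u(2) uw using E(1,2) n l by simp
    finally show "e l 0 \<otimes> u \<otimes> f 0 l \<otimes> intertwiner n f w e = e l l" .
  qed
  finally show ?thesis using E(3) by simp
qed

text \<open>Over a local ring a single index \<open>k\<close> with a unit in the corner entry of
  \<open>f k k\<close> would do, with \<open>u = e_00 f_k0\<close> and
  \<open>w = f_0k e_00 d\<close>. Over a product of local rings \<open>k\<close> varies with the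
  component; the orthogonal central idempotents \<open>C k\<close> mark the components in which
  \<open>k\<close> is used.\<close>

lemma matrix_units_partial_equivalence:
  assumes e: "matrix_units n e" and f: "matrix_units n f" and n: "0 < n"
    and C: "\<And>k. k < n \<Longrightarrow> C k \<in> carrier R"
    and central: "\<And>k x. k < n \<Longrightarrow> x \<in> carrier R \<Longrightarrow> C k \<otimes> x = x \<otimes> C k"
    and orth: "\<And>k l. k < n \<Longrightarrow> l < n \<Longrightarrow> C k \<otimes> C l = (if k = l then C k else \<zero>)"
    and d: "d \<in> carrier R" "d \<otimes> e 0 0 = e 0 0 \<otimes> d"
    and sum: "psum R (\<lambda>k. C k \<otimes> (e 0 0 \<otimes> f k k \<otimes> e 0 0)) n \<otimes> d = e 0 0"
  defines "u \<equiv> psum R (\<lambda>k. C k \<otimes> (e 0 0 \<otimes> f k 0)) n"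
    and "w \<equiv> psum R (\<lambda>k. f 0 k \<otimes> e 0 0 \<otimes> C k) n \<otimes> d"
  shows "u \<in> carrier R" "w \<in> carrier R" "e 0 0 \<otimes> u = u" "u \<otimes> f 0 0 = u" "f 0 0 \<otimes> w = w" "w \<otimes> e 0 0 = w"
    and "u \<otimes> w = e 0 0"
proof -
  note E = matrix_unitsD[OF e] and F = matrix_unitsD[OF f]
  let ?s = "psum R (\<lambda>k. f 0 k \<otimes> e 0 0 \<otimes> C k) n"
  have uc: "C k \<otimes> (e 0 0 \<otimes> f k 0) \<in> carrier R" and sc: "f 0 k \<otimes> e 0 0 \<otimes> C k \<in> carrier R" if "k < n" for k
    using that C E F n by auto
  have s: "?s \<in> carrier R" using sc by (intro psum_closed)
  show u: "u \<in> carrier R" unfolding u_def using uc by (intro psum_closed)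
  show w: "w \<in> carrier R" unfolding w_def using s d by simp
  have "e 0 0 \<otimes> (C k \<otimes> (e 0 0 \<otimes> f k 0)) = C k \<otimes> (e 0 0 \<otimes> f k 0)" if k: "k < n" for k
  proof -
    have "e 0 0 \<otimes> (C k \<otimes> (e 0 0 \<otimes> f k 0)) = (e 0 0 \<otimes> C k) \<otimes> (e 0 0 \<otimes> f k 0)"
      using C E(1) F(1) n k by (simp add: m_assoc)
    also have "\<dots> = C k \<otimes> ((e 0 0 \<otimes> e 0 0) \<otimes> f k 0)"
      unfolding central[OF k E(1)[OF n n], symmetric] using C E(1) F(1) n k by (simp add: m_assoc)
    finally show ?thesis using E(2)[OF n n n n] by simp
  qed
  then show "e 0 0 \<otimes> u = u"
    unfolding u_def using E(1) n uc by (subst psum_rdistr) (auto intro!: psum_cong)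
  have "C k \<otimes> (e 0 0 \<otimes> f k 0) \<otimes> f 0 0 = C k \<otimes> (e 0 0 \<otimes> f k 0)" if k: "k < n" for k
    using C E(1) F(1) n k F(2)[OF k n n n] by (simp add: m_assoc)
  then show "u \<otimes> f 0 0 = u"
    unfolding u_def using F(1) n uc by (subst psum_ldistr) (auto intro!: psum_cong)
  have fs: "f k 0 \<otimes> ?s = psum R (\<lambda>l. f k l \<otimes> e 0 0 \<otimes> C l) n" if k: "k < n" for k
  proof -
    have "f k 0 \<otimes> (f 0 l \<otimes> e 0 0 \<otimes> C l) = f k l \<otimes> e 0 0 \<otimes> C l" if l: "l < n" for l
      using C E(1) F(1) n k l F(2)[OF k n n l] by (simp add: m_assoc[symmetric])
    then show ?thesis using F(1) n k sc by (subst psum_rdistr) (auto intro!: psum_cong)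
  qed
  show "f 0 0 \<otimes> w = w"
    unfolding w_def using fs[OF n] s d F(1) n by (simp add: m_assoc[symmetric])
  have "w \<otimes> e 0 0 = (?s \<otimes> e 0 0) \<otimes> d" unfolding w_def using s d E(1) n by (simp add: m_assoc)
  also have "?s \<otimes> e 0 0 = ?s"
  proof -
    have "f 0 k \<otimes> e 0 0 \<otimes> C k \<otimes> e 0 0 = f 0 k \<otimes> e 0 0 \<otimes> C k" if k: "k < n" for k
    proof -
      have "f 0 k \<otimes> e 0 0 \<otimes> C k \<otimes> e 0 0 = f 0 k \<otimes> e 0 0 \<otimes> (C k \<otimes> e 0 0)"
        using C E(1) F(1) n k by (simp add: m_assoc)
      also have "\<dots> = f 0 k \<otimes> (e 0 0 \<otimes> e 0 0) \<otimes> C k"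
        unfolding central[OF k E(1)[OF n n]] using C E(1) F(1) n k by (simp add: m_assoc)
      finally show ?thesis using E(2)[OF n n n n] by simp
    qed
    then show ?thesis using E(1) n sc by (subst psum_ldistr) (auto intro!: psum_cong)
  qed
  finally show "w \<otimes> e 0 0 = w" by (simp add: w_def)
  have "u \<otimes> w = (u \<otimes> ?s) \<otimes> d" unfolding w_def using u s d by (simp add: m_assoc)
  also have "u \<otimes> ?s = psum R (\<lambda>k. C k \<otimes> (e 0 0 \<otimes> f k 0) \<otimes> ?s) n"
    unfolding u_def by (rule psum_ldistr) (use uc s in auto)
  also have "\<dots> = psum R (\<lambda>k. C k \<otimes> (e 0 0 \<otimes> f k k \<otimes> e 0 0)) n"
  proof (rule psum_cong)
    fix k assume k: "k < n"
    have Ce: "C k \<otimes> e 0 0 \<in> carrier R" using C E(1) n k by simp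
    have "C k \<otimes> (e 0 0 \<otimes> f k 0) \<otimes> ?s = (C k \<otimes> e 0 0) \<otimes> (f k 0 \<otimes> ?s)"
      using C E(1) F(1) n k s by (simp add: m_assoc)
    also have "\<dots> = psum R (\<lambda>l. (C k \<otimes> e 0 0) \<otimes> (f k l \<otimes> e 0 0 \<otimes> C l)) n"
      unfolding fs[OF k] by (rule psum_rdistr) (use C E F n k Ce in auto)
    also have "\<dots> = C k \<otimes> (e 0 0 \<otimes> f k k \<otimes> e 0 0)"
    proof (rule psum_single[OF k])
      \<comment> \<open>Centrality collects the idempotents in front, where
        \<open>C k \<otimes> C l\<close> removes the mixed terms.\<close>
      have *: "(C k \<otimes> e 0 0) \<otimes> (f k l \<otimes> e 0 0 \<otimes> C l) = (C k \<otimes> C l) \<otimes> (e 0 0 \<otimes> f k l \<otimes> e 0 0)"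
        if l: "l < n" for l
      proof -
        have x: "e 0 0 \<otimes> f k l \<otimes> e 0 0 \<in> carrier R" using E(1) F(1) n k l by simp
        have "(C k \<otimes> e 0 0) \<otimes> (f k l \<otimes> e 0 0 \<otimes> C l) = C k \<otimes> ((e 0 0 \<otimes> f k l \<otimes> e 0 0) \<otimes> C l)"
          using C E(1) F(1) n k l by (simp add: m_assoc)
        also have "\<dots> = C k \<otimes> (C l \<otimes> (e 0 0 \<otimes> f k l \<otimes> e 0 0))" unfolding central[OF l x] ..
        finally show ?thesis using C k l x by (simp add: m_assoc)
      qed
      show "(C k \<otimes> e 0 0) \<otimes> (f k k \<otimes> e 0 0 \<otimes> C k) = C k \<otimes> (e 0 0 \<otimes> f k k \<otimes> e 0 0)"
        unfolding *[OF k] orth[OF k k] by simp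
      show "(C k \<otimes> e 0 0) \<otimes> (f k l \<otimes> e 0 0 \<otimes> C l) = \<zero>" if "l < n" "l \<noteq> k" for l
        unfolding *[OF that(1)] orth[OF k that(1)] using that E(1) F(1) n k by simp
    qed (use C E F n k in auto)
    finally show "C k \<otimes> (e 0 0 \<otimes> f k 0) \<otimes> ?s = C k \<otimes> (e 0 0 \<otimes> f k k \<otimes> e 0 0)" .
  qed
  finally show "u \<otimes> w = e 0 0" unfolding sum .
qed

end

section \<open>Standard matrix units and entrywise maps\<close>

context ring
begin

definition elem_mat :: "nat \<Rightarrow> nat \<Rightarrow> nat \<Rightarrow> nat \<times> nat \<Rightarrow> 'a" where
  "elem_mat n i j = (\<lambda>p\<in>{..<n} \<times> {..<n}. if p = (i, j) then \<one> else \<zero>)"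

abbreviation sc where "sc n c \<equiv> scalar_mat n R c"

lemma elem_mat_closed: "elem_mat n i j \<in> carrier (M n)"
  unfolding elem_mat_def by (rule mat_closedI) simp

lemma elem_mat_entry:
  "k < n \<Longrightarrow> l < n \<Longrightarrow> elem_mat n i j (k, l) = (if k = i \<and> l = j then \<one> else \<zero>)"
  by (simp add: elem_mat_def)

lemma sc_closed: "c \<in> carrier R \<Longrightarrow> sc n c \<in> carrier (M n)"
  by (auto simp: scalar_mat_def mat_ring_def)

lemma sc_entry: "k < n \<Longrightarrow> l < n \<Longrightarrow> sc n c (k, l) = (if k = l then c else \<zero>)"
  by (simp add: scalar_mat_def)

lemma elem_mat_mult:
  assumes "A \<in> carrier (M n)" "i < n" "j < n" "k < n" "l < n"
  shows "(elem_mat n i j \<otimes>\<^bsub>M n\<^esub> A) (k, l) = (if k = i then A (j, l) else \<zero>)"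
    and "(A \<otimes>\<^bsub>M n\<^esub> elem_mat n i j) (k, l) = (if l = j then A (k, i) else \<zero>)"
proof -
  note ec = mat_entry_closed[OF assms(1)]
  have "psum R (\<lambda>m. elem_mat n i j (k, m) \<otimes> A (m, l)) n = (if k = i then A (j, l) else \<zero>)"
    by (rule psum_single[OF assms(3)]) (use assms ec in \<open>auto simp: elem_mat_entry\<close>)
  then show "(elem_mat n i j \<otimes>\<^bsub>M n\<^esub> A) (k, l) = (if k = i then A (j, l) else \<zero>)"
    using mat_mult[OF elem_mat_closed assms(1,4,5)] by simp
  have "psum R (\<lambda>m. A (k, m) \<otimes> elem_mat n i j (m, l)) n = (if l = j then A (k, i) else \<zero>)"
    by (rule psum_single[OF assms(2)]) (use assms ec in \<open>auto simp: elem_mat_entry\<close>)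
  then show "(A \<otimes>\<^bsub>M n\<^esub> elem_mat n i j) (k, l) = (if l = j then A (k, i) else \<zero>)"
    using mat_mult[OF assms(1) elem_mat_closed assms(4,5)] by simp
qed

lemma sc_mult:
  assumes "A \<in> carrier (M n)" "c \<in> carrier R" "k < n" "l < n"
  shows "(sc n c \<otimes>\<^bsub>M n\<^esub> A) (k, l) = c \<otimes> A (k, l)"
    and "(A \<otimes>\<^bsub>M n\<^esub> sc n c) (k, l) = A (k, l) \<otimes> c"
proof -
  note ec = mat_entry_closed[OF assms(1)]
  have "psum R (\<lambda>m. sc n c (k, m) \<otimes> A (m, l)) n = c \<otimes> A (k, l)"
    by (rule psum_single[OF assms(3)]) (use assms ec in \<open>auto simp: sc_entry\<close>)
  then show "(sc n c \<otimes>\<^bsub>M n\<^esub> A) (k, l) = c \<otimes> A (k, l)"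
    using mat_mult[OF sc_closed[OF assms(2)] assms(1,3,4)] by simp
  have "psum R (\<lambda>m. A (k, m) \<otimes> sc n c (m, l)) n = A (k, l) \<otimes> c"
    by (rule psum_single[OF assms(4)]) (use assms ec in \<open>auto simp: sc_entry\<close>)
  then show "(A \<otimes>\<^bsub>M n\<^esub> sc n c) (k, l) = A (k, l) \<otimes> c"
    using mat_mult[OF assms(1) sc_closed[OF assms(2)] assms(3,4)] by simp
qed

lemma mat_psum: "i < n \<Longrightarrow> j < n \<Longrightarrow> psum (M n) t m (i, j) = psum R (\<lambda>k. t k (i, j)) m"
  by (induction m) (auto simp: mat_zero mat_add)

lemma matrix_units_elem_mat: "ring.matrix_units (M n) n (elem_mat n)"
proof -
  interpret T: ring "M n" by (rule ring_mat_ring)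
  show ?thesis
    unfolding T.matrix_units_def
  proof (intro conjI allI impI elem_mat_closed)
    fix i j k l assume ijkl: "i < n" "j < n" "k < n" "l < n"
    show "elem_mat n i j \<otimes>\<^bsub>M n\<^esub> elem_mat n k l = (if j = k then elem_mat n i l else \<zero>\<^bsub>M n\<^esub>)"
      by (rule mat_eqI[where n = n])
        (use ijkl in \<open>auto simp: elem_mat_mult elem_mat_closed elem_mat_entry mat_zero\<close>)
  next
    show "psum (M n) (\<lambda>i. elem_mat n i i) n = \<one>\<^bsub>M n\<^esub>"
    proof (rule mat_eqI[where n = n])
      fix i j assume ij: "i < n" "j < n"
      show "psum (M n) (\<lambda>i. elem_mat n i i) n (i, j) = \<one>\<^bsub>M n\<^esub> (i, j)"
        unfolding mat_psum[OF ij]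
        by (rule psum_single[OF ij(1)]) (use ij in \<open>auto simp: elem_mat_entry mat_one\<close>)
    qed (auto intro: elem_mat_closed)
  qed
qed

text \<open>Moves an arbitrary entry to the corner, which reduces statements about entries to
  statements about scalar matrices.\<close>

lemma elem_mat_sandwich:
  assumes "A \<in> carrier (M n)" "k < n" "l < n" "0 < n"
  shows "elem_mat n 0 k \<otimes>\<^bsub>M n\<^esub> A \<otimes>\<^bsub>M n\<^esub> elem_mat n l 0 = sc n (A (k, l)) \<otimes>\<^bsub>M n\<^esub> elem_mat n 0 0"
proof -
  interpret T: ring "M n" by (rule ring_mat_ring)
  have c: "A (k, l) \<in> carrier R" using mat_entry_closed assms by simp
  show ?thesis
    by (rule mat_eqI[where n = n])
      (use assms c in \<open>auto simp: elem_mat_mult sc_mult elem_mat_closed sc_closed elem_mat_entry sc_entry\<close>)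
qed

text \<open>Commutation with matrix units moves the entry \<open>(k, l)\<close> to the corner both
  before and after \<open>h\<close>, where \<open>h\<close> only sees the scalar matrix of that
  entry.\<close>

lemma entrywise_of_commuting:
  assumes h: "\<And>A. A \<in> carrier (M n) \<Longrightarrow> h A \<in> carrier (M n)"
    and hl: "\<And>A i j. A \<in> carrier (M n) \<Longrightarrow> i < n \<Longrightarrow> j < n \<Longrightarrow>
      h (elem_mat n i j \<otimes>\<^bsub>M n\<^esub> A) = elem_mat n i j \<otimes>\<^bsub>M n\<^esub> h A"
    and hr: "\<And>A i j. A \<in> carrier (M n) \<Longrightarrow> i < n \<Longrightarrow> j < n \<Longrightarrow>
      h (A \<otimes>\<^bsub>M n\<^esub> elem_mat n i j) = h A \<otimes>\<^bsub>M n\<^esub> elem_mat n i j"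
    and A: "A \<in> carrier (M n)" and kl: "k < n" "l < n"
  shows "h A (k, l) = h (sc n (A (k, l))) (0, 0)"
proof -
  interpret T: ring "M n" by (rule ring_mat_ring)
  have n: "0 < n" using kl by simp
  have c: "A (k, l) \<in> carrier R" using mat_entry_closed A kl by simp
  have "h (elem_mat n 0 k \<otimes>\<^bsub>M n\<^esub> A \<otimes>\<^bsub>M n\<^esub> elem_mat n l 0) = elem_mat n 0 k \<otimes>\<^bsub>M n\<^esub> h A \<otimes>\<^bsub>M n\<^esub> elem_mat n l 0"
    using hr[of "elem_mat n 0 k \<otimes>\<^bsub>M n\<^esub> A" l 0] hl[OF A n kl(1)] A kl n by (simp add: elem_mat_closed)
  then have "h (sc n (A (k, l)) \<otimes>\<^bsub>M n\<^esub> elem_mat n 0 0) = sc n (h A (k, l)) \<otimes>\<^bsub>M n\<^esub> elem_mat n 0 0"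
    unfolding elem_mat_sandwich[OF A kl n] elem_mat_sandwich[OF h[OF A] kl n] .
  then have "h (sc n (A (k, l))) \<otimes>\<^bsub>M n\<^esub> elem_mat n 0 0 = sc n (h A (k, l)) \<otimes>\<^bsub>M n\<^esub> elem_mat n 0 0"
    using hr[OF sc_closed[OF c] n n] by simp
  then have "(h (sc n (A (k, l))) \<otimes>\<^bsub>M n\<^esub> elem_mat n 0 0) (0, 0) = (sc n (h A (k, l)) \<otimes>\<^bsub>M n\<^esub> elem_mat n 0 0) (0, 0)"
    by simp
  then show ?thesis
    using n kl A c h mat_entry_closed[OF h[OF A] kl]
    by (simp add: elem_mat_mult sc_closed sc_entry)
qed

end

text \<open>Where each component is local, the \<open>(0,0)\<close> entries \<open>x\<^sub>k\<close> of \<open>\<sigma>(E\<^sub>k\<^sub>k)\<close>, which sum to \<open>1\<close>, combine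
  to a unit with the help of central idempotents \<open>c\<^sub>k\<close>; this yields \<open>u\<close>, \<open>w\<close> with \<open>u w = E\<^sub>0\<^sub>0\<close>. Now \<open>w u\<close> is
  the image of an idempotent multiple \<open>g E\<^sub>0\<^sub>0\<close>; as \<open>g\<close> is central, so is \<open>\<sigma>(g)\<close>, and \<open>u w = E\<^sub>0\<^sub>0\<close> forces
  \<open>\<sigma>(g) = 1\<close>, whence \<open>w u = \<sigma>(E\<^sub>0\<^sub>0)\<close>.\<close>

lemma (in complete_filtered_ring) matrix_units_conjugate:
  fixes \<sigma> :: "(nat \<times> nat \<Rightarrow> 'a) \<Rightarrow> nat \<times> nat \<Rightarrow> 'a"
  assumes n: "1 \<le> n"
    and sig: "\<sigma> \<in> ring_iso (M n) (M n)"
    and wsig: "\<And>A. A \<in> carrier (M n) \<Longrightarrow> mat_filtration n v (\<sigma> A) = mat_filtration n v A"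
    and local: "\<And>x. (\<And>k. k < n \<Longrightarrow> x k \<in> nonneg) \<Longrightarrow> psum R x n = \<one> \<Longrightarrow>
      \<exists>c d. (\<forall>k<n. c k \<in> nonneg \<and> (\<forall>y\<in>carrier R. c k \<otimes> y = y \<otimes> c k)) \<and>
        (\<forall>k<n. \<forall>l<n. c k \<otimes> c l = (if k = l then c k else \<zero>)) \<and>
        d \<in> nonneg \<and> psum R (\<lambda>k. c k \<otimes> x k) n \<otimes> d = \<one>"
    and idem: "\<And>g y. g \<in> nonneg \<Longrightarrow> g \<otimes> g = g \<Longrightarrow> y \<in> carrier R \<Longrightarrow> g \<otimes> y = y \<otimes> g"
  obtains a b where "a \<in> carrier (M n)" "b \<in> carrier (M n)"
    "0 \<le> mat_filtration n v a" "0 \<le> mat_filtration n v b"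
    "a \<otimes>\<^bsub>M n\<^esub> b = \<one>\<^bsub>M n\<^esub>" "b \<otimes>\<^bsub>M n\<^esub> a = \<one>\<^bsub>M n\<^esub>"
    "\<And>k l. k < n \<Longrightarrow> l < n \<Longrightarrow> a \<otimes>\<^bsub>M n\<^esub> \<sigma> (elem_mat n k l) \<otimes>\<^bsub>M n\<^esub> b = elem_mat n k l"
proof -
  let ?w = "mat_filtration n v"
  define T where "T = M n"
  interpret T: complete_filtered_ring T ?w
    unfolding T_def by (rule complete_filtered_ring_mat[OF complete_filtered_ring_axioms n])
  have n0: "0 < n" using n by simp
  define e where "e = elem_mat n"
  define f where "f k l = \<sigma> (e k l)" for k l
  note s = ring_iso_memE[OF sig, folded T_def]
  have s0: "\<sigma> \<zero>\<^bsub>T\<^esub> = \<zero>\<^bsub>T\<^esub>"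
    by (rule additive_zero[where h = \<sigma>, OF T.abelian_group_axioms T.abelian_group_axioms]) (use s in auto)
  have inj: "x = y" if "x \<in> carrier T" "y \<in> carrier T" "\<sigma> x = \<sigma> y" for x y
    using s(5) that by (auto simp: bij_betw_def inj_on_def)
  have surj: "\<exists>x. x \<in> carrier T \<and> \<sigma> x = y" if "y \<in> carrier T" for y
  proof -
    have "y \<in> \<sigma> ` carrier T" using s(5) that by (simp add: bij_betw_def)
    then show ?thesis by auto
  qed
  have ec: "e k l \<in> carrier T" for k l unfolding e_def T_def by (rule elem_mat_closed)
  have eu: "T.matrix_units n e" unfolding e_def T_def by (rule matrix_units_elem_mat)
  note E = T.matrix_unitsD[OF eu]
  have fu: "T.matrix_units n f"
    unfolding T.matrix_units_def
  proof (intro conjI allI impI)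
    show "f i j \<in> carrier T" for i j unfolding f_def using s(1) ec .
    show "f i j \<otimes>\<^bsub>T\<^esub> f k l = (if j = k then f i l else \<zero>\<^bsub>T\<^esub>)" if "i < n" "j < n" "k < n" "l < n" for i j k l
      unfolding f_def s(2)[OF ec ec, symmetric] E(2)[OF that] using s0 by simp
    have "\<sigma> (psum T (\<lambda>i. e i i) n) = psum T (\<lambda>i. \<sigma> (e i i)) n"
      by (rule additive_psum[where h = \<sigma>, OF T.abelian_group_axioms s0]) (use s ec in auto)
    then show "psum T (\<lambda>i. f i i) n = \<one>\<^bsub>T\<^esub>" unfolding f_def E(3) s(4) by simp
  qed
  note Fm = T.matrix_unitsD[OF fu]
  have fc: "f k l \<in> carrier T" for k l unfolding f_def using s(1) ec .
  have le: "c \<le> ?w A \<longleftrightarrow> (\<forall>i<n. \<forall>j<n. c \<le> v (A (i, j)))" for c A by (rule le_mat_filtration_iff[OF n])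
  have we: "0 \<le> ?w (e k l)" for k l unfolding le e_def by (simp add: elem_mat_entry)
  have wf: "0 \<le> ?w (f k l)" for k l unfolding f_def using wsig[folded T_def, OF ec] we by simp
  have ent: "A (i, j) \<in> carrier R" if "A \<in> carrier T" "i < n" "j < n" for A i j
    using mat_entry_closed that unfolding T_def by blast
  have entn: "A (i, j) \<in> nonneg" if "A \<in> carrier T" "0 \<le> ?w A" "i < n" "j < n" for A i j
    using ent[OF that(1,3,4)] that(2-4) unfolding le nonneg_def by simp
  define x where "x k = f k k (0, 0)" for k
  have xn: "x k \<in> nonneg" for k unfolding x_def by (rule entn[OF fc wf n0 n0])
  have "psum R x n = psum T (\<lambda>k. f k k) n (0, 0)"
    unfolding T_def mat_psum[OF n0 n0] x_def ..
  then have "psum R x n = \<one>" unfolding Fm(3) unfolding T_def using mat_one[OF n0 n0] by simp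
  then obtain c d where c: "\<And>k. k < n \<Longrightarrow> c k \<in> nonneg" "\<And>k y. k < n \<Longrightarrow> y \<in> carrier R \<Longrightarrow> c k \<otimes> y = y \<otimes> c k"
    "\<And>k l. k < n \<Longrightarrow> l < n \<Longrightarrow> c k \<otimes> c l = (if k = l then c k else \<zero>)"
    and d: "d \<in> nonneg" "psum R (\<lambda>k. c k \<otimes> x k) n \<otimes> d = \<one>"
    using local[of x, OF xn] by blast
  have cc: "c k \<in> carrier R" if "k < n" for k using c(1)[OF that] by (simp add: nonneg_def)
  have dc: "d \<in> carrier R" using d(1) by (simp add: nonneg_def)
  have scc: "sc n y \<in> carrier T" if "y \<in> carrier R" for y using sc_closed[OF that] unfolding T_def .
  have wsc: "0 \<le> ?w (sc n y)" if "y \<in> nonneg" for y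
    using that unfolding le by (simp add: sc_entry nonneg_def)
  note eqI = mat_eqI[where n = n, folded T_def]
  note sm = sc_mult[where n = n, folded T_def]
  note em = elem_mat_mult[where n = n, folded T_def e_def]
  have central: "sc n y \<otimes>\<^bsub>T\<^esub> A = A \<otimes>\<^bsub>T\<^esub> sc n y"
    if "y \<in> carrier R" "\<And>z. z \<in> carrier R \<Longrightarrow> y \<otimes> z = z \<otimes> y" "A \<in> carrier T" for y A
    by (rule eqI) (use that ent scc in \<open>auto simp: sm\<close>)
  \<comment> \<open>A scalar matrix commutes with \<open>e 0 0\<close> whether or not its entry is
    central; this will be applied to \<open>d\<close>.\<close>
  have sce: "sc n y \<otimes>\<^bsub>T\<^esub> e 0 0 = e 0 0 \<otimes>\<^bsub>T\<^esub> sc n y" if "y \<in> carrier R" for y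
    by (rule eqI) (use that scc ec in \<open>auto simp: sm e_def elem_mat_entry\<close>)
  have orth: "sc n (c k) \<otimes>\<^bsub>T\<^esub> sc n (c l) = (if k = l then sc n (c k) else \<zero>\<^bsub>T\<^esub>)" if kl: "k < n" "l < n" for k l
  proof (rule eqI)
    fix i j assume ij: "i < n" "j < n"
    have "(sc n (c k) \<otimes>\<^bsub>T\<^esub> sc n (c l)) (i, j) = (if i = j then c k \<otimes> c l else \<zero>)"
      using ij cc kl scc by (simp add: sm sc_entry)
    then show "(sc n (c k) \<otimes>\<^bsub>T\<^esub> sc n (c l)) (i, j) = (if k = l then sc n (c k) else \<zero>\<^bsub>T\<^esub>) (i, j)"
      unfolding c(3)[OF kl] unfolding T_def using ij by (simp add: sc_entry mat_zero)
  qed (use scc cc kl in auto)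
  \<comment> \<open>Enclosing \<open>f k k\<close> between two copies of \<open>e 0 0\<close> leaves
    only its corner entry \<open>x k\<close>, so the claim is the choice of \<open>c\<close> and
    \<open>d\<close> written in position \<open>(0, 0)\<close>.\<close>
  have sum: "psum T (\<lambda>k. sc n (c k) \<otimes>\<^bsub>T\<^esub> (e 0 0 \<otimes>\<^bsub>T\<^esub> f k k \<otimes>\<^bsub>T\<^esub> e 0 0)) n \<otimes>\<^bsub>T\<^esub> sc n d = e 0 0"
  proof (rule eqI)
    let ?t = "\<lambda>k. sc n (c k) \<otimes>\<^bsub>T\<^esub> (e 0 0 \<otimes>\<^bsub>T\<^esub> f k k \<otimes>\<^bsub>T\<^esub> e 0 0)"
    have tc: "psum T ?t n \<in> carrier T" using scc cc ec fc by (intro T.psum_closed) auto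
    then show "psum T ?t n \<otimes>\<^bsub>T\<^esub> sc n d \<in> carrier T" using scc dc by simp
    fix i j assume ij: "i < n" "j < n"
    have tk: "?t k (i, j) = (if i = 0 \<and> j = 0 then c k \<otimes> x k else \<zero>)" if k: "k < n" for k
      using ij k n0 cc ec fc unfolding x_def by (simp add: sm em)
    have "psum T ?t n (i, j) = psum R (\<lambda>k. ?t k (i, j)) n"
      unfolding T_def by (rule mat_psum[OF ij])
    also have "\<dots> = psum R (\<lambda>k. if i = 0 \<and> j = 0 then c k \<otimes> x k else \<zero>) n"
      by (rule psum_cong) (rule tk)
    also have "\<dots> \<otimes> d = e 0 0 (i, j)"
      using d(2) psum_zero[of n "\<lambda>_. \<zero>"] dc ij by (auto simp: e_def elem_mat_entry)
    finally show "(psum T ?t n \<otimes>\<^bsub>T\<^esub> sc n d) (i, j) = e 0 0 (i, j)"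
      using sm(2)[OF tc dc ij] by simp
  qed (rule ec)
  define u where "u = psum T (\<lambda>k. sc n (c k) \<otimes>\<^bsub>T\<^esub> (e 0 0 \<otimes>\<^bsub>T\<^esub> f k 0)) n"
  define w where "w = psum T (\<lambda>k. f 0 k \<otimes>\<^bsub>T\<^esub> e 0 0 \<otimes>\<^bsub>T\<^esub> sc n (c k)) n \<otimes>\<^bsub>T\<^esub> sc n d"
  note uw = T.matrix_units_partial_equivalence[OF eu fu n0 scc[OF cc] central[OF cc c(2)] orth scc[OF dc] sce[OF dc] sum,
      folded u_def w_def]
  have O: "A \<otimes>\<^bsub>T\<^esub> B \<in> T.nonneg" if "A \<in> T.nonneg" "B \<in> T.nonneg" for A B
    using subringE(6)[OF T.subring_nonneg that] .
  have Op: "psum T t m \<in> T.nonneg" if "\<And>k. k < m \<Longrightarrow> t k \<in> T.nonneg" for t m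
    using that T.v_psum_le[of m t 0] unfolding T.nonneg_def by auto
  have On: "e k l \<in> T.nonneg" "f k l \<in> T.nonneg" "sc n d \<in> T.nonneg" for k l
    using we ec wf fc wsc d(1) scc[OF dc] by (auto simp: T.nonneg_def)
  have On': "sc n (c k) \<in> T.nonneg" if "k < n" for k
    using that wsc[OF c(1)] scc[OF cc] by (auto simp: T.nonneg_def)
  have uO: "u \<in> T.nonneg" unfolding u_def by (intro Op O On On')
  have wO: "w \<in> T.nonneg" unfolding w_def by (intro Op O On On')
  have wu: "w \<otimes>\<^bsub>T\<^esub> u = f 0 0"
  proof -
    define q where "q = w \<otimes>\<^bsub>T\<^esub> u"
    have q: "q \<in> carrier T" "0 \<le> ?w q" using O[OF wO uO] by (auto simp: q_def T.nonneg_def)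
    have fq: "f 0 0 \<otimes>\<^bsub>T\<^esub> q = q" unfolding q_def using uw fc by (simp add: T.m_assoc[symmetric])
    have qf: "q \<otimes>\<^bsub>T\<^esub> f 0 0 = q" unfolding q_def using uw fc by (simp add: T.m_assoc)
    have "q \<otimes>\<^bsub>T\<^esub> q = w \<otimes>\<^bsub>T\<^esub> (u \<otimes>\<^bsub>T\<^esub> w) \<otimes>\<^bsub>T\<^esub> u"
      unfolding q_def using uw(1,2) by (simp add: T.m_assoc)
    also have "\<dots> = q" by (simp only: uw(7) uw(6) q_def)
    finally have qq: "q \<otimes>\<^bsub>T\<^esub> q = q" .
    obtain h where h: "h \<in> carrier T" "\<sigma> h = q" using surj[OF q(1)] by auto
    \<comment> \<open>\<open>h\<close>, the preimage of \<open>q\<close>, lies in the corner cut out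
      by \<open>e 0 0\<close>. That corner is a copy of \<open>R\<close>, so \<open>h\<close> is
      given by its entry \<open>g\<close>, and \<open>g\<close> is idempotent along with
      \<open>q\<close>.\<close>
    have eh: "e 0 0 \<otimes>\<^bsub>T\<^esub> h = h"
      by (rule inj) (use h ec s(2) fq in \<open>auto simp: f_def\<close>)
    have he: "h \<otimes>\<^bsub>T\<^esub> e 0 0 = h"
      by (rule inj) (use h ec s(2) qf in \<open>auto simp: f_def\<close>)
    have hh: "h \<otimes>\<^bsub>T\<^esub> h = h"
      by (rule inj) (use h s(2) qq in auto)
    define g where "g = h (0, 0)"
    have gc: "g \<in> carrier R" unfolding g_def using ent h n0 by blast
    have hg: "sc n g \<otimes>\<^bsub>T\<^esub> e 0 0 = h"
      using elem_mat_sandwich[OF h(1)[unfolded T_def] n0 n0 n0, folded T_def e_def g_def] eh he by simp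
    have "sc n g \<otimes>\<^bsub>T\<^esub> h = h \<otimes>\<^bsub>T\<^esub> h"
      using scc[OF gc] ec h(1) by (subst (2) hg[symmetric]) (simp add: T.m_assoc eh)
    then have "(sc n g \<otimes>\<^bsub>T\<^esub> h) (0, 0) = h (0, 0)" unfolding hh by simp
    then have gg: "g \<otimes> g = g" unfolding sm(1)[OF h(1) gc n0 n0] by (simp add: g_def)
    have "0 \<le> ?w h" using wsig[folded T_def, OF h(1)] h(2) q(2) by simp
    then have gn: "g \<in> nonneg" unfolding g_def using entn h(1) n0 by blast
    define G where "G = \<sigma> (sc n g)"
    have Gc: "G \<in> carrier T" unfolding G_def using s(1) scc gc by blast
    have G: "G \<otimes>\<^bsub>T\<^esub> y = y \<otimes>\<^bsub>T\<^esub> G" if y: "y \<in> carrier T" for y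
    proof -
      obtain z where z: "z \<in> carrier T" "\<sigma> z = y" using surj[OF y] by auto
      show ?thesis
        unfolding G_def z(2)[symmetric] s(2)[OF scc[OF gc] z(1), symmetric] s(2)[OF z(1) scc[OF gc], symmetric]
        using central[OF gc idem[OF gn gg] z(1)] by simp
    qed
    have qG: "q = G \<otimes>\<^bsub>T\<^esub> f 0 0"
      unfolding G_def f_def s(2)[OF scc[OF gc] ec, symmetric] hg h(2) ..
    have e00: "e 0 0 \<otimes>\<^bsub>T\<^esub> e 0 0 = e 0 0" using E(2)[OF n0 n0 n0 n0] by simp
    \<comment> \<open>Squaring \<open>u w = e 0 0\<close> exposes \<open>q = G f 0 0\<close> in the
      middle. Pulling the central \<open>G\<close> to the front leaves
      \<open>G e 0 0 = e 0 0\<close>.\<close>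
    have "e 0 0 = (u \<otimes>\<^bsub>T\<^esub> w) \<otimes>\<^bsub>T\<^esub> (u \<otimes>\<^bsub>T\<^esub> w)" by (simp only: uw(7) e00)
    also have "\<dots> = u \<otimes>\<^bsub>T\<^esub> q \<otimes>\<^bsub>T\<^esub> w" unfolding q_def using uw(1,2) by (simp add: T.m_assoc)
    also have "\<dots> = (u \<otimes>\<^bsub>T\<^esub> G) \<otimes>\<^bsub>T\<^esub> (f 0 0 \<otimes>\<^bsub>T\<^esub> w)"
      unfolding qG using uw(1,2) Gc fc by (simp add: T.m_assoc)
    also have "\<dots> = G \<otimes>\<^bsub>T\<^esub> (u \<otimes>\<^bsub>T\<^esub> w)"
      by (simp only: uw(5) G[OF uw(1), symmetric] T.m_assoc[OF Gc uw(1,2)])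
    finally have Ge: "G \<otimes>\<^bsub>T\<^esub> e 0 0 = e 0 0" by (simp only: uw(7))
    \<comment> \<open>Being central, \<open>G\<close> can be moved next to the middle factor in
      \<open>e_kk = e_k0 e_00 e_0k\<close>. Summing over \<open>k\<close> then gives
      \<open>G = \<one>\<close>.\<close>
    have Gek: "G \<otimes>\<^bsub>T\<^esub> e k k = e k k" if k: "k < n" for k
    proof -
      have "G \<otimes>\<^bsub>T\<^esub> e k k = G \<otimes>\<^bsub>T\<^esub> (e k 0 \<otimes>\<^bsub>T\<^esub> e 0 k)" using E(2)[OF k n0 n0 k] by simp
      also have "\<dots> = (G \<otimes>\<^bsub>T\<^esub> e k 0) \<otimes>\<^bsub>T\<^esub> e 0 k" using Gc ec by (simp add: T.m_assoc)
      also have "\<dots> = (e k 0 \<otimes>\<^bsub>T\<^esub> e 0 0 \<otimes>\<^bsub>T\<^esub> G) \<otimes>\<^bsub>T\<^esub> e 0 k"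
        unfolding G[OF ec] E(2)[OF k n0 n0 n0] by simp
      also have "\<dots> = e k 0 \<otimes>\<^bsub>T\<^esub> (e 0 0 \<otimes>\<^bsub>T\<^esub> G) \<otimes>\<^bsub>T\<^esub> e 0 k" using Gc ec by (simp add: T.m_assoc)
      also have "\<dots> = e k 0 \<otimes>\<^bsub>T\<^esub> e 0 0 \<otimes>\<^bsub>T\<^esub> e 0 k" unfolding G[OF ec, symmetric] Ge ..
      also have "\<dots> = e k k" unfolding E(2)[OF k n0 n0 n0] using E(2)[OF k n0 n0 k] by simp
      finally show ?thesis .
    qed
    have "G \<otimes>\<^bsub>T\<^esub> psum T (\<lambda>k. e k k) n = psum T (\<lambda>k. G \<otimes>\<^bsub>T\<^esub> e k k) n"
      by (rule T.psum_rdistr) (use Gc ec in auto)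
    also have "\<dots> = psum T (\<lambda>k. e k k) n" by (rule psum_cong) (rule Gek)
    finally have "G = \<one>\<^bsub>T\<^esub>" unfolding E(3) using Gc by simp
    then show ?thesis using qG fc unfolding q_def by simp
  qed
  define a where "a = T.intertwiner n e u f"
  define b where "b = T.intertwiner n f w e"
  have aO: "a \<in> T.nonneg" unfolding a_def T.intertwiner_def by (intro Op O On uO)
  have bO: "b \<in> T.nonneg" unfolding b_def T.intertwiner_def by (intro Op O On wO)
  have ab: "a \<otimes>\<^bsub>T\<^esub> b = \<one>\<^bsub>T\<^esub>"
    unfolding a_def b_def by (rule T.intertwiner_inverse[OF eu fu n0 uw(1,4,2,7)])
  have ba: "b \<otimes>\<^bsub>T\<^esub> a = \<one>\<^bsub>T\<^esub>"
    unfolding a_def b_def by (rule T.intertwiner_inverse[OF fu eu n0 uw(2,6,1) wu])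
  have conj: "a \<otimes>\<^bsub>T\<^esub> f k l \<otimes>\<^bsub>T\<^esub> b = e k l" if kl: "k < n" "l < n" for k l
  proof -
    have "a \<otimes>\<^bsub>T\<^esub> f k l = e k l \<otimes>\<^bsub>T\<^esub> a"
      by (simp only: a_def T.intertwiner_mult[OF eu fu uw(1) kl])
    then show ?thesis using aO bO ec ab by (simp add: T.m_assoc T.nonneg_def)
  qed
  show thesis
    by (rule that[of a b, folded T_def e_def])
      (use aO bO ab ba conj in \<open>auto simp: T.nonneg_def f_def\<close>)
qed

section \<open>Reduction to entrywise skew derivations\<close>

lemma (in complete_filtered_ring) v_gt_iff:
  assumes "x \<in> carrier R" "y \<in> carrier R" "y \<noteq> \<zero>"
  shows "v y < v x \<longleftrightarrow> v y + 1 \<le> v x"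
proof -
  obtain k :: int where k: "v y = ereal (real_of_int k)" using v_int[OF assms(2)] v_inf assms by auto
  have one: "(1::ereal) = ereal 1" by (simp add: one_ereal_def)
  show ?thesis using v_int[OF assms(1)] unfolding k one by auto
qed

lemma (in ring) sc_hom:
  assumes "c \<in> carrier R" "d \<in> carrier R"
  shows "sc n (c \<otimes> d) = sc n c \<otimes>\<^bsub>M n\<^esub> sc n d" "sc n (c \<oplus> d) = sc n c \<oplus>\<^bsub>M n\<^esub> sc n d"
    "sc n \<one> = \<one>\<^bsub>M n\<^esub>" "sc n \<zero> = \<zero>\<^bsub>M n\<^esub>"
proof -
  interpret T: ring "M n" by (rule ring_mat_ring)
  show "sc n (c \<otimes> d) = sc n c \<otimes>\<^bsub>M n\<^esub> sc n d"
    by (rule mat_eqI[where n = n]) (use assms sc_closed in \<open>auto simp: sc_mult sc_entry\<close>)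
  show "sc n (c \<oplus> d) = sc n c \<oplus>\<^bsub>M n\<^esub> sc n d"
    by (rule mat_eqI[where n = n]) (use assms sc_closed in \<open>auto simp: mat_add sc_entry\<close>)
  show "sc n \<one> = \<one>\<^bsub>M n\<^esub>"
    by (rule mat_eqI[where n = n]) (use sc_closed in \<open>auto simp: mat_one sc_entry\<close>)
  show "sc n \<zero> = \<zero>\<^bsub>M n\<^esub>"
    by (rule mat_eqI[where n = n]) (use sc_closed in \<open>auto simp: mat_zero sc_entry\<close>)
qed

lemma (in complete_filtered_ring) mat_filtration_sc:
  assumes "1 \<le> n"
  shows "mat_filtration n v (sc n c) = v c"
proof (rule antisym)
  have "mat_filtration n v (sc n c) \<le> v (sc n c (0, 0))"
    using le_mat_filtration_iff[OF assms, THEN iffD1, OF order_refl, rule_format, of 0 0] assms by simp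
  then show "mat_filtration n v (sc n c) \<le> v c" using assms by (simp add: sc_entry)
  show "v c \<le> mat_filtration n v (sc n c)"
    unfolding le_mat_filtration_iff[OF assms] by (simp add: sc_entry)
qed

text \<open>The assumptions \<open>local\<close> and \<open>idem\<close> are the traces of a product
  of local domains and enter through \<open>matrix_units_conjugate\<close>. The two closing
  identities are the hypotheses \<open>sig\<close> and \<open>del\<close> of
  \<open>change_of_variable\<close>.\<close>

lemma (in complete_filtered_ring) skew_derivation_entrywise:
  fixes \<sigma> \<delta> :: "(nat \<times> nat \<Rightarrow> 'a) \<Rightarrow> nat \<times> nat \<Rightarrow> 'a"
  assumes n: "1 \<le> n"
    and skew: "skew_derivation (M n) \<sigma> \<delta>" and compat: "skew_compatible (M n) (mat_filtration n v) \<sigma> \<delta>"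
    and local: "\<And>x. (\<And>k. k < n \<Longrightarrow> x k \<in> nonneg) \<Longrightarrow> psum R x n = \<one> \<Longrightarrow>
      \<exists>c d. (\<forall>k<n. c k \<in> nonneg \<and> (\<forall>y\<in>carrier R. c k \<otimes> y = y \<otimes> c k)) \<and>
        (\<forall>k<n. \<forall>l<n. c k \<otimes> c l = (if k = l then c k else \<zero>)) \<and>
        d \<in> nonneg \<and> psum R (\<lambda>k. c k \<otimes> x k) n \<otimes> d = \<one>"
    and idem: "\<And>g y. g \<in> nonneg \<Longrightarrow> g \<otimes> g = g \<Longrightarrow> y \<in> carrier R \<Longrightarrow> g \<otimes> y = y \<otimes> g"
  obtains a b t \<tau> \<theta> where "a \<in> carrier (M n)" "b \<in> carrier (M n)" "t \<in> carrier (M n)"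
    "0 \<le> mat_filtration n v a" "0 \<le> mat_filtration n v b" "1 \<le> mat_filtration n v t"
    "a \<otimes>\<^bsub>M n\<^esub> b = \<one>\<^bsub>M n\<^esub>" "b \<otimes>\<^bsub>M n\<^esub> a = \<one>\<^bsub>M n\<^esub>"
    "skew_derivation R \<tau> \<theta>" "skew_compatible R v \<tau> \<theta>"
    "skew_derivation (M n) (mat_map n \<tau>) (mat_map n \<theta>)"
    "skew_compatible (M n) (mat_filtration n v) (mat_map n \<tau>) (mat_map n \<theta>)"
    "\<And>A. A \<in> carrier (M n) \<Longrightarrow> mat_map n \<tau> A \<otimes>\<^bsub>M n\<^esub> a = a \<otimes>\<^bsub>M n\<^esub> \<sigma> A"
    "\<And>A. A \<in> carrier (M n) \<Longrightarrow> a \<otimes>\<^bsub>M n\<^esub> \<delta> A \<oplus>\<^bsub>M n\<^esub> mat_map n \<tau> A \<otimes>\<^bsub>M n\<^esub> t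
        = mat_map n \<theta> A \<oplus>\<^bsub>M n\<^esub> t \<otimes>\<^bsub>M n\<^esub> A"
proof -
  let ?w = "mat_filtration n v"
  have n0: "0 < n" using n by simp
  define T where "T = M n"
  interpret T: complete_filtered_ring T ?w
    unfolding T_def by (rule complete_filtered_ring_mat[OF complete_filtered_ring_axioms n])
  have sig: "\<sigma> \<in> ring_iso T T" and dc: "\<And>A. A \<in> carrier T \<Longrightarrow> \<delta> A \<in> carrier T"
    and da: "\<And>A B. A \<in> carrier T \<Longrightarrow> B \<in> carrier T \<Longrightarrow> \<delta> (A \<oplus>\<^bsub>T\<^esub> B) = \<delta> A \<oplus>\<^bsub>T\<^esub> \<delta> B"
    and dm: "\<And>A B. A \<in> carrier T \<Longrightarrow> B \<in> carrier T \<Longrightarrow>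
        \<delta> (A \<otimes>\<^bsub>T\<^esub> B) = \<delta> A \<otimes>\<^bsub>T\<^esub> B \<oplus>\<^bsub>T\<^esub> \<sigma> A \<otimes>\<^bsub>T\<^esub> \<delta> B"
    using skew unfolding skew_derivation_def T_def[symmetric] by auto
  note s = ring_iso_memE[OF sig]
  have s0: "\<sigma> \<zero>\<^bsub>T\<^esub> = \<zero>\<^bsub>T\<^esub>"
    by (rule additive_zero[where h = \<sigma>, OF T.abelian_group_axioms T.abelian_group_axioms]) (use s in auto)
  have wsig: "?w (\<sigma> A) = ?w A" if "A \<in> carrier T" for A
    using compat that s0 unfolding skew_compatible_def T_def[symmetric] by (cases "A = \<zero>\<^bsub>T\<^esub>") auto
  have wdel: "?w A + 1 \<le> ?w (\<delta> A)" if "A \<in> carrier T" "A \<noteq> \<zero>\<^bsub>T\<^esub>" for A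
    using compat that T.v_gt_iff[OF dc[OF that(1)] that] unfolding skew_compatible_def T_def[symmetric] by auto
  obtain a b where ab: "a \<in> carrier T" "b \<in> carrier T" "0 \<le> ?w a" "0 \<le> ?w b"
    "a \<otimes>\<^bsub>T\<^esub> b = \<one>\<^bsub>T\<^esub>" "b \<otimes>\<^bsub>T\<^esub> a = \<one>\<^bsub>T\<^esub>"
    and conj: "\<And>k l. k < n \<Longrightarrow> l < n \<Longrightarrow> a \<otimes>\<^bsub>T\<^esub> \<sigma> (elem_mat n k l) \<otimes>\<^bsub>T\<^esub> b = elem_mat n k l"
  proof (rule matrix_units_conjugate[where \<sigma> = \<sigma>, OF n sig[unfolded T_def], folded T_def], goal_cases)
    case (1 A)
    show ?case using 1(2) by (rule wsig)
  next
    case (2 x)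
    show ?case using 2(2-) by (rule local)
  next
    case (3 g y)
    show ?case using 3(2-) by (rule idem)
  next
    case (4 a b)
    show ?case using 4(2-) by (rule 4(1))
  qed
  define e where "e = elem_mat n"
  have ec: "e k l \<in> carrier T" for k l unfolding e_def T_def by (rule elem_mat_closed)
  have eu: "T.matrix_units n e" unfolding e_def T_def by (rule matrix_units_elem_mat)
  note E = T.matrix_unitsD[OF eu]
  have le: "c \<le> ?w A \<longleftrightarrow> (\<forall>i<n. \<forall>j<n. c \<le> v (A (i, j)))" for c A by (rule le_mat_filtration_iff[OF n])
  have we: "0 \<le> ?w (e k l)" for k l unfolding le e_def by (simp add: elem_mat_entry)
  have enz: "e k l \<noteq> \<zero>\<^bsub>T\<^esub>" if "k < n" "l < n" for k l
  proof
    assume "e k l = \<zero>\<^bsub>T\<^esub>"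
    then have "e k l (k, l) = \<zero>" unfolding T_def using mat_zero that by simp
    then have "v \<one> = \<infinity>" using that by (simp add: e_def elem_mat_entry)
    then show False by simp
  qed
  have lc: "b \<otimes>\<^bsub>T\<^esub> (a \<otimes>\<^bsub>T\<^esub> x) = x" "a \<otimes>\<^bsub>T\<^esub> (b \<otimes>\<^bsub>T\<^esub> x) = x" if "x \<in> carrier T" for x
    using ab that by (simp_all add: T.m_assoc[symmetric])

  define s' where "s' A = a \<otimes>\<^bsub>T\<^esub> \<sigma> A \<otimes>\<^bsub>T\<^esub> b" for A
  have s'c: "s' A \<in> carrier T" if "A \<in> carrier T" for A unfolding s'_def using ab s(1) that by simp
  have s'a: "s' A \<otimes>\<^bsub>T\<^esub> a = a \<otimes>\<^bsub>T\<^esub> \<sigma> A" if "A \<in> carrier T" for A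
    unfolding s'_def using ab s(1)[OF that] by (simp add: T.m_assoc)
  have s'mult: "s' (A \<otimes>\<^bsub>T\<^esub> B) = s' A \<otimes>\<^bsub>T\<^esub> s' B" if "A \<in> carrier T" "B \<in> carrier T" for A B
    unfolding s'_def s(2)[OF that] using ab(1,2) s(1) that by (simp add: T.m_assoc lc)
  have s'add: "s' (A \<oplus>\<^bsub>T\<^esub> B) = s' A \<oplus>\<^bsub>T\<^esub> s' B" if "A \<in> carrier T" "B \<in> carrier T" for A B
    unfolding s'_def s(3)[OF that] using ab(1,2) s(1) that by (simp add: T.l_distr T.r_distr)
  have s'one: "s' \<one>\<^bsub>T\<^esub> = \<one>\<^bsub>T\<^esub>" unfolding s'_def s(4) using ab by simp
  have s'zero: "s' \<zero>\<^bsub>T\<^esub> = \<zero>\<^bsub>T\<^esub>" unfolding s'_def s0 using ab by simp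
  have sig_s': "\<sigma> A = b \<otimes>\<^bsub>T\<^esub> s' A \<otimes>\<^bsub>T\<^esub> a" if "A \<in> carrier T" for A
    unfolding s'_def using ab s(1)[OF that] by (simp add: T.m_assoc lc)
  have s'inj: "A = B" if "A \<in> carrier T" "B \<in> carrier T" "s' A = s' B" for A B
  proof -
    have "\<sigma> A = \<sigma> B" unfolding sig_s'[OF that(1)] sig_s'[OF that(2)] that(3) ..
    then show ?thesis using s(5) that(1,2) by (auto simp: bij_betw_def inj_on_def)
  qed
  have s'surj: "\<exists>A. A \<in> carrier T \<and> s' A = B" if B: "B \<in> carrier T" for B
  proof -
    have "b \<otimes>\<^bsub>T\<^esub> B \<otimes>\<^bsub>T\<^esub> a \<in> \<sigma> ` carrier T" using s(5) ab B by (simp add: bij_betw_def)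
    then obtain A where A: "A \<in> carrier T" "\<sigma> A = b \<otimes>\<^bsub>T\<^esub> B \<otimes>\<^bsub>T\<^esub> a" by auto
    have "s' A = B" unfolding s'_def A(2) using ab B by (simp add: T.m_assoc lc)
    then show ?thesis using A(1) by blast
  qed
  \<comment> \<open>Factors of value at least \<open>0\<close> do not lower a value. Applied to
    conjugation by \<open>a\<close> and to its inverse, this shows that conjugation preserves
    values.\<close>
  have w3: "?w x \<le> ?w (p \<otimes>\<^bsub>T\<^esub> x \<otimes>\<^bsub>T\<^esub> q)"
    if "p \<in> carrier T" "q \<in> carrier T" "x \<in> carrier T" "0 \<le> ?w p" "0 \<le> ?w q" for p q x
    using T.v_mult_le[of "p \<otimes>\<^bsub>T\<^esub> x" q "?w x" 0] T.v_mult_le[of p x 0 "?w x"] that by simp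
  have ws': "?w (s' A) = ?w A" if A: "A \<in> carrier T" for A
  proof (rule antisym)
    show "?w (s' A) \<le> ?w A"
      using w3[OF ab(2,1) s'c[OF A] ab(4,3)] unfolding sig_s'[OF A, symmetric] wsig[OF A] .
    show "?w A \<le> ?w (s' A)"
      using w3[OF ab(1,2) s(1)[OF A] ab(3,4)] unfolding s'_def[symmetric] wsig[OF A] .
  qed
  have s'e: "s' (e k l) = e k l" if "k < n" "l < n" for k l
    unfolding s'_def e_def using conj that .

  \<comment> \<open>The derivation belonging to the variable \<open>a x\<close>, with automorphism
    \<open>s'\<close>.\<close>
  define d1 where "d1 A = a \<otimes>\<^bsub>T\<^esub> \<delta> A" for A
  have d1c: "d1 A \<in> carrier T" if "A \<in> carrier T" for A unfolding d1_def using ab dc that by simp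
  have d1add: "d1 (A \<oplus>\<^bsub>T\<^esub> B) = d1 A \<oplus>\<^bsub>T\<^esub> d1 B" if "A \<in> carrier T" "B \<in> carrier T" for A B
    unfolding d1_def da[OF that] using ab dc that by (simp add: T.r_distr)
  have d1m: "d1 (A \<otimes>\<^bsub>T\<^esub> B) = d1 A \<otimes>\<^bsub>T\<^esub> B \<oplus>\<^bsub>T\<^esub> s' A \<otimes>\<^bsub>T\<^esub> d1 B" if "A \<in> carrier T" "B \<in> carrier T" for A B
  proof -
    have "d1 (A \<otimes>\<^bsub>T\<^esub> B) = a \<otimes>\<^bsub>T\<^esub> \<delta> A \<otimes>\<^bsub>T\<^esub> B \<oplus>\<^bsub>T\<^esub> (a \<otimes>\<^bsub>T\<^esub> \<sigma> A) \<otimes>\<^bsub>T\<^esub> \<delta> B"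
      unfolding d1_def dm[OF that] using ab(1) dc s(1) that by (simp add: T.r_distr T.m_assoc)
    also have "(a \<otimes>\<^bsub>T\<^esub> \<sigma> A) \<otimes>\<^bsub>T\<^esub> \<delta> B = s' A \<otimes>\<^bsub>T\<^esub> d1 B"
      unfolding s'a[OF that(1), symmetric] d1_def using ab(1) dc s'c that by (simp add: T.m_assoc)
    finally show ?thesis unfolding d1_def .
  qed
  have wd1: "?w A + 1 \<le> ?w (d1 A)" if "A \<in> carrier T" "A \<noteq> \<zero>\<^bsub>T\<^esub>" for A
    using T.v_mult_le[OF ab(1) dc[OF that(1)] ab(3) wdel[OF that]] unfolding d1_def by simp

  \<comment> \<open>If \<open>d1 (e k 0) = t e_k0 - e_k0 t\<close>, then the sum of the
    \<open>d1 (e k 0) e_0k\<close> is \<open>t\<close> minus the sum of the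
    \<open>e_k0 t e_0k\<close>. The latter commutes with all matrix units and may be dropped, which
    suggests this \<open>t\<close>.\<close>
  define t where "t = psum T (\<lambda>k. d1 (e k 0) \<otimes>\<^bsub>T\<^esub> e 0 k) n"
  have tk: "d1 (e k 0) \<otimes>\<^bsub>T\<^esub> e 0 k \<in> carrier T" for k using d1c ec by simp
  have tc: "t \<in> carrier T" unfolding t_def using tk by (intro T.psum_closed)
  have wt: "1 \<le> ?w t"
    unfolding t_def
  proof (rule T.v_psum_le[OF tk])
    fix k assume k: "k < n"
    have "0 + 1 \<le> ?w (e k 0) + 1" by (rule add_right_mono[OF we])
    then have "1 \<le> ?w (d1 (e k 0))" using wd1[OF ec enz[OF k n0]] by (metis add_0 order_trans)
    then show "1 \<le> ?w (d1 (e k 0) \<otimes>\<^bsub>T\<^esub> e 0 k)"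
      using T.v_mult_le[OF d1c[OF ec] ec _ we, of 1 k 0 0 k] by simp
  qed
  \<comment> \<open>Both sides equal \<open>d1 (e i 0) e_0j\<close>. On the right, \<open>1\<close>
    is written as the sum of the \<open>e_k0 e_0k\<close>, and the Leibniz rule turns the summands
    into \<open>d1 (e_ij e_k0) e_0k\<close>, which vanish unless \<open>k = j\<close>.\<close>
  have te: "t \<otimes>\<^bsub>T\<^esub> e i j = d1 (e i j) \<oplus>\<^bsub>T\<^esub> e i j \<otimes>\<^bsub>T\<^esub> t" if ij: "i < n" "j < n" for i j
  proof -
    have "t \<otimes>\<^bsub>T\<^esub> e i j = psum T (\<lambda>k. d1 (e k 0) \<otimes>\<^bsub>T\<^esub> e 0 k \<otimes>\<^bsub>T\<^esub> e i j) n"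
      unfolding t_def by (rule T.psum_ldistr) (use tk ec in auto)
    also have "\<dots> = d1 (e i 0) \<otimes>\<^bsub>T\<^esub> e 0 j"
    proof (rule T.psum_single[OF ij(1)])
      have *: "d1 (e k 0) \<otimes>\<^bsub>T\<^esub> e 0 k \<otimes>\<^bsub>T\<^esub> e i j = d1 (e k 0) \<otimes>\<^bsub>T\<^esub> (if k = i then e 0 j else \<zero>\<^bsub>T\<^esub>)" if k: "k < n" for k
        unfolding E(2)[OF n0 k ij, symmetric] using d1c ec by (simp add: T.m_assoc)
      show "d1 (e i 0) \<otimes>\<^bsub>T\<^esub> e 0 i \<otimes>\<^bsub>T\<^esub> e i j = d1 (e i 0) \<otimes>\<^bsub>T\<^esub> e 0 j" using *[OF ij(1)] by simp
      show "d1 (e k 0) \<otimes>\<^bsub>T\<^esub> e 0 k \<otimes>\<^bsub>T\<^esub> e i j = \<zero>\<^bsub>T\<^esub>" if "k < n" "k \<noteq> i" for k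
        using *[OF that(1)] that d1c ec by simp
    qed (use d1c ec in auto)
    finally have l: "t \<otimes>\<^bsub>T\<^esub> e i j = d1 (e i 0) \<otimes>\<^bsub>T\<^esub> e 0 j" .
    have "d1 (e i j) = psum T (\<lambda>k. d1 (e i j) \<otimes>\<^bsub>T\<^esub> (e k 0 \<otimes>\<^bsub>T\<^esub> e 0 k)) n"
    proof -
      have "d1 (e i j) = d1 (e i j) \<otimes>\<^bsub>T\<^esub> psum T (\<lambda>k. e k k) n" using E(3) d1c ec by simp
      also have "\<dots> = psum T (\<lambda>k. d1 (e i j) \<otimes>\<^bsub>T\<^esub> e k k) n"
        by (rule T.psum_rdistr) (use d1c ec in auto)
      also have "\<dots> = psum T (\<lambda>k. d1 (e i j) \<otimes>\<^bsub>T\<^esub> (e k 0 \<otimes>\<^bsub>T\<^esub> e 0 k)) n"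
        by (rule psum_cong) (use E(2)[OF _ n0 n0] in simp)
      finally show ?thesis .
    qed
    moreover have "e i j \<otimes>\<^bsub>T\<^esub> t = psum T (\<lambda>k. e i j \<otimes>\<^bsub>T\<^esub> (d1 (e k 0) \<otimes>\<^bsub>T\<^esub> e 0 k)) n"
      unfolding t_def by (rule T.psum_rdistr) (use tk ec in auto)
    ultimately have "d1 (e i j) \<oplus>\<^bsub>T\<^esub> e i j \<otimes>\<^bsub>T\<^esub> t
        = psum T (\<lambda>k. d1 (e i j) \<otimes>\<^bsub>T\<^esub> (e k 0 \<otimes>\<^bsub>T\<^esub> e 0 k)) n \<oplus>\<^bsub>T\<^esub>
          psum T (\<lambda>k. e i j \<otimes>\<^bsub>T\<^esub> (d1 (e k 0) \<otimes>\<^bsub>T\<^esub> e 0 k)) n"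
      by (rule arg_cong2)
    also have "\<dots> = psum T (\<lambda>k. d1 (e i j) \<otimes>\<^bsub>T\<^esub> (e k 0 \<otimes>\<^bsub>T\<^esub> e 0 k) \<oplus>\<^bsub>T\<^esub>
        e i j \<otimes>\<^bsub>T\<^esub> (d1 (e k 0) \<otimes>\<^bsub>T\<^esub> e 0 k)) n"
      by (rule T.psum_add[symmetric]) (use d1c ec in auto)
    also have "\<dots> = d1 (e i 0) \<otimes>\<^bsub>T\<^esub> e 0 j"
    proof (rule T.psum_single[OF ij(2)])
      have *: "d1 (e i j) \<otimes>\<^bsub>T\<^esub> (e k 0 \<otimes>\<^bsub>T\<^esub> e 0 k) \<oplus>\<^bsub>T\<^esub> e i j \<otimes>\<^bsub>T\<^esub> (d1 (e k 0) \<otimes>\<^bsub>T\<^esub> e 0 k)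
          = d1 (e i j \<otimes>\<^bsub>T\<^esub> e k 0) \<otimes>\<^bsub>T\<^esub> e 0 k" if k: "k < n" for k
        unfolding d1m[OF ec ec] s'e[OF ij] using d1c ec by (simp add: T.l_distr T.m_assoc)
      show "d1 (e i j) \<otimes>\<^bsub>T\<^esub> (e j 0 \<otimes>\<^bsub>T\<^esub> e 0 j) \<oplus>\<^bsub>T\<^esub> e i j \<otimes>\<^bsub>T\<^esub> (d1 (e j 0) \<otimes>\<^bsub>T\<^esub> e 0 j) = d1 (e i 0) \<otimes>\<^bsub>T\<^esub> e 0 j"
        unfolding *[OF ij(2)] E(2)[OF ij ij(2) n0] by simp
      have d10: "d1 \<zero>\<^bsub>T\<^esub> = \<zero>\<^bsub>T\<^esub>"
        by (rule additive_zero[where h = d1, OF T.abelian_group_axioms T.abelian_group_axioms]) (use d1c d1add in auto)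
      show "d1 (e i j) \<otimes>\<^bsub>T\<^esub> (e k 0 \<otimes>\<^bsub>T\<^esub> e 0 k) \<oplus>\<^bsub>T\<^esub> e i j \<otimes>\<^bsub>T\<^esub> (d1 (e k 0) \<otimes>\<^bsub>T\<^esub> e 0 k) = \<zero>\<^bsub>T\<^esub>" if "k < n" "k \<noteq> j" for k
        unfolding *[OF that(1)] E(2)[OF ij that(1) n0] using that d10 ec by simp
    qed (use d1c ec in auto)
    finally show ?thesis unfolding l by simp
  qed

  define d2 where "d2 A = d1 A \<ominus>\<^bsub>T\<^esub> (t \<otimes>\<^bsub>T\<^esub> A \<ominus>\<^bsub>T\<^esub> s' A \<otimes>\<^bsub>T\<^esub> t)" for A
  have d2c: "d2 A \<in> carrier T" if "A \<in> carrier T" for A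
    unfolding d2_def using d1c s'c tc that by simp
  have d2t: "d2 A \<oplus>\<^bsub>T\<^esub> t \<otimes>\<^bsub>T\<^esub> A = d1 A \<oplus>\<^bsub>T\<^esub> s' A \<otimes>\<^bsub>T\<^esub> t" if A: "A \<in> carrier T" for A
  proof -
    have "(x \<ominus>\<^bsub>T\<^esub> (y \<ominus>\<^bsub>T\<^esub> z)) \<oplus>\<^bsub>T\<^esub> y = x \<oplus>\<^bsub>T\<^esub> z"
      if "x \<in> carrier T" "y \<in> carrier T" "z \<in> carrier T" for x y z
    proof -
      have "(x \<ominus>\<^bsub>T\<^esub> (y \<ominus>\<^bsub>T\<^esub> z)) \<oplus>\<^bsub>T\<^esub> y = (x \<oplus>\<^bsub>T\<^esub> z) \<oplus>\<^bsub>T\<^esub> (\<ominus>\<^bsub>T\<^esub> y \<oplus>\<^bsub>T\<^esub> y)"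
        using that by (simp only: a_minus_def T.minus_add T.minus_minus T.add.inv_closed T.add.m_closed T.a_ac)
      also have "\<dots> = x \<oplus>\<^bsub>T\<^esub> z" using that by (simp only: T.l_neg T.r_zero T.add.m_closed)
      finally show ?thesis .
    qed
    then show ?thesis unfolding d2_def using d1c s'c tc A by simp
  qed
  \<comment> \<open>Avoids calculating with differences: \<open>d2 A\<close> is recognised as the
    solution of the equation in \<open>d2t\<close>, by cancelling \<open>t A\<close>.\<close>
  have d2I: "d2 A = x" if "A \<in> carrier T" "x \<in> carrier T" "x \<oplus>\<^bsub>T\<^esub> t \<otimes>\<^bsub>T\<^esub> A = d1 A \<oplus>\<^bsub>T\<^esub> s' A \<otimes>\<^bsub>T\<^esub> t" for A x
  proof -
    have "d2 A \<oplus>\<^bsub>T\<^esub> t \<otimes>\<^bsub>T\<^esub> A = x \<oplus>\<^bsub>T\<^esub> t \<otimes>\<^bsub>T\<^esub> A" unfolding d2t[OF that(1)] that(3) ..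
    then show ?thesis
      using T.add.right_cancel[of "t \<otimes>\<^bsub>T\<^esub> A" "d2 A" x] that(1,2) d2c tc by simp
  qed
  have d2add: "d2 (A \<oplus>\<^bsub>T\<^esub> B) = d2 A \<oplus>\<^bsub>T\<^esub> d2 B" if A: "A \<in> carrier T" and B: "B \<in> carrier T" for A B
  proof (rule d2I)
    have "d2 A \<oplus>\<^bsub>T\<^esub> d2 B \<oplus>\<^bsub>T\<^esub> t \<otimes>\<^bsub>T\<^esub> (A \<oplus>\<^bsub>T\<^esub> B) = (d2 A \<oplus>\<^bsub>T\<^esub> t \<otimes>\<^bsub>T\<^esub> A) \<oplus>\<^bsub>T\<^esub> (d2 B \<oplus>\<^bsub>T\<^esub> t \<otimes>\<^bsub>T\<^esub> B)"
      using A B tc d2c by (simp add: T.r_distr T.a_ac)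
    also have "\<dots> = d1 (A \<oplus>\<^bsub>T\<^esub> B) \<oplus>\<^bsub>T\<^esub> s' (A \<oplus>\<^bsub>T\<^esub> B) \<otimes>\<^bsub>T\<^esub> t"
      unfolding d2t[OF A] d2t[OF B] d1add[OF A B] s'add[OF A B]
      using A B tc d1c s'c by (simp add: T.l_distr T.a_ac)
    finally show "d2 A \<oplus>\<^bsub>T\<^esub> d2 B \<oplus>\<^bsub>T\<^esub> t \<otimes>\<^bsub>T\<^esub> (A \<oplus>\<^bsub>T\<^esub> B) = d1 (A \<oplus>\<^bsub>T\<^esub> B) \<oplus>\<^bsub>T\<^esub> s' (A \<oplus>\<^bsub>T\<^esub> B) \<otimes>\<^bsub>T\<^esub> t" .
  qed (use A B d2c in auto)
  have d2m: "d2 (A \<otimes>\<^bsub>T\<^esub> B) = d2 A \<otimes>\<^bsub>T\<^esub> B \<oplus>\<^bsub>T\<^esub> s' A \<otimes>\<^bsub>T\<^esub> d2 B" if A: "A \<in> carrier T" and B: "B \<in> carrier T" for A B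
  proof (rule d2I)
    have "d2 A \<otimes>\<^bsub>T\<^esub> B \<oplus>\<^bsub>T\<^esub> s' A \<otimes>\<^bsub>T\<^esub> d2 B \<oplus>\<^bsub>T\<^esub> t \<otimes>\<^bsub>T\<^esub> (A \<otimes>\<^bsub>T\<^esub> B)
        = (d2 A \<oplus>\<^bsub>T\<^esub> t \<otimes>\<^bsub>T\<^esub> A) \<otimes>\<^bsub>T\<^esub> B \<oplus>\<^bsub>T\<^esub> s' A \<otimes>\<^bsub>T\<^esub> d2 B"
      using A B tc d2c s'c by (simp add: T.l_distr T.m_assoc T.a_ac)
    also have "\<dots> = d1 A \<otimes>\<^bsub>T\<^esub> B \<oplus>\<^bsub>T\<^esub> s' A \<otimes>\<^bsub>T\<^esub> (d2 B \<oplus>\<^bsub>T\<^esub> t \<otimes>\<^bsub>T\<^esub> B)"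
      unfolding d2t[OF A] using A B tc d1c d2c s'c by (simp add: T.l_distr T.r_distr T.m_assoc T.a_ac)
    also have "\<dots> = d1 (A \<otimes>\<^bsub>T\<^esub> B) \<oplus>\<^bsub>T\<^esub> s' (A \<otimes>\<^bsub>T\<^esub> B) \<otimes>\<^bsub>T\<^esub> t"
      unfolding d2t[OF B] d1m[OF A B] s'mult[OF A B]
      using A B tc d1c s'c by (simp add: T.r_distr T.m_assoc T.a_ac)
    finally show "d2 A \<otimes>\<^bsub>T\<^esub> B \<oplus>\<^bsub>T\<^esub> s' A \<otimes>\<^bsub>T\<^esub> d2 B \<oplus>\<^bsub>T\<^esub> t \<otimes>\<^bsub>T\<^esub> (A \<otimes>\<^bsub>T\<^esub> B)
        = d1 (A \<otimes>\<^bsub>T\<^esub> B) \<oplus>\<^bsub>T\<^esub> s' (A \<otimes>\<^bsub>T\<^esub> B) \<otimes>\<^bsub>T\<^esub> t" .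
  qed (use A B d2c s'c in auto)
  have d2e: "d2 (e i j) = \<zero>\<^bsub>T\<^esub>" if ij: "i < n" "j < n" for i j
    by (rule d2I) (use te[OF ij] s'e[OF ij] tc ec d1c in auto)
  have wd2: "?w A + 1 \<le> ?w (d2 A)" if A: "A \<in> carrier T" "A \<noteq> \<zero>\<^bsub>T\<^esub>" for A
  proof -
    have "?w A + 1 \<le> ?w (t \<otimes>\<^bsub>T\<^esub> A)"
      using T.v_mult_le[OF tc A(1) wt order_refl] by (simp add: add.commute)
    moreover have "?w A + 1 \<le> ?w (s' A \<otimes>\<^bsub>T\<^esub> t)"
      using T.v_mult_le[OF s'c[OF A(1)] tc _ wt, of "?w A"] ws'[OF A(1)] by simp
    ultimately show ?thesis
      unfolding d2_def using wd1[OF A] d1c s'c tc A(1) by (intro T.v_minus_le) auto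
  qed
  have s'ent: "s' A (k, l) = s' (sc n (A (k, l))) (0, 0)" if "A \<in> carrier T" "k < n" "l < n" for A k l
    by (rule entrywise_of_commuting[where h = s' and n = n, folded T_def e_def])
      (use that s'c s'mult s'e ec in auto)
  have d2ent: "d2 A (k, l) = d2 (sc n (A (k, l))) (0, 0)" if "A \<in> carrier T" "k < n" "l < n" for A k l
    by (rule entrywise_of_commuting[where h = d2 and n = n, folded T_def e_def])
      (use that d2c d2m s'e d2e s'c ec in auto)
  \<comment> \<open>The maps on entries are recovered from scalar matrices; by \<open>s'ent\<close>
    and \<open>d2ent\<close> the corner of the image carries all the information.\<close>
  define \<tau> where "\<tau> c = s' (sc n c) (0, 0)" for c
  define \<theta> where "\<theta> c = d2 (sc n c) (0, 0)" for c
  note scc = sc_closed[where n = n, folded T_def]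
  note scm = sc_hom[where n = n, folded T_def]
  note eqI = mat_eqI[where n = n, folded T_def]
  have ent: "A (i, j) \<in> carrier R" if "A \<in> carrier T" "i < n" "j < n" for A i j
    using mat_entry_closed that unfolding T_def by blast
  have mm: "mat_map n h A \<in> carrier T" if "\<And>c. c \<in> carrier R \<Longrightarrow> h c \<in> carrier R" "A \<in> carrier T" for h A
    unfolding mat_map_def T_def by (rule mat_closedI) (use that ent in auto)
  have \<tau>c: "\<tau> c \<in> carrier R" and \<theta>c: "\<theta> c \<in> carrier R" if "c \<in> carrier R" for c
    unfolding \<tau>_def \<theta>_def using ent s'c d2c scc that n0 by auto
  have s'map: "s' A = mat_map n \<tau> A" if "A \<in> carrier T" for A
    by (rule eqI) (use that s'c mm[of \<tau>] \<tau>c s'ent in \<open>auto simp: mat_map_def \<tau>_def\<close>)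
  have d2map: "d2 A = mat_map n \<theta> A" if "A \<in> carrier T" for A
    by (rule eqI) (use that d2c mm[of \<theta>] \<theta>c d2ent in \<open>auto simp: mat_map_def \<theta>_def\<close>)
  have d2zero: "d2 \<zero>\<^bsub>T\<^esub> = \<zero>\<^bsub>T\<^esub>"
    by (rule additive_zero[where h = d2, OF T.abelian_group_axioms T.abelian_group_axioms]) (use d2c d2add in auto)
  have \<tau>0: "\<tau> \<zero> = \<zero>" and \<theta>0: "\<theta> \<zero> = \<zero>"
    unfolding \<tau>_def \<theta>_def scm(4)[OF zero_closed zero_closed] s'zero d2zero
    unfolding T_def using mat_zero[OF n0 n0] by simp_all
  have s'sc: "s' (sc n c) = sc n (\<tau> c)" if "c \<in> carrier R" for c
    by (rule eqI) (use s'c scc \<tau>c that \<tau>0 s'map in \<open>auto simp: mat_map_def sc_entry\<close>)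
  have d2sc: "d2 (sc n c) = sc n (\<theta> c)" if "c \<in> carrier R" for c
    by (rule eqI) (use d2c scc \<theta>c that \<theta>0 d2map in \<open>auto simp: mat_map_def sc_entry\<close>)
  have sc00: "sc n c (0, 0) = c" for c using n0 by (simp add: sc_entry)
  have scinj: "c = d" if "sc n c = sc n d" for c d using that sc00 by metis
  have \<tau>m: "\<tau> (c \<otimes> d) = \<tau> c \<otimes> \<tau> d" if "c \<in> carrier R" "d \<in> carrier R" for c d
    by (rule scinj) (use that in \<open>simp add: s'sc[symmetric] scm \<tau>c s'mult scc\<close>)
  have \<tau>a: "\<tau> (c \<oplus> d) = \<tau> c \<oplus> \<tau> d" if "c \<in> carrier R" "d \<in> carrier R" for c d
    by (rule scinj) (use that in \<open>simp add: s'sc[symmetric] scm \<tau>c s'add scc\<close>)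
  have \<tau>1: "\<tau> \<one> = \<one>"
    by (rule scinj) (simp add: s'sc[symmetric] scm(3)[OF one_closed one_closed] s'one)
  have \<theta>a: "\<theta> (c \<oplus> d) = \<theta> c \<oplus> \<theta> d" if "c \<in> carrier R" "d \<in> carrier R" for c d
    by (rule scinj) (use that in \<open>simp add: d2sc[symmetric] scm \<theta>c d2add scc\<close>)
  have \<theta>m: "\<theta> (c \<otimes> d) = \<theta> c \<otimes> d \<oplus> \<tau> c \<otimes> \<theta> d" if "c \<in> carrier R" "d \<in> carrier R" for c d
    by (rule scinj) (use that in \<open>simp add: d2sc[symmetric] s'sc[symmetric] scm \<theta>c \<tau>c d2m scc\<close>)
  have bij: "bij_betw \<tau> (carrier R) (carrier R)"
    unfolding bij_betw_def
  proof
    show "inj_on \<tau> (carrier R)"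
    proof (rule inj_onI)
      fix c d assume cd: "c \<in> carrier R" "d \<in> carrier R" "\<tau> c = \<tau> d"
      then have "s' (sc n c) = s' (sc n d)" by (simp add: s'sc)
      then show "c = d" using s'inj scc cd scinj by blast
    qed
    \<comment> \<open>A preimage of the scalar matrix of \<open>y\<close> is not known in advance to
      be scalar, but its corner entry already maps to \<open>y\<close>.\<close>
    have "y \<in> \<tau> ` carrier R" if y: "y \<in> carrier R" for y
    proof -
      obtain A where A: "A \<in> carrier T" "s' A = sc n y" using s'surj[OF scc[OF y]] by auto
      have "\<tau> (A (0, 0)) = y"
        using s'ent[OF A(1) n0 n0] unfolding A(2) sc00 \<tau>_def ..
      then show ?thesis using ent[OF A(1) n0 n0] by blast
    qed
    then show "\<tau> ` carrier R = carrier R" using \<tau>c by auto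
  qed
  have skew': "skew_derivation R \<tau> \<theta>"
    unfolding skew_derivation_def
    using bij \<tau>c \<tau>m \<tau>a \<tau>1 \<theta>c \<theta>a \<theta>m by (auto intro!: ring_iso_memI)
  have compat': "skew_compatible R v \<tau> \<theta>"
    unfolding skew_compatible_def
  proof (intro ballI conjI)
    fix r assume "r \<in> carrier R - {\<zero>}"
    then have r: "r \<in> carrier R" "r \<noteq> \<zero>" by auto
    show "v (\<tau> r) = v r"
      using ws'[OF scc[OF r(1)]] unfolding s'sc[OF r(1)] mat_filtration_sc[OF n] .
    have "sc n r \<noteq> \<zero>\<^bsub>T\<^esub>" using scinj[of r \<zero>] r scm(4)[OF r(1) r(1)] by auto
    from wd2[OF scc[OF r(1)] this] show "v r < v (\<theta> r)"
      unfolding d2sc[OF r(1)] mat_filtration_sc[OF n] v_gt_iff[OF \<theta>c[OF r(1)] r] .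
  qed
  have bij': "bij_betw s' (carrier T) (carrier T)"
    unfolding bij_betw_def
  proof
    show "inj_on s' (carrier T)" using s'inj by (rule inj_onI)
    have "B \<in> s' ` carrier T" if "B \<in> carrier T" for B using s'surj[OF that] by auto
    then show "s' ` carrier T = carrier T" using s'c by auto
  qed
  have bijm: "bij_betw (mat_map n \<tau>) (carrier T) (carrier T)"
    using bij' bij_betw_cong[of "carrier T" s' "mat_map n \<tau>"] s'map by simp
  have skewm: "skew_derivation T (mat_map n \<tau>) (mat_map n \<theta>)"
    unfolding skew_derivation_def
    using bijm s'c d2c s'mult s'add s'one d2add d2m
    by (auto intro!: ring_iso_memI simp: s'map[symmetric] d2map[symmetric])
  have compatm: "skew_compatible T ?w (mat_map n \<tau>) (mat_map n \<theta>)"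
    unfolding skew_compatible_def
  proof (intro ballI conjI)
    fix A assume "A \<in> carrier T - {\<zero>\<^bsub>T\<^esub>}"
    then have A: "A \<in> carrier T" "A \<noteq> \<zero>\<^bsub>T\<^esub>" by auto
    show "?w (mat_map n \<tau> A) = ?w A" unfolding s'map[OF A(1), symmetric] by (rule ws'[OF A(1)])
    show "?w A < ?w (mat_map n \<theta> A)"
      unfolding d2map[OF A(1), symmetric] T.v_gt_iff[OF d2c[OF A(1)] A] by (rule wd2[OF A])
  qed
  have conj1: "mat_map n \<tau> A \<otimes>\<^bsub>T\<^esub> a = a \<otimes>\<^bsub>T\<^esub> \<sigma> A" if "A \<in> carrier T" for A
    using s'a[OF that] unfolding s'map[OF that] .
  have conj2: "a \<otimes>\<^bsub>T\<^esub> \<delta> A \<oplus>\<^bsub>T\<^esub> mat_map n \<tau> A \<otimes>\<^bsub>T\<^esub> t = mat_map n \<theta> A \<oplus>\<^bsub>T\<^esub> t \<otimes>\<^bsub>T\<^esub> A"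
    if "A \<in> carrier T" for A
    using d2t[OF that] unfolding s'map[OF that] d2map[OF that] d1_def by simp
  show thesis
    by (rule that[of a b t \<tau> \<theta>, folded T_def])
      (use ab tc wt skew' compat' skewm compatm conj1 conj2 in auto)
qed

section \<open>Power series over matrix rings\<close>

context complete_filtered_ring
begin

abbreviation D where "D \<equiv> R\<lparr>carrier := nonneg\<rparr>"

lemma v_nat:
  assumes "x \<in> carrier R" "0 \<le> v x"
  shows "v x = \<infinity> \<or> (\<exists>k::nat. v x = ereal (real k))"
proof (cases "v x = \<infinity>")
  case False
  then obtain k :: int where k: "v x = ereal (real_of_int k)" using v_int assms(1) by blast
  then have "v x = ereal (real (nat k))" using assms(2) by simp
  then show ?thesis by blast
qed simp

lemma vL_nonneg: "x \<in> vL k \<longleftrightarrow> x \<in> nonneg \<and> ereal (real k) \<le> v x"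
proof -
  have "0 \<le> ereal (real k)" by simp
  then show ?thesis unfolding vL_def nonneg_def using order_trans by blast
qed

text \<open>Compatibility lets both maps restrict to \<open>nonneg\<close>, and integrality turns
  the strict increase under \<open>\<theta>\<close> into one step in the chain.\<close>

lemma skew_chain_ring_nonneg:
  assumes "skew_derivation R \<tau> \<theta>" "skew_compatible R v \<tau> \<theta>"
  shows "skew_chain_ring D vL v \<tau> \<theta>"
proof -
  note s = assms(1)[unfolded skew_derivation_def]
  note si = ring_iso_memE[OF s[THEN conjunct1]]
  have dc: "\<theta> x \<in> carrier R" if "x \<in> carrier R" for x using s that by auto
  have c: "x \<in> carrier R" if "x \<in> nonneg" for x using that by (simp add: nonneg_def)
  have z: "\<tau> \<zero> = \<zero>" "\<theta> \<zero> = \<zero>"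
    using additive_zero[where h = \<tau>, OF abelian_group_axioms abelian_group_axioms] si
      additive_zero[where h = \<theta>, OF abelian_group_axioms abelian_group_axioms] dc s by auto
  have vt: "v (\<tau> x) = v x" if "x \<in> carrier R" for x
    using assms(2) that z unfolding skew_compatible_def by (cases "x = \<zero>") auto
  have vd: "v x + 1 \<le> v (\<theta> x)" if x: "x \<in> carrier R" for x
  proof (cases "x = \<zero>")
    case False
    then have "v x < v (\<theta> x)" using assms(2) x unfolding skew_compatible_def by auto
    then show ?thesis using v_gt_iff[OF dc[OF x] x False] by simp
  qed (simp add: z)
  interpret DD: chain_ring D vL by (rule chain_ring_nonneg)
  show ?thesis
  proof
    show "x \<in> vL k \<longleftrightarrow> x \<in> carrier D \<and> ereal (real k) \<le> v x" for x k
      using vL_nonneg by simp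
    show "\<tau> x \<in> vL k" if "x \<in> vL k" for x k
      using that si(1) vt by (simp add: vL_def)
    show "\<theta> x \<in> vL (Suc k)" if "x \<in> vL k" for x k
    proof -
      have x: "x \<in> carrier R" "ereal (real k) \<le> v x" using that by (auto simp: vL_def)
      have "ereal (real (Suc k)) = ereal (real k) + 1" by (simp add: one_ereal_def)
      also have "\<dots> \<le> v x + 1" by (rule add_right_mono[OF x(2)])
      also have "\<dots> \<le> v (\<theta> x)" by (rule vd[OF x(1)])
      finally show ?thesis using dc x by (simp add: vL_def)
    qed
  qed (use si s c in auto)
qed

end

lemma psum_carrier_update: "psum (R\<lparr>carrier := H\<rparr>) t n = psum R t n"
  by (induction n) auto

lemma mat_map_ring_hom:
  assumes "ring A" "ring B" and f: "f \<in> ring_hom A B"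
  shows "mat_map n f \<in> ring_hom (mat_ring n A) (mat_ring n B)"
proof -
  interpret A: ring A by fact
  interpret B: ring B by fact
  note fm = ring_hom_memE[OF f]
  have f0: "f \<zero>\<^bsub>A\<^esub> = \<zero>\<^bsub>B\<^esub>"
    by (rule additive_zero[where h = f, OF A.abelian_group_axioms B.abelian_group_axioms]) (use fm in auto)
  have c: "mat_map n f G \<in> carrier (mat_ring n B)" if "G \<in> carrier (mat_ring n A)" for G
    unfolding mat_map_def by (rule B.mat_closedI) (use fm(1) A.mat_entry_closed[OF that] in auto)
  have ent: "mat_map n f G (i, j) = f (G (i, j))" if "i < n" "j < n" for G i j
    using that by (simp add: mat_map_def)
  show ?thesis
  proof (rule ring_hom_memI)
    fix G H assume GH: "G \<in> carrier (mat_ring n A)" "H \<in> carrier (mat_ring n A)"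
    note e = A.mat_entry_closed[OF GH(1)] A.mat_entry_closed[OF GH(2)]
    show "mat_map n f (G \<otimes>\<^bsub>mat_ring n A\<^esub> H) = mat_map n f G \<otimes>\<^bsub>mat_ring n B\<^esub> mat_map n f H"
    proof (rule B.mat_eqI[where n = n])
      fix i j assume ij: "i < n" "j < n"
      have "f (psum A (\<lambda>k. G (i, k) \<otimes>\<^bsub>A\<^esub> H (k, j)) n) = psum B (\<lambda>k. f (G (i, k) \<otimes>\<^bsub>A\<^esub> H (k, j))) n"
        by (rule additive_psum[where h = f, OF A.abelian_group_axioms f0]) (use fm(3) e ij in auto)
      also have "\<dots> = psum B (\<lambda>k. mat_map n f G (i, k) \<otimes>\<^bsub>B\<^esub> mat_map n f H (k, j)) n"
        by (rule psum_cong) (simp add: ent ij fm(2) e)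
      finally show "mat_map n f (G \<otimes>\<^bsub>mat_ring n A\<^esub> H) (i, j) = (mat_map n f G \<otimes>\<^bsub>mat_ring n B\<^esub> mat_map n f H) (i, j)"
        by (simp add: ent ij A.mat_mult[OF GH ij] B.mat_mult[OF c c ij] GH)
    qed (use c A.mat_mult_closed B.mat_mult_closed GH in auto)
    show "mat_map n f (G \<oplus>\<^bsub>mat_ring n A\<^esub> H) = mat_map n f G \<oplus>\<^bsub>mat_ring n B\<^esub> mat_map n f H"
      by (rule B.mat_eqI[where n = n])
        (use c A.mat_add_closed B.mat_add_closed GH fm(3) e in \<open>auto simp: ent A.mat_add B.mat_add\<close>)
  next
    show "mat_map n f \<one>\<^bsub>mat_ring n A\<^esub> = \<one>\<^bsub>mat_ring n B\<^esub>"
      by (rule B.mat_eqI[where n = n])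
        (use c A.mat_one_closed B.mat_one_closed fm(4) f0 in \<open>auto simp: ent A.mat_one B.mat_one\<close>)
  qed (rule c)
qed

text \<open>The products of \<open>mat_ring n D\<close> and \<open>M n\<close> are sums over
  different carriers; they agree because both reduce to \<open>psum\<close>.\<close>

lemma (in complete_filtered_ring) ring_hom_nonneg_mat:
  assumes h: "h \<in> ring_hom Q (M n)"
    and Op: "Op \<subseteq> carrier Q" "\<And>q i j. q \<in> Op \<Longrightarrow> i < n \<Longrightarrow> j < n \<Longrightarrow> h q (i, j) \<in> nonneg"
  shows "h \<in> ring_hom (Q\<lparr>carrier := Op\<rparr>) (mat_ring n D)"
proof -
  interpret D: ring D using subring_is_ring[OF subring_nonneg] .
  note hm = ring_hom_memE[OF h]
  have c: "h q \<in> carrier (mat_ring n D)" if "q \<in> Op" for q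
    using hm(1)[of q] Op that by (auto simp: mat_ring_def PiE_iff)
  show ?thesis
  proof (rule ring_hom_memI)
    fix x y assume "x \<in> carrier (Q\<lparr>carrier := Op\<rparr>)" "y \<in> carrier (Q\<lparr>carrier := Op\<rparr>)"
    then have xy: "x \<in> Op" "y \<in> Op" and xyQ: "x \<in> carrier Q" "y \<in> carrier Q" using Op(1) by auto
    note cR = hm(1)[OF xyQ(1)] hm(1)[OF xyQ(2)]
    have "h x \<otimes>\<^bsub>M n\<^esub> h y = h x \<otimes>\<^bsub>mat_ring n D\<^esub> h y"
    proof (rule mat_eqI[where n = n])
      have "nonneg \<subseteq> carrier R" by (auto simp: nonneg_def)
      then show "h x \<otimes>\<^bsub>mat_ring n D\<^esub> h y \<in> carrier (M n)"
        using D.mat_mult_closed[OF c[OF xy(1)] c[OF xy(2)]]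
        by (auto simp: mat_ring_def[of n D] mat_ring_def[of n R] PiE_iff)
      fix i j assume ij: "i < n" "j < n"
      show "(h x \<otimes>\<^bsub>M n\<^esub> h y) (i, j) = (h x \<otimes>\<^bsub>mat_ring n D\<^esub> h y) (i, j)"
        unfolding mat_mult[OF cR ij] D.mat_mult[OF c[OF xy(1)] c[OF xy(2)] ij] psum_carrier_update by simp
    qed (rule mat_mult_closed[OF cR])
    then show "h (x \<otimes>\<^bsub>Q\<lparr>carrier := Op\<rparr>\<^esub> y) = h x \<otimes>\<^bsub>mat_ring n D\<^esub> h y" using hm(2)[OF xyQ] by simp
    show "h (x \<oplus>\<^bsub>Q\<lparr>carrier := Op\<rparr>\<^esub> y) = h x \<oplus>\<^bsub>mat_ring n D\<^esub> h y"
      using hm(3)[OF xyQ] by (simp add: mat_ring_def)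
  qed (use c hm(4) in \<open>auto simp: mat_ring_def\<close>)
qed

text \<open>Checking multiplicativity of \<open>\<Theta>\<close> on coefficients would mean
  comparing limits of double sums. Instead the universal property provides a homomorphism sending
  \<open>x\<close> to the scalar matrix of the variable, and \<open>\<Theta>\<close> is identified
  with it. Bijectivity is then seen on coefficients and entries.\<close>

lemma (in complete_filtered_ring) power_series_matrix_iso:
  fixes \<sigma> \<delta> :: "'q \<Rightarrow> 'q" and \<tau> \<theta> :: "'a \<Rightarrow> 'a"
  assumes n: "1 \<le> n" and Q: "ring Q" and h: "h \<in> ring_iso Q (M n)"
    and vQ: "vQ = (\<lambda>q. mat_filtration n v (h q))"
    and Op: "Op = Q\<lparr>carrier := complete_filtered_ring.nonneg Q vQ\<rparr>"
    and \<sigma>: "skew_derivation Q \<sigma> \<delta>" "skew_compatible Q vQ \<sigma> \<delta>"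
    and \<tau>: "skew_derivation R \<tau> \<theta>" "skew_compatible R v \<tau> \<theta>"
    and h\<sigma>: "\<And>q. q \<in> carrier Q \<Longrightarrow> h (\<sigma> q) = mat_map n \<tau> (h q)"
    and h\<delta>: "\<And>q. q \<in> carrier Q \<Longrightarrow> h (\<delta> q) = mat_map n \<theta> (h q)"
  defines "P \<equiv> skew_ps_ring D v \<tau> \<theta>" and "S \<equiv> skew_ps_ring Op vQ \<sigma> \<delta>"
  defines "\<Theta> \<equiv> (\<lambda>s. \<lambda>p\<in>{..<n} \<times> {..<n}. \<lambda>i. h (s i) p)"
  shows "\<Theta> \<in> ring_iso S (mat_ring n P)"
    and "\<And>s. s \<in> carrier S \<Longrightarrow> mat_filtration n (ps_filtration v) (\<Theta> s) = ps_filtration vQ s"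
    and "filtered_ring S (ps_filtration vQ)"
    and "filtered_ring (mat_ring n P) (mat_filtration n (ps_filtration v))"
proof -
  note iso = ring_iso_memE[OF h]
  interpret Mn: complete_filtered_ring "M n" "mat_filtration n v"
    by (rule complete_filtered_ring_mat[OF complete_filtered_ring_axioms n])
  interpret Q: complete_filtered_ring Q vQ
    unfolding vQ by (rule complete_filtered_ring_pullback[OF Mn.complete_filtered_ring_axioms Q h])
  interpret CO: skew_chain_ring Op Q.vL vQ \<sigma> \<delta>
    unfolding Op by (rule Q.skew_chain_ring_nonneg[OF \<sigma>])
  interpret CD: skew_chain_ring D vL v \<tau> \<theta> by (rule skew_chain_ring_nonneg[OF \<tau>])
  have Oc: "carrier Op = Q.nonneg" by (simp add: Op)
  have OQ: "q \<in> carrier Q" if "q \<in> carrier Op" for q using that by (simp add: Oc Q.nonneg_def)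
  have vO: "vQ q = \<infinity> \<or> (\<exists>k::nat. vQ q = ereal (real k))" if "q \<in> carrier Op" for q
    using that Q.v_nat by (simp add: Oc Q.nonneg_def)
  have vD: "v c = \<infinity> \<or> (\<exists>k::nat. v c = ereal (real k))" if "c \<in> carrier D" for c
    using that v_nat by (simp add: nonneg_def)
  have oneO: "vQ \<one>\<^bsub>Op\<^esub> = 0" "v \<one>\<^bsub>D\<^esub> = 0" by (simp_all add: Op)
  have CS: "complete_filtered_ring S (ps_filtration vQ)"
    "\<And>s k. s \<in> CO.SL k \<longleftrightarrow> s \<in> carrier S \<and> ereal (real k) \<le> ps_filtration vQ s"
    "\<And>s. s \<in> carrier S \<Longrightarrow> ps_filtration vQ s = \<infinity> \<or> (\<exists>k::nat. ps_filtration vQ s = ereal (real k))"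
    unfolding S_def by (rule CO.complete_filtered_ring_S[OF oneO(1)], erule vO, assumption?)+
  have CP: "complete_filtered_ring P (ps_filtration v)"
    "\<And>s k. s \<in> CD.SL k \<longleftrightarrow> s \<in> carrier P \<and> ereal (real k) \<le> ps_filtration v s"
    "\<And>s. s \<in> carrier P \<Longrightarrow> ps_filtration v s = \<infinity> \<or> (\<exists>k::nat. ps_filtration v s = ereal (real k))"
    unfolding P_def by (rule CD.complete_filtered_ring_S[OF oneO(2)], erule vD, assumption?)+
  interpret S: complete_filtered_ring S "ps_filtration vQ" by (rule CS(1))
  interpret P: complete_filtered_ring P "ps_filtration v" by (rule CP(1))
  define T where "T = mat_ring n P"
  let ?w = "mat_filtration n (ps_filtration v)"
  interpret T: complete_filtered_ring T ?w
    unfolding T_def by (rule complete_filtered_ring_mat[OF P.complete_filtered_ring_axioms n])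
  have Tent: "A (i, j) \<in> carrier P" if "A \<in> carrier T" "i < n" "j < n" for A i j
    using P.mat_entry_closed that unfolding T_def by blast
  have wT: "c \<le> ?w A \<longleftrightarrow> (\<forall>i<n. \<forall>j<n. c \<le> ps_filtration v (A (i, j)))" for c A
    by (rule le_mat_filtration_iff[OF n])
  \<comment> \<open>Series over \<open>D\<close> have values at least \<open>0\<close>, so
    \<open>nonneg\<close> is all of \<open>T\<close>, and \<open>chain_ring_nonneg\<close> provides
    a chain on \<open>T\<close> itself.\<close>
  have pos: "0 \<le> ?w A" if "A \<in> carrier T" for A
  proof -
    have "0 \<le> ps_filtration v (A (i, j))" if "i < n" "j < n" for i j
      using CP(3)[OF Tent[OF \<open>A \<in> carrier T\<close> that]] by auto
    then show ?thesis unfolding wT by blast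
  qed
  then have "T.nonneg = carrier T" by (auto simp: T.nonneg_def)
  then have "T\<lparr>carrier := T.nonneg\<rparr> = T" by simp
  then interpret CT: chain_ring T T.vL using T.chain_ring_nonneg by simp
  interpret CPs: chain_ring P CD.SL unfolding P_def by (rule CD.chain_ring_S)
  have TL: "A \<in> T.vL k \<longleftrightarrow> A \<in> carrier T \<and> (\<forall>i<n. \<forall>j<n. A (i, j) \<in> CD.SL k)" for A k
    using CP(2) Tent by (auto simp: T.vL_def wT)
  have vQle: "c \<le> vQ q \<longleftrightarrow> (\<forall>i<n. \<forall>j<n. c \<le> v (h q (i, j)))" for c q
    unfolding vQ by (rule le_mat_filtration_iff[OF n])
  have OL: "q \<in> Q.vL k \<longleftrightarrow> q \<in> carrier Q \<and> (\<forall>i<n. \<forall>j<n. h q (i, j) \<in> vL k)" for q k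
    using mat_entry_closed[OF iso(1)] unfolding Q.vL_def vL_def by (auto simp: vQle)
  have hent: "h q (i, j) \<in> carrier D" if "q \<in> carrier Op" "i < n" "j < n" for q i j
    using that OL[of q 0] CO.L_0 CD.L_0 by auto
  define g where "g = mat_map n (ps_const D) \<circ> h"
  have hD: "h \<in> ring_hom Op (mat_ring n D)"
    unfolding Op by (rule ring_hom_nonneg_mat)
      (use h hent in \<open>auto simp: ring_iso_def Op Q.nonneg_def\<close>)
  have g: "g \<in> ring_hom Op T"
    unfolding T_def g_def
    by (rule ring_hom_trans[OF hD mat_map_ring_hom[OF CD.ring_axioms P.ring_axioms CD.ps_const_ring_hom[folded P_def]]])
  have gent: "g q (i, j) = ps_const D (h q (i, j))" if "i < n" "j < n" for q i j
    using that by (simp add: g_def mat_map_def)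
  define y where "y = scalar_mat n P (ps_var D)"
  note varc = CD.var_closed[folded P_def]
  have yc: "y \<in> carrier T" unfolding y_def T_def by (rule P.sc_closed[OF varc])
  have yL: "y \<in> T.vL 1"
    unfolding TL using yc CD.var_SL by (auto simp: y_def P.sc_entry)
  have gL: "g q \<in> T.vL k" if "q \<in> Q.vL k" for q k
  proof -
    have "q \<in> carrier Op" using CO.L_carrier[OF that] .
    then show ?thesis
      unfolding TL using ring_hom_memE(1)[OF g] that OL CD.const_SL by (auto simp: gent)
  qed
  note constP = CD.const_closed[folded P_def]
  \<comment> \<open>At each entry this is the commutation rule of \<open>P\<close>, because
    \<open>h\<close> turns \<open>\<sigma>\<close> and \<open>\<delta>\<close> into the entrywise
    maps of \<open>\<tau>\<close> and \<open>\<theta>\<close>.\<close>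
  have yg: "y \<otimes>\<^bsub>T\<^esub> g q = g (\<sigma> q) \<otimes>\<^bsub>T\<^esub> y \<oplus>\<^bsub>T\<^esub> g (\<delta> q)" if q: "q \<in> carrier Op" for q
  proof (rule P.mat_eqI[where n = n, folded T_def])
    have c: "g q \<in> carrier T" "g (\<sigma> q) \<in> carrier T" "g (\<delta> q) \<in> carrier T"
      using ring_hom_memE(1)[OF g] q CO.sig_closed CO.del_closed by auto
    then show "y \<otimes>\<^bsub>T\<^esub> g q \<in> carrier T" "g (\<sigma> q) \<otimes>\<^bsub>T\<^esub> y \<oplus>\<^bsub>T\<^esub> g (\<delta> q) \<in> carrier T"
      using yc by auto
    fix i j assume ij: "i < n" "j < n"
    have "(y \<otimes>\<^bsub>T\<^esub> g q) (i, j) = ps_var D \<otimes>\<^bsub>P\<^esub> ps_const D (h q (i, j))"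
      unfolding y_def T_def P.sc_mult(1)[OF c(1)[unfolded T_def] varc ij] gent[OF ij] ..
    also have "\<dots> = ps_const D (\<tau> (h q (i, j))) \<otimes>\<^bsub>P\<^esub> ps_var D \<oplus>\<^bsub>P\<^esub> ps_const D (\<theta> (h q (i, j)))"
      unfolding P_def by (rule CD.var_const[OF hent[OF q ij]])
    also have "\<tau> (h q (i, j)) = h (\<sigma> q) (i, j)" unfolding h\<sigma>[OF OQ[OF q]] using ij by (simp add: mat_map_def)
    also have "\<theta> (h q (i, j)) = h (\<delta> q) (i, j)" unfolding h\<delta>[OF OQ[OF q]] using ij by (simp add: mat_map_def)
    also have "ps_const D (h (\<sigma> q) (i, j)) \<otimes>\<^bsub>P\<^esub> ps_var D \<oplus>\<^bsub>P\<^esub> ps_const D (h (\<delta> q) (i, j))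
        = (g (\<sigma> q) \<otimes>\<^bsub>T\<^esub> y \<oplus>\<^bsub>T\<^esub> g (\<delta> q)) (i, j)"
      unfolding T_def P.mat_add[OF ij] y_def P.sc_mult(2)[OF c(2)[unfolded T_def] varc ij] gent[OF ij] ..
    finally show "(y \<otimes>\<^bsub>T\<^esub> g q) (i, j) = (g (\<sigma> q) \<otimes>\<^bsub>T\<^esub> y \<oplus>\<^bsub>T\<^esub> g (\<delta> q)) (i, j)" .
  qed
  have "\<exists>\<Phi>. \<Phi> \<in> ring_hom S T \<and> (\<forall>s\<in>carrier S. \<Phi> s = CT.tsum (\<lambda>i. g (s i) \<otimes>\<^bsub>T\<^esub> y [^]\<^bsub>T\<^esub> i))"
  proof (rule CO.ps_hom_exists[OF CT.chain_ring_axioms g gL yL yg, folded S_def])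
    fix \<Phi>
    assume "\<Phi> \<in> ring_hom S T" "\<And>s. s \<in> carrier S \<Longrightarrow> \<Phi> s = CT.tsum (\<lambda>i. g (s i) \<otimes>\<^bsub>T\<^esub> y [^]\<^bsub>T\<^esub> i)"
    then show ?thesis by blast
  qed
  then obtain \<Phi> where \<Phi>: "\<Phi> \<in> ring_hom S T"
    "\<And>s. s \<in> carrier S \<Longrightarrow> \<Phi> s = CT.tsum (\<lambda>i. g (s i) \<otimes>\<^bsub>T\<^esub> y [^]\<^bsub>T\<^esub> i)"
    by blast
  have ypow: "y [^]\<^bsub>T\<^esub> i = scalar_mat n P (ps_monom D \<one>\<^bsub>D\<^esub> i)" for i :: nat
  proof (induction i)
    case 0
    have "ps_monom D \<one>\<^bsub>D\<^esub> 0 = \<one>\<^bsub>P\<^esub>" unfolding P_def CD.S_one ps_monom_def by simp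
    then show ?case unfolding T_def using P.sc_hom(3)[OF P.one_closed P.one_closed] by simp
  next
    case (Suc i)
    note mc = CD.monom_closed[OF CD.one_closed, folded P_def, of i]
    have "ps_var D \<otimes>\<^bsub>P\<^esub> ps_monom D \<one>\<^bsub>D\<^esub> i = ps_monom D \<one>\<^bsub>D\<^esub> (Suc i)"
      unfolding P_def CD.var_mult[OF CD.monom_closed[OF CD.one_closed]]
      by (auto simp: fun_eq_iff ps_monom_def CD.shift_def CD.sig_zero[simplified] CD.del_zero[simplified]
          CD.sig_one[simplified] CD.del_one[simplified] split: nat.split)
    moreover have "y \<otimes>\<^bsub>T\<^esub> y [^]\<^bsub>T\<^esub> i = scalar_mat n P (ps_var D \<otimes>\<^bsub>P\<^esub> ps_monom D \<one>\<^bsub>D\<^esub> i)"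
      by (simp only: Suc) (simp only: y_def T_def P.sc_hom(1)[OF varc mc])
    ultimately have "y \<otimes>\<^bsub>T\<^esub> y [^]\<^bsub>T\<^esub> i = scalar_mat n P (ps_monom D \<one>\<^bsub>D\<^esub> (Suc i))" by simp
    then show ?case using T.nat_pow_Suc2[OF yc] by simp
  qed
  have hsc: "h (s i) (k, l) \<in> carrier D" if "s \<in> carrier S" "k < n" "l < n" for s i k l
    using that hent unfolding S_def CO.S_carrier by blast
  \<comment> \<open>Taking an entry is additive and respects the chains, so the entry
    \<open>(k, l)\<close> of \<open>\<Phi> s\<close> is the sum of the monomials with coefficients
    \<open>h (s i) (k, l)\<close>.\<close>
  have \<Theta>\<Phi>: "\<Theta> s = \<Phi> s" if s: "s \<in> carrier S" for s
  proof (rule P.mat_eqI[where n = n, folded T_def])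
    have sc: "s i \<in> carrier Op" for i using s unfolding S_def CO.S_carrier by blast
    show "\<Theta> s \<in> carrier T"
      unfolding \<Theta>_def T_def
    proof (rule P.mat_closedI)
      fix k l assume "k < n" "l < n"
      then show "(\<lambda>i. h (s i) (k, l)) \<in> carrier P"
        using hsc[OF s] unfolding P_def CD.S_carrier by blast
    qed
    show "\<Phi> s \<in> carrier T" by (rule ring_hom_memE(1)[OF \<Phi>(1) s])
    fix k l assume kl: "k < n" "l < n"
    have tc: "g (s i) \<otimes>\<^bsub>T\<^esub> y [^]\<^bsub>T\<^esub> i \<in> T.vL i" for i
    proof -
      have "y [^]\<^bsub>T\<^esub> i \<in> T.vL i"
      proof (induction i)
        case 0
        then show ?case using CT.L_0 by simp
      next
        case (Suc i)
        then show ?case using CT.mult_L[OF Suc yL] by simp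
      qed
      moreover have "g (s i) \<in> T.vL 0" using ring_hom_memE(1)[OF g sc] CT.L_0 by simp
      ultimately show ?thesis using CT.mult_L by fastforce
    qed
    have ti: "(g (s i) \<otimes>\<^bsub>T\<^esub> y [^]\<^bsub>T\<^esub> i) (k, l) = ps_monom D (h (s i) (k, l)) i" for i
    proof -
      note mc = CD.monom_closed[OF CD.one_closed, folded P_def, of i]
      note hc = hsc[OF s kl, of i]
      have gc: "g (s i) \<in> carrier (mat_ring n P)" using ring_hom_memE(1)[OF g sc] unfolding T_def .
      have "(g (s i) \<otimes>\<^bsub>T\<^esub> y [^]\<^bsub>T\<^esub> i) (k, l) = ps_const D (h (s i) (k, l)) \<otimes>\<^bsub>P\<^esub> ps_monom D \<one>\<^bsub>D\<^esub> i"
        by (simp only: ypow) (simp only: T_def P.sc_mult(2)[OF gc mc kl] gent[OF kl])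
      also have "\<dots> = (\<lambda>j. h (s i) (k, l) \<otimes>\<^bsub>D\<^esub> ps_monom D \<one>\<^bsub>D\<^esub> i j)"
        unfolding P_def by (rule CD.const_mult[OF hc mc[unfolded P_def]])
      also have "\<dots> = ps_monom D (h (s i) (k, l)) i"
        using CD.r_one[OF hc] CD.r_null[OF hc] by (auto simp: ps_monom_def fun_eq_iff)
      finally show ?thesis .
    qed
    have "\<Phi> s (k, l) = CPs.tsum (\<lambda>i. (g (s i) \<otimes>\<^bsub>T\<^esub> y [^]\<^bsub>T\<^esub> i) (k, l))"
      unfolding \<Phi>(2)[OF s]
    proof (rule CT.additive_tsum[where h = "\<lambda>A. A (k, l)", OF CPs.chain_group_axioms _ _ _ tc])
      show "A \<in> carrier T \<Longrightarrow> A (k, l) \<in> carrier P" for A using Tent kl by blast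
      show "(A \<oplus>\<^bsub>T\<^esub> B) (k, l) = A (k, l) \<oplus>\<^bsub>P\<^esub> B (k, l)" for A B unfolding T_def by (rule P.mat_add[OF kl])
      show "A \<in> T.vL i \<Longrightarrow> A (k, l) \<in> CD.SL i" for A i using TL kl by blast
    qed
    also have "\<dots> = (\<lambda>i. h (s i) (k, l))"
      unfolding ti P_def by (rule CD.tsum_monom[of "\<lambda>i. h (s i) (k, l)"])
        (use hsc[OF s kl] in \<open>simp only: CD.S_carrier, blast\<close>)
    finally show "\<Theta> s (k, l) = \<Phi> s (k, l)" using kl by (simp add: \<Theta>_def)
  qed
  have hom: "\<Theta> \<in> ring_hom S T"
    by (rule ring_hom_memI; use \<Theta>\<Phi> ring_hom_memE[OF \<Phi>(1)] S.m_closed S.a_closed S.one_closed in simp)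
  have inj: "q = q'" if "q \<in> carrier Q" "q' \<in> carrier Q" "h q = h q'" for q q'
    using iso(5) that by (auto simp: bij_betw_def inj_on_def)
  have "inj_on \<Theta> (carrier S)"
  proof (rule inj_onI)
    fix s r assume s: "s \<in> carrier S" and r: "r \<in> carrier S" and eq: "\<Theta> s = \<Theta> r"
    have sc: "s i \<in> carrier Q" "r i \<in> carrier Q" for i
      using s r OQ unfolding S_def CO.S_carrier by blast+
    show "s = r"
    proof
      fix i
      have "h (s i) (k, l) = h (r i) (k, l)" if "k < n" "l < n" for k l
      proof -
        have "\<Theta> s (k, l) i = \<Theta> r (k, l) i" using eq by simp
        then show ?thesis using that by (simp add: \<Theta>_def)
      qed
      then have "h (s i) = h (r i)" by (intro mat_eqI[where n = n] iso(1) sc) auto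
      then show "s i = r i" using inj sc by blast
    qed
  qed
  moreover have "A \<in> \<Theta> ` carrier S" if A: "A \<in> carrier T" for A
  proof -
    \<comment> \<open>The coefficients at \<open>i\<close> of all entries form a matrix over
      \<open>D\<close>; its preimage under \<open>h\<close> has value at least
      \<open>0\<close>.\<close>
    have "\<exists>q. q \<in> carrier Op \<and> (\<forall>k<n. \<forall>l<n. h q (k, l) = A (k, l) i)" for i
    proof -
      define B where "B = (\<lambda>p\<in>{..<n} \<times> {..<n}. A p i)"
      have An: "A (k, l) i \<in> nonneg" if "k < n" "l < n" for k l
        using Tent[OF A that] unfolding P_def CD.S_carrier by simp
      then have B: "B \<in> carrier (M n)"
        unfolding B_def by (intro mat_closedI) (auto simp: nonneg_def)
      then have "B \<in> h ` carrier Q" using iso(5) by (simp add: bij_betw_def)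
      then obtain q where q: "q \<in> carrier Q" "h q = B" by auto
      have "0 \<le> vQ q"
        unfolding vQle q(2) using An by (auto simp: B_def nonneg_def)
      then have "q \<in> carrier Op" using q by (simp add: Oc Q.nonneg_def)
      then show ?thesis using q(2) by (auto simp: B_def)
    qed
    then obtain s where s: "\<And>i. s i \<in> carrier Op" "\<And>i k l. k < n \<Longrightarrow> l < n \<Longrightarrow> h (s i) (k, l) = A (k, l) i"
      by metis
    have sS: "s \<in> carrier S" unfolding S_def CO.S_carrier using s(1) by blast
    have "\<Theta> s = A"
      by (rule P.mat_eqI[where n = n, folded T_def])
        (use A ring_hom_memE(1)[OF hom sS] s(2) in \<open>auto simp: \<Theta>_def\<close>)
    then show ?thesis using sS by blast
  qed
  ultimately have "bij_betw \<Theta> (carrier S) (carrier T)"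
    unfolding bij_betw_def using ring_hom_memE(1)[OF hom] by blast
  then show "\<Theta> \<in> ring_iso S (mat_ring n P)" using hom by (simp add: ring_iso_def T_def)
  show "?w (\<Theta> s) = ps_filtration vQ s" if s: "s \<in> carrier S" for s
  proof (rule nat_valued_eqI)
    have \<Theta>c: "\<Theta> s \<in> carrier T" by (rule ring_hom_memE(1)[OF hom s])
    show "?w (\<Theta> s) = \<infinity> \<or> (\<exists>k::nat. ?w (\<Theta> s) = ereal (real k))" by (rule T.v_nat[OF \<Theta>c pos[OF \<Theta>c]])
    show "ps_filtration vQ s = \<infinity> \<or> (\<exists>k::nat. ps_filtration vQ s = ereal (real k))" by (rule CS(3)[OF s])
    fix k
    have sc: "s i \<in> carrier Q" for i using s OQ unfolding S_def CO.S_carrier by blast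
    \<comment> \<open>Both filtrations are bounds over entries and degrees; comparing thresholds
      only exchanges the two quantifiers.\<close>
    have "ereal (real k) \<le> ?w (\<Theta> s) \<longleftrightarrow> \<Theta> s \<in> T.vL k" using \<Theta>c by (simp add: T.vL_def)
    also have "\<dots> \<longleftrightarrow> (\<forall>i<n. \<forall>j<n. \<forall>m. h (s m) (i, j) \<in> vL (k - m))"
      unfolding TL CD.SL_def using \<Theta>c by (simp add: \<Theta>_def)
    also have "\<dots> \<longleftrightarrow> (\<forall>m. s m \<in> Q.vL (k - m))" unfolding OL using sc by blast
    also have "\<dots> \<longleftrightarrow> s \<in> CO.SL k" unfolding CO.SL_def by simp
    also have "\<dots> \<longleftrightarrow> ereal (real k) \<le> ps_filtration vQ s" using CS(2) s by simp
    finally show "ereal (real k) \<le> ?w (\<Theta> s) \<longleftrightarrow> ereal (real k) \<le> ps_filtration vQ s" .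
  qed
  show "filtered_ring S (ps_filtration vQ)"
    unfolding filtered_ring_def using S.ring_axioms S.filt by blast
  show "filtered_ring (mat_ring n P) ?w"
    unfolding filtered_ring_def T_def[symmetric] using T.ring_axioms T.filt by blast
qed

text \<open>The inverse is the geometric series of \<open>z\<close>, which converges because
  \<open>z^i\<close> lies in \<open>L i\<close>.\<close>

lemma (in chain_ring) left_inverse_one_minus:
  assumes z: "z \<in> L 1"
  shows "\<exists>y\<in>carrier R. y \<otimes> (\<one> \<ominus> z) = \<one>"
proof -
  have zc: "z \<in> carrier R" using L_carrier z .
  have zL: "z [^] i \<in> L i" for i :: nat
  proof (induction i)
    case (Suc i)
    then show ?case using mult_L[OF Suc z] by simp
  qed (simp add: L_0)
  let ?y = "tsum (\<lambda>i. z [^] i)"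
  have y: "?y \<in> carrier R" using zL by (rule tsum_closed)
  have geom: "psum R (\<lambda>i. z [^] i) n \<otimes> (\<one> \<ominus> z) = \<one> \<ominus> z [^] n" for n
  proof (induction n)
    case (Suc n)
    have c: "psum R (\<lambda>i. z [^] i) n \<in> carrier R" using zc by simp
    have e: "z [^] n \<otimes> (\<one> \<ominus> z) = z [^] n \<ominus> z [^] Suc n"
      using zc by (simp add: a_minus_def r_distr r_minus)
    have "psum R (\<lambda>i. z [^] i) (Suc n) \<otimes> (\<one> \<ominus> z) = (\<one> \<ominus> z [^] n) \<oplus> (z [^] n \<ominus> z [^] Suc n)"
      using c zc Suc e by (simp add: l_distr)
    also have "\<dots> = \<one> \<ominus> z [^] Suc n"
      by (rule minus_trans[symmetric]) (use zc in auto)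
    finally show ?case .
  qed (use zc in simp)
  \<comment> \<open>The partial sum of length \<open>n\<close> times \<open>1 - z\<close> is
    \<open>1 - z^n\<close>, which is \<open>1\<close> modulo \<open>L n\<close>.\<close>
  have "?y \<otimes> (\<one> \<ominus> z) = \<one>"
  proof (rule cg_eqI)
    fix n
    let ?p = "psum R (\<lambda>i. z [^] i) n"
    have p: "?p \<in> carrier R" using zc by simp
    have "?p \<ominus> ?y \<in> L n" using cg_tsum[of "\<lambda>i. z [^] i" n, OF zL] by (simp add: cg_def)
    then have "(?p \<ominus> ?y) \<otimes> (\<one> \<ominus> z) \<in> L n"
      using mult_L[of "?p \<ominus> ?y" n "\<one> \<ominus> z" 0] zc L_0 by simp
    moreover have "(?p \<ominus> ?y) \<otimes> (\<one> \<ominus> z) = (?p \<otimes> (\<one> \<ominus> z)) \<ominus> (?y \<otimes> (\<one> \<ominus> z))"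
      using p y zc by (simp add: a_minus_def l_distr l_minus)
    ultimately have 1: "cg n (\<one> \<ominus> z [^] n) (?y \<otimes> (\<one> \<ominus> z))"
      unfolding cg_def geom using y zc by simp
    have "cg n (\<one> \<ominus> z [^] n) (\<one> \<ominus> \<zero>)"
      unfolding a_minus_def using cg_add[OF cg_refl[OF one_closed], of n "\<ominus> (z [^] n)" "\<ominus> \<zero>"]
        neg_L[OF zL[of n]] zc by (simp add: cg_def)
    then have 2: "cg n (\<one> \<ominus> z [^] n) \<one>" by simp
    show "cg n (?y \<otimes> (\<one> \<ominus> z)) \<one>" using cg_trans[OF cg_sym[OF 1] 2] .
  qed
  then show ?thesis using y by blast
qed

text \<open>If a maximal left ideal \<open>I\<close> missed \<open>t\<close>, then
  \<open>1 = x + r t\<close> with \<open>x\<close> in \<open>I\<close>. But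
  \<open>x = 1 - r t\<close> has a left inverse, so \<open>I\<close> would contain
  \<open>1\<close>.\<close>

lemma (in chain_ring) L_1_jacobson:
  assumes t: "t \<in> L 1"
  shows "t \<in> jacobson_radical R"
proof -
  have tc: "t \<in> carrier R" using L_carrier t .
  have "t \<in> I" if max: "maximal_left_ideal I R" for I
  proof (rule ccontr)
    assume tI: "t \<notin> I"
    have I: "left_ideal I R" and InR: "I \<noteq> carrier R" using max by (auto simp: maximal_left_ideal_def)
    interpret I: additive_subgroup I R using I by (simp add: left_ideal_def)
    have IR: "x \<in> carrier R" if "x \<in> I" for x using I.a_subset that by blast
    have Imult: "r \<otimes> x \<in> I" if "r \<in> carrier R" "x \<in> I" for r x using I that by (simp add: left_ideal_def)
    \<comment> \<open>The left ideal generated by \<open>I\<close> and \<open>t\<close>.\<close>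
    define K where "K = {x \<oplus> r \<otimes> t | x r. x \<in> I \<and> r \<in> carrier R}"
    have KI: "x \<oplus> r \<otimes> t \<in> K" if "x \<in> I" "r \<in> carrier R" for x r using that by (auto simp: K_def)
    have KE: "\<exists>x r. k = x \<oplus> r \<otimes> t \<and> x \<in> I \<and> r \<in> carrier R" if "k \<in> K" for k using that by (simp add: K_def)
    have KR: "K \<subseteq> carrier R" using IR tc by (auto simp: K_def)
    have "left_ideal K R"
      unfolding left_ideal_def
    proof (intro conjI ballI)
      show "additive_subgroup K R"
      proof (rule additive_subgroupI, unfold_locales)
        show "K \<subseteq> carrier (add_monoid R)" using KR by simp
        show "\<one>\<^bsub>add_monoid R\<^esub> \<in> K" using KI[OF I.zero_closed zero_closed] tc by simp
      next
        fix p q assume p: "p \<in> K" and q: "q \<in> K"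
        obtain x r where p: "p = x \<oplus> r \<otimes> t" "x \<in> I" "r \<in> carrier R" using KE[OF p] by blast
        obtain y s where q: "q = y \<oplus> s \<otimes> t" "y \<in> I" "s \<in> carrier R" using KE[OF q] by blast
        have "p \<oplus> q = (x \<oplus> y) \<oplus> (r \<oplus> s) \<otimes> t" using p q IR tc by (simp add: l_distr a_ac)
        then show "p \<otimes>\<^bsub>add_monoid R\<^esub> q \<in> K" using KI[of "x \<oplus> y" "r \<oplus> s"] p q by simp
      next
        fix p assume p: "p \<in> K"
        obtain x r where p: "p = x \<oplus> r \<otimes> t" "x \<in> I" "r \<in> carrier R" using KE[OF p] by blast
        have "\<ominus> p = \<ominus> x \<oplus> (\<ominus> r) \<otimes> t" using p IR tc by (simp add: minus_add l_minus)
        then show "inv\<^bsub>add_monoid R\<^esub> p \<in> K" using KI[of "\<ominus> x" "\<ominus> r"] I.a_inv_closed[OF p(2)] p by (simp add: a_inv_def)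
      qed
      fix s p assume s: "s \<in> carrier R" and p: "p \<in> K"
      obtain x r where p: "p = x \<oplus> r \<otimes> t" "x \<in> I" "r \<in> carrier R" using KE[OF p] by blast
      have "s \<otimes> p = s \<otimes> x \<oplus> (s \<otimes> r) \<otimes> t" using s p IR tc by (simp add: r_distr m_assoc)
      then show "s \<otimes> p \<in> K" using KI[of "s \<otimes> x" "s \<otimes> r"] Imult s p by simp
    qed
    moreover have "I \<subseteq> K"
    proof
      fix x assume x: "x \<in> I"
      show "x \<in> K" using KI[OF x zero_closed] IR[OF x] tc by simp
    qed
    moreover have "t \<in> K" using KI[OF I.zero_closed one_closed] tc by simp
    ultimately have "K = carrier R" using max tI unfolding maximal_left_ideal_def by blast
    then obtain x r where x: "\<one> = x \<oplus> r \<otimes> t" "x \<in> I" "r \<in> carrier R" using KE[of \<one>] by auto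
    have "x = \<one> \<ominus> r \<otimes> t"
      unfolding x(1) using IR[OF x(2)] x(3) tc by (simp add: a_minus_def a_assoc r_neg)
    moreover have "r \<otimes> t \<in> L 1" using mult_L[of r 0 t 1] x(3) t L_0 by simp
    ultimately obtain y where y: "y \<in> carrier R" "y \<otimes> x = \<one>"
      using left_inverse_one_minus by blast
    then have 1: "\<one> \<in> I" using Imult[OF y(1) x(2)] by simp
    have "z \<in> I" if "z \<in> carrier R" for z using Imult[OF that 1] that by simp
    then show False using InR IR by blast
  qed
  then show ?thesis using tc by (auto simp: jacobson_radical_def)
qed

section \<open>Transport along isomorphisms and the theorem over a general base ring\<close>

lemma skew_derivation_closed:
  assumes "skew_derivation R s d" "x \<in> carrier R"
  shows "s x \<in> carrier R" "d x \<in> carrier R"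
proof -
  have s: "s \<in> ring_iso R R" and d: "d \<in> carrier R \<rightarrow> carrier R"
    using assms(1) by (auto simp: skew_derivation_def)
  show "s x \<in> carrier R" by (rule ring_iso_memE(1)[OF s assms(2)])
  show "d x \<in> carrier R" using d assms(2) by auto
qed

text \<open>Used in both directions: from \<open>Q\<close> to matrices along \<open>h\<close>, and
  back along its inverse.\<close>

lemma skew_derivation_transport:
  assumes A: "ring A" and B: "ring B" and g: "g \<in> ring_iso A B"
    and g': "\<And>x. x \<in> carrier A \<Longrightarrow> g' (g x) = x" "\<And>y. y \<in> carrier B \<Longrightarrow> g' y \<in> carrier A"
      "\<And>y. y \<in> carrier B \<Longrightarrow> g (g' y) = y"
    and w: "\<And>x. x \<in> carrier A \<Longrightarrow> wB (g x) = wA x"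
    and s: "skew_derivation A s d" "skew_compatible A wA s d"
  shows "skew_derivation B (\<lambda>y. g (s (g' y))) (\<lambda>y. g (d (g' y)))"
    and "skew_compatible B wB (\<lambda>y. g (s (g' y))) (\<lambda>y. g (d (g' y)))"
proof -
  interpret A: ring A by fact
  interpret B: ring B by fact
  note gm = ring_iso_memE[OF g]
  note sd = s(1)[unfolded skew_derivation_def]
  note sm = ring_iso_memE[OF sd[THEN conjunct1]]
  have d: "d x \<in> carrier A" if "x \<in> carrier A" for x using sd that by auto
  have gI: "g x = y" if "x \<in> carrier A" "y \<in> carrier B" "x = g' y" for x y using g'(3) that by simp
  have g'I: "g' y = x" if "x \<in> carrier A" "g x = y" for x y using g'(1) that by auto
  have g'm: "g' (x \<otimes>\<^bsub>B\<^esub> y) = g' x \<otimes>\<^bsub>A\<^esub> g' y" "g' (x \<oplus>\<^bsub>B\<^esub> y) = g' x \<oplus>\<^bsub>A\<^esub> g' y"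
    if "x \<in> carrier B" "y \<in> carrier B" for x y
    by (rule g'I; use that g' gm in simp)+
  have g'1: "g' \<one>\<^bsub>B\<^esub> = \<one>\<^bsub>A\<^esub>" by (rule g'I) (use gm in auto)
  have g'0: "g' y \<noteq> \<zero>\<^bsub>A\<^esub>" if "y \<in> carrier B" "y \<noteq> \<zero>\<^bsub>B\<^esub>" for y
  proof
    assume "g' y = \<zero>\<^bsub>A\<^esub>"
    then have "y = g \<zero>\<^bsub>A\<^esub>" using g'(3)[OF that(1)] by simp
    also have "\<dots> = \<zero>\<^bsub>B\<^esub>"
      by (rule additive_zero[where h = g, OF A.abelian_group_axioms B.abelian_group_axioms]) (use gm in auto)
    finally show False using that by simp
  qed
  define s' where "s' = inv_into (carrier A) s"
  have s': "s' x \<in> carrier A" "s (s' x) = x" if "x \<in> carrier A" for x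
    using that sm(5) bij_betw_inv_into_right[OF sm(5)] bij_betwE[OF bij_betw_inv_into[OF sm(5)]]
    by (auto simp: s'_def)
  have s's: "s' (s x) = x" if "x \<in> carrier A" for x
    using that bij_betw_inv_into_left[OF sm(5)] by (simp add: s'_def)
  have bij: "bij_betw (\<lambda>y. g (s (g' y))) (carrier B) (carrier B)"
    by (rule bij_betw_byWitness[where f' = "\<lambda>y. g (s' (g' y))"])
      (use g' gm(1) sm(1) s' s's in auto)
  show "skew_derivation B (\<lambda>y. g (s (g' y))) (\<lambda>y. g (d (g' y)))"
    unfolding skew_derivation_def
  proof (intro conjI ballI)
    show "(\<lambda>y. g (s (g' y))) \<in> ring_iso B B"
      by (rule ring_iso_memI) (use bij g' gm sm in \<open>auto simp: g'm g'1\<close>)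
    show "(\<lambda>y. g (d (g' y))) \<in> carrier B \<rightarrow> carrier B" using g' gm d by auto
    fix x y assume xy: "x \<in> carrier B" "y \<in> carrier B"
    have c: "g' x \<in> carrier A" "g' y \<in> carrier A" using xy g' by auto
    have "d (g' x \<oplus>\<^bsub>A\<^esub> g' y) = d (g' x) \<oplus>\<^bsub>A\<^esub> d (g' y)" using sd c by blast
    then show "g (d (g' (x \<oplus>\<^bsub>B\<^esub> y))) = g (d (g' x)) \<oplus>\<^bsub>B\<^esub> g (d (g' y))"
      using c d gm(3) by (simp add: g'm xy)
    have "d (g' x \<otimes>\<^bsub>A\<^esub> g' y) = d (g' x) \<otimes>\<^bsub>A\<^esub> g' y \<oplus>\<^bsub>A\<^esub> s (g' x) \<otimes>\<^bsub>A\<^esub> d (g' y)" using sd c by blast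
    then show "g (d (g' (x \<otimes>\<^bsub>B\<^esub> y))) = g (d (g' x)) \<otimes>\<^bsub>B\<^esub> y \<oplus>\<^bsub>B\<^esub> g (s (g' x)) \<otimes>\<^bsub>B\<^esub> g (d (g' y))"
      using c d gm(2,3) sm(1) g'(3) by (simp add: g'm xy)
  qed
  show "skew_compatible B wB (\<lambda>y. g (s (g' y))) (\<lambda>y. g (d (g' y)))"
    unfolding skew_compatible_def
  proof (intro ballI)
    fix y assume "y \<in> carrier B - {\<zero>\<^bsub>B\<^esub>}"
    then have y: "y \<in> carrier B" "y \<noteq> \<zero>\<^bsub>B\<^esub>" by auto
    have "g' y \<in> carrier A - {\<zero>\<^bsub>A\<^esub>}" using g'0[OF y] g'(2)[OF y(1)] by blast
    then have "wA (s (g' y)) = wA (g' y) \<and> wA (g' y) < wA (d (g' y))"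
      using s(2) unfolding skew_compatible_def by blast
    then show "wB (g (s (g' y))) = wB y \<and> wB y < wB (g (d (g' y)))"
      using w[of "g' y"] w[OF sm(1)] w[OF d] g'(2,3)[OF y(1)] by simp
  qed
qed

text \<open>The theorem for a complete filtered base ring with the properties \<open>local\<close>
  and \<open>idem\<close>. The change of variable takes place over \<open>Op\<close>, towards the
  pair \<open>(\<sigma>', \<delta>')\<close> that corresponds under \<open>h\<close> to the
  entrywise pair; \<open>\<Theta>\<close> then only rearranges coefficients.\<close>

lemma (in complete_filtered_ring) matrix_skew_power_series:
  fixes \<sigma> \<delta> :: "'q \<Rightarrow> 'q"
  assumes n: "1 \<le> n" and Q: "ring Q" and h: "h \<in> ring_iso Q (M n)"
    and vQ: "vQ = (\<lambda>q. mat_filtration n v (h q))"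
    and Op: "Op = Q\<lparr>carrier := {q \<in> carrier Q. 0 \<le> vQ q}\<rparr>"
    and \<sigma>: "skew_derivation Q \<sigma> \<delta>" "skew_compatible Q vQ \<sigma> \<delta>"
    and local: "\<And>x. (\<And>k. k < n \<Longrightarrow> x k \<in> nonneg) \<Longrightarrow> psum R x n = \<one> \<Longrightarrow>
      \<exists>c d. (\<forall>k<n. c k \<in> nonneg \<and> (\<forall>y\<in>carrier R. c k \<otimes> y = y \<otimes> c k)) \<and>
        (\<forall>k<n. \<forall>l<n. c k \<otimes> c l = (if k = l then c k else \<zero>)) \<and>
        d \<in> nonneg \<and> psum R (\<lambda>k. c k \<otimes> x k) n \<otimes> d = \<one>"
    and idem: "\<And>g y. g \<in> nonneg \<Longrightarrow> g \<otimes> g = g \<Longrightarrow> y \<in> carrier R \<Longrightarrow> g \<otimes> y = y \<otimes> g"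
  shows "\<exists>\<tau> \<theta> \<phi> a t.
           skew_derivation R \<tau> \<theta> \<and> skew_compatible R v \<tau> \<theta> \<and>
           filtered_ring_iso
             (skew_ps_ring Op vQ \<sigma> \<delta>) (ps_filtration vQ)
             (mat_ring n (skew_ps_ring D v \<tau> \<theta>)) (mat_filtration n (ps_filtration v)) \<phi> \<and>
           (\<forall>r\<in>carrier Op. \<phi> (ps_const Op r) = mat_map n (ps_const D) (h r)) \<and>
           a \<in> Units Op \<and> t \<in> jacobson_radical Op \<and>
           \<phi> (ps_const Op a \<otimes>\<^bsub>skew_ps_ring Op vQ \<sigma> \<delta>\<^esub> ps_var Op
                \<ominus>\<^bsub>skew_ps_ring Op vQ \<sigma> \<delta>\<^esub> ps_const Op t)
             = scalar_mat n (skew_ps_ring D v \<tau> \<theta>) (ps_var D)"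
proof -
  let ?w = "mat_filtration n v"
  note iso = ring_iso_memE[OF h]
  interpret T: complete_filtered_ring "M n" ?w
    by (rule complete_filtered_ring_mat[OF complete_filtered_ring_axioms n])
  interpret Q: complete_filtered_ring Q vQ
    unfolding vQ by (rule complete_filtered_ring_pullback[OF T.complete_filtered_ring_axioms Q h])
  have Op: "Op = Q\<lparr>carrier := Q.nonneg\<rparr>" by (simp add: Op Q.nonneg_def)
  define j where "j = inv_into (carrier Q) h"
  have jh: "j (h q) = q" if "q \<in> carrier Q" for q
    using that bij_betw_inv_into_left[OF iso(5)] by (simp add: j_def)
  have jc: "j A \<in> carrier Q" and hj: "h (j A) = A" if "A \<in> carrier (M n)" for A
    using that bij_betw_inv_into_right[OF iso(5)] bij_betwE[OF bij_betw_inv_into[OF iso(5)]]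
    by (auto simp: j_def)
  have wh: "?w (h q) = vQ q" for q by (simp add: vQ)
  have inj: "q = q'" if "q \<in> carrier Q" "q' \<in> carrier Q" "h q = h q'" for q q'
    by (metis jh that)
  have jiso: "j \<in> ring_iso (M n) Q"
  proof (rule ring_iso_memI)
    show "bij_betw j (carrier (M n)) (carrier Q)" unfolding j_def by (rule bij_betw_inv_into[OF iso(5)])
    show "j \<one>\<^bsub>M n\<^esub> = \<one>\<^bsub>Q\<^esub>" by (rule inj) (use jc hj iso in auto)
    fix x y assume "x \<in> carrier (M n)" "y \<in> carrier (M n)"
    then show "j (x \<otimes>\<^bsub>M n\<^esub> y) = j x \<otimes>\<^bsub>Q\<^esub> j y" "j (x \<oplus>\<^bsub>M n\<^esub> y) = j x \<oplus>\<^bsub>Q\<^esub> j y"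
      using jc hj iso by (auto intro!: inj)
  qed (rule jc)
  have tr: "skew_derivation (M n) (\<lambda>A. h (\<sigma> (j A))) (\<lambda>A. h (\<delta> (j A)))"
    "skew_compatible (M n) ?w (\<lambda>A. h (\<sigma> (j A))) (\<lambda>A. h (\<delta> (j A)))"
    by (rule skew_derivation_transport[where g = h and g' = j and wA = vQ and wB = ?w];
        (fact Q T.ring_axioms h \<sigma> | simp add: jh jc hj wh))+
  have "\<exists>a1 b1 t1 \<tau> \<theta>. a1 \<in> carrier (M n) \<and> b1 \<in> carrier (M n) \<and> t1 \<in> carrier (M n) \<and>
    0 \<le> ?w a1 \<and> 0 \<le> ?w b1 \<and> 1 \<le> ?w t1 \<and> a1 \<otimes>\<^bsub>M n\<^esub> b1 = \<one>\<^bsub>M n\<^esub> \<and> b1 \<otimes>\<^bsub>M n\<^esub> a1 = \<one>\<^bsub>M n\<^esub> \<and>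
    skew_derivation R \<tau> \<theta> \<and> skew_compatible R v \<tau> \<theta> \<and>
    skew_derivation (M n) (mat_map n \<tau>) (mat_map n \<theta>) \<and> skew_compatible (M n) ?w (mat_map n \<tau>) (mat_map n \<theta>) \<and>
    (\<forall>A\<in>carrier (M n). mat_map n \<tau> A \<otimes>\<^bsub>M n\<^esub> a1 = a1 \<otimes>\<^bsub>M n\<^esub> h (\<sigma> (j A))) \<and>
    (\<forall>A\<in>carrier (M n). a1 \<otimes>\<^bsub>M n\<^esub> h (\<delta> (j A)) \<oplus>\<^bsub>M n\<^esub> mat_map n \<tau> A \<otimes>\<^bsub>M n\<^esub> t1
        = mat_map n \<theta> A \<oplus>\<^bsub>M n\<^esub> t1 \<otimes>\<^bsub>M n\<^esub> A)"
  proof (rule skew_derivation_entrywise[OF n tr], goal_cases)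
    case (1 x)
    then show ?case by (rule local)
  next
    case (2 g y)
    then show ?case by (rule idem)
  next
    case (3 a b t \<tau> \<theta>)
    show ?case
      by (rule exI[of _ a], rule exI[of _ b], rule exI[of _ t], rule exI[of _ \<tau>], rule exI[of _ \<theta>])
        (intro conjI ballI 3)
  qed
  then obtain a1 b1 t1 \<tau> \<theta> where ab1: "a1 \<in> carrier (M n)" "b1 \<in> carrier (M n)" "t1 \<in> carrier (M n)"
    "0 \<le> ?w a1" "0 \<le> ?w b1" "1 \<le> ?w t1" "a1 \<otimes>\<^bsub>M n\<^esub> b1 = \<one>\<^bsub>M n\<^esub>" "b1 \<otimes>\<^bsub>M n\<^esub> a1 = \<one>\<^bsub>M n\<^esub>"
    and \<tau>: "skew_derivation R \<tau> \<theta>" "skew_compatible R v \<tau> \<theta>"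
    and \<tau>n: "skew_derivation (M n) (mat_map n \<tau>) (mat_map n \<theta>)" "skew_compatible (M n) ?w (mat_map n \<tau>) (mat_map n \<theta>)"
    and conj: "\<And>A. A \<in> carrier (M n) \<Longrightarrow> mat_map n \<tau> A \<otimes>\<^bsub>M n\<^esub> a1 = a1 \<otimes>\<^bsub>M n\<^esub> h (\<sigma> (j A))"
    "\<And>A. A \<in> carrier (M n) \<Longrightarrow> a1 \<otimes>\<^bsub>M n\<^esub> h (\<delta> (j A)) \<oplus>\<^bsub>M n\<^esub> mat_map n \<tau> A \<otimes>\<^bsub>M n\<^esub> t1
        = mat_map n \<theta> A \<oplus>\<^bsub>M n\<^esub> t1 \<otimes>\<^bsub>M n\<^esub> A"
    by (elim exE conjE) (rule that; blast)
  define \<sigma>' where "\<sigma>' = (\<lambda>q. j (mat_map n \<tau> (h q)))"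
  define \<delta>' where "\<delta>' = (\<lambda>q. j (mat_map n \<theta> (h q)))"
  have wj: "vQ (j A) = ?w A" if "A \<in> carrier (M n)" for A using hj[OF that] by (simp add: vQ)
  have \<sigma>': "skew_derivation Q \<sigma>' \<delta>'" "skew_compatible Q vQ \<sigma>' \<delta>'"
    unfolding \<sigma>'_def \<delta>'_def
    by (rule skew_derivation_transport[where g = j and g' = h and wA = ?w and wB = vQ];
        (fact Q T.ring_axioms jiso \<tau>n | simp add: jh hj wj iso(1)))+
  have mc: "mat_map n \<tau> A \<in> carrier (M n)" "mat_map n \<theta> A \<in> carrier (M n)" if "A \<in> carrier (M n)" for A
    using skew_derivation_closed[OF \<tau>n(1) that] .
  have h\<sigma>': "h (\<sigma>' q) = mat_map n \<tau> (h q)" and h\<delta>': "h (\<delta>' q) = mat_map n \<theta> (h q)" if "q \<in> carrier Q" for q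
    unfolding \<sigma>'_def \<delta>'_def using hj mc iso(1)[OF that] by auto
  have \<sigma>c: "\<sigma> q \<in> carrier Q" "\<delta> q \<in> carrier Q" if "q \<in> carrier Q" for q
    using skew_derivation_closed[OF \<sigma>(1) that] .
  have C: "skew_chain_ring Op Q.vL vQ \<sigma> \<delta>" unfolding Op by (rule Q.skew_chain_ring_nonneg[OF \<sigma>])
  have C': "skew_chain_ring Op Q.vL vQ \<sigma>' \<delta>'" unfolding Op by (rule Q.skew_chain_ring_nonneg[OF \<sigma>'])
  interpret C: skew_chain_ring Op Q.vL vQ \<sigma> \<delta> by (rule C)
  interpret C': skew_chain_ring Op Q.vL vQ \<sigma>' \<delta>' by (rule C')
  define a b t where "a = j a1" "b = j b1" "t = j t1"
  note abt_def = this
  have habt: "h a = a1" "h b = b1" "h t = t1" unfolding abt_def using hj ab1 by auto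
  have abQ: "a \<in> carrier Q" "b \<in> carrier Q" "t \<in> carrier Q" unfolding abt_def using jc ab1 by auto
  have vabt: "vQ a = ?w a1" "vQ b = ?w b1" "vQ t = ?w t1" using wh[of a] wh[of b] wh[of t] habt by simp_all
  have abO: "a \<in> carrier Op" "b \<in> carrier Op"
    using abQ ab1 by (simp_all add: Op Q.nonneg_def vabt)
  have tL: "t \<in> Q.vL 1" using abQ ab1 by (simp add: Q.vL_def vabt one_ereal_def)
  have OpQ: "q \<in> carrier Q" if "q \<in> carrier Op" for q using that by (simp add: Op Q.nonneg_def)
  have ops: "x \<otimes>\<^bsub>Op\<^esub> y = x \<otimes>\<^bsub>Q\<^esub> y" "x \<oplus>\<^bsub>Op\<^esub> y = x \<oplus>\<^bsub>Q\<^esub> y" "\<one>\<^bsub>Op\<^esub> = \<one>\<^bsub>Q\<^esub>" "\<zero>\<^bsub>Op\<^esub> = \<zero>\<^bsub>Q\<^esub>" for x y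
    by (simp_all add: Op)
  have ab: "a \<otimes>\<^bsub>Op\<^esub> b = \<one>\<^bsub>Op\<^esub>" "b \<otimes>\<^bsub>Op\<^esub> a = \<one>\<^bsub>Op\<^esub>"
    unfolding ops by (rule inj; use abQ iso ab1 habt in simp)+
  have \<sigma>'c: "\<sigma>' q \<in> carrier Q" "\<delta>' q \<in> carrier Q" if "q \<in> carrier Q" for q
    unfolding \<sigma>'_def \<delta>'_def using jc mc iso(1)[OF that] by auto
  have cv1: "\<sigma>' r \<otimes>\<^bsub>Op\<^esub> a = a \<otimes>\<^bsub>Op\<^esub> \<sigma> r" if "r \<in> carrier Op" for r
  proof -
    have r: "r \<in> carrier Q" using OpQ[OF that] .
    show ?thesis unfolding ops
      by (rule inj) (use abQ \<sigma>c[OF r] \<sigma>'c[OF r] conj(1)[OF iso(1)[OF r]] jh[OF r] h\<sigma>'[OF r] iso(2) habt in auto)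
  qed
  have cv2: "a \<otimes>\<^bsub>Op\<^esub> \<delta> r \<oplus>\<^bsub>Op\<^esub> \<sigma>' r \<otimes>\<^bsub>Op\<^esub> t = \<delta>' r \<oplus>\<^bsub>Op\<^esub> t \<otimes>\<^bsub>Op\<^esub> r" if "r \<in> carrier Op" for r
  proof -
    have r: "r \<in> carrier Q" using OpQ[OF that] .
    show ?thesis unfolding ops
      by (rule inj) (use abQ r \<sigma>c[OF r] \<sigma>'c[OF r] conj(2)[OF iso(1)[OF r]] jh[OF r] h\<sigma>'[OF r] h\<delta>'[OF r]
          iso(2,3) habt in auto)
  qed
  define S where "S = skew_ps_ring Op vQ \<sigma> \<delta>"
  define S' where "S' = skew_ps_ring Op vQ \<sigma>' \<delta>'"
  define P where "P = skew_ps_ring D v \<tau> \<theta>"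
  define \<Theta> where "\<Theta> = (\<lambda>s. \<lambda>p\<in>{..<n} \<times> {..<n}. \<lambda>i::nat. h (s i) p)"
  have \<Theta>: "\<Theta> \<in> ring_iso S' (mat_ring n P)"
    "\<And>s. s \<in> carrier S' \<Longrightarrow> mat_filtration n (ps_filtration v) (\<Theta> s) = ps_filtration vQ s"
    "filtered_ring (mat_ring n P) (mat_filtration n (ps_filtration v))"
    unfolding S'_def P_def \<Theta>_def
    by (rule power_series_matrix_iso[OF n Q h vQ Op \<sigma>' \<tau>]; (erule h\<sigma>' | erule h\<delta>' | assumption))+
  have "\<exists>\<Phi>. \<Phi> \<in> ring_iso S S' \<and> (\<forall>s\<in>carrier S. \<forall>k. \<Phi> s \<in> C.SL k \<longleftrightarrow> s \<in> C.SL k) \<and>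
    (\<forall>r\<in>carrier Op. \<Phi> (ps_const Op r) = ps_const Op r) \<and>
    \<Phi> (ps_const Op a \<otimes>\<^bsub>S\<^esub> ps_var Op \<ominus>\<^bsub>S\<^esub> ps_const Op t) = ps_var Op"
  proof (rule change_of_variable[OF C C' abO ab tL, folded S_def S'_def], goal_cases)
    case (1 r)
    then show ?case by (rule cv1)
  next
    case (2 r)
    then show ?case by (rule cv2)
  next
    case (3 \<Phi>)
    show ?case by (rule exI[of _ \<Phi>]) (intro conjI ballI allI 3)
  qed
  then obtain \<Phi> where \<Phi>: "\<Phi> \<in> ring_iso S S'"
    and \<Phi>L: "\<And>s k. s \<in> carrier S \<Longrightarrow> \<Phi> s \<in> C.SL k \<longleftrightarrow> s \<in> C.SL k"
    and \<Phi>c: "\<And>r. r \<in> carrier Op \<Longrightarrow> \<Phi> (ps_const Op r) = ps_const Op r"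
    and \<Phi>v: "\<Phi> (ps_const Op a \<otimes>\<^bsub>S\<^esub> ps_var Op \<ominus>\<^bsub>S\<^esub> ps_const Op t) = ps_var Op"
    by blast
  have h0: "h \<zero>\<^bsub>Q\<^esub> = \<zero>\<^bsub>M n\<^esub>"
    by (rule additive_zero[where h = h, OF Q.abelian_group_axioms T.abelian_group_axioms]) (use iso in auto)
  have vO: "vQ q = \<infinity> \<or> (\<exists>k::nat. vQ q = ereal (real k))" if "q \<in> carrier Op" for q
    using that Q.v_nat by (simp add: Op Q.nonneg_def)
  have one: "vQ \<one>\<^bsub>Op\<^esub> = 0" by (simp add: Op)
  have CS: "complete_filtered_ring S (ps_filtration vQ)"
    "\<And>s k. s \<in> C.SL k \<longleftrightarrow> s \<in> carrier S \<and> ereal (real k) \<le> ps_filtration vQ s"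
    "\<And>s. s \<in> carrier S \<Longrightarrow> ps_filtration vQ s = \<infinity> \<or> (\<exists>k::nat. ps_filtration vQ s = ereal (real k))"
    unfolding S_def by (rule C.complete_filtered_ring_S[OF one], erule vO, assumption?)+
  have CS': "\<And>s k. s \<in> C.SL k \<longleftrightarrow> s \<in> carrier S' \<and> ereal (real k) \<le> ps_filtration vQ s"
    unfolding S'_def by (rule C'.complete_filtered_ring_S(2)[OF one], erule vO)
  have CS'3: "\<And>s. s \<in> carrier S' \<Longrightarrow> ps_filtration vQ s = \<infinity> \<or> (\<exists>k::nat. ps_filtration vQ s = ereal (real k))"
    unfolding S'_def by (rule C'.complete_filtered_ring_S(3)[OF one], erule vO, assumption)
  note \<Phi>m = ring_iso_memE[OF \<Phi>]
  \<comment> \<open>\<open>S\<close> and \<open>S'\<close> have the same carrier and the same chain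
    \<open>SL\<close>, only their products differ. Preserving every \<open>SL k\<close> therefore
    means preserving values.\<close>
  have \<Phi>w: "ps_filtration vQ (\<Phi> s) = ps_filtration vQ s" if s: "s \<in> carrier S" for s
    by (rule nat_valued_eqI[OF CS'3[OF \<Phi>m(1)[OF s]] CS(3)[OF s]])
      (use \<Phi>L[OF s] CS(2)[of s] CS'[of "\<Phi> s"] s \<Phi>m(1)[OF s] in blast)
  define \<phi> where "\<phi> = \<Theta> \<circ> \<Phi>"
  have fs: "filtered_ring S (ps_filtration vQ)"
    using CS(1) unfolding filtered_ring_def complete_filtered_ring_def complete_filtered_ring_axioms_def by blast
  have "filtered_ring_iso S (ps_filtration vQ) (mat_ring n P) (mat_filtration n (ps_filtration v)) \<phi>"
    unfolding filtered_ring_iso_def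
  proof (intro conjI ballI fs \<Theta>(3))
    show "\<phi> \<in> ring_iso S (mat_ring n P)" unfolding \<phi>_def using ring_iso_set_trans[OF \<Phi> \<Theta>(1)] .
    show "mat_filtration n (ps_filtration v) (\<phi> s) = ps_filtration vQ s" if "s \<in> carrier S" for s
      unfolding \<phi>_def comp_apply \<Theta>(2)[OF \<Phi>m(1)[OF that]] by (rule \<Phi>w[OF that])
  qed
  moreover have "\<phi> (ps_const Op r) = mat_map n (ps_const D) (h r)" if "r \<in> carrier Op" for r
    unfolding \<phi>_def comp_apply \<Phi>c[OF that] \<Theta>_def mat_map_def
    by (rule restrict_ext) (auto simp: ps_const_def fun_eq_iff ops h0 mat_zero)
  moreover have "\<phi> (ps_const Op a \<otimes>\<^bsub>S\<^esub> ps_var Op \<ominus>\<^bsub>S\<^esub> ps_const Op t) = scalar_mat n P (ps_var D)"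
    unfolding \<phi>_def comp_apply \<Phi>v \<Theta>_def scalar_mat_def P_def skew_ps_ring_def
    by (rule restrict_ext) (auto simp: ps_var_def fun_eq_iff ops h0 iso(4) mat_zero mat_one)
  moreover have "a \<in> Units Op" unfolding Units_def using abO ab by blast
  moreover have "t \<in> jacobson_radical Op" by (rule C.L_1_jacobson[OF tL])
  ultimately show ?thesis using \<tau> unfolding S_def P_def by blast
qed

text \<open>Completeness is given for \<open>D\<close> and in terms of a double limit, but needed
  for \<open>F\<close> and with a rate. Subtracting the first term moves a sequence of the required
  kind into \<open>D\<close>.\<close>

lemma (in nc_dvr) complete_filtered_ring_dvr:
  assumes complete: "filt_complete DR v"
  shows "complete_filtered_ring F v" "{x \<in> carrier F. 0 \<le> v x} = D"
proof -
  show D: "{x \<in> carrier F. 0 \<le> v x} = D" using v_facts(2) by auto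
  have vadd: "c \<le> v (x \<oplus> y)" if "x \<in> carrier F" "y \<in> carrier F" "c \<le> v x" "c \<le> v y" for x y c
    using v_add[OF that(1,2)] that(3,4) by (meson min.boundedI order_trans)
  have m1: "\<ominus> \<one> \<in> carrier F" "\<ominus> \<one> \<noteq> \<zero>" using one_neq_zero by (auto simp: minus_equality)
  \<comment> \<open>Twice the value of \<open>-1\<close> is the value of \<open>1\<close>, which is
    \<open>0\<close>. Exact additivity thus yields the invariance under negation that
    \<open>complete_filtered_ring\<close> asks for.\<close>
  have "v (\<ominus> \<one>) + v (\<ominus> \<one>) = v (\<ominus> \<one> \<otimes> \<ominus> \<one>)" using v_facts(3) m1 by simp
  also have "\<dots> = 0" using v_one by (simp add: l_minus)
  finally have vm1: "v (\<ominus> \<one>) = 0" using v_facts(1)[OF m1] by auto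
  have neg: "v (\<ominus> x) = v x" if "x \<in> carrier F" for x
  proof (cases "x = \<zero>")
    case False
    then have "v (\<ominus> \<one> \<otimes> x) = v (\<ominus> \<one>) + v x" using v_facts(3) m1 that by blast
    then show ?thesis using that vm1 by (simp add: l_minus)
  qed simp
  have vminus: "c \<le> v (x \<ominus> y)" if "x \<in> carrier F" "y \<in> carrier F" "c \<le> v x" "c \<le> v y" for x y c
    unfolding a_minus_def using vadd[of x "\<ominus> y" c] that neg by simp
  show "complete_filtered_ring F v"
  proof
    show "filtration F v" by (rule filtration_v)
    show "x \<in> carrier F \<Longrightarrow> v (\<ominus> x) = v x" for x by (rule neg)
    fix s assume s: "\<And>n. s n \<in> carrier F" and d: "\<And>n. ereal (real n) \<le> v (s (Suc n) \<ominus> s n)"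
    have tail: "ereal (real n) \<le> v (s (n + k) \<ominus> s n)" for n k
    proof (induction k)
      case (Suc k)
      have "s (n + Suc k) \<ominus> s n = (s (Suc (n + k)) \<ominus> s (n + k)) \<oplus> (s (n + k) \<ominus> s n)"
        using minus_trans[of "s (Suc (n + k))" "s (n + k)" "s n"] s by simp
      moreover have "ereal (real n) \<le> v (s (Suc (n + k)) \<ominus> s (n + k))"
        by (rule order_trans[OF _ d]) simp
      ultimately show ?case using vadd Suc s by simp
    qed (use s v_zero in simp)
    have tail': "ereal (real n) \<le> v (s m \<ominus> s n)" if "n \<le> m" for n m
      using tail[of n "m - n"] that by simp
    have cauchy: "ereal (real n) \<le> v (s m \<ominus> s m')" if "n \<le> m" "n \<le> m'" for n m m'
    proof -
      have "s m \<ominus> s m' = (s m \<ominus> s n) \<oplus> \<ominus> (s m' \<ominus> s n)"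
        using minus_trans[of "s m" "s n" "s m'"] minus_swap[of "s m'" "s n"] s by simp
      then show ?thesis using vadd[OF _ _ tail'[OF that(1)], of "\<ominus> (s m' \<ominus> s n)"] tail'[OF that(2)] s neg by simp
    qed
    define u where "u n = s n \<ominus> s 0" for n
    have uD: "u n \<in> D" for n
    proof -
      have "ereal (real 0) \<le> v (u n)" unfolding u_def by (rule tail') simp
      then have "0 \<le> v (u n)" by (simp flip: zero_ereal_def)
      then show ?thesis using v_facts(2)[of "u n"] s by (simp add: u_def)
    qed
    have uu: "u m \<ominus> u n = s m \<ominus> s n" for m n
      using minus_trans[of "s m" "s 0" "s n"] minus_swap[of "s n" "s 0"] s
      unfolding u_def by (simp add: a_minus_def)
    have "((\<lambda>(m, n). v (u m \<ominus>\<^bsub>DR\<^esub> u n)) \<longlongrightarrow> \<infinity>) (sequentially \<times>\<^sub>F sequentially)"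
      unfolding tendsto_PInfty
    proof
      fix r :: real
      obtain N :: nat where N: "r < real N" using reals_Archimedean2 by blast
      have "ereal r < v (u m \<ominus>\<^bsub>DR\<^esub> u n)" if "N \<le> m" "N \<le> n" for m n
      proof -
        have "ereal r < ereal (real N)" using N by simp
        also have "\<dots> \<le> v (s m \<ominus> s n)" by (rule cauchy[OF that])
        finally show ?thesis using a_minus_subring[OF sub uD] uu by simp
      qed
      then show "\<forall>\<^sub>F x in sequentially \<times>\<^sub>F sequentially. ereal r < (case x of (m, n) \<Rightarrow> v (u m \<ominus>\<^bsub>DR\<^esub> u n))"
        unfolding eventually_prod_sequentially by auto
    qed
    moreover have "range u \<subseteq> carrier DR" using uD by auto
    ultimately obtain l where "filt_tendsto DR v u l" using complete unfolding filt_complete_def by blast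
    then have l: "l \<in> D" and lim: "(\<lambda>n. v (u n \<ominus> l)) \<longlonglongrightarrow> \<infinity>"
      using a_minus_subring[OF sub] by (auto simp: filt_tendsto_def)
    have uc: "u n \<in> carrier F" for n using uD by simp
    have lc: "l \<in> carrier F" using l by simp
    \<comment> \<open>The bare limit is sharpened to a rate: \<open>u n\<close> is compared with
      some later \<open>u m\<close> that is already close enough to \<open>l\<close>.\<close>
    have ul: "ereal (real n) \<le> v (u n \<ominus> l)" for n
    proof -
      have "\<forall>\<^sub>F m in sequentially. ereal (real n) < v (u m \<ominus> l)"
        using lim unfolding tendsto_PInfty by blast
      then obtain M where M: "\<forall>m\<ge>M. ereal (real n) < v (u m \<ominus> l)" unfolding eventually_sequentially by blast
      define m where "m = max M n"
      have "ereal (real n) \<le> v (u n \<ominus> u m)" unfolding uu by (rule cauchy) (auto simp: m_def)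
      moreover have "ereal (real n) \<le> v (u m \<ominus> l)" using M by (auto simp: m_def intro: less_imp_le)
      ultimately show ?thesis
        using vadd[of "u n \<ominus> u m" "u m \<ominus> l"] minus_trans[of "u n" "u m" l] uc lc by simp
    qed
    have "s n \<ominus> (l \<oplus> s 0) = u n \<ominus> l" for n
      unfolding u_def using s lc by (simp add: a_minus_def minus_add a_ac)
    then show "\<exists>l\<in>carrier F. \<forall>n. ereal (real n) \<le> v (s n \<ominus> l)"
      using ul lc s by (intro bexI[of _ "l \<oplus> s 0"]) auto
  qed
qed

section \<open>Matrices over products, and the main result\<close>

lemma psum_prod_ring:
  "i \<in> I \<Longrightarrow> psum (prod_ring I R) t n i = psum (R i) (\<lambda>k. t k i) n"
  by (induction n) (auto simp: prod_ring_simps)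

text \<open>Makes precise the identification of matrices over a product with families of matrices;
  sums in a product ring are formed componentwise.\<close>

lemma prod_mat_map_iso:
  assumes F: "\<And>i. i \<in> I \<Longrightarrow> ring (F i)" and A: "\<And>i. i \<in> I \<Longrightarrow> ring (A i)"
    and iota: "\<And>i. i \<in> I \<Longrightarrow> \<iota> i \<in> ring_iso (A i) (mat_ring n (F i))"
  shows "prod_mat_map I n \<iota> \<in> ring_iso (prod_ring I A) (mat_ring n (prod_ring I F))"
proof -
  let ?Q = "prod_ring I A" and ?F = "prod_ring I F" and ?h = "prod_mat_map I n \<iota>"
  interpret F: ring ?F using F by (rule ring_prod_ring)
  note io = ring_iso_memE[OF iota]
  have qc: "q i \<in> carrier (A i)" if "q \<in> carrier ?Q" "i \<in> I" for q i
    using that by (auto simp: prod_ring_simps)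
  have ent: "?h q (k, l) i = \<iota> i (q i) (k, l)" if "k < n" "l < n" "i \<in> I" for q k l i
    using that by (simp add: prod_mat_map_def)
  have ic: "\<iota> i (q i) (k, l) \<in> carrier (F i)" if "q \<in> carrier ?Q" "k < n" "l < n" "i \<in> I" for q k l i
    using ring.mat_entry_closed[OF F[OF that(4)] io(1)[OF that(4) qc[OF that(1,4)]] that(2,3)] .
  have hc: "?h q \<in> carrier (mat_ring n ?F)" if "q \<in> carrier ?Q" for q
    unfolding prod_mat_map_def
    by (rule F.mat_closedI) (use ic[OF that] in \<open>auto simp: prod_ring_simps\<close>)
  have eqI: "B = B'" if B: "B \<in> carrier (mat_ring n ?F)" "B' \<in> carrier (mat_ring n ?F)"
    and e: "\<And>k l i. k < n \<Longrightarrow> l < n \<Longrightarrow> i \<in> I \<Longrightarrow> B (k, l) i = B' (k, l) i" for B B'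
  proof (rule F.mat_eqI[OF B])
    fix k l assume kl: "k < n" "l < n"
    show "B (k, l) = B' (k, l)"
      by (rule prod_ring_eqI[OF F.mat_entry_closed[OF B(1) kl] F.mat_entry_closed[OF B(2) kl] e[OF kl]])
  qed
  have Qcl: "x \<otimes>\<^bsub>?Q\<^esub> y \<in> carrier ?Q" "x \<oplus>\<^bsub>?Q\<^esub> y \<in> carrier ?Q" "\<one>\<^bsub>?Q\<^esub> \<in> carrier ?Q"
    if "x \<in> carrier ?Q" "y \<in> carrier ?Q" for x y
  proof -
    interpret Q: ring ?Q using A by (rule ring_prod_ring)
    show "x \<otimes>\<^bsub>?Q\<^esub> y \<in> carrier ?Q" "x \<oplus>\<^bsub>?Q\<^esub> y \<in> carrier ?Q" "\<one>\<^bsub>?Q\<^esub> \<in> carrier ?Q" using that by auto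
  qed
  show ?thesis
  proof (rule ring_iso_memI)
    fix x y assume x: "x \<in> carrier ?Q" and y: "y \<in> carrier ?Q"
    show "?h (x \<otimes>\<^bsub>?Q\<^esub> y) = ?h x \<otimes>\<^bsub>mat_ring n ?F\<^esub> ?h y"
    proof (rule eqI[OF hc[OF Qcl(1)[OF x y]] F.mat_mult_closed[OF hc[OF x] hc[OF y]]])
      fix k l i assume kli: "k < n" "l < n" "i \<in> I"
      have "(?h x \<otimes>\<^bsub>mat_ring n ?F\<^esub> ?h y) (k, l) i
          = psum (F i) (\<lambda>m. (?h x (k, m) \<otimes>\<^bsub>?F\<^esub> ?h y (m, l)) i) n"
        unfolding F.mat_mult[OF hc[OF x] hc[OF y] kli(1,2)] by (rule psum_prod_ring[OF kli(3)])
      also have "\<dots> = psum (F i) (\<lambda>m. \<iota> i (x i) (k, m) \<otimes>\<^bsub>F i\<^esub> \<iota> i (y i) (m, l)) n"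
        by (rule psum_cong) (simp add: prod_ring_simps kli ent)
      also have "\<dots> = ?h (x \<otimes>\<^bsub>?Q\<^esub> y) (k, l) i"
        using ring.mat_mult[OF F[OF kli(3)] io(1)[OF kli(3) qc[OF x kli(3)]] io(1)[OF kli(3) qc[OF y kli(3)]] kli(1,2)]
          io(2)[OF kli(3) qc[OF x kli(3)] qc[OF y kli(3)]] kli by (simp add: ent prod_ring_simps)
      finally show "?h (x \<otimes>\<^bsub>?Q\<^esub> y) (k, l) i = (?h x \<otimes>\<^bsub>mat_ring n ?F\<^esub> ?h y) (k, l) i" by simp
    qed
    show "?h (x \<oplus>\<^bsub>?Q\<^esub> y) = ?h x \<oplus>\<^bsub>mat_ring n ?F\<^esub> ?h y"
    proof (rule eqI[OF hc[OF Qcl(2)[OF x y]] F.mat_add_closed[OF hc[OF x] hc[OF y]]])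
      fix k l i assume kli: "k < n" "l < n" "i \<in> I"
      show "?h (x \<oplus>\<^bsub>?Q\<^esub> y) (k, l) i = (?h x \<oplus>\<^bsub>mat_ring n ?F\<^esub> ?h y) (k, l) i"
        using io(3)[OF kli(3) qc[OF x kli(3)] qc[OF y kli(3)]] kli
        by (simp add: ent prod_ring_simps F.mat_add ring.mat_add[OF F])
    qed
  next
    have "ring ?Q" using A by (rule ring_prod_ring)
    then have one: "\<one>\<^bsub>?Q\<^esub> \<in> carrier ?Q" by (intro monoid.one_closed ring.is_monoid)
    show "?h \<one>\<^bsub>?Q\<^esub> = \<one>\<^bsub>mat_ring n ?F\<^esub>"
    proof (rule eqI[OF hc[OF one] F.mat_one_closed])
      fix k l i assume kli: "k < n" "l < n" "i \<in> I"
      show "?h \<one>\<^bsub>?Q\<^esub> (k, l) i = \<one>\<^bsub>mat_ring n ?F\<^esub> (k, l) i"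
        using io(4)[OF kli(3)] kli
        by (simp add: ent prod_ring_simps F.mat_one ring.mat_one[OF F])
    qed
    show "bij_betw ?h (carrier ?Q) (carrier (mat_ring n ?F))"
      unfolding bij_betw_def
    proof
      show "inj_on ?h (carrier ?Q)"
      proof (rule inj_onI)
        fix x y assume x: "x \<in> carrier ?Q" and y: "y \<in> carrier ?Q" and eq: "?h x = ?h y"
        show "x = y"
        proof (rule prod_ring_eqI[OF x y])
          fix i assume i: "i \<in> I"
          have "\<iota> i (x i) = \<iota> i (y i)"
          proof (rule ring.mat_eqI[OF F[OF i] io(1)[OF i qc[OF x i]] io(1)[OF i qc[OF y i]]])
            fix k l assume "k < n" "l < n"
            then show "\<iota> i (x i) (k, l) = \<iota> i (y i) (k, l)" using ent[of k l i x] ent[of k l i y] eq i by simp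
          qed
          then show "x i = y i" using io(5)[OF i] qc x y i by (auto simp: bij_betw_def inj_on_def)
        qed
      qed
      have "B \<in> ?h ` carrier ?Q" if B: "B \<in> carrier (mat_ring n ?F)" for B
      proof -
        have Bc: "B (k, l) i \<in> carrier (F i)" if "k < n" "l < n" "i \<in> I" for k l i
          using F.mat_entry_closed[OF B that(1,2)] that(3) by (auto simp: prod_ring_simps)
        have "\<exists>a. a \<in> carrier (A i) \<and> \<iota> i a = (\<lambda>p\<in>{..<n} \<times> {..<n}. B p i)" if i: "i \<in> I" for i
        proof -
          have "(\<lambda>p\<in>{..<n} \<times> {..<n}. B p i) \<in> carrier (mat_ring n (F i))"
            by (rule ring.mat_closedI[OF F[OF i]]) (use Bc i in auto)
          then have "(\<lambda>p\<in>{..<n} \<times> {..<n}. B p i) \<in> \<iota> i ` carrier (A i)"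
            using io(5)[OF i] by (simp add: bij_betw_def)
          then show ?thesis by auto
        qed
        then obtain q where q: "\<And>i. i \<in> I \<Longrightarrow> q i \<in> carrier (A i)"
          "\<And>i. i \<in> I \<Longrightarrow> \<iota> i (q i) = (\<lambda>p\<in>{..<n} \<times> {..<n}. B p i)" by metis
        have qQ: "restrict q I \<in> carrier ?Q" using q(1) by (auto simp: prod_ring_simps)
        have "?h (restrict q I) = B"
          by (rule eqI[OF hc[OF qQ] B]) (simp add: ent q(2))
        then show ?thesis using qQ by blast
      qed
      then show "?h ` carrier ?Q = carrier (mat_ring n ?F)" using hc by blast
    qed
  qed (rule hc)
qed

text \<open>What remains is to identify \<open>Dp\<close> and \<open>Op\<close> with the elements of
  value at least \<open>0\<close>, and to verify \<open>local\<close> and \<open>idem\<close> for a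
  product of discrete valuation rings.\<close>

theorem theoremA:
  fixes d n :: nat
    and F :: "nat \<Rightarrow> 'a ring" and D :: "nat \<Rightarrow> 'a set"
    and A :: "nat \<Rightarrow> 'b ring"
    and \<iota> :: "nat \<Rightarrow> 'b \<Rightarrow> nat \<times> nat \<Rightarrow> 'a"
    and \<sigma> \<delta> :: "(nat \<Rightarrow> 'b) \<Rightarrow> (nat \<Rightarrow> 'b)"
    and Fp Dp :: "(nat \<Rightarrow> 'a) ring" and vF :: "(nat \<Rightarrow> 'a) \<Rightarrow> ereal"
    and Q Op :: "(nat \<Rightarrow> 'b) ring" and vQ :: "(nat \<Rightarrow> 'b) \<Rightarrow> ereal"
    and \<iota>p :: "(nat \<Rightarrow> 'b) \<Rightarrow> nat \<times> nat \<Rightarrow> nat \<Rightarrow> 'a"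
  defines "Fp \<equiv> prod_ring {..<d} F"
    and "vF \<equiv> prod_filtration {..<d} (\<lambda>i. adic_filtration (F i) (D i))"
    and "Dp \<equiv> Fp\<lparr>carrier := \<Pi>\<^sub>E i\<in>{..<d}. D i\<rparr>"
    and "Q \<equiv> prod_ring {..<d} A"
    and "\<iota>p \<equiv> prod_mat_map {..<d} n \<iota>"
    and "vQ \<equiv> (\<lambda>q. mat_filtration n vF (\<iota>p q))"
    and "Op \<equiv> Q\<lparr>carrier := \<Pi>\<^sub>E i\<in>{..<d}.
                {a \<in> carrier (A i). \<iota> i a \<in> carrier (mat_ring n ((F i)\<lparr>carrier := D i\<rparr>))}\<rparr>"
  assumes d_pos: "d \<ge> 1" and n_pos: "n \<ge> 1"
    and dvr: "\<And>i. i < d \<Longrightarrow> complete_dvr (F i) (D i)"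
    and A_ring: "\<And>i. i < d \<Longrightarrow> ring (A i)"
    and Q_semisimple: "semisimple_artinian Q"
    and Q_ideals: "minimal_nonzero_ideals Q = prod_factor {..<d} A ` {..<d}"
    and iota: "\<And>i. i < d \<Longrightarrow> \<iota> i \<in> ring_iso (A i) (mat_ring n (F i))"
    and skew: "skew_derivation Q \<sigma> \<delta>"
    and compat: "skew_compatible Q vQ \<sigma> \<delta>"
    and permutes: "bij_betw (\<lambda>I. \<sigma> ` I) (minimal_nonzero_ideals Q) (minimal_nonzero_ideals Q)"
    and transitive: "\<And>I K. I \<in> minimal_nonzero_ideals Q \<Longrightarrow> K \<in> minimal_nonzero_ideals Q \<Longrightarrow>
                       \<exists>k::nat. (\<sigma> ^^ k) ` I = K"
  shows "\<exists>\<tau> \<theta> \<phi> a t.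
           skew_derivation Fp \<tau> \<theta> \<and> skew_compatible Fp vF \<tau> \<theta> \<and>
           filtered_ring_iso
             (skew_ps_ring Op vQ \<sigma> \<delta>) (ps_filtration vQ)
             (mat_ring n (skew_ps_ring Dp vF \<tau> \<theta>)) (mat_filtration n (ps_filtration vF)) \<phi> \<and>
           (\<forall>r\<in>carrier Op. \<phi> (ps_const Op r) = mat_map n (ps_const Dp) (\<iota>p r)) \<and>
           a \<in> Units Op \<and> t \<in> jacobson_radical Op \<and>
           \<phi> (ps_const Op a \<otimes>\<^bsub>skew_ps_ring Op vQ \<sigma> \<delta>\<^esub> ps_var Op
                \<ominus>\<^bsub>skew_ps_ring Op vQ \<sigma> \<delta>\<^esub> ps_const Op t)
             = scalar_mat n (skew_ps_ring Dp vF \<tau> \<theta>) (ps_var Dp)"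
proof -
  have cdvr: "nc_dvr (F i) (D i)" "complete_filtered_ring (F i) (adic_filtration (F i) (D i))"
    "{x \<in> carrier (F i). 0 \<le> adic_filtration (F i) (D i) x} = D i" if "i \<in> {..<d}" for i
  proof -
    show 1: "nc_dvr (F i) (D i)" using dvr[of i] that by unfold_locales (simp add: complete_dvr_def)
    have "filt_complete ((F i)\<lparr>carrier := D i\<rparr>) (adic_filtration (F i) (D i))"
      using dvr[of i] that by (simp add: complete_dvr_def)
    then show "complete_filtered_ring (F i) (adic_filtration (F i) (D i))"
      "{x \<in> carrier (F i). 0 \<le> adic_filtration (F i) (D i) x} = D i"
      using nc_dvr.complete_filtered_ring_dvr[OF 1] by blast+
  qed
  have I: "finite {..<d}" "{..<d} \<noteq> {}" using d_pos by (auto simp: lessThan_empty_iff)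
  interpret K: complete_filtered_ring Fp vF
    unfolding Fp_def vF_def by (rule complete_filtered_ring_prod[OF I cdvr(2)])
  have Fr: "ring (F i)" if "i \<in> {..<d}" for i using cdvr(2)[OF that] by (simp add: complete_filtered_ring_def)
  have Ar: "ring (A i)" if "i \<in> {..<d}" for i using A_ring that by simp
  have h: "\<iota>p \<in> ring_iso Q (mat_ring n Fp)"
    unfolding \<iota>p_def Q_def Fp_def by (rule prod_mat_map_iso[OF Fr Ar iota]) auto
  have vFle: "c \<le> vF x \<longleftrightarrow> (\<forall>i<d. c \<le> adic_filtration (F i) (D i) (x i))" for c x
    unfolding vF_def prod_filtration_def using ereal_le_MinI[OF I] by (auto simp: lessThan_def)
  have Fpc: "x i \<in> carrier (F i)" if "x \<in> carrier Fp" "i < d" for x i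
    using that by (auto simp: Fp_def prod_ring_simps)
  have FpI: "restrict x {..<d} \<in> carrier Fp" if "\<And>i. i < d \<Longrightarrow> x i \<in> carrier (F i)" for x
    using that by (auto simp: Fp_def prod_ring_simps)
  have Fpeq: "x = y" if "x \<in> carrier Fp" "y \<in> carrier Fp" "\<And>i. i < d \<Longrightarrow> x i = y i" for x y
    using prod_ring_eqI[of x "{..<d}" F y] that by (auto simp: Fp_def)
  have Fps: "(x \<otimes>\<^bsub>Fp\<^esub> y) i = x i \<otimes>\<^bsub>F i\<^esub> y i" "\<one>\<^bsub>Fp\<^esub> i = \<one>\<^bsub>F i\<^esub>" "\<zero>\<^bsub>Fp\<^esub> i = \<zero>\<^bsub>F i\<^esub>" if "i < d" for x y i
    using that by (simp_all add: Fp_def prod_ring_simps)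
  have Di: "D i = {x \<in> carrier (F i). 0 \<le> adic_filtration (F i) (D i) x}" if "i < d" for i
    using cdvr(3) that by simp
  have nonneg: "x \<in> K.nonneg \<longleftrightarrow> x \<in> carrier Fp \<and> (\<forall>i<d. x i \<in> D i)" for x
    unfolding K.nonneg_def using vFle Fpc Di by blast
  have FpPi: "x \<in> carrier Fp \<longleftrightarrow> (\<forall>i<d. x i \<in> carrier (F i)) \<and> x \<in> extensional {..<d}" for x
    by (auto simp: Fp_def prod_ring_simps PiE_iff)
  have Dp: "Dp = Fp\<lparr>carrier := K.nonneg\<rparr>"
  proof -
    have "(\<Pi>\<^sub>E i\<in>{..<d}. D i) = K.nonneg"
    proof (intro Set.set_eqI iffI)
      fix x assume "x \<in> (\<Pi>\<^sub>E i\<in>{..<d}. D i)"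
      moreover have "D i \<subseteq> carrier (F i)" if "i < d" for i using Di[OF that] by blast
      ultimately show "x \<in> K.nonneg" unfolding nonneg FpPi by (auto simp: PiE_iff)
    next
      fix x assume "x \<in> K.nonneg"
      then show "x \<in> (\<Pi>\<^sub>E i\<in>{..<d}. D i)" unfolding nonneg FpPi by (auto simp: PiE_iff)
    qed
    then show ?thesis by (simp add: Dp_def)
  qed
  have vQle: "c \<le> vQ q \<longleftrightarrow> (\<forall>k<n. \<forall>l<n. c \<le> vF (\<iota>p q (k, l)))" for c q
    unfolding vQ_def by (rule le_mat_filtration_iff[OF n_pos])
  have Op: "Op = Q\<lparr>carrier := {q \<in> carrier Q. 0 \<le> vQ q}\<rparr>"
  proof -
    have "(\<Pi>\<^sub>E i\<in>{..<d}. {a \<in> carrier (A i). \<iota> i a \<in> carrier (mat_ring n ((F i)\<lparr>carrier := D i\<rparr>))})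
        = {q \<in> carrier Q. 0 \<le> vQ q}"
    proof (rule Set.set_eqI)
      fix q
      have e: "\<iota>p q (k, l) i = \<iota> i (q i) (k, l)" if "k < n" "l < n" "i < d" for k l i
        using that by (simp add: \<iota>p_def prod_mat_map_def)
      have "\<iota> i (q i) \<in> carrier (mat_ring n ((F i)\<lparr>carrier := D i\<rparr>)) \<longleftrightarrow>
          (\<forall>k<n. \<forall>l<n. 0 \<le> adic_filtration (F i) (D i) (\<iota>p q (k, l) i))"
        if i: "i < d" and q: "q i \<in> carrier (A i)" for i
      proof -
        have m: "\<iota> i (q i) \<in> carrier (mat_ring n (F i))" using ring_iso_memE(1)[OF iota[OF i] q] .
        then have c: "\<iota> i (q i) (k, l) \<in> carrier (F i)" if "k < n" "l < n" for k l
          using ring.mat_entry_closed[OF Fr _ that] i by simp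
        have "\<iota> i (q i) \<in> carrier (mat_ring n ((F i)\<lparr>carrier := D i\<rparr>)) \<longleftrightarrow>
            (\<forall>k<n. \<forall>l<n. \<iota> i (q i) (k, l) \<in> D i)"
          using m by (auto simp: mat_ring_def PiE_iff)
        also have "\<dots> \<longleftrightarrow> (\<forall>k<n. \<forall>l<n. 0 \<le> adic_filtration (F i) (D i) (\<iota>p q (k, l) i))"
          using c e i Di[OF i] by auto
        finally show ?thesis .
      qed
      then show "q \<in> (\<Pi>\<^sub>E i\<in>{..<d}. {a \<in> carrier (A i). \<iota> i a \<in> carrier (mat_ring n ((F i)\<lparr>carrier := D i\<rparr>))})
          \<longleftrightarrow> q \<in> {q \<in> carrier Q. 0 \<le> vQ q}"
        unfolding Q_def vQle vFle prod_ring_simps by (auto simp: PiE_iff)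
    qed
    then show ?thesis by (simp add: Op_def)
  qed
  have local: "\<exists>c e. (\<forall>k<n. c k \<in> K.nonneg \<and> (\<forall>y\<in>carrier Fp. c k \<otimes>\<^bsub>Fp\<^esub> y = y \<otimes>\<^bsub>Fp\<^esub> c k)) \<and>
      (\<forall>k<n. \<forall>l<n. c k \<otimes>\<^bsub>Fp\<^esub> c l = (if k = l then c k else \<zero>\<^bsub>Fp\<^esub>)) \<and>
      e \<in> K.nonneg \<and> psum Fp (\<lambda>k. c k \<otimes>\<^bsub>Fp\<^esub> x k) n \<otimes>\<^bsub>Fp\<^esub> e = \<one>\<^bsub>Fp\<^esub>"
    if x: "\<And>k. k < n \<Longrightarrow> x k \<in> K.nonneg" and sum: "psum Fp x n = \<one>\<^bsub>Fp\<^esub>" for x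
  proof -
    have xD: "x k i \<in> D i" "x k i \<in> carrier (F i)" if "k < n" "i < d" for k i
      using x[OF that(1)] that Fpc unfolding nonneg by auto
    \<comment> \<open>If in component \<open>i\<close> all summands had value at least
      \<open>1\<close>, so would their sum, which is the identity and has value
      \<open>0\<close>.\<close>
    have "\<exists>k<n. adic_filtration (F i) (D i) (x k i) = 0" if i: "i < d" for i
    proof (rule ccontr)
      assume no: "\<not> ?thesis"
      interpret Fi: complete_filtered_ring "F i" "adic_filtration (F i) (D i)" using cdvr(2) i by simp
      have "1 \<le> adic_filtration (F i) (D i) (x k i)" if k: "k < n" for k
      proof -
        have p: "0 \<le> adic_filtration (F i) (D i) (x k i)" "adic_filtration (F i) (D i) (x k i) \<noteq> 0"
          using xD(1)[OF k i] Di[OF i] no k by auto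
        show ?thesis using Fi.v_nat[OF xD(2)[OF k i] p(1)] p(2) by (auto simp: one_ereal_def)
      qed
      then have "1 \<le> adic_filtration (F i) (D i) (psum (F i) (\<lambda>k. x k i) n)"
        using xD i by (intro Fi.v_psum_le) auto
      also have "psum (F i) (\<lambda>k. x k i) n = \<one>\<^bsub>F i\<^esub>"
        using sum psum_prod_ring[of i "{..<d}" F x n] i Fps(2)[OF i] by (simp add: Fp_def)
      finally show False by simp
    qed
    then obtain \<kappa> where \<kappa>: "\<And>i. i < d \<Longrightarrow> \<kappa> i < n"
      "\<And>i. i < d \<Longrightarrow> adic_filtration (F i) (D i) (x (\<kappa> i) i) = 0" by metis
    \<comment> \<open>\<open>\<kappa>\<close> picks a summand that is a unit in each component.
      \<open>c k\<close> is the indicator of the components where \<open>k\<close> was picked, and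
      \<open>e\<close> below collects the inverses of the picked units.\<close>
    define c where "c k = (\<lambda>i\<in>{..<d}. if \<kappa> i = k then \<one>\<^bsub>F i\<^esub> else \<zero>\<^bsub>F i\<^esub>)" for k
    define e where "e = (\<lambda>i\<in>{..<d}. inv\<^bsub>F i\<^esub> (x (\<kappa> i) i))"
    have ci: "c k i = (if \<kappa> i = k then \<one>\<^bsub>F i\<^esub> else \<zero>\<^bsub>F i\<^esub>)" if "i < d" for k i using that by (simp add: c_def)
    have cc: "c k \<in> carrier Fp" for k
      unfolding c_def
    proof (rule FpI)
      fix i assume "i < d"
      then interpret Fi: ring "F i" using Fr by simp
      show "(if \<kappa> i = k then \<one>\<^bsub>F i\<^esub> else \<zero>\<^bsub>F i\<^esub>) \<in> carrier (F i)" by simp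
    qed
    have cn: "c k \<in> K.nonneg" for k
      unfolding nonneg using cc ci nc_dvr.D_closed(2,3)[OF cdvr(1)] by auto
    have central: "c k \<otimes>\<^bsub>Fp\<^esub> y = y \<otimes>\<^bsub>Fp\<^esub> c k" if y: "y \<in> carrier Fp" for k y
    proof (rule Fpeq)
      fix i assume i: "i < d"
      interpret Fi: ring "F i" using Fr i by simp
      show "(c k \<otimes>\<^bsub>Fp\<^esub> y) i = (y \<otimes>\<^bsub>Fp\<^esub> c k) i" using Fpc[OF y i] by (simp add: Fps i ci)
    qed (use cc y in auto)
    have orth: "c k \<otimes>\<^bsub>Fp\<^esub> c l = (if k = l then c k else \<zero>\<^bsub>Fp\<^esub>)" for k l
    proof (rule Fpeq)
      fix i assume i: "i < d"
      interpret Fi: ring "F i" using Fr i by simp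
      show "(c k \<otimes>\<^bsub>Fp\<^esub> c l) i = (if k = l then c k else \<zero>\<^bsub>Fp\<^esub>) i" by (simp add: Fps i ci)
    qed (use cc in auto)
    have eD: "inv\<^bsub>F i\<^esub> (x (\<kappa> i) i) \<in> D i" "x (\<kappa> i) i \<noteq> \<zero>\<^bsub>F i\<^esub>" if i: "i < d" for i
      using nc_dvr.v_unit[OF cdvr(1) xD(2)[OF \<kappa>(1)[OF i] i] \<kappa>(2)[OF i]] i by auto
    have ec: "e \<in> carrier Fp" unfolding e_def by (rule FpI) (use eD Di in auto)
    have en: "e \<in> K.nonneg" unfolding nonneg using ec eD by (simp add: e_def)
    have "psum Fp (\<lambda>k. c k \<otimes>\<^bsub>Fp\<^esub> x k) n \<otimes>\<^bsub>Fp\<^esub> e = \<one>\<^bsub>Fp\<^esub>"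
    proof (rule Fpeq)
      have xc: "x k \<in> carrier Fp" if "k < n" for k using x[OF that] nonneg by simp
      show "psum Fp (\<lambda>k. c k \<otimes>\<^bsub>Fp\<^esub> x k) n \<otimes>\<^bsub>Fp\<^esub> e \<in> carrier Fp" using ec cc xc by auto
      fix i assume i: "i < d"
      interpret Fi: nc_dvr "F i" "D i" using cdvr(1) i by simp
      have "psum Fp (\<lambda>k. c k \<otimes>\<^bsub>Fp\<^esub> x k) n i = psum (F i) (\<lambda>k. (c k \<otimes>\<^bsub>Fp\<^esub> x k) i) n"
        using psum_prod_ring[of i "{..<d}" F] i by (simp add: Fp_def)
      also have "\<dots> = x (\<kappa> i) i"
        by (rule Fi.psum_single[OF \<kappa>(1)[OF i]]) (use xD i \<kappa>(1)[OF i] in \<open>auto simp: Fps ci\<close>)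
      finally show "(psum Fp (\<lambda>k. c k \<otimes>\<^bsub>Fp\<^esub> x k) n \<otimes>\<^bsub>Fp\<^esub> e) i = \<one>\<^bsub>Fp\<^esub> i"
        using eD(2)[OF i] xD(2)[OF \<kappa>(1)[OF i] i] i by (simp add: Fps e_def)
    qed simp
    then show ?thesis using cn central orth en by blast
  qed
  have idem: "g \<otimes>\<^bsub>Fp\<^esub> y = y \<otimes>\<^bsub>Fp\<^esub> g"
    if g: "g \<in> K.nonneg" "g \<otimes>\<^bsub>Fp\<^esub> g = g" and y: "y \<in> carrier Fp" for g y
  proof (rule Fpeq)
    have gc: "g \<in> carrier Fp" using g nonneg by simp
    then show "g \<otimes>\<^bsub>Fp\<^esub> y \<in> carrier Fp" "y \<otimes>\<^bsub>Fp\<^esub> g \<in> carrier Fp" using y by auto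
    fix i assume i: "i < d"
    interpret Fi: nc_dvr "F i" "D i" using cdvr(1) i by simp
    note gi = Fpc[OF gc i]
    have gg: "g i \<otimes>\<^bsub>F i\<^esub> g i = g i" using Fps(1)[OF i, of g g] g(2) by simp
    \<comment> \<open>Cancelling in the division ring \<open>F i\<close> leaves only the trivial
      idempotents, which are central.\<close>
    have "g i = \<zero>\<^bsub>F i\<^esub> \<or> g i = \<one>\<^bsub>F i\<^esub>"
    proof (rule disjCI)
      assume "g i \<noteq> \<one>\<^bsub>F i\<^esub>"
      then show "g i = \<zero>\<^bsub>F i\<^esub>"
        using Fi.left_cancel[OF gi _ gi Fi.one_closed] gg gi by auto
    qed
    then show "(g \<otimes>\<^bsub>Fp\<^esub> y) i = (y \<otimes>\<^bsub>Fp\<^esub> g) i" using Fpc[OF y i] by (auto simp: Fps i)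
  qed
  have Q: "ring Q" unfolding Q_def by (rule ring_prod_ring[OF Ar])
  show ?thesis
    unfolding Dp
  proof (rule K.matrix_skew_power_series)
    show "vQ = (\<lambda>q. mat_filtration n vF (\<iota>p q))" by (simp add: vQ_def)
  qed (fact n_pos Q h Op skew compat | rule local idem; assumption)+
qed

end
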